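(* For $x\in\mathbb{R}$ and $y>0$ let $$Q=Q(x,y)=\frac1y\begin{pmatrix}x&-1\\1&x\end{pmatrix}.$$ For $K\in\mathbb{N}$ let $P^{Q}(K)=\{z_K^p:p\in\Lambda^Q\}\cap I^2$ with $z_K^p\in T_K(p)$, let $P_{mod}^{Q}(K)$ be the modified point set obtained from $P^Q(K)$ by the modification algorithm, and let $N_m=\#P_{mod}^{Q}(K)$ (with $N_m\geq1$). Then $$\mathcal{D}\big(L(P_{mod}^{Q(x,y)}(K))\big)\ \leq\ \sqrt{\frac{18}{N_m}}+O\Big(\frac1{K^2}\Big),$$ where the implied constant depends only on $x,y$.
   Context: $\mathbb{S}^2\subset\mathbb{R}^3$ is the unit sphere, $\sigma$ its normalized surface measure. For $w\in\mathbb{S}^2$ and $t\in[-1,1]$, $C(w,t)=\{x\in\mathbb{S}^2 : \langle w,x\rangle\geq t\}$. For a finite set $P_N=\{p_1,\dots,p_N\}\subset\mathbb{S}^2$ of $N$ points, the spherical cap discrepancy is $$\mathcal{D}(P_N)=\sup_{w\in\mathbb{S}^2}\sup_{-1\leq t\leq 1}\Big|\frac1N\sum_{j=1}^N\chi_{C(w,t)}(p_j)-\sigma(C(w,t))\Big|.$$ $I^2=[0,1)\times(0,1)$, $\partial I^2$ is the boundary of the unit square, and $\mathbb{S}^2_p$ is $\mathbb{S}^2$ with the poles $(0,0,\pm1)$ removed. The Lambert map is the (area preserving) bijection $L:I^2\to\mathbb{S}^2_p$, $$L(x,y)=\big(2\sqrt{y-y^2}\cos(2\pi x),\,2\sqrt{y-y^2}\sin(2\pi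 x),\,1-2y\big).$$ For $Q\in\mathrm{GL}(\mathbb{R}^2)$: $\Lambda^Q=Q\mathbb{Z}^2$, $\Omega^Q=Q[0,1)^2$, and for $K\in\mathbb{N}$, $p\in\Lambda^Q$: $T_K(p)=\frac1K(p+\Omega^Q)$; these sets tile $\mathbb{R}^2$. For each $p$ an arbitrary $z_K^p\in T_K(p)$ is chosen. $\lambda$ is Lebesgue measure and $e_1,e_2$ the standard basis of $\mathbb{R}^2$. Modification algorithm. Let $f(x)=\max(\min(x,1)+\min(2-x,0),0)$ and let $\rho:[0,4]\to\partial I^2$, $\rho(x)=f(x)e_1+f(4-x)e_2$, a parametrization of $\partial I^2$. Let $Ad$ be the set of $p\in\Lambda^Q$ such that the interior of $T_K(p)$ intersects $\partial I^2$. If $Ad=\emptyset$, set $P_{mod}^Q(K)=P^Q(K)$. Otherwise start from $P^Q(K)$ and remove every $z_K^q\in P^Q(K)$ with $q\in Ad$. Choose $t_0<t_1<\dots<t_R$ in $[0,4]$ and distinct $q_0,\dots,q_R\in\Lambda^Q$ with $\rho(t_j)\in T_K(q_j)$, such that the list of the $q_j$ is maximal, i.e. no other $p\in\Lambda^Q$ has $\rho(\tau)\in T_K(p)$ for some $\tau$. Delete all pairs $(t_j,q_j)$ with $q_j\notin Ad$, and relabel the remaining ones in order as $t_0'<\dots<t'_{R'}$ and $q_0',\dots,q'_{R'}$. For $1\leq k\leq4$ let $B_k=\{j : k-1\leq t_j'<k\}$. For each $k=1,2,3,4$ separately do the following: let $s_1$ be the first integer with $\min(B_k)<s_1\leq\max(B_k)$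 and $$\frac{K^2}{|\det(Q)|}\sum_{j=\min(B_k)}^{s_1}\lambda\big(T_K(q_j')\cap I^2\big)>1,$$ and add an arbitrary point $\zeta_K^1\in T_K(q'_{s_1})\cap I^2$ to the point set; once $\zeta_K^1,\dots,\zeta_K^m$ have been added, let $s_{m+1}$ be the first integer with $s_m<s_{m+1}\leq\max(B_k)$ and $$\frac{K^2}{|\det(Q)|}\sum_{j=\min(B_k)}^{s_{m+1}}\lambda\big(T_K(q_j')\cap I^2\big)>m+1,$$ and add an arbitrary point $\zeta_K^{m+1}\in T_K(q'_{s_{m+1}})\cap I^2$; as soon as no such integer exists, pass to the next $k$. The resulting set is $P_{mod}^Q(K)$. *)

theory Defs
  imports "HOL-Analysis.Analysis"
begin

section \<open>Spherical cap discrepancy\<close>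

text \<open>Colatitude \<open>\<theta>\<close> and longitude \<open>\<phi>\<close>; the area element of this parametrization of the unit
  sphere is \<open>sin \<theta> d\<theta> d\<phi>\<close>, with total mass \<open>4 * pi\<close>.\<close>

definition sphere_param :: "real \<times> real \<Rightarrow> real^3" where
  "sphere_param = (\<lambda>(\<theta>, \<phi>). vector [sin \<theta> * cos \<phi>, sin \<theta> * sin \<phi>, cos \<theta>])"

definition sphere_measure :: "(real^3) measure" where
  "sphere_measure =
     distr
       (density lborel
         (\<lambda>(\<theta>, \<phi>). ennreal (indicator ({0..pi} \<times> {0..2 * pi}) (\<theta>, \<phi>) * sin \<theta> / (4 * pi))))
       borel sphere_param"

definition cap :: "real^3 \<Rightarrow> real \<Rightarrow> (real^3) set" where
  "cap w t = {u \<in> sphere 0 1. t \<le> w \<bullet> u}"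

definition cap_discrepancy :: "(real^3) set \<Rightarrow> real" where
  "cap_discrepancy P =
     (SUP w \<in> sphere 0 1. SUP t \<in> {-1..1}.
        \<bar>(1 / real (card P)) * (\<Sum>p\<in>P. indicator (cap w t) p) - measure sphere_measure (cap w t)\<bar>)"

section \<open>The Lambert map\<close>

definition I2 :: "(real^2) set" where
  "I2 = {v. 0 \<le> v$1 \<and> v$1 < 1 \<and> 0 < v$2 \<and> v$2 < 1}"

definition lambert :: "real^2 \<Rightarrow> real^3" where
  "lambert v =
     vector [2 * sqrt (v$2 - (v$2)^2) * cos (2 * pi * v$1),
             2 * sqrt (v$2 - (v$2)^2) * sin (2 * pi * v$1),
             1 - 2 * v$2]"

section \<open>Perturbed lattices\<close>

definition lattice :: "real^2^2 \<Rightarrow> (real^2) set" where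
  "lattice Q = (\<lambda>v. Q *v v) ` {v. \<forall>i. v$i \<in> \<int>}"

definition fund_domain :: "real^2^2 \<Rightarrow> (real^2) set" where
  "fund_domain Q = (\<lambda>v. Q *v v) ` {v. \<forall>i. 0 \<le> v$i \<and> v$i < 1}"

definition tile :: "real^2^2 \<Rightarrow> nat \<Rightarrow> real^2 \<Rightarrow> (real^2) set" where
  "tile Q K p = (\<lambda>w. (1 / real K) *\<^sub>R (p + w)) ` fund_domain Q"

text \<open>The family \<open>z\<close> chooses one point in every tile of level \<open>K\<close>.\<close>

definition tile_choice :: "real^2^2 \<Rightarrow> nat \<Rightarrow> (real^2 \<Rightarrow> real^2) \<Rightarrow> bool" where
  "tile_choice Q K z \<longleftrightarrow> (\<forall>p \<in> lattice Q. z p \<in> tile Q K p)"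

definition point_set :: "real^2^2 \<Rightarrow> (real^2 \<Rightarrow> real^2) \<Rightarrow> (real^2) set" where
  "point_set Q z = z ` lattice Q \<inter> I2"

section \<open>The modification algorithm\<close>

definition hat :: "real \<Rightarrow> real" where
  "hat s = max (min s 1 + min (2 - s) 0) 0"

definition rho :: "real \<Rightarrow> real^2" where
  "rho s = vector [hat s, hat (4 - s)]"

definition Ad :: "real^2^2 \<Rightarrow> nat \<Rightarrow> (real^2) set" where
  "Ad Q K = {p \<in> lattice Q. interior (tile Q K p) \<inter> frontier I2 \<noteq> {}}"

text \<open>The pairs \<open>(t\<^sub>j, q\<^sub>j)\<close> are kept in one list, indexed from 0.\<close>

definition boundary_list :: "real^2^2 \<Rightarrow> nat \<Rightarrow> (real \<times> (real^2)) list \<Rightarrow> bool" where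
  "boundary_list Q K tq \<longleftrightarrow>
     sorted_wrt (<) (map fst tq) \<and> distinct (map snd tq) \<and>
     (\<forall>(t, q) \<in> set tq. t \<in> {0..4} \<and> q \<in> lattice Q \<and> rho t \<in> tile Q K q) \<and>
     (\<forall>p \<in> lattice Q. (\<exists>\<tau> \<in> {0..4}. rho \<tau> \<in> tile Q K p) \<longrightarrow> p \<in> snd ` set tq)"

definition Ad_list :: "real^2^2 \<Rightarrow> nat \<Rightarrow> (real \<times> (real^2)) list \<Rightarrow> (real \<times> (real^2)) list" where
  "Ad_list Q K tq = filter (\<lambda>(t, q). q \<in> Ad Q K) tq"

text \<open>From here on \<open>tq\<close> is the relabelled list of the pairs \<open>(t'\<^sub>j, q'\<^sub>j)\<close>.\<close>

definition edge_indices :: "(real \<times> (real^2)) list \<Rightarrow> nat \<Rightarrow> nat set" where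
  "edge_indices tq k =
     {j. j < length tq \<and> real k - 1 \<le> fst (tq ! j) \<and> fst (tq ! j) < real k}"

definition edge_weight ::
    "real^2^2 \<Rightarrow> nat \<Rightarrow> (real \<times> (real^2)) list \<Rightarrow> nat \<Rightarrow> nat \<Rightarrow> real" where
  "edge_weight Q K tq k s =
     (real K)^2 / \<bar>det Q\<bar> *
     (\<Sum>j = Min (edge_indices tq k)..s. measure lebesgue (tile Q K (snd (tq ! j)) \<inter> I2))"

definition first_index ::
    "real^2^2 \<Rightarrow> nat \<Rightarrow> (real \<times> (real^2)) list \<Rightarrow> nat \<Rightarrow> nat \<Rightarrow> nat \<Rightarrow> nat \<Rightarrow> bool" where
  "first_index Q K tq k prev m s \<longleftrightarrow>
     prev < s \<and> s \<le> Max (edge_indices tq k) \<and> edge_weight Q K tq k s > real m \<and>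
     (\<forall>s'. prev < s' \<and> s' < s \<longrightarrow> \<not> edge_weight Q K tq k s' > real m)"

text \<open>\<open>edge_run Q K tq k m prev A\<close>: after \<open>m\<close> points have been added for the \<open>k\<close>-th edge, the last
  one at index \<open>prev\<close> (with \<open>prev\<close> the minimum of the \<open>k\<close>-th index set if \<open>m = 0\<close>), \<open>A\<close> is a
  possible set of the points still to be added for this edge.\<close>

inductive edge_run ::
    "real^2^2 \<Rightarrow> nat \<Rightarrow> (real \<times> (real^2)) list \<Rightarrow> nat \<Rightarrow> nat \<Rightarrow> nat \<Rightarrow> (real^2) set \<Rightarrow> bool"
  for Q K tq k where
  stop: "\<nexists>s. first_index Q K tq k prev (Suc m) s \<Longrightarrow> edge_run Q K tq k m prev {}"
| step: "\<lbrakk> first_index Q K tq k prev (Suc m) s;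
           \<zeta> \<in> tile Q K (snd (tq ! s)) \<inter> I2;
           edge_run Q K tq k (Suc m) s A \<rbrakk>
         \<Longrightarrow> edge_run Q K tq k m prev (insert \<zeta> A)"

definition edge_additions ::
    "real^2^2 \<Rightarrow> nat \<Rightarrow> (real \<times> (real^2)) list \<Rightarrow> nat \<Rightarrow> (real^2) set \<Rightarrow> bool" where
  "edge_additions Q K tq k A \<longleftrightarrow>
     (if edge_indices tq k = {} then A = {}
      else edge_run Q K tq k 0 (Min (edge_indices tq k)) A)"

text \<open>The algorithm involves arbitrary choices, so it is a relation: \<open>P\<close> is a possible output.\<close>

definition modified_point_set ::
    "real^2^2 \<Rightarrow> nat \<Rightarrow> (real^2 \<Rightarrow> real^2) \<Rightarrow> (real^2) set \<Rightarrow> bool" where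
  "modified_point_set Q K z P \<longleftrightarrow>
     (if Ad Q K = {} then P = point_set Q z
      else \<exists>tq A. boundary_list Q K tq \<and>
             (\<forall>k \<in> {1..4}. edge_additions Q K (Ad_list Q K tq) k (A k)) \<and>
             P = (point_set Q z - z ` Ad Q K) \<union> (\<Union>k \<in> {1..4}. A k))"

section \<open>The family of square lattices\<close>

definition Qmat :: "real \<Rightarrow> real \<Rightarrow> real^2^2" where
  "Qmat x y = (1 / y) *\<^sub>R vector [vector [x, -1], vector [1, x]]"

end

theory Submission
  imports Defs "HOL-Computational_Algebra.Polynomial"
begin

text \<open>The Lambert map preserves area, so a cap becomes the region \<open>F > t\<close> in the unit square and the
  tiles become the cells of a square grid. An inner tile that the curve \<open>F = t\<close> does not meet contributes
  to the point count what it contributes to the area, except that points chosen on the boundary of tiles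
  touching an edge of the square may be lost or gained there. Since the complement of a cap is a cap, only
  upper bounds for the surplus are needed: the number of tiles met by the curve, minus the part of the cap
  in these tiles, plus the effect of the lost and gained points. Monotone arcs of the curve meet at most
  as many tiles as their variation in grid coordinates. For caps near the hemispheres this alone
  would exceed the constant \<open>sqrt 18\<close> once the lost and gained points are included; there the area of the cap inside the
  tiles met by the curve makes up for the difference. Along an edge the added points follow the
  accumulated area within one unit on each interval where \<open>F - t\<close> has constant sign, and each edge has at
  most two zeros of \<open>F - t\<close>. As the point set is finite, a cap may be perturbed to a generic one.\<close>

section \<open>Area of spherical caps\<close>

text \<open>Division by \<open>N_m\<close> turns an error O(1) in the count into O(1/K^2), so the
  count has to be right up to O(1), uniformly in the cap. Hence arcs are cut only at roots of
  polynomials of fixed degree, each piece costing a bounded amount. The leading term has no slack.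
  With \<open>h = \<kappa> * sqrt (1 + \<xi>^2)\<close>, the root of the number of tiles per unit
  area, the curve meets up to about \<open>3 * \<kappa> * (1 + \<bar>\<xi>\<bar>)\<close> tiles. For
  \<open>\<bar>\<xi>\<bar> = 1\<close> this is \<open>sqrt 18 * h\<close>, while the lost and gained
  points are also of order \<open>\<kappa>\<close>. For \<open>vv \<le> 4/5\<close> the curve is
  short enough to leave room for them. Beyond that, the area in the tiles met has to supply
  \<open>17/32 * \<mu> * \<kappa>\<close>. Here 17/32 is 1/2 + 1/32: 1/2 is the weight of a lost
  point for a hemisphere, and 1/32 is the maximum of \<open>\<bar>t\<bar> / 2 - 2 * t^2\<close>, the
  part not absorbed by the shortening of the curve as \<open>t\<close> grows. For
  \<open>\<xi> = 0\<close> points can be lost or gained on more edges, but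
  \<open>\<kappa> * (1 + \<bar>\<xi>\<bar>)\<close> is small enough to need no area.\<close>

abbreviation pt :: "real \<Rightarrow> real \<Rightarrow> real^2" where "pt x y \<equiv> vector [x, y]"

lemma pt_eta: "pt (w$1) (w$2) = w"
  by (simp add: vec_eq_iff forall_2)

lemma vec2_eqI: "v$1 = w$1 \<Longrightarrow> v$2 = w$2 \<Longrightarrow> v = (w::real^2)"
  by (simp add: vec_eq_iff forall_2)

lemma continuous_pt: "continuous_on UNIV (\<lambda>p::real\<times>real. pt (fst p) (snd p))"
proof -
  have eq: "(\<lambda>p::real\<times>real. pt (fst p) (snd p)) = (\<lambda>p. \<chi> i. if i = 1 then fst p else snd p)"
    by (auto simp: vec_eq_iff forall_2)
  show ?thesis
    unfolding eq
  proof (intro continuous_on_vec_lambda)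
    fix i :: 2
    show "continuous_on UNIV (\<lambda>p::real\<times>real. if i = 1 then fst p else snd p)"
      by (cases "i = 1") (auto intro!: continuous_intros)
  qed
qed

lemma measurable_pt [measurable]:
  "(\<lambda>p::real\<times>real. pt (fst p) (snd p)) \<in> borel_measurable borel"
  by (rule borel_measurable_continuous_onI[OF continuous_pt])

lemma measurable_pt_case [measurable]:
  "(\<lambda>(x,y). pt x y) \<in> borel_measurable (borel \<Otimes>\<^sub>M borel)"
  using measurable_pt by (simp add: borel_prod case_prod_beta')

section \<open>Slicing planar Lebesgue measure\<close>

lemma Basis_vec2: "(Basis :: (real^2) set) = {axis 1 1, axis 2 1}"
  by (auto simp: Basis_vec_def UNIV_2)

lemma axis_neq2: "axis 1 1 \<noteq> (axis 2 1 :: real^2)"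
  by (simp add: axis_eq_axis)

lemma lborel_vec2: "(lborel :: (real^2) measure) = distr (lborel :: (real\<times>real) measure) borel (\<lambda>p. pt (fst p) (snd p))"
proof (rule lborel_eqI)
  fix l u :: "real^2"
  assume le: "\<And>b. b \<in> Basis \<Longrightarrow> l \<bullet> b \<le> u \<bullet> b"
  have 1: "l$1 \<le> u$1" "l$2 \<le> u$2"
    using le[of "axis 1 1"] le[of "axis 2 1"] by (auto simp: Basis_vec2 inner_axis)
  have eq: "(\<lambda>p. pt (fst p) (snd p)) -` box l u = box (l$1, l$2) (u$1, u$2)"
    by (auto simp: box_def Basis_vec2 inner_axis Basis_prod_def)
  have "emeasure (distr lborel borel (\<lambda>p. pt (fst p) (snd p))) (box l u) = emeasure lborel (box (l$1, l$2) (u$1, u$2))"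
    by (subst emeasure_distr) (auto simp: eq)
  also have "\<dots> = ennreal (\<Prod>b\<in>Basis. ((u$1, u$2) - (l$1, l$2)) \<bullet> b)"
    using 1 by (subst emeasure_lborel_box) (auto simp: Basis_prod_def)
  also have "(\<Prod>b\<in>Basis. ((u$1, u$2) - (l$1, l$2)) \<bullet> b) = (\<Prod>b\<in>Basis. (u - l) \<bullet> b)"
    unfolding Basis_vec2 by (simp add: axis_neq2 inner_axis Basis_prod_def)
  finally show "emeasure (distr lborel borel (\<lambda>p. pt (fst p) (snd p))) (box l u) = (\<Prod>b\<in>Basis. (u - l) \<bullet> b)" .
qed simp

lemma emeasure_vec2_sections:
  fixes A :: "(real^2) set"
  assumes [measurable]: "A \<in> sets borel"
  shows "emeasure lborel A = (\<integral>\<^sup>+y. emeasure lborel {x. pt x y \<in> A} \<partial>lborel)"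
proof -
  let ?B = "{p::real\<times>real. pt (fst p) (snd p) \<in> A}"
  have B[measurable]: "?B \<in> sets (borel \<Otimes>\<^sub>M borel)"
    unfolding borel_prod using measurable_sets[OF measurable_pt assms] by (simp add: vimage_def)
  have "emeasure lborel A = emeasure (lborel :: (real\<times>real) measure) ?B"
    by (subst lborel_vec2, subst emeasure_distr) (auto simp: vimage_def)
  also have "\<dots> = emeasure (lborel \<Otimes>\<^sub>M lborel) ?B"
    by (simp add: lborel_prod)
  also have "\<dots> = (\<integral>\<^sup>+y. \<integral>\<^sup>+x. indicator ?B (x, y) \<partial>lborel \<partial>lborel)"
    by (subst lborel_pair.nn_integral_snd) auto
  also have "\<dots> = (\<integral>\<^sup>+y. emeasure lborel {x. pt x y \<in> A} \<partial>lborel)"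
  proof (intro nn_integral_cong)
    fix y :: real
    have [measurable]: "{x. pt x y \<in> A} \<in> sets borel"
    proof -
      have "(\<lambda>x. pt x y) \<in> borel_measurable borel" by measurable
      from measurable_sets[OF this assms] show ?thesis by (simp add: vimage_def)
    qed
    have "(\<integral>\<^sup>+x. indicator ?B (x, y) \<partial>lborel) = (\<integral>\<^sup>+x. indicator {x. pt x y \<in> A} x \<partial>lborel)"
      by (intro nn_integral_cong) (auto simp: indicator_def)
    then show "(\<integral>\<^sup>+x. indicator ?B (x, y) \<partial>lborel) = emeasure lborel {x. pt x y \<in> A}"
      by simp
  qed
  finally show ?thesis .
qed

text \<open>Clipping gives \<open>arccos\<close> a meaningful argument when a circle of latitude
  misses the cap (\<open>arccos 1 = 0\<close>) or lies inside it
  (\<open>arccos (-1) = pi\<close>).\<close>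

definition clip :: "real \<Rightarrow> real" where "clip x = max (-1) (min 1 x)"

text \<open>The density of \<open>m + r * cos \<phi>\<close> for a uniformly distributed angle \<open>\<phi>\<close>, that is, of the height of
  a circle of latitude above the plane that bounds a cap.\<close>

definition arcsine_density :: "real \<Rightarrow> real \<Rightarrow> real \<Rightarrow> real" where
  "arcsine_density m r \<tau> = (if \<bar>\<tau> - m\<bar> < r then 1 / (pi * sqrt (r\<^sup>2 - (\<tau> - m)\<^sup>2)) else 0)"

lemma arcsine_density_nonneg: "0 \<le> arcsine_density m r \<tau>"
proof -
  have "0 \<le> r\<^sup>2 - (\<tau> - m)\<^sup>2" if "\<bar>\<tau> - m\<bar> < r"
    using that by (simp add: abs_le_square_iff[symmetric])
  then show ?thesis by (auto simp: arcsine_density_def)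
qed

lemma arcsine_density_measurable [measurable (raw)]:
  assumes [measurable]: "f \<in> borel_measurable M" "g \<in> borel_measurable M" "h \<in> borel_measurable M"
  shows "(\<lambda>x. arcsine_density (f x) (g x) (h x)) \<in> borel_measurable M"
  unfolding arcsine_density_def by measurable

text \<open>The antiderivative \<open>- arccos ((\<tau> - m) / r) / pi\<close> stays continuous at
  the ends of the support, where the density blows up; so the fundamental theorem is used in the
  form that asks for derivatives only in the interior.\<close>

lemma arcsine_tail:
  assumes r: "r > 0"
  shows "(\<integral>\<^sup>+\<tau>. ennreal (arcsine_density m r \<tau>) * indicator {\<tau>0<..} \<tau> \<partial>lborel)
       = ennreal (arccos (clip ((\<tau>0 - m) / r)) / pi)"
proof -
  define l where "l = max (m - r) (min (m + r) \<tau>0)"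
  have l: "m - r \<le> l" "l \<le> m + r" using r by (auto simp: l_def)
  define g where "g = (\<lambda>\<tau>. - arccos ((\<tau> - m) / r) / pi)"
  have "(arcsine_density m r has_integral (g (m + r) - g l)) {l..m+r}"
  proof (rule fundamental_theorem_of_calculus_interior)
    show "l \<le> m + r" by (rule l)
    have "-1 \<le> (\<tau> - m) / r \<and> (\<tau> - m) / r \<le> 1" if "\<tau> \<in> {l..m+r}" for \<tau>
      using that l r by (auto simp: field_simps)
    then show "continuous_on {l..m+r} g"
      unfolding g_def using r by (intro continuous_intros) auto
    fix \<tau> assume \<tau>: "\<tau> \<in> {l<..<m+r}"
    then have a: "\<bar>\<tau> - m\<bar> < r" using l by auto
    then have b: "-1 < (\<tau> - m) / r" "(\<tau> - m) / r < 1" using r by (auto simp: field_simps)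
    have "(g has_real_derivative (- (inverse (- sqrt (1 - ((\<tau> - m) / r)\<^sup>2)) * (1 / r)) / pi)) (at \<tau>)"
      unfolding g_def using b r by (auto intro!: derivative_eq_intros)
    moreover have "r * sqrt (1 - ((\<tau> - m) / r)\<^sup>2) = sqrt (r\<^sup>2 - (\<tau> - m)\<^sup>2)"
    proof -
      have "r * sqrt (1 - ((\<tau> - m) / r)\<^sup>2) = sqrt (r\<^sup>2 * (1 - ((\<tau> - m) / r)\<^sup>2))"
        using r by (simp add: real_sqrt_mult)
      also have "r\<^sup>2 * (1 - ((\<tau> - m) / r)\<^sup>2) = r\<^sup>2 - (\<tau> - m)\<^sup>2"
        using r by (simp add: field_simps)
      finally show ?thesis .
    qed
    ultimately show "(g has_vector_derivative arcsine_density m r \<tau>) (at \<tau>)"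
      using a r by (simp add: arcsine_density_def has_real_derivative_iff_has_vector_derivative[symmetric] field_simps)
  qed
  then have "(\<integral>\<^sup>+\<tau>. ennreal (arcsine_density m r \<tau>) * indicator {l..m+r} \<tau> \<partial>lborel) = ennreal (g (m + r) - g l)"
    by (intro nn_integral_has_integral_lebesgue') (auto simp: arcsine_density_nonneg)
  also have "g (m + r) - g l = arccos (clip ((\<tau>0 - m) / r)) / pi"
  proof -
    have "(l - m) / r = clip ((\<tau>0 - m) / r)"
      using r by (auto simp: clip_def l_def max_def min_def field_simps)
    then show ?thesis using r by (simp add: g_def)
  qed
  also have "(\<integral>\<^sup>+\<tau>. ennreal (arcsine_density m r \<tau>) * indicator {l..m+r} \<tau> \<partial>lborel)
           = (\<integral>\<^sup>+\<tau>. ennreal (arcsine_density m r \<tau>) * indicator {\<tau>0<..} \<tau> \<partial>lborel)"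
  proof (rule nn_integral_cong_AE)
    have "AE \<tau> in lborel. \<tau> \<noteq> \<tau>0" by (simp add: AE_lborel_singleton)
    then show "AE \<tau> in lborel. ennreal (arcsine_density m r \<tau>) * indicator {l..m+r} \<tau>
             = ennreal (arcsine_density m r \<tau>) * indicator {\<tau>0<..} \<tau>"
      by eventually_elim (auto simp: indicator_def arcsine_density_def l_def)
  qed
  finally show ?thesis .
qed

lemma arcsine_total:
  assumes r: "r > 0"
  shows "(\<integral>\<^sup>+\<tau>. ennreal (arcsine_density m r \<tau>) \<partial>lborel) = 1"
proof -
  have "(\<integral>\<^sup>+\<tau>. ennreal (arcsine_density m r \<tau>) \<partial>lborel)
      = (\<integral>\<^sup>+\<tau>. ennreal (arcsine_density m r \<tau>) * indicator {m-r<..} \<tau> \<partial>lborel)"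
    by (intro nn_integral_cong) (auto simp: indicator_def arcsine_density_def)
  then show ?thesis using r by (simp add: arcsine_tail clip_def)
qed

section \<open>The part of a circle of latitude inside a cap\<close>

lemma emeasure_periodic_window:
  fixes A :: "real set"
  assumes [measurable]: "A \<in> sets borel" and per: "\<And>x. x + 1 \<in> A \<longleftrightarrow> x \<in> A" and a: "0 \<le> a" "a \<le> 1"
  shows "emeasure lborel (A \<inter> {a..<a+1}) = emeasure lborel (A \<inter> {0..<1})"
proof -
  have sh: "emeasure lborel (A \<inter> {1..<1+a}) = emeasure lborel (A \<inter> {0..<a})"
  proof -
    have "emeasure lborel (A \<inter> {1..<1+a}) = emeasure (distr lborel borel ((+) 1)) (A \<inter> {1..<1+a})"
      by (simp add: lborel_distr_plus)
    also have "\<dots> = emeasure lborel ((+) 1 -` (A \<inter> {1..<1+a}))"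
      by (subst emeasure_distr) auto
    also have "(+) 1 -` (A \<inter> {1..<1+a}) = A \<inter> {0..<a}"
    proof (rule set_eqI)
      fix x
      have "1 + x \<in> A \<longleftrightarrow> x \<in> A" using per[of x] by (simp only: add.commute[of 1 x])
      then show "x \<in> (+) 1 -` (A \<inter> {1..<1+a}) \<longleftrightarrow> x \<in> A \<inter> {0..<a}" by simp
    qed
    finally show ?thesis .
  qed
  have "emeasure lborel (A \<inter> {a..<a+1}) = emeasure lborel ((A \<inter> {a..<1}) \<union> (A \<inter> {1..<1+a}))"
    using a by (intro arg_cong[where f="emeasure lborel"]) auto
  also have "\<dots> = emeasure lborel (A \<inter> {a..<1}) + emeasure lborel (A \<inter> {0..<a})"
    by (subst plus_emeasure[symmetric]) (auto simp: sh)
  also have "\<dots> = emeasure lborel ((A \<inter> {a..<1}) \<union> (A \<inter> {0..<a}))"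
    by (subst plus_emeasure) auto
  also have "(A \<inter> {a..<1}) \<union> (A \<inter> {0..<a}) = A \<inter> {0..<1}"
    using a by auto
  finally show ?thesis .
qed

lemma cos_gt_iff_abs_less_arccos:
  assumes "\<bar>x\<bar> \<le> pi"
  shows "cos x > c \<longleftrightarrow> \<bar>x\<bar> < arccos (clip c) \<or> c < -1"
proof (cases "\<bar>c\<bar> \<le> 1")
  case True
  then have "cos (arccos c) = c" by (rule cos_arccos_abs)
  moreover have "0 \<le> arccos c" "arccos c \<le> pi" using True by (auto intro: arccos_lbound arccos_ubound)
  ultimately have "cos \<bar>x\<bar> > c \<longleftrightarrow> \<bar>x\<bar> < arccos c"
    using cos_mono_less_eq[of "arccos c" "\<bar>x\<bar>"] assms by auto
  moreover have "clip c = c" using True by (auto simp: clip_def)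
  ultimately show ?thesis using True by auto
next
  case False
  then consider "c > 1" | "c < -1" by linarith
  then show ?thesis
  proof cases
    case 1
    then have "clip c = 1" "\<not> c < cos x" using cos_le_one[of x] by (auto simp: clip_def simp del: cos_le_one)
    then show ?thesis using 1 by simp
  next
    case 2
    then show ?thesis using cos_ge_minus_one[of x] by (simp add: less_le_trans)
  qed
qed

lemma emeasure_cos_gt:
  assumes x0: "0 \<le> x0" "x0 < 1"
  shows "emeasure lborel {x \<in> {0..<1}. cos (2 * pi * (x - x0)) > c} = ennreal (arccos (clip c) / pi)"
proof -
  \<comment> \<open>A representative of the centre modulo 1 for which the window of length 1 around
    it starts in [0, 1].\<close>
  define m where "m = (if x0 \<ge> 1/2 then x0 else x0 + 1)"
  define A where "A = {x. cos (2 * pi * (x - x0)) > c}"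
  have A_m: "A = {x. cos (2 * pi * (x - m)) > c}"
  proof -
    have "cos (2 * pi * (x - (x0 + 1))) = cos (2 * pi * (x - x0))" for x
      using cos_periodic[of "2 * pi * (x - (x0 + 1))"] by (simp add: algebra_simps)
    then show ?thesis by (auto simp: A_def m_def)
  qed
  have [measurable]: "A \<in> sets borel" unfolding A_def by measurable
  have per: "x + 1 \<in> A \<longleftrightarrow> x \<in> A" for x
    using cos_periodic[of "2 * pi * (x - x0)"] by (simp add: A_def algebra_simps)
  have "emeasure lborel (A \<inter> {0..<1}) = emeasure lborel (A \<inter> {m - 1/2..<m - 1/2+1})"
    by (rule emeasure_periodic_window[symmetric]) (use per x0 in \<open>auto simp: m_def\<close>)
  also have "\<dots> = emeasure lborel {m - arccos (clip c) / (2*pi)..m + arccos (clip c) / (2*pi)}"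
  proof -
    define h where "h = arccos (clip c) / (2*pi)"
    have cl: "\<bar>clip c\<bar> \<le> 1" by (auto simp: clip_def)
    have h: "0 \<le> h" "h \<le> 1/2"
      using arccos_lbound[of "clip c"] arccos_ubound[of "clip c"] cl by (auto simp: h_def field_simps)
    have c1: "c < -1 \<Longrightarrow> h = 1/2" by (simp add: clip_def h_def)
    have eq: "x \<in> A \<longleftrightarrow> \<bar>x - m\<bar> < h \<or> c < -1" if "\<bar>x - m\<bar> \<le> 1/2" for x
    proof -
      have "\<bar>2 * pi * (x - m)\<bar> \<le> pi" using that by (simp add: abs_mult)
      from cos_gt_iff_abs_less_arccos[OF this, of c]
      moreover have "\<bar>2 * pi * (x - m)\<bar> = 2 * pi * \<bar>x - m\<bar>" by (simp add: abs_mult)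
      moreover have "2 * pi * \<bar>x - m\<bar> < arccos (clip c) \<longleftrightarrow> \<bar>x - m\<bar> < h" by (simp add: field_simps h_def)
      ultimately show ?thesis by (simp add: A_m)
    qed
    show ?thesis unfolding h_def[symmetric]
    proof (rule emeasure_eq_AE)
      have "AE x in lborel. x \<noteq> m - h" "AE x in lborel. x \<noteq> m + h"
        by (simp_all add: AE_lborel_singleton)
      then show "AE x in lborel. x \<in> A \<inter> {m - 1 / 2..<m - 1 / 2 + 1} \<longleftrightarrow> x \<in> {m - h..m + h}"
      proof eventually_elim
        case (elim x)
        show ?case
        proof (cases "\<bar>x - m\<bar> \<le> 1/2")
          case True
          then show ?thesis using eq[OF True] elim h c1 by auto
        next
          case False
          then have "x < m - 1/2 \<or> x > m + 1/2" by linarith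
          then show ?thesis using h by auto
        qed
      qed
    qed auto
  qed
  also have "\<dots> = ennreal (arccos (clip c) / pi)"
    using arccos_lbound[of "clip c"] by (subst emeasure_lborel_Icc) (auto simp: clip_def field_simps)
  finally show ?thesis by (simp add: A_def Int_def conj_commute)
qed

text \<open>\<open>capF c b x0 p\<close> is the inner product of \<open>lambert p\<close> with the unit vector of height \<open>b\<close> and longitude
  \<open>2 * pi * x0\<close> (see \<open>inner_lambert\<close>).\<close>

definition capF :: "real \<Rightarrow> real \<Rightarrow> real \<Rightarrow> real^2 \<Rightarrow> real" where
  "capF c b x0 w = c * (2 * sqrt (w$2 - (w$2)\<^sup>2)) * cos (2 * pi * (w$1 - x0)) + b * (1 - 2 * w$2)"

lemma continuous_capF: "continuous_on UNIV (capF c b x0)"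
  unfolding capF_def by (intro continuous_intros)

lemma capF_measurable [measurable]: "capF c b x0 \<in> borel_measurable borel"
  by (rule borel_measurable_continuous_onI[OF continuous_capF])

lemma I2_measurable [measurable]: "I2 \<in> sets borel"
proof -
  have "(\<lambda>v::real^2. v$i) \<in> borel_measurable borel" for i
    by (intro borel_measurable_continuous_onI continuous_intros)
  then show ?thesis unfolding I2_def by measurable
qed

text \<open>Both sides equal \<open>1 - b^2 - s^2 - \<tau>^2 + 2 * b * s * \<tau>\<close>, the Gram
  determinant of the north pole, the cap axis and a point of the sphere. Its symmetry lets the
  height \<open>s\<close> and the inner product \<open>\<tau>\<close> with the axis exchange their
  roles.\<close>

lemma cap_discriminant:
  fixes c b s \<tau> :: real
  assumes "c\<^sup>2 + b\<^sup>2 = 1"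
  shows "c\<^sup>2 * (1 - s\<^sup>2) - (\<tau> - b * s)\<^sup>2 = c\<^sup>2 * (1 - \<tau>\<^sup>2) - (s - \<tau> * b)\<^sup>2"
proof -
  have "c\<^sup>2 = 1 - b\<^sup>2" using assms by simp
  then show ?thesis by (simp only:) (simp add: power2_eq_square algebra_simps)
qed

text \<open>By the symmetry of the Gram determinant, the arcsine density in \<open>\<tau>\<close> at
  fixed height is also, at fixed \<open>\<tau>\<close>, an arcsine density in \<open>y\<close>. The
  factor 1/2 comes from \<open>s = 1 - 2 * y\<close>.\<close>

lemma arcsine_density_cap:
  fixes c b y \<tau> :: real
  assumes c: "c > 0" "c\<^sup>2 + b\<^sup>2 = 1"
  shows "arcsine_density (b * (1 - 2*y)) (c * (2 * sqrt (y - y\<^sup>2))) \<tau> * indicator {0<..<1} y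
       = (if \<bar>\<tau>\<bar> < 1 then arcsine_density ((1 - \<tau>*b)/2) (c * sqrt (1 - \<tau>\<^sup>2) / 2) y / 2 else 0)"
proof -
  define s where "s = 1 - 2*y"
  define R where "R = c\<^sup>2 * (1 - s\<^sup>2) - (\<tau> - b * s)\<^sup>2"
  have R2: "R = c\<^sup>2 * (1 - \<tau>\<^sup>2) - (s - \<tau> * b)\<^sup>2" unfolding R_def by (rule cap_discriminant[OF c(2)])
  have yy: "4 * (y - y\<^sup>2) = 1 - s\<^sup>2" by (simp add: s_def power2_eq_square algebra_simps)
  have y01: "0 < y \<and> y < 1 \<longleftrightarrow> s\<^sup>2 < 1"
  proof -
    have "s\<^sup>2 < 1 \<longleftrightarrow> \<bar>s\<bar> < 1" by (simp add: abs_square_less_1)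
    then show ?thesis by (auto simp: s_def)
  qed
  have abs_lt: "\<bar>x\<bar> < r \<longleftrightarrow> x\<^sup>2 < r\<^sup>2" if "r \<ge> 0" for x r :: real
    using that abs_le_square_iff[of r x] by (auto simp: not_le[symmetric])
  have L: "arcsine_density (b * (1 - 2*y)) (c * (2 * sqrt (y - y\<^sup>2))) \<tau> * indicator {0<..<1} y
      = (if R > 0 then 1 / (pi * sqrt R) else 0)"
  proof (cases "s\<^sup>2 < 1")
    case True
    then have r2: "(c * (2 * sqrt (y - y\<^sup>2)))\<^sup>2 = c\<^sup>2 * (1 - s\<^sup>2)" and r0: "0 \<le> c * (2 * sqrt (y - y\<^sup>2))"
      using yy c by (auto simp: power_mult_distrib)
    have "\<bar>\<tau> - b * (1 - 2*y)\<bar> < c * (2 * sqrt (y - y\<^sup>2)) \<longleftrightarrow> R > 0"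
      unfolding abs_lt[OF r0] r2 R_def s_def by auto
    then show ?thesis using True y01 unfolding arcsine_density_def r2 by (auto simp: R_def s_def)
  next
    case False
    then have "c\<^sup>2 * (1 - s\<^sup>2) \<le> 0" by (simp add: mult_le_0_iff)
    then have "R \<le> 0" unfolding R_def using zero_le_power2[of "\<tau> - b * s"] by linarith
    then show ?thesis using False y01 by auto
  qed
  show ?thesis
  proof (cases "\<bar>\<tau>\<bar> < 1")
    case True
    then have t2: "\<tau>\<^sup>2 < 1" by (simp add: abs_square_less_1)
    have r2: "(c * sqrt (1 - \<tau>\<^sup>2) / 2)\<^sup>2 = c\<^sup>2 * (1 - \<tau>\<^sup>2) / 4" and r0: "0 \<le> c * sqrt (1 - \<tau>\<^sup>2) / 2"
      using t2 c by (auto simp: power_mult_distrib power_divide)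
    have y2: "(y - (1 - \<tau>*b)/2)\<^sup>2 = (s - \<tau> * b)\<^sup>2 / 4" by (simp add: s_def power2_eq_square field_simps)
    have R4: "c\<^sup>2 * (1 - \<tau>\<^sup>2) / 4 - (s - \<tau> * b)\<^sup>2 / 4 = R / 4" unfolding R2 by simp
    have "\<bar>y - (1 - \<tau>*b)/2\<bar> < c * sqrt (1 - \<tau>\<^sup>2) / 2 \<longleftrightarrow> R > 0"
      unfolding abs_lt[OF r0] r2 y2 R2 by auto
    then have "arcsine_density ((1 - \<tau>*b)/2) (c * sqrt (1 - \<tau>\<^sup>2) / 2) y / 2 = (if R > 0 then 1 / (pi * sqrt R) else 0)"
      unfolding arcsine_density_def r2 y2 R4 by (auto simp: real_sqrt_divide)
    then show ?thesis unfolding L using True by simp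
  next
    case False
    then have "\<tau>\<^sup>2 \<ge> 1" by (simp add: abs_square_less_1 not_less[symmetric])
    then have "c\<^sup>2 * (1 - \<tau>\<^sup>2) \<le> 0" by (simp add: mult_le_0_iff)
    then have "R \<le> 0" unfolding R2 using zero_le_power2[of "s - \<tau> * b"] by linarith
    then show ?thesis unfolding L using False by simp
  qed
qed

lemma emeasure_capF_gt:
  assumes c: "c > 0" "c\<^sup>2 + b\<^sup>2 = 1" and x0: "0 \<le> x0" "x0 < 1" and t: "\<bar>t\<bar> \<le> 1"
  shows "emeasure lborel {w \<in> I2. capF c b x0 w > t} = ennreal ((1 - t) / 2)"
proof -
  have [measurable]: "{w \<in> I2. capF c b x0 w > t} \<in> sets borel" by measurable
  define r where "r y = c * (2 * sqrt (y - y\<^sup>2))" for y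
  have r_meas [measurable]: "r \<in> borel_measurable borel" unfolding r_def by measurable
  have slice: "emeasure lborel {x. pt x y \<in> {w \<in> I2. capF c b x0 w > t}}
     = (\<integral>\<^sup>+\<tau>. ennreal (arcsine_density (b * (1 - 2*y)) (r y) \<tau> * indicator {0<..<1} y) * indicator {t<..} \<tau> \<partial>lborel)" for y
  proof (cases "0 < y \<and> y < 1")
    case True
    have "y\<^sup>2 < y" using True by (simp add: power2_eq_square)
    then have rp: "r y > 0" using c by (simp add: r_def)
    have "{x. pt x y \<in> {w \<in> I2. capF c b x0 w > t}} = {x \<in> {0..<1}. cos (2 * pi * (x - x0)) > (t - b * (1 - 2*y)) / r y}"
      using True rp by (auto simp: I2_def capF_def r_def[symmetric] field_simps)
    then have "emeasure lborel {x. pt x y \<in> {w \<in> I2. capF c b x0 w > t}} = ennreal (arccos (clip ((t - b * (1 - 2*y)) / r y)) / pi)"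
      by (simp only: emeasure_cos_gt[OF x0])
    then show ?thesis using True by (simp add: arcsine_tail[OF rp])
  next
    case False
    then have "{x. pt x y \<in> {w \<in> I2. capF c b x0 w > t}} = {}" by (auto simp: I2_def)
    then show ?thesis using False by (simp only: emeasure_empty) simp
  qed
  have "emeasure lborel {w \<in> I2. capF c b x0 w > t} =
     (\<integral>\<^sup>+y. \<integral>\<^sup>+\<tau>. ennreal (arcsine_density (b * (1 - 2*y)) (r y) \<tau> * indicator {0<..<1} y) * indicator {t<..} \<tau> \<partial>lborel \<partial>lborel)"
    by (subst emeasure_vec2_sections) (simp_all add: slice del: mem_Collect_eq)
  \<comment> \<open>After the exchange the inner integral runs over \<open>y\<close> and equals 1/2
    for every \<open>\<tau>\<close> in (-1, 1): the inner product with a tilted axis is uniformly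
    distributed, as Archimedes' theorem says for the polar one.\<close>
  also have "\<dots> = (\<integral>\<^sup>+\<tau>. \<integral>\<^sup>+y. ennreal (arcsine_density (b * (1 - 2*y)) (r y) \<tau> * indicator {0<..<1} y) * indicator {t<..} \<tau> \<partial>lborel \<partial>lborel)"
  proof (rule lborel_pair.Fubini')
    have "(\<lambda>(\<tau>, y). ennreal (arcsine_density (b * (1 - 2*y)) (r y) \<tau> * indicator {0<..<1} y) * indicator {t<..} \<tau>)
        \<in> borel_measurable (borel \<Otimes>\<^sub>M borel)"
      by measurable
    then show "(\<lambda>(\<tau>, y). ennreal (arcsine_density (b * (1 - 2*y)) (r y) \<tau> * indicator {0<..<1} y) * indicator {t<..} \<tau>)
        \<in> borel_measurable (lborel \<Otimes>\<^sub>M lborel)"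
      by (simp add: lborel_prod borel_prod)
  qed
  also have "\<dots> = (\<integral>\<^sup>+\<tau>. ennreal (1/2) * indicator {t<..<1} \<tau> \<partial>lborel)"
  proof (rule nn_integral_cong)
    fix \<tau> :: real
    show "(\<integral>\<^sup>+y. ennreal (arcsine_density (b * (1 - 2*y)) (r y) \<tau> * indicator {0<..<1} y) * indicator {t<..} \<tau> \<partial>lborel)
        = ennreal (1/2) * indicator {t<..<1} \<tau>"
    proof (cases "\<bar>\<tau>\<bar> < 1")
      case True
      then have "c * sqrt (1 - \<tau>\<^sup>2) / 2 > 0" using c by (simp add: abs_square_less_1)
      then have tot: "(\<integral>\<^sup>+y. ennreal (arcsine_density ((1 - \<tau>*b)/2) (c * sqrt (1 - \<tau>\<^sup>2) / 2) y) \<partial>lborel) = 1"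
        by (rule arcsine_total)
      have "(\<integral>\<^sup>+y. ennreal (arcsine_density (b * (1 - 2*y)) (r y) \<tau> * indicator {0<..<1} y) * indicator {t<..} \<tau> \<partial>lborel)
         = (\<integral>\<^sup>+y. (ennreal (1/2) * indicator {t<..} \<tau>) * ennreal (arcsine_density ((1 - \<tau>*b)/2) (c * sqrt (1 - \<tau>\<^sup>2) / 2) y) \<partial>lborel)"
        unfolding r_def arcsine_density_cap[OF c]
      proof (intro nn_integral_cong)
        fix y
        let ?a = "arcsine_density ((1 - \<tau>*b)/2) (c * sqrt (1 - \<tau>\<^sup>2) / 2) y"
        have "ennreal (1/2) * ennreal ?a = ennreal (1/2 * ?a)"
          by (rule ennreal_mult[symmetric]) (auto simp: arcsine_density_nonneg)
        then show "ennreal (if \<bar>\<tau>\<bar> < 1 then ?a / 2 else 0) * indicator {t<..} \<tau> = ennreal (1/2) * indicator {t<..} \<tau> * ennreal ?a"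
          using True by (auto simp: indicator_def)
      qed
      also have "\<dots> = ennreal (1/2) * indicator {t<..} \<tau>"
        by (subst nn_integral_cmult) (auto simp: tot)
      finally show ?thesis using True by (auto simp: indicator_def)
    next
      case False
      then show ?thesis unfolding r_def arcsine_density_cap[OF c] using t by (auto simp: indicator_def)
    qed
  qed
  also have "\<dots> = ennreal ((1 - t) / 2)"
  proof -
    have "(\<integral>\<^sup>+\<tau>. ennreal (1/2) * indicator {t<..<1} \<tau> \<partial>lborel) = ennreal (1/2) * emeasure lborel {t<..<1}"
      by (subst nn_integral_cmult) auto
    also have "\<dots> = ennreal (1/2) * ennreal (1 - t)" using t by simp
    also have "\<dots> = ennreal (1/2 * (1 - t))" using t by (intro ennreal_mult[symmetric]) auto
    finally show ?thesis by simp
  qed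
  finally show ?thesis .
qed

section \<open>The Lambert map carries planar area to the sphere measure\<close>

lemma continuous_lambert: "continuous_on UNIV lambert"
proof -
  have eq: "lambert = (\<lambda>v. \<chi> i. if i = 1 then 2 * sqrt (v$2 - (v$2)^2) * cos (2 * pi * v$1)
      else if i = 2 then 2 * sqrt (v$2 - (v$2)^2) * sin (2 * pi * v$1) else 1 - 2 * v$2)"
    by (auto simp: fun_eq_iff vec_eq_iff forall_3 lambert_def)
  show ?thesis
    unfolding eq
  proof (intro continuous_on_vec_lambda)
    fix i :: 3
    show "continuous_on UNIV (\<lambda>v::real^2. if i = 1 then 2 * sqrt (v$2 - (v$2)^2) * cos (2 * pi * v$1)
      else if i = 2 then 2 * sqrt (v$2 - (v$2)^2) * sin (2 * pi * v$1) else 1 - 2 * v$2)"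
      by (cases "i = 1"; cases "i = 2"; simp; intro continuous_intros)
  qed
qed

lemma lambert_measurable [measurable]: "lambert \<in> borel_measurable borel"
  by (rule borel_measurable_continuous_onI[OF continuous_lambert])

lemma continuous_sphere_param: "continuous_on UNIV sphere_param"
proof -
  have eq: "sphere_param = (\<lambda>p. \<chi> i. if i = 1 then sin (fst p) * cos (snd p)
      else if i = 2 then sin (fst p) * sin (snd p) else cos (fst p))"
    by (auto simp: fun_eq_iff vec_eq_iff forall_3 sphere_param_def)
  show ?thesis
    unfolding eq
  proof (intro continuous_on_vec_lambda)
    fix i :: 3
    show "continuous_on UNIV (\<lambda>p::real\<times>real. if i = 1 then sin (fst p) * cos (snd p)
      else if i = 2 then sin (fst p) * sin (snd p) else cos (fst p))"
      by (cases "i = 1"; cases "i = 2"; simp; intro continuous_intros)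
  qed
qed

lemma sphere_param_measurable [measurable]: "sphere_param \<in> borel_measurable borel"
  by (rule borel_measurable_continuous_onI[OF continuous_sphere_param])

lemma lambert_sphere_param:
  assumes "0 \<le> \<theta>" "\<theta> \<le> pi"
  shows "lambert (pt x ((1 - cos \<theta>) / 2)) = sphere_param (\<theta>, 2 * pi * x)"
proof -
  have "(1 - cos \<theta>) / 2 - ((1 - cos \<theta>) / 2)\<^sup>2 = (sin \<theta> / 2)\<^sup>2"
    using sin_squared_eq[of \<theta>] by (simp add: power_divide) (simp add: power2_eq_square field_simps)
  then have "2 * sqrt ((1 - cos \<theta>) / 2 - ((1 - cos \<theta>) / 2)\<^sup>2) = sin \<theta>"
    using sin_ge_zero[OF assms] by (simp add: real_sqrt_unique)
  moreover have "1 - 2 * ((1 - cos \<theta>) / 2) = cos \<theta>" by (simp add: field_simps)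
  ultimately show ?thesis
    by (simp only: lambert_def sphere_param_def vector_2 prod.case)
qed

lemma emeasure_sphere_measure:
  assumes [measurable]: "A \<in> sets borel"
  shows "emeasure sphere_measure A = emeasure lborel {w \<in> I2. lambert w \<in> A}"
proof -
  define M where "M y = (\<integral>\<^sup>+x. indicator {0..1} x * indicator A (lambert (pt x y)) \<partial>lborel)" for y
  have [measurable]: "M \<in> borel_measurable borel"
    unfolding M_def by measurable
  have f_meas [measurable]: "(\<lambda>p. ennreal (indicator ({0..pi} \<times> {0..2 * pi}) p * sin (fst p) / (4 * pi))) \<in> borel_measurable (borel :: (real\<times>real) measure)"
    unfolding borel_prod[symmetric] by measurable
  have "emeasure sphere_measure A = emeasure (density lborel (\<lambda>(\<theta>, \<phi>). ennreal (indicator ({0..pi} \<times> {0..2 * pi}) (\<theta>, \<phi>) * sin \<theta> / (4 * pi)))) (sphere_param -` A)"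
    unfolding sphere_measure_def by (subst emeasure_distr) auto
  also have "(\<lambda>(\<theta>, \<phi>). ennreal (indicator ({0..pi} \<times> {0..2 * pi}) (\<theta>, \<phi>) * sin \<theta> / (4 * pi))) = (\<lambda>p. ennreal (indicator ({0..pi} \<times> {0..2 * pi}) p * sin (fst p) / (4 * pi)))"
    by (auto simp: fun_eq_iff)
  also have "emeasure (density lborel \<dots>) (sphere_param -` A) = (\<integral>\<^sup>+p. ennreal (indicator ({0..pi} \<times> {0..2 * pi}) p * sin (fst p) / (4 * pi)) * indicator (sphere_param -` A) p \<partial>lborel)"
  proof (rule emeasure_density)
    show "sphere_param -` A \<in> sets lborel"
      using measurable_sets[OF sphere_param_measurable assms] by simp
  qed (use f_meas in simp)
  also have "\<dots> = (\<integral>\<^sup>+p. ennreal (indicator ({0..pi} \<times> {0..2 * pi}) p * sin (fst p) / (4 * pi)) * indicator A (sphere_param p) \<partial>lborel)"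
    by (intro nn_integral_cong) (auto simp: indicator_def)
  also have "\<dots> = (\<integral>\<^sup>+\<theta>. \<integral>\<^sup>+\<phi>. ennreal (indicator ({0..pi} \<times> {0..2 * pi}) (\<theta>,\<phi>) * sin \<theta> / (4 * pi)) * indicator A (sphere_param (\<theta>,\<phi>)) \<partial>lborel \<partial>lborel)"
  proof -
    have "(\<lambda>p. ennreal (indicator ({0..pi} \<times> {0..2 * pi}) p * sin (fst p) / (4 * pi)) * indicator A (sphere_param p)) \<in> borel_measurable (borel :: (real\<times>real) measure)"
      using f_meas by measurable
    then have "(\<lambda>p. ennreal (indicator ({0..pi} \<times> {0..2 * pi}) p * sin (fst p) / (4 * pi)) * indicator A (sphere_param p)) \<in> borel_measurable (lborel \<Otimes>\<^sub>M lborel :: (real\<times>real) measure)"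
      by (simp add: lborel_prod)
    from lborel.nn_integral_fst[OF this] show ?thesis by (simp add: lborel_prod)
  qed
  also have "\<dots> = (\<integral>\<^sup>+\<theta>. M ((1 - cos \<theta>) / 2) * ennreal (sin \<theta> / 2) * indicator {0..pi} \<theta> \<partial>lborel)"
  proof (rule nn_integral_cong)
    fix \<theta> :: real
    show "(\<integral>\<^sup>+\<phi>. ennreal (indicator ({0..pi} \<times> {0..2 * pi}) (\<theta>,\<phi>) * sin \<theta> / (4 * pi)) * indicator A (sphere_param (\<theta>,\<phi>)) \<partial>lborel)
      = M ((1 - cos \<theta>) / 2) * ennreal (sin \<theta> / 2) * indicator {0..pi} \<theta>"
    proof (cases "\<theta> \<in> {0..pi}")
      case True
      then have s: "0 \<le> sin \<theta>" by (auto intro: sin_ge_zero)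
      have [measurable]: "(\<lambda>\<phi>. sphere_param (\<theta>, \<phi>)) \<in> borel_measurable borel"
        by (intro borel_measurable_continuous_onI continuous_on_compose2[OF continuous_sphere_param]) (auto intro!: continuous_intros)
      have "(\<integral>\<^sup>+\<phi>. ennreal (indicator ({0..pi} \<times> {0..2 * pi}) (\<theta>,\<phi>) * sin \<theta> / (4 * pi)) * indicator A (sphere_param (\<theta>,\<phi>)) \<partial>lborel)
         = (\<integral>\<^sup>+\<phi>. ennreal (sin \<theta> / (4 * pi)) * (indicator {0..2*pi} \<phi> * indicator A (sphere_param (\<theta>,\<phi>))) \<partial>lborel)"
        using True by (intro nn_integral_cong) (auto simp: indicator_def)
      also have "\<dots> = ennreal (sin \<theta> / (4 * pi)) * (\<integral>\<^sup>+\<phi>. indicator {0..2*pi} \<phi> * indicator A (sphere_param (\<theta>,\<phi>)) \<partial>lborel)"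
        by (rule nn_integral_cmult) measurable
      also have "(\<integral>\<^sup>+\<phi>. indicator {0..2*pi} \<phi> * indicator A (sphere_param (\<theta>,\<phi>)) \<partial>lborel)
         = ennreal (2*pi) * (\<integral>\<^sup>+x. indicator {0..2*pi} (2*pi*x) * indicator A (sphere_param (\<theta>,2*pi*x)) \<partial>lborel)"
        by (subst nn_integral_real_affine[where c="2*pi" and t=0]) auto
      also have "(\<integral>\<^sup>+x. indicator {0..2*pi} (2*pi*x) * indicator A (sphere_param (\<theta>,2*pi*x)) \<partial>lborel) = M ((1 - cos \<theta>) / 2)"
      proof -
        have "indicator {0..2*pi} (2*pi*x) = (indicator {0..1} x :: ennreal)" for x
          using mult_le_cancel_left_pos[of "2*pi" 0 x] mult_le_cancel_left_pos[of "2*pi" x 1] by (simp add: indicator_def)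
        then show ?thesis unfolding M_def using True by (simp add: lambert_sphere_param)
      qed
      also have "ennreal (sin \<theta> / (4 * pi)) * (ennreal (2 * pi) * M ((1 - cos \<theta>) / 2)) = M ((1 - cos \<theta>) / 2) * ennreal (sin \<theta> / 2)"
      proof -
        have "ennreal (sin \<theta> / (4 * pi)) * ennreal (2 * pi) = ennreal (sin \<theta> / (4 * pi) * (2 * pi))"
          using s by (intro ennreal_mult[symmetric]) auto
        also have "sin \<theta> / (4 * pi) * (2 * pi) = sin \<theta> / 2" by simp
        finally show ?thesis by (metis mult.assoc mult.commute)
      qed
      finally show ?thesis using True by simp
    next
      case False
      then show ?thesis by (auto simp: indicator_def)
    qed
  qed
  \<comment> \<open>The substitution \<open>y = (1 - cos \<theta>) / 2\<close> absorbs the weight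
    \<open>sin \<theta> / 2\<close>; this is why the Lambert map preserves area.\<close>
  also have "\<dots> = (\<integral>\<^sup>+y. M y * indicator {(1 - cos 0)/2..(1 - cos pi)/2} y \<partial>lborel)"
  proof (rule nn_integral_substitution_aux[symmetric])
    show "((\<lambda>\<theta>. (1 - cos \<theta>) / 2) has_real_derivative sin \<theta> / 2) (at \<theta>)" for \<theta> :: real
      by (auto intro!: derivative_eq_intros)
    show "continuous_on {0..pi} (\<lambda>\<theta>. sin \<theta> / 2)" by (intro continuous_intros) simp
    show "M \<in> borel_measurable borel" by measurable
  qed (simp_all add: sin_ge_zero)
  also have "\<dots> = (\<integral>\<^sup>+y. emeasure lborel {x. pt x y \<in> {w \<in> I2. lambert w \<in> A}} \<partial>lborel)"
  proof (rule nn_integral_cong_AE)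
    have "AE y in lborel. y \<noteq> 0" "AE y in lborel. y \<noteq> (1::real)"
      by (simp_all add: AE_lborel_singleton)
    then show "AE y in lborel. M y * indicator {(1 - cos 0)/2..(1 - cos pi)/2} y = emeasure lborel {x. pt x y \<in> {w \<in> I2. lambert w \<in> A}}"
    proof eventually_elim
      case (elim y)
      show ?case
      proof (cases "y \<in> {0..1}")
        case True
        have [measurable]: "(\<lambda>x. pt x y) \<in> borel_measurable borel" by measurable
        have [measurable]: "{x. 0 \<le> x \<and> x < 1 \<and> lambert (pt x y) \<in> A} \<in> sets borel" by measurable
        have "M y = (\<integral>\<^sup>+x. indicator {x. 0 \<le> x \<and> x < 1 \<and> lambert (pt x y) \<in> A} x \<partial>lborel)"
          unfolding M_def
        proof (rule nn_integral_cong_AE)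
          have "AE x in lborel. x \<noteq> (1::real)" by (simp add: AE_lborel_singleton)
          then show "AE x in lborel. indicator {0..1} x * indicator A (lambert (pt x y)) = (indicator {x. 0 \<le> x \<and> x < 1 \<and> lambert (pt x y) \<in> A} x :: ennreal)"
            by eventually_elim (auto simp: indicator_def)
        qed
        also have "\<dots> = emeasure lborel {x. 0 \<le> x \<and> x < 1 \<and> lambert (pt x y) \<in> A}" by simp
        also have "{x. 0 \<le> x \<and> x < 1 \<and> lambert (pt x y) \<in> A} = {x. pt x y \<in> {w \<in> I2. lambert w \<in> A}}"
          using True elim by (auto simp: I2_def)
        finally show ?thesis using True by simp
      next
        case False
        then have "{x. pt x y \<in> {w \<in> I2. lambert w \<in> A}} = {}" by (auto simp: I2_def)
        then show ?thesis using False by (simp only: emeasure_empty) simp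
      qed
    qed
  qed
  also have "\<dots> = emeasure lborel {w \<in> I2. lambert w \<in> A}"
    by (rule emeasure_vec2_sections[symmetric]) measurable
  finally show ?thesis .
qed

lemma inner_lambert:
  "(vector [c * cos (2*pi*x0), c * sin (2*pi*x0), b] :: real^3) \<bullet> lambert p = capF c b x0 p"
proof -
  have "cos (2 * pi * (p$1 - x0)) = cos (2*pi*p$1) * cos (2*pi*x0) + sin (2*pi*p$1) * sin (2*pi*x0)"
    by (simp add: right_diff_distrib cos_diff)
  then show ?thesis
    by (simp add: inner_vec_def sum_3 lambert_def capF_def algebra_simps)
qed

lemma norm_vec3_eq_1_iff: "norm (w :: real^3) = 1 \<longleftrightarrow> (w$1)\<^sup>2 + (w$2)\<^sup>2 + (w$3)\<^sup>2 = 1"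
  by (simp add: norm_eq_1 inner_vec_def sum_3 power2_eq_square)

lemma lambert_in_sphere:
  assumes "p \<in> I2"
  shows "lambert p \<in> sphere 0 1"
proof -
  have "(p$2)\<^sup>2 \<le> p$2" using assms by (auto simp: I2_def power2_eq_square mult_left_le)
  then have s: "(sqrt (p$2 - (p$2)\<^sup>2))\<^sup>2 = p$2 - (p$2)\<^sup>2" by simp
  have "(lambert p$1)\<^sup>2 + (lambert p$2)\<^sup>2 = 4 * (p$2 - (p$2)\<^sup>2) * ((cos (2*pi*p$1))\<^sup>2 + (sin (2*pi*p$1))\<^sup>2)"
  proof -
    have "(lambert p$1)\<^sup>2 = 4 * (p$2 - (p$2)\<^sup>2) * (cos (2*pi*p$1))\<^sup>2" "(lambert p$2)\<^sup>2 = 4 * (p$2 - (p$2)\<^sup>2) * (sin (2*pi*p$1))\<^sup>2"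
      by (simp_all add: lambert_def power_mult_distrib s)
    then show ?thesis by (simp only: distrib_left)
  qed
  then have "(lambert p$1)\<^sup>2 + (lambert p$2)\<^sup>2 + (lambert p$3)\<^sup>2 = 1"
    by (simp add: lambert_def) (simp add: power2_eq_square algebra_simps)
  then show ?thesis by (simp add: norm_vec3_eq_1_iff)
qed

lemma lambert_inj: "inj_on lambert I2"
proof (rule inj_onI)
  fix p q assume p: "p \<in> I2" and q: "q \<in> I2" and eq: "lambert p = lambert q"
  from eq have e3: "p$2 = q$2" by (auto simp: lambert_def vec_eq_iff forall_3)
  have "(p$2)\<^sup>2 < p$2" using p by (auto simp: I2_def power2_eq_square)
  then have r: "sqrt (p$2 - (p$2)\<^sup>2) > 0" by simp
  have "cos (2*pi*p$1) = cos (2*pi*q$1)" "sin (2*pi*p$1) = sin (2*pi*q$1)"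
    using eq r e3 by (auto simp: lambert_def vec_eq_iff forall_3)
  then obtain n where n: "2*pi*p$1 = 2*pi*q$1 + 2*pi*real_of_int n"
    using sin_cos_eq_iff by blast
  then have "2*pi*p$1 = 2*pi*(q$1 + real_of_int n)" by (simp add: algebra_simps)
  then have e: "p$1 = q$1 + real_of_int n" by simp
  then have "\<bar>real_of_int n\<bar> < 1" using p q by (auto simp: I2_def)
  then have "n = 0" by linarith
  with e e3 show "p = q" by (intro vec2_eqI) auto
qed

lemma unit_vector_param:
  assumes "w \<in> sphere (0::real^3) 1"
  obtains c b x0 where "c \<ge> 0" "c\<^sup>2 + b\<^sup>2 = 1" "0 \<le> x0" "x0 < 1"
    "w = vector [c * cos (2*pi*x0), c * sin (2*pi*x0), b]"
proof -
  have n: "(w$1)\<^sup>2 + (w$2)\<^sup>2 + (w$3)\<^sup>2 = 1" using assms by (simp add: norm_vec3_eq_1_iff)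
  define c where "c = sqrt ((w$1)\<^sup>2 + (w$2)\<^sup>2)"
  have c2: "c\<^sup>2 = (w$1)\<^sup>2 + (w$2)\<^sup>2" by (simp add: c_def)
  show ?thesis
  proof (cases "c = 0")
    case True
    then have "w$1 = 0" "w$2 = 0" using c2 by auto
    then have "w = vector [c * cos (2*pi*0), c * sin (2*pi*0), w$3]"
      using True by (auto simp: vec_eq_iff forall_3)
    with n c2 show ?thesis by (intro that[of c "w$3" 0]) (auto simp: c_def)
  next
    case False
    then have cp: "c > 0" by (simp add: c_def less_le)
    have "(w$1 / c)\<^sup>2 + (w$2 / c)\<^sup>2 = 1"
    proof -
      have "(w$1 / c)\<^sup>2 + (w$2 / c)\<^sup>2 = c\<^sup>2 / c\<^sup>2"
        unfolding c2 power_divide by (simp only: add_divide_distrib)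
      then show ?thesis using False by simp
    qed
    then obtain u where u: "0 \<le> u" "u < 2*pi" "w$1 / c = cos u" "w$2 / c = sin u"
      by (rule sincos_total_2pi)
    have "w = vector [c * cos (2*pi*(u/(2*pi))), c * sin (2*pi*(u/(2*pi))), w$3]"
      using cp u(3,4)[symmetric] by (auto simp: vec_eq_iff forall_3)
    with u n c2 cp show ?thesis by (intro that[of c "w$3" "u/(2*pi)"]) auto
  qed
qed

lemma emeasure_I2: "emeasure lborel I2 = 1"
proof -
  have "emeasure lborel I2 = (\<integral>\<^sup>+(y::real). indicator {0<..<1} y \<partial>lborel)"
    unfolding emeasure_vec2_sections[OF I2_measurable]
  proof (rule nn_integral_cong)
    fix y :: real
    have "{x. pt x y \<in> I2} = (if 0 < y \<and> y < 1 then {0..<1} else {})" by (auto simp: I2_def)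
    then show "emeasure lborel {x. pt x y \<in> I2} = indicator {0<..<1} y" by (simp only:) simp
  qed
  then show ?thesis by simp
qed

text \<open>For a polar axis the inner product is constant on every circle of latitude and the
  arcsine density degenerates, so the area is read off from a band of heights.\<close>

lemma emeasure_I2_polar_band:
  assumes "\<bar>b\<bar> = 1" "\<bar>t\<bar> \<le> 1"
  shows "emeasure lborel {w \<in> I2. capF 0 b x0 w \<ge> t} = ennreal ((1 - t) / 2)"
proof -
  have b: "b = 1 \<or> b = -1" using assms by auto
  define J where "J = (if b = 1 then {0..(1-t)/2} else {(1+t)/2..1})"
  have [measurable]: "{w \<in> I2. capF 0 b x0 w \<ge> t} \<in> sets borel" by measurable
  have "emeasure lborel {w \<in> I2. capF 0 b x0 w \<ge> t} = (\<integral>\<^sup>+y. emeasure lborel {x. pt x y \<in> {w \<in> I2. capF 0 b x0 w \<ge> t}} \<partial>lborel)"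
    by (rule emeasure_vec2_sections) measurable
  also have "\<dots> = (\<integral>\<^sup>+y. indicator J y \<partial>lborel)"
  proof (rule nn_integral_cong_AE)
    have "AE y in lborel. y \<noteq> 0" "AE y in lborel. y \<noteq> (1::real)"
      by (simp_all add: AE_lborel_singleton)
    then show "AE y in lborel. emeasure lborel {x. pt x y \<in> {w \<in> I2. capF 0 b x0 w \<ge> t}} = indicator J y"
    proof eventually_elim
      case (elim y)
      have "{x. pt x y \<in> {w \<in> I2. capF 0 b x0 w \<ge> t}} = (if y \<in> J then {0..<1} else {})"
        using b elim assms(2) by (auto simp: I2_def capF_def J_def field_simps)
      then show ?case by (simp only:) simp
    qed
  qed
  also have "\<dots> = ennreal ((1 - t) / 2)" using assms(2) by (auto simp: J_def field_simps)
  finally show ?thesis .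
qed

text \<open>The closed cap is squeezed between the open caps with threshold \<open>t\<close> and
  with thresholds slightly below \<open>t\<close>, whose areas are continuous in the
  threshold.\<close>

lemma emeasure_capF_ge:
  assumes c: "c \<ge> 0" "c\<^sup>2 + b\<^sup>2 = 1" and x0: "0 \<le> x0" "x0 < 1" and t: "\<bar>t\<bar> \<le> 1"
  shows "emeasure lborel {w \<in> I2. capF c b x0 w \<ge> t} = ennreal ((1 - t) / 2)"
proof (cases "c = 0")
  case True
  then have "b\<^sup>2 = 1" using c by simp
  then have "b = 1 \<or> b = -1" by (simp add: power2_eq_1_iff)
  then have "\<bar>b\<bar> = 1" by auto
  with t True show ?thesis by (simp add: emeasure_I2_polar_band)
next
  case False
  then have cp: "c > 0" using c by simp
  have [measurable]: "{w \<in> I2. capF c b x0 w \<ge> t'} \<in> sets borel" "{w \<in> I2. capF c b x0 w > t'} \<in> sets borel" for t'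
    by measurable
  show ?thesis
  proof (rule antisym)
    show "ennreal ((1 - t) / 2) \<le> emeasure lborel {w \<in> I2. capF c b x0 w \<ge> t}"
      unfolding emeasure_capF_gt[OF cp c(2) x0 t, symmetric] by (intro emeasure_mono) auto
    show "emeasure lborel {w \<in> I2. capF c b x0 w \<ge> t} \<le> ennreal ((1 - t) / 2)"
    proof (cases "t = -1")
      case True
      have "emeasure lborel {w \<in> I2. capF c b x0 w \<ge> t} \<le> emeasure lborel I2"
        by (intro emeasure_mono) auto
      with True show ?thesis by (simp add: emeasure_I2)
    next
      case False
      show ?thesis
      proof (rule ennreal_le_epsilon)
        fix e :: real assume e: "e > 0"
        define t' where "t' = max (-1) (t - e)"
        have t': "t' < t" "\<bar>t'\<bar> \<le> 1" "t' \<ge> t - e" using t False e by (auto simp: t'_def)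
        have "emeasure lborel {w \<in> I2. capF c b x0 w \<ge> t} \<le> emeasure lborel {w \<in> I2. capF c b x0 w > t'}"
          using t' by (intro emeasure_mono) auto
        also have "\<dots> = ennreal ((1 - t') / 2)" by (rule emeasure_capF_gt[OF cp c(2) x0 t'(2)])
        also have "\<dots> \<le> ennreal ((1 - t) / 2 + e)"
        proof (rule ennreal_leI)
          have "(1 - t') / 2 \<le> (1 - (t - e)) / 2" using t'(3) by simp
          also have "\<dots> = (1 - t) / 2 + e / 2" by (simp add: field_simps)
          also have "\<dots> \<le> (1 - t) / 2 + e" using e by simp
          finally show "(1 - t') / 2 \<le> (1 - t) / 2 + e" .
        qed
        also have "\<dots> = ennreal ((1 - t) / 2) + ennreal e" using t e by (intro ennreal_plus) auto
        finally show "emeasure lborel {w \<in> I2. capF c b x0 w \<ge> t} \<le> ennreal ((1 - t) / 2) + ennreal e" .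
      qed
    qed
  qed
qed

lemma measure_cap:
  assumes w: "w \<in> sphere 0 1" and t: "\<bar>t\<bar> \<le> 1"
  shows "measure sphere_measure (cap w t) = (1 - t) / 2"
proof -
  obtain c b x0 where p: "c \<ge> 0" "c\<^sup>2 + b\<^sup>2 = 1" "0 \<le> x0" "x0 < 1"
    and w_eq: "w = vector [c * cos (2*pi*x0), c * sin (2*pi*x0), b]"
    using unit_vector_param[OF w] by blast
  have "closed (cap w t)"
    unfolding cap_def using closed_Int[OF closed_sphere[of 0 1] closed_halfspace_ge[of t w]]
    by (simp add: Int_def)
  then have "emeasure sphere_measure (cap w t) = emeasure lborel {v \<in> I2. lambert v \<in> cap w t}"
    by (intro emeasure_sphere_measure) auto
  also have "{v \<in> I2. lambert v \<in> cap w t} = {v \<in> I2. capF c b x0 v \<ge> t}"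
    using lambert_in_sphere by (auto simp: cap_def w_eq inner_lambert)
  also have "emeasure lborel \<dots> = ennreal ((1 - t) / 2)" by (rule emeasure_capF_ge[OF p t])
  finally show ?thesis using t by (simp add: measure_def)
qed

section \<open>Tiles met by the boundary of a cap\<close>

text \<open>Splitting at a point of \<open>Z\<close> leaves fewer breakpoints on either side, so an
  estimate on breakpoint-free intervals extends to all intervals. The last argument of
  \<open>P\<close> counts the pieces and lets additive constants accumulate.\<close>

lemma breakpoint_induct:
  fixes Z :: "real set"
  assumes fin: "finite Z"
    and base: "\<And>a b. lo \<le> a \<Longrightarrow> a < b \<Longrightarrow> b \<le> hi \<Longrightarrow> Z \<inter> {a<..<b} = {} \<Longrightarrow> P a b 1"
    and step: "\<And>a z b m n. lo \<le> a \<Longrightarrow> a < z \<Longrightarrow> z < b \<Longrightarrow> b \<le> hi \<Longrightarrow> P a z m \<Longrightarrow> P z b n \<Longrightarrow> P a b (m + n)"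
    and ab: "lo \<le> a" "a < b" "b \<le> hi"
  shows "P a b (card (Z \<inter> {a<..<b}) + 1)"
  using ab
proof (induction "card (Z \<inter> {a<..<b})" arbitrary: a b rule: less_induct)
  case less
  show ?case
  proof (cases "Z \<inter> {a<..<b} = {}")
    case True
    then show ?thesis using base[OF less.prems] by simp
  next
    case False
    then obtain z where z: "z \<in> Z" "a < z" "z < b" by auto
    let ?A = "Z \<inter> {a<..<z}" and ?B = "Z \<inter> {z<..<b}"
    have f: "finite ?A" "finite ?B" using fin by auto
    have "Z \<inter> {a<..<b} = insert z (?A \<union> ?B)" using z by auto
    then have cc: "card (Z \<inter> {a<..<b}) = card ?A + card ?B + 1"
      using f by (simp add: card_Un_disjoint disjoint_iff)
    have PA: "P a z (card ?A + 1)" using less.prems z by (intro less.hyps) (auto simp: cc)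
    have PB: "P z b (card ?B + 1)" using less.prems z by (intro less.hyps) (auto simp: cc)
    have "P a b ((card ?A + 1) + (card ?B + 1))"
      by (rule step[OF less.prems(1) z(2,3) less.prems(3) PA PB])
    then show ?thesis by (simp add: cc)
  qed
qed

lemma card_int_set_le:
  fixes A :: "int set"
  assumes "\<And>a b. a \<in> A \<Longrightarrow> b \<in> A \<Longrightarrow> real_of_int \<bar>a - b\<bar> \<le> C" "C \<ge> 0"
  shows "finite A \<and> real (card A) \<le> C + 1"
proof (cases "A = {}")
  case False
  then obtain a where a: "a \<in> A" by auto
  have "A \<subseteq> {a - \<lfloor>C\<rfloor>..a + \<lfloor>C\<rfloor>}"
  proof
    fix x assume "x \<in> A"
    from assms(1)[OF this a] have "\<bar>x - a\<bar> \<le> \<lfloor>C\<rfloor>" by (simp add: le_floor_iff)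
    then show "x \<in> {a - \<lfloor>C\<rfloor>..a + \<lfloor>C\<rfloor>}" by auto
  qed
  then have fin: "finite A" using finite_subset by blast
  have sub: "A \<subseteq> {Min A..Max A}" using fin by auto
  have "card A \<le> card {Min A..Max A}" by (rule card_mono[OF _ sub]) simp
  moreover have "Min A \<le> Max A" using fin False by (meson Max_in Min_le)
  ultimately have "int (card A) \<le> Max A - Min A + 1" by simp
  then have "real_of_int (int (card A)) \<le> real_of_int (Max A - Min A + 1)" by (simp only: of_int_le_iff)
  moreover have "real_of_int \<bar>Max A - Min A\<bar> \<le> C" using assms(1)[OF Max_in Min_in] fin False by simp
  ultimately show ?thesis using fin by auto
qed (use assms in auto)

text \<open>With both coordinates monotone, a signed sum of the two floors never decreases along the
  curve and determines the visited cell. The cells are thus counted by integers in a range of length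
  \<open>B\<close> plus 2 for rounding, and 1 is added for the end point.\<close>

lemma card_cells_monotone:
  fixes f g :: "real \<Rightarrow> real"
  assumes f: "mono_on D f \<or> mono_on D (\<lambda>s. - f s)" and g: "mono_on D g \<or> mono_on D (\<lambda>s. - g s)"
    and B: "\<And>s s'. s \<in> D \<Longrightarrow> s' \<in> D \<Longrightarrow> \<bar>f s - f s'\<bar> + \<bar>g s - g s'\<bar> \<le> B" and B0: "B \<ge> 0"
  shows "finite ((\<lambda>s. (\<lfloor>f s\<rfloor>, \<lfloor>g s\<rfloor>)) ` D) \<and> real (card ((\<lambda>s. (\<lfloor>f s\<rfloor>, \<lfloor>g s\<rfloor>)) ` D)) \<le> B + 3"
proof -
  have ex: "\<exists>e::int. (e = 1 \<or> e = -1) \<and> (\<forall>s\<in>D. \<forall>s'\<in>D. s \<le> s' \<longrightarrow> e * \<lfloor>h s\<rfloor> \<le> e * \<lfloor>h s'\<rfloor>)"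
    if "mono_on D h \<or> mono_on D (\<lambda>s. - h s)" for h :: "real \<Rightarrow> real"
    using that
  proof
    assume "mono_on D h"
    then show ?thesis by (intro exI[of _ 1]) (auto simp: mono_on_def intro: floor_mono)
  next
    assume "mono_on D (\<lambda>s. - h s)"
    then show ?thesis by (intro exI[of _ "-1"]) (auto simp: mono_on_def intro: floor_mono)
  qed
  obtain e1 where e1: "e1 = 1 \<or> e1 = -1" "\<And>s s'. s\<in>D \<Longrightarrow> s'\<in>D \<Longrightarrow> s \<le> s' \<Longrightarrow> e1 * \<lfloor>f s\<rfloor> \<le> e1 * \<lfloor>f s'\<rfloor>"
    using ex[OF f] by blast
  obtain e2 where e2: "e2 = 1 \<or> e2 = -1" "\<And>s s'. s\<in>D \<Longrightarrow> s'\<in>D \<Longrightarrow> s \<le> s' \<Longrightarrow> e2 * \<lfloor>g s\<rfloor> \<le> e2 * \<lfloor>g s'\<rfloor>"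
    using ex[OF g] by blast
  define H where "H = (\<lambda>(i::int, j::int). e1 * i + e2 * j)"
  let ?c = "\<lambda>s. (\<lfloor>f s\<rfloor>, \<lfloor>g s\<rfloor>)"
  have inj0: "?c s = ?c s'" if "s \<in> D" "s' \<in> D" "s \<le> s'" "H (?c s) = H (?c s')" for s s'
  proof -
    have gen: "a = a' \<and> b = b'" if "a \<le> a'" "b \<le> b'" "a + b = a' + b'" for a b a' b' :: int
      using that by auto
    have "e1 * \<lfloor>f s\<rfloor> + e2 * \<lfloor>g s\<rfloor> = e1 * \<lfloor>f s'\<rfloor> + e2 * \<lfloor>g s'\<rfloor>"
      using that(4) unfolding H_def prod.case .
    from gen[OF e1(2)[OF that(1-3)] e2(2)[OF that(1-3)] this]
    have "e1 * \<lfloor>f s\<rfloor> = e1 * \<lfloor>f s'\<rfloor>" "e2 * \<lfloor>g s\<rfloor> = e2 * \<lfloor>g s'\<rfloor>" by blast+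
    moreover have "e1 \<noteq> 0" "e2 \<noteq> 0" using e1(1) e2(1) by auto
    ultimately have "\<lfloor>f s\<rfloor> = \<lfloor>f s'\<rfloor>" "\<lfloor>g s\<rfloor> = \<lfloor>g s'\<rfloor>" by (simp_all only: mult_cancel_left simp_thms)
    then show ?thesis by (simp only:)
  qed
  have inj1: "?c s = ?c s'" if "s \<in> D" "s' \<in> D" "H (?c s) = H (?c s')" for s s'
  proof (cases "s \<le> s'")
    case True
    then show ?thesis by (rule inj0[OF that(1,2) _ that(3)])
  next
    case False
    then have "s' \<le> s" by simp
    then show ?thesis by (rule inj0[OF that(2,1) _ that(3)[symmetric], symmetric])
  qed
  have inj: "inj_on H (?c ` D)"
  proof (rule inj_onI)
    fix p q assume "p \<in> ?c ` D" "q \<in> ?c ` D" "H p = H q"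
    then obtain s s' where "s \<in> D" "s' \<in> D" "p = ?c s" "q = ?c s'" by blast
    with \<open>H p = H q\<close> show "p = q" using inj1[of s s'] by (simp only:)
  qed
  have "finite (H ` ?c ` D) \<and> real (card (H ` ?c ` D)) \<le> (B + 2) + 1"
  proof (rule card_int_set_le)
    fix a b assume "a \<in> H ` ?c ` D" "b \<in> H ` ?c ` D"
    then obtain s s' where s: "s \<in> D" "s' \<in> D" "a = H (?c s)" "b = H (?c s')" by blast
    obtain i j where ij: "i = \<lfloor>f s\<rfloor> - \<lfloor>f s'\<rfloor>" "j = \<lfloor>g s\<rfloor> - \<lfloor>g s'\<rfloor>" by blast
    have fl: "\<bar>real_of_int (\<lfloor>x\<rfloor> - \<lfloor>y\<rfloor>)\<bar> \<le> \<bar>x - y\<bar> + 1" for x y :: real by linarith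
    have ii: "\<bar>real_of_int i\<bar> \<le> \<bar>f s - f s'\<bar> + 1" "\<bar>real_of_int j\<bar> \<le> \<bar>g s - g s'\<bar> + 1"
      unfolding ij by (rule fl)+
    have "a - b = e1 * i + e2 * j"
      unfolding s(3,4) H_def prod.case ij right_diff_distrib by (simp only: add_diff_add)
    then have "\<bar>a - b\<bar> \<le> \<bar>i\<bar> + \<bar>j\<bar>" using e1(1) e2(1) by auto
    then have "real_of_int \<bar>a - b\<bar> \<le> \<bar>real_of_int i\<bar> + \<bar>real_of_int j\<bar>"
      by (simp only: of_int_abs[symmetric] of_int_add[symmetric] of_int_le_iff)
    then show "real_of_int \<bar>a - b\<bar> \<le> B + 2" using ii B[OF s(1,2)] by (simp only: of_int_abs)
  qed (use B0 in auto)
  then have fin: "finite (H ` ?c ` D)" and cd: "real (card (H ` ?c ` D)) \<le> B + 2 + 1" by blast+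
  have "finite (?c ` D)" by (rule finite_imageD[OF fin inj])
  moreover have "real (card (?c ` D)) \<le> B + 3" using cd unfolding card_image[OF inj] by simp
  ultimately show ?thesis by blast
qed

lemma deriv_nonzero_monotone:
  fixes f f' :: "real \<Rightarrow> real"
  assumes cont: "continuous_on {p..q} f"
    and der: "\<And>s. s \<in> {p<..<q} \<Longrightarrow> (f has_real_derivative f' s) (at s)"
    and cont': "continuous_on {p<..<q} f'" and nz: "\<And>s. s \<in> {p<..<q} \<Longrightarrow> f' s \<noteq> 0"
  shows "mono_on {p..q} f \<or> mono_on {p..q} (\<lambda>s. - f s)"
proof -
  have "(\<forall>s\<in>{p<..<q}. f' s > 0) \<or> (\<forall>s\<in>{p<..<q}. f' s < 0)"
  proof (rule ccontr)
    assume "\<not> ?thesis"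
    then obtain a b where "a \<in> {p<..<q}" "b \<in> {p<..<q}" "f' a \<le> 0" "f' b \<ge> 0" by (auto simp: not_less)
    moreover have "connected (f' ` {p<..<q})" by (rule connected_continuous_image[OF cont']) simp
    ultimately have "0 \<in> f' ` {p<..<q}"
      by (meson connectedD_interval image_eqI)
    then show False using nz by auto
  qed
  then show ?thesis
  proof
    assume pos: "\<forall>s\<in>{p<..<q}. f' s > 0"
    have "f s \<le> f s'" if "s \<in> {p..q}" "s' \<in> {p..q}" "s \<le> s'" for s s'
    proof (cases "s = s'")
      case False
      then have "f s < f s'"
      proof (intro DERIV_pos_imp_increasing_open[of s s' f])
        show "continuous_on {s..s'} f" by (rule continuous_on_subset[OF cont]) (use that in auto)
        show "\<exists>y. (f has_real_derivative y) (at x) \<and> 0 < y" if "s < x" "x < s'" for x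
          using der[of x] pos that \<open>s \<in> {p..q}\<close> \<open>s' \<in> {p..q}\<close> by auto
      qed (use that False in auto)
      then show ?thesis by simp
    qed simp
    then show ?thesis by (auto simp: mono_on_def)
  next
    assume neg: "\<forall>s\<in>{p<..<q}. f' s < 0"
    have "f s' \<le> f s" if "s \<in> {p..q}" "s' \<in> {p..q}" "s \<le> s'" for s s'
    proof (cases "s = s'")
      case False
      then have "f s > f s'"
      proof (intro DERIV_neg_imp_decreasing_open[of s s' f])
        show "continuous_on {s..s'} f" by (rule continuous_on_subset[OF cont]) (use that in auto)
        show "\<exists>y. (f has_real_derivative y) (at x) \<and> y < 0" if "s < x" "x < s'" for x
          using der[of x] neg that \<open>s \<in> {p..q}\<close> \<open>s' \<in> {p..q}\<close> by auto
      qed (use that False in auto)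
      then show ?thesis by simp
    qed simp
    then show ?thesis by (auto simp: mono_on_def)
  qed
qed

lemma mono_on_abs_diff_le:
  fixes f :: "real \<Rightarrow> real"
  assumes "mono_on {p..q} f \<or> mono_on {p..q} (\<lambda>s. - f s)" "s \<in> {p..q}" "s' \<in> {p..q}"
  shows "\<bar>f s - f s'\<bar> \<le> \<bar>f q - f p\<bar>"
  using assms(1)
proof
  assume m: "mono_on {p..q} f"
  have "f p \<le> f s" "f s \<le> f q" "f p \<le> f s'" "f s' \<le> f q"
    using assms(2,3) by (auto intro!: mono_onD[OF m])
  then show ?thesis by linarith
next
  assume m: "mono_on {p..q} (\<lambda>s. - f s)"
  have "- f p \<le> - f s" "- f s \<le> - f q" "- f p \<le> - f s'" "- f s' \<le> - f q"
    using assms(2,3) mono_onD[OF m, of p s] mono_onD[OF m, of s q] mono_onD[OF m, of p s'] mono_onD[OF m, of s' q] by auto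
  then show ?thesis by linarith
qed

lemma mono_on_abs_diff_add:
  fixes f :: "real \<Rightarrow> real"
  assumes "mono_on {p..q} f \<or> mono_on {p..q} (\<lambda>s. - f s)" "p \<le> a" "a \<le> z" "z \<le> b" "b \<le> q"
  shows "\<bar>f b - f a\<bar> = \<bar>f z - f a\<bar> + \<bar>f b - f z\<bar>"
  using assms(1)
proof
  assume m: "mono_on {p..q} f"
  have "f a \<le> f z" "f z \<le> f b" using assms(2-) by (auto intro!: mono_onD[OF m])
  then show ?thesis by linarith
next
  assume m: "mono_on {p..q} (\<lambda>s. - f s)"
  have "- f a \<le> - f z" "- f z \<le> - f b" using assms(2-) mono_onD[OF m, of a z] mono_onD[OF m, of z b] by auto
  then show ?thesis by linarith
qed

text \<open>For \<open>\<kappa> = K * \<eta> / (1 + \<xi>\<^sup>2)\<close> the tiles of level \<open>K\<close> for \<open>Qmat \<xi> \<eta>\<close> are the sets on which \<open>cell\<close> is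
  constant.\<close>

locale grid =
  fixes \<xi> \<kappa> :: real
  assumes \<kappa>_pos: "\<kappa> > 0"
begin

definition gu :: "real^2 \<Rightarrow> real" where "gu w = \<kappa> * (\<xi> * w$1 + w$2)"
definition gv :: "real^2 \<Rightarrow> real" where "gv w = \<kappa> * (\<xi> * w$2 - w$1)"
definition cell :: "real^2 \<Rightarrow> int \<times> int" where "cell w = (\<lfloor>gu w\<rfloor>, \<lfloor>gv w\<rfloor>)"

end

text \<open>In the coordinate \<open>s = 1 - 2 * y\<close> the boundary curve \<open>F = t\<close> consists of the two arcs
  \<open>x = x0 + X s\<close> and \<open>x = x0 - X s\<close> (mod 1) over \<open>s1 \<le> s \<le> s2\<close>. The genericity assumptions
  \<open>t \<noteq> 0\<close> and \<open>\<bar>b\<bar> \<noteq> \<bar>t\<bar>\<close> keep the polynomials \<open>P1\<close>, \<open>P2\<close>, \<open>P3\<close> below from vanishing identically.\<close>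

locale gcap =
  fixes c b x0 t :: real
  assumes c_pos: "c > 0" and cb: "c\<^sup>2 + b\<^sup>2 = 1" and t_lt: "\<bar>t\<bar> < 1" and t_nz: "t \<noteq> 0"
    and bt: "\<bar>b\<bar> \<noteq> \<bar>t\<bar>" and x0: "0 \<le> x0" "x0 < 1"
begin

abbreviation F :: "real^2 \<Rightarrow> real" where "F \<equiv> capF c b x0"

definition vv :: real where "vv = c * sqrt (1 - t\<^sup>2)"
definition Rq :: "real \<Rightarrow> real" where "Rq s = vv\<^sup>2 - (s - t * b)\<^sup>2"
definition G :: "real \<Rightarrow> real" where "G s = (t - b * s) / (c * sqrt (1 - s\<^sup>2))"
definition X :: "real \<Rightarrow> real" where "X s = arccos (G s) / (2 * pi)"
definition X' :: "real \<Rightarrow> real" where "X' s = (b - t * s) / (2 * pi * ((1 - s\<^sup>2) * sqrt (Rq s)))"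

definition s1 :: real where "s1 = t * b - vv"
definition s2 :: real where "s2 = t * b + vv"

lemma t2: "t\<^sup>2 < 1" using t_lt by (simp add: abs_square_less_1)

lemma vv_sq: "vv\<^sup>2 = (1 - t\<^sup>2) * (1 - b\<^sup>2)"
proof -
  have "c\<^sup>2 = 1 - b\<^sup>2" using cb by simp
  then show ?thesis using t2 by (simp add: vv_def power_mult_distrib)
qed

lemma vv_pos: "vv > 0" unfolding vv_def using c_pos t2 by simp

lemma b2: "b\<^sup>2 < 1" using cb c_pos zero_less_power[OF c_pos, of 2] by linarith

lemma tb_lt: "\<bar>t * b\<bar> < 1"
proof -
  have "\<bar>b\<bar> < 1" using b2 by (simp add: abs_square_less_1)
  then have "\<bar>t\<bar> * \<bar>b\<bar> \<le> \<bar>t\<bar> * 1" by (intro mult_left_mono) auto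
  then show ?thesis using t_lt by (simp add: abs_mult)
qed

lemma Rq_eq: "Rq s = c\<^sup>2 * (1 - s\<^sup>2) - (t - b * s)\<^sup>2"
  unfolding Rq_def cap_discriminant[OF cb, of s t] using t2 by (simp add: vv_def power_mult_distrib)

text \<open>The poles have the inner products \<open>b\<close> and \<open>- b\<close> with the axis,
  so \<open>\<bar>b\<bar> \<noteq> \<bar>t\<bar>\<close> keeps the boundary circle away from them
  and the parameter interval strictly inside (-1, 1).\<close>

lemma vv_less: "vv < 1 - t * b" "vv < 1 + t * b"
proof -
  have n: "b \<noteq> t" "b \<noteq> - t" using bt by auto
  have "vv\<^sup>2 = (1 - t*b)\<^sup>2 - (t - b)\<^sup>2" unfolding vv_sq by (simp add: power2_eq_square algebra_simps)
  then have "vv\<^sup>2 < (1 - t*b)\<^sup>2" using n by simp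
  then show "vv < 1 - t * b" by (rule power_less_imp_less_base) (use tb_lt in auto)
  have "vv\<^sup>2 = (1 + t*b)\<^sup>2 - (t + b)\<^sup>2" unfolding vv_sq by (simp add: power2_eq_square algebra_simps)
  moreover have "t + b \<noteq> 0" using n by linarith
  ultimately have "vv\<^sup>2 < (1 + t*b)\<^sup>2" by simp
  then show "vv < 1 + t * b" by (rule power_less_imp_less_base) (use tb_lt in auto)
qed

lemma s12: "-1 < s1" "s1 < s2" "s2 < 1"
  using vv_less vv_pos by (auto simp: s1_def s2_def)

lemma Rq_nonneg_iff: "0 \<le> Rq s \<longleftrightarrow> s1 \<le> s \<and> s \<le> s2"
proof -
  have "0 \<le> Rq s \<longleftrightarrow> \<bar>s - t * b\<bar> \<le> vv"
    using vv_pos abs_le_square_iff[of "s - t*b" vv] by (auto simp: Rq_def)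
  then show ?thesis by (auto simp: s1_def s2_def)
qed

lemma Rq_pos: "s1 < s \<Longrightarrow> s < s2 \<Longrightarrow> 0 < Rq s"
proof -
  assume "s1 < s" "s < s2"
  then have "\<bar>s - t * b\<bar> < \<bar>vv\<bar>" using vv_pos by (auto simp: s1_def s2_def)
  then have "(s - t * b)\<^sup>2 < vv\<^sup>2" using abs_le_square_iff[of vv "s - t*b"] by (auto simp: not_le[symmetric])
  then show ?thesis by (simp add: Rq_def)
qed

lemma s_sq_less: assumes "s1 \<le> s" "s \<le> s2" shows "s\<^sup>2 < 1"
  using assms s12 by (subst abs_square_less_1) auto

lemma G_sq: assumes "s1 \<le> s" "s \<le> s2" shows "1 - (G s)\<^sup>2 = Rq s / (c\<^sup>2 * (1 - s\<^sup>2))"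
proof -
  have p: "0 < 1 - s\<^sup>2" using s_sq_less[OF assms] by simp
  then have "(c * sqrt (1 - s\<^sup>2))\<^sup>2 = c\<^sup>2 * (1 - s\<^sup>2)" by (simp add: power_mult_distrib)
  then have "(G s)\<^sup>2 = (t - b * s)\<^sup>2 / (c\<^sup>2 * (1 - s\<^sup>2))" by (simp add: G_def power_divide)
  then show ?thesis using p c_pos unfolding Rq_eq by (simp add: diff_divide_distrib)
qed

lemma G_bounds: assumes "s1 \<le> s" "s \<le> s2" shows "\<bar>G s\<bar> \<le> 1"
proof -
  have "0 \<le> 1 - (G s)\<^sup>2" unfolding G_sq[OF assms] using assms Rq_nonneg_iff s_sq_less[OF assms] by simp
  then show ?thesis by (simp add: abs_square_le_1)
qed

lemma G_bounds_strict: assumes "s1 < s" "s < s2" shows "\<bar>G s\<bar> < 1"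
proof -
  have "0 < 1 - (G s)\<^sup>2" using assms Rq_pos s_sq_less[of s] c_pos by (subst G_sq) auto
  then show ?thesis by (simp add: abs_square_less_1)
qed

lemma cont_G: "continuous_on {s1..s2} G"
  unfolding G_def using c_pos s_sq_less by (intro continuous_intros) fastforce+

lemma cont_X: "continuous_on {s1..s2} X"
proof -
  have "continuous_on {s1..s2} (\<lambda>s. arccos (G s))"
    by (intro continuous_on_arccos cont_G) (use G_bounds in \<open>auto simp: abs_le_iff\<close>)
  then show ?thesis unfolding X_def by (intro continuous_on_divide continuous_on_const) auto
qed

lemma X_bounds: assumes "s1 \<le> s" "s \<le> s2" shows "0 \<le> X s" "X s \<le> 1/2"
  using arccos_lbound[of "G s"] arccos_ubound[of "G s"] G_bounds[OF assms] by (auto simp: X_def field_simps abs_le_iff)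

lemma cos_X: assumes "s1 \<le> s" "s \<le> s2" shows "cos (2 * pi * X s) = G s"
  using cos_arccos_abs[OF G_bounds[OF assms]] by (simp add: X_def)

lemma deriv_X: assumes s: "s1 < s" "s < s2" shows "(X has_real_derivative X' s) (at s)"
proof -
  have ss: "s\<^sup>2 < 1" using s_sq_less s by simp
  define w where "w = sqrt (1 - s\<^sup>2)"
  have w: "w > 0" "w\<^sup>2 = 1 - s\<^sup>2" using ss by (auto simp: w_def)
  have dw: "((\<lambda>s. sqrt (1 - s\<^sup>2)) has_real_derivative (- s / w)) (at s)"
    using ss w by (auto intro!: derivative_eq_intros simp: w_def field_simps)
  have dG: "(G has_real_derivative ((- b) * (c * w) - (t - b * s) * (c * (- s / w))) / (c * w)\<^sup>2) (at s)"
  proof -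
    have d1: "((\<lambda>s. t - b * s) has_real_derivative (- b)) (at s)"
      by (auto intro!: derivative_eq_intros)
    have d2: "((\<lambda>s. c * sqrt (1 - s\<^sup>2)) has_real_derivative (c * (- s / w))) (at s)"
      by (rule DERIV_cmult[OF dw])
    have "c * sqrt (1 - s\<^sup>2) \<noteq> 0" using c_pos w by (simp add: w_def)
    from DERIV_divide[OF d1 d2 this] show ?thesis
      unfolding G_def w_def power2_eq_square[of "c * sqrt (1 - s\<^sup>2)"] by simp
  qed
  have G': "((- b) * (c * w) - (t - b * s) * (c * (- s / w))) / (c * w)\<^sup>2 = - (b - t * s) / (c * w * w\<^sup>2)"
  proof -
    have "(- b) * (c * w) - (t - b * s) * (c * (- s / w)) = c * (- b * w\<^sup>2 + (t - b * s) * s) / w"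
      using w(1) by (simp add: field_simps power2_eq_square)
    also have "- b * w\<^sup>2 + (t - b * s) * s = - (b - t * s)" unfolding w(2) by (simp add: algebra_simps power2_eq_square)
    finally have e: "(- b) * (c * w) - (t - b * s) * (c * (- s / w)) = c * (- (b - t * s)) / w" .
    have "c * (- q) / w / (c * w)\<^sup>2 = - q / (c * w * w\<^sup>2)" for q
      using w(1) c_pos by (simp add: power2_eq_square)
    then show ?thesis unfolding e .
  qed
  have sq: "sqrt (1 - (G s)\<^sup>2) = sqrt (Rq s) / (c * w)"
    using s c_pos w by (simp add: G_sq real_sqrt_divide real_sqrt_mult w_def)
  have Rp: "sqrt (Rq s) > 0" using Rq_pos[OF s] by simp
  have g: "-1 < G s" "G s < 1" using G_bounds_strict[OF s] by (auto simp: abs_less_iff)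
  have "((\<lambda>s. arccos (G s)) has_real_derivative (inverse (- sqrt (1 - (G s)\<^sup>2)) * (- (b - t * s) / (c * w * w\<^sup>2)))) (at s)"
    by (rule DERIV_chain2[OF DERIV_arccos[OF g] dG[unfolded G']])
  also have "inverse (- sqrt (1 - (G s)\<^sup>2)) * (- (b - t * s) / (c * w * w\<^sup>2)) = (b - t * s) / (w\<^sup>2 * sqrt (Rq s))"
    unfolding sq using w(1) c_pos Rp by (simp add: field_simps)
  finally have "((\<lambda>s. arccos (G s) / (2 * pi)) has_real_derivative ((b - t * s) / (w\<^sup>2 * sqrt (Rq s)) / (2 * pi))) (at s)"
    by (rule DERIV_cdivide)
  then show ?thesis unfolding X_def X'_def w(2) by (simp add: mult_ac)
qed

lemma cont_X': "continuous_on {s1<..<s2} X'"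
  unfolding X'_def
proof (intro continuous_intros ballI)
  show "continuous_on {s1<..<s2} Rq" unfolding Rq_def by (intro continuous_intros)
  fix s assume "s \<in> {s1<..<s2}"
  then show "2 * pi * ((1 - s\<^sup>2) * sqrt (Rq s)) \<noteq> 0"
    using Rq_pos[of s] s_sq_less[of s] by auto
qed

text \<open>Squaring removes the root in \<open>X'\<close>: prescribing the slope of the curve
  becomes a polynomial equation in \<open>s\<close>, with a number of solutions bounded
  independently of the cap.\<close>

lemma X'_sq: assumes s: "s1 < s" "s < s2"
  shows "(X' s)\<^sup>2 * (4 * pi\<^sup>2 * ((1 - s\<^sup>2)\<^sup>2 * Rq s)) = (b - t * s)\<^sup>2"
proof -
  have p: "Rq s > 0" "1 - s\<^sup>2 > 0" using Rq_pos[OF s] s_sq_less[of s] s by auto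
  have "(2 * pi * ((1 - s\<^sup>2) * sqrt (Rq s)))\<^sup>2 = 4 * pi\<^sup>2 * ((1 - s\<^sup>2)\<^sup>2 * Rq s)"
    using p by (simp add: power_mult_distrib)
  then show ?thesis using p unfolding X'_def power_divide by simp
qed

definition \<gamma> :: "real \<Rightarrow> real \<Rightarrow> real^2" where "\<gamma> e s = pt (frac (x0 + e * X s)) ((1 - s) / 2)"

lemma sqrt_y: "2 * sqrt ((1 - s) / 2 - ((1 - s) / 2)\<^sup>2) = sqrt (1 - s\<^sup>2)"
proof -
  have "(1 - s) / 2 - ((1 - s) / 2)\<^sup>2 = (1 - s\<^sup>2) / 2\<^sup>2" by (simp add: power2_eq_square field_simps)
  then show ?thesis by (simp only: real_sqrt_divide real_sqrt_abs)
qed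

lemma F_pt: assumes "s\<^sup>2 < 1"
  shows "F (pt x ((1 - s) / 2)) - t = c * sqrt (1 - s\<^sup>2) * (cos (2 * pi * (x - x0)) - G s)"
proof -
  have "c * sqrt (1 - s\<^sup>2) * G s = t - b * s" using assms c_pos by (simp add: G_def)
  moreover have "1 - 2 * ((1 - s) / 2) = s" by (simp add: field_simps)
  moreover from this have "F (pt x ((1 - s) / 2)) = c * sqrt (1 - s\<^sup>2) * cos (2 * pi * (x - x0)) + b * s"
    by (simp only: capF_def vector_2 sqrt_y)
  ultimately show ?thesis by (simp add: algebra_simps)
qed

lemma level_set_param:
  assumes w: "w \<in> I2" "F w = t"
  shows "\<exists>e\<in>{1,-1}. \<exists>s. s1 \<le> s \<and> s \<le> s2 \<and> w = \<gamma> e s"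
proof -
  define s where "s = 1 - 2 * w$2"
  have w2: "w$2 = (1 - s) / 2" by (simp add: s_def)
  have ss: "s\<^sup>2 < 1" using w(1) by (subst abs_square_less_1) (auto simp: I2_def s_def abs_less_iff)
  have "w = pt (w$1) ((1 - s) / 2)" using pt_eta[of w] by (simp add: w2)
  then have "c * sqrt (1 - s\<^sup>2) * (cos (2 * pi * (w$1 - x0)) - G s) = 0"
    using F_pt[OF ss, of "w$1"] w(2) by simp
  then have cG: "cos (2 * pi * (w$1 - x0)) = G s" using c_pos ss by simp
  have sr: "s1 \<le> s \<and> s \<le> s2"
  proof -
    have "(c * sqrt (1 - s\<^sup>2))\<^sup>2 = c\<^sup>2 * (1 - s\<^sup>2)" using ss by (simp add: power_mult_distrib)
    moreover have "(G s)\<^sup>2 \<le> 1" unfolding cG[symmetric] by (simp add: abs_square_le_1)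
    ultimately have "(t - b * s)\<^sup>2 \<le> c\<^sup>2 * (1 - s\<^sup>2)"
      using ss c_pos by (simp add: G_def power_divide divide_le_eq)
    then show ?thesis using Rq_nonneg_iff[of s] by (simp add: Rq_eq)
  qed
  have "cos (2 * pi * (w$1 - x0)) = cos (2 * pi * X s)" using cG cos_X sr by simp
  then obtain n :: int where "2 * pi * (w$1 - x0) = 2 * pi * X s + 2 * real_of_int n * pi \<or> 2 * pi * (w$1 - x0) = - (2 * pi * X s) + 2 * real_of_int n * pi"
    unfolding cos_eq by (metis Ints_cases)
  then have "2 * pi * (w$1 - x0) = 2 * pi * (X s + real_of_int n) \<or> 2 * pi * (w$1 - x0) = 2 * pi * (- X s + real_of_int n)"
    by (simp add: algebra_simps)
  then have "w$1 - x0 = X s + real_of_int n \<or> w$1 - x0 = - X s + real_of_int n" by simp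
  then obtain e where e: "e \<in> {1, -1::real}" "x0 + e * X s = w$1 - real_of_int n" by force
  have "frac (x0 + e * X s) = w$1"
    using w(1) unfolding e(2) by (simp add: frac_unique_iff I2_def)
  then have "w = \<gamma> e s" by (intro vec2_eqI) (auto simp: \<gamma>_def w2)
  with e(1) sr show ?thesis by auto
qed

end

section \<open>Cells met by the boundary arcs\<close>

lemma integer_free_floor_const:
  fixes h :: "real \<Rightarrow> real"
  assumes cont: "continuous_on {p<..<q} h" and free: "\<And>s. s \<in> {p<..<q} \<Longrightarrow> h s \<notin> \<int>"
  obtains k where "\<And>s. s \<in> {p<..<q} \<Longrightarrow> \<lfloor>h s\<rfloor> = k"
proof -
  have le: "\<lfloor>h s'\<rfloor> \<le> \<lfloor>h s\<rfloor>" if s: "s \<in> {p<..<q}" "s' \<in> {p<..<q}" for s s'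
  proof (rule ccontr)
    assume "\<not> ?thesis"
    then have lt: "\<lfloor>h s\<rfloor> < \<lfloor>h s'\<rfloor>" by simp
    have a: "h s \<le> of_int \<lfloor>h s'\<rfloor>" using lt by linarith
    have b: "of_int \<lfloor>h s'\<rfloor> \<le> h s'" by simp
    have "connected (h ` {p<..<q})" by (rule connected_continuous_image[OF cont]) simp
    then have "of_int \<lfloor>h s'\<rfloor> \<in> h ` {p<..<q}"
      using a b s by (meson connectedD_interval image_eqI)
    then obtain x where "x \<in> {p<..<q}" "h x = of_int \<lfloor>h s'\<rfloor>" by force
    then show False using free[of x] by (metis Ints_of_int)
  qed
  show ?thesis
  proof (cases "{p<..<q} = {}")
    case False
    then obtain s0 where "s0 \<in> {p<..<q}" by blast
    then show ?thesis using le by (intro that[of "\<lfloor>h s0\<rfloor>"]) (meson order_antisym)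
  qed (use that in auto)
qed

locale gridcap = grid \<xi> \<kappa> + gcap c b x0 t for \<xi> \<kappa> c b x0 t
begin

text \<open>\<open>P1\<close> and \<open>P2\<close> vanish where \<open>gu\<close> or \<open>gv\<close> is stationary along the curve, that is, where
  \<open>\<xi> * X' s = \<plusminus>1/2\<close> or \<open>X' s = \<plusminus>\<xi>/2\<close>; \<open>P3\<close> vanishes where the curve crosses the seam \<open>x = 0\<close>, and
  \<open>X'\<close> changes sign at \<open>b / t\<close>.\<close>

definition PW :: "real poly" where "PW = [:1, 0, -1:]^2 * [:vv\<^sup>2 - (t*b)\<^sup>2, 2*t*b, -1:]"
definition P1 :: "real poly" where "P1 = smult (\<xi>\<^sup>2) ([:b, -t:]^2) - smult (pi\<^sup>2) PW"
definition P2 :: "real poly" where "P2 = [:b, -t:]^2 - smult (\<xi>\<^sup>2 * pi\<^sup>2) PW"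
definition P3 :: "real poly" where "P3 = smult ((c * cos (2*pi*x0))\<^sup>2) [:1, 0, -1:] - [:t, -b:]^2"

definition brk :: "real set" where
  "brk = {s. poly P1 s = 0} \<union> {s. poly P2 s = 0} \<union> {s. poly P3 s = 0} \<union> {b / t}"

lemma poly_PW: "poly PW s = (1 - s\<^sup>2)\<^sup>2 * Rq s"
  by (simp add: PW_def Rq_def power2_eq_square algebra_simps)

lemma poly_P1: "poly P1 s = \<xi>\<^sup>2 * (b - t * s)\<^sup>2 - pi\<^sup>2 * ((1 - s\<^sup>2)\<^sup>2 * Rq s)"
  by (simp add: P1_def poly_PW mult_ac)

lemma poly_P2: "poly P2 s = (b - t * s)\<^sup>2 - \<xi>\<^sup>2 * pi\<^sup>2 * ((1 - s\<^sup>2)\<^sup>2 * Rq s)"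
  by (simp add: P2_def poly_PW mult_ac)

lemma poly_P3: "poly P3 s = (c * cos (2*pi*x0))\<^sup>2 * (1 - s\<^sup>2) - (t - b * s)\<^sup>2"
  by (simp add: P3_def power2_eq_square algebra_simps)

text \<open>At 1 the factor \<open>(1 - s^2)^2\<close> vanishes and a multiple of the square of
  \<open>b - t\<close> survives, nonzero for a generic cap. For \<open>\<xi> = 0\<close> the
  multiple is zero in \<open>P1\<close>, and the point 2 serves, where \<open>Rq\<close> is
  negative.\<close>

lemma nonzero_polys: "P1 \<noteq> 0" "P2 \<noteq> 0" "P3 \<noteq> 0"
proof -
  have n: "b - t \<noteq> 0" "t - b \<noteq> 0" using bt by auto
  show "P1 \<noteq> 0"
  proof (cases "\<xi> = 0")
    case True
    have "vv < 2 - t * b" using vv_less by simp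
    then have "vv\<^sup>2 < (2 - t*b)\<^sup>2" using vv_pos by (intro power_strict_mono) auto
    then have "\<xi>\<^sup>2 * (b - t * 2)\<^sup>2 - pi\<^sup>2 * ((1 - 2\<^sup>2)\<^sup>2 * Rq 2) \<noteq> 0" using True by (simp add: Rq_def)
    then have "poly P1 2 \<noteq> 0" by (simp only: poly_P1 not_False_eq_True)
    then show ?thesis by (metis poly_0)
  next
    case False
    then have "poly P1 1 \<noteq> 0" using n by (simp add: poly_P1)
    then show ?thesis by auto
  qed
  have "poly P2 1 \<noteq> 0" "poly P3 1 \<noteq> 0" using n by (auto simp: poly_P2 poly_P3)
  then show "P2 \<noteq> 0" "P3 \<noteq> 0" by auto
qed

lemma brk_finite: "finite brk" "card brk \<le> 15"
proof -
  have dl: "degree ([:b, -t:]^2) \<le> 6" for b t :: real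
    by (rule order_trans[OF degree_power_le]) (simp add: degree_pCons_eq_if)
  have dW: "degree PW \<le> 6" unfolding PW_def
    by (rule order_trans[OF degree_mult_le], rule order_trans[OF add_mono[OF degree_power_le order_refl]]) simp
  have d: "degree P1 \<le> 6" "degree P2 \<le> 6"
    unfolding P1_def P2_def using dl dW by (auto intro!: degree_diff_le order_trans[OF degree_smult_le])
  have d3: "degree P3 \<le> 2"
    unfolding P3_def
    by (intro degree_diff_le order_trans[OF degree_smult_le] order_trans[OF degree_power_le]) (auto simp: degree_pCons_eq_if)
  have f: "finite {s. poly P1 s = 0}" "finite {s. poly P2 s = 0}" "finite {s. poly P3 s = 0}"
    using nonzero_polys by (auto simp: poly_roots_finite)
  have k: "card {s. poly P1 s = 0} \<le> 6" "card {s. poly P2 s = 0} \<le> 6" "card {s. poly P3 s = 0} \<le> 2"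
    using card_poly_roots_bound[OF nonzero_polys(1)] card_poly_roots_bound[OF nonzero_polys(2)]
      card_poly_roots_bound[OF nonzero_polys(3)] d d3 by linarith+
  show "finite brk" using f by (simp add: brk_def)
  have "card brk \<le> card {s. poly P1 s = 0} + card {s. poly P2 s = 0} + card {s. poly P3 s = 0} + card {b / t}"
    unfolding brk_def by (meson add_mono card_Un_le order_refl order_trans)
  then show "card brk \<le> 15" using k by simp
qed

text \<open>At a crossing of the seam \<open>2 * pi * X s\<close> equals \<open>2 * pi * x0\<close>
  up to sign and full turns. Taking cosines gives \<open>G s = cos (2 * pi * x0)\<close>, and
  squaring this gives a root of \<open>P3\<close>.\<close>

lemma integer_offset_brk:
  assumes s: "s1 < s" "s < s2" and e: "e \<in> {1, -1}" and i: "x0 + e * X s \<in> \<int>"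
  shows "poly P3 s = 0"
proof -
  obtain n :: int where n: "x0 + e * X s = of_int n" using i by (auto elim: Ints_cases)
  then have "X s = e * (of_int n - x0)" using e by auto
  then have "2 * pi * X s = 2 * pi * (e * (of_int n - x0))" by (simp only:)
  also have "\<dots> = e * (2 * pi * of_int n - 2 * pi * x0)" by (simp add: algebra_simps)
  finally have "2 * pi * X s = e * (2 * pi * of_int n - 2 * pi * x0)" .
  then have "2 * pi * X s = 2 * pi * of_int n - 2 * pi * x0 \<or> 2 * pi * X s = - (2 * pi * of_int n - 2 * pi * x0)" using e by auto
  then have "cos (2 * pi * X s) = cos (2 * pi * of_int n - 2 * pi * x0)" by (metis cos_minus)
  also have "\<dots> = cos (2 * pi * x0)"
    using cos_int_2pin[of n] sin_int_2pin[of n] by (simp add: cos_diff mult_ac)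
  finally have g: "G s = cos (2 * pi * x0)" using cos_X[of s] s by simp
  have ss: "s\<^sup>2 < 1" using s_sq_less[of s] s by simp
  then have "t - b * s = c * sqrt (1 - s\<^sup>2) * cos (2 * pi * x0)"
    using c_pos unfolding g[symmetric] by (simp add: G_def)
  then have "(t - b * s)\<^sup>2 = (c * cos (2 * pi * x0))\<^sup>2 * (1 - s\<^sup>2)"
    using ss by (simp add: power_mult_distrib)
  then show ?thesis by (simp add: poly_P3)
qed

lemma cont_X_sub: "s1 \<le> p \<Longrightarrow> q \<le> s2 \<Longrightarrow> continuous_on {p..q} X"
  by (rule continuous_on_subset[OF cont_X]) auto

lemma X_monotone:
  assumes "s1 \<le> p" "q \<le> s2" "b / t \<notin> {p<..<q}"
  shows "mono_on {p..q} X \<or> mono_on {p..q} (\<lambda>s. - X s)"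
proof (rule deriv_nonzero_monotone)
  show "continuous_on {p..q} X" by (rule cont_X_sub) (use assms in auto)
  show "continuous_on {p<..<q} X'" by (rule continuous_on_subset[OF cont_X']) (use assms in auto)
  fix s assume s: "s \<in> {p<..<q}"
  then show "(X has_real_derivative X' s) (at s)" using assms by (intro deriv_X) auto
  have "b - t * s \<noteq> 0" using assms(3) s t_nz by (auto simp: field_simps)
  moreover have "Rq s > 0" "s\<^sup>2 < 1" using s assms Rq_pos[of s] s_sq_less[of s] by auto
  ultimately show "X' s \<noteq> 0" by (simp add: X'_def)
qed

text \<open>Between breakpoints the seam is not crossed, so \<open>frac\<close> only subtracts a
  constant, and the derivatives of \<open>gu\<close> and \<open>gv\<close> along the curve do not
  vanish. The monotone count applies, and \<open>\<kappa> * (1 + \<bar>\<xi>\<bar>)\<close> bounds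
  the change of \<open>gu\<close> and \<open>gv\<close> together per unit of change of
  \<open>x\<close> and \<open>y\<close> together.\<close>

lemma cells_base:
  assumes pq: "s1 \<le> p" "p < q" "q \<le> s2" and free: "brk \<inter> {p<..<q} = {}" and e: "e \<in> {1, -1}"
  shows "finite ((cell \<circ> \<gamma> e) ` {p<..<q})
    \<and> real (card ((cell \<circ> \<gamma> e) ` {p<..<q})) \<le> \<kappa> * (1 + \<bar>\<xi>\<bar>) * (\<bar>X q - X p\<bar> + (q - p) / 2) + 3"
proof -
  define h where "h s = x0 + e * X s" for s
  have ch: "continuous_on {p..q} h" unfolding h_def using cont_X_sub[OF pq(1,3)] by (intro continuous_intros)
  have ch': "continuous_on {p<..<q} h" by (rule continuous_on_subset[OF ch]) auto
  have "h s \<notin> \<int>" if "s \<in> {p<..<q}" for s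
    using integer_offset_brk[of s e] that free pq e by (auto simp: h_def brk_def)
  then obtain k where k: "\<And>s. s \<in> {p<..<q} \<Longrightarrow> \<lfloor>h s\<rfloor> = k"
    using integer_free_floor_const[OF ch'] by blast
  define f where "f s = \<kappa> * (\<xi> * (h s - k) + (1 - s) / 2)" for s
  define g where "g s = \<kappa> * (\<xi> * ((1 - s) / 2) - (h s - k))" for s
  have cellfg: "(cell \<circ> \<gamma> e) s = (\<lfloor>f s\<rfloor>, \<lfloor>g s\<rfloor>)" if "s \<in> {p<..<q}" for s
    using k[OF that] by (simp add: cell_def gu_def gv_def \<gamma>_def f_def g_def frac_def h_def)
  have X_mono: "mono_on {p..q} X \<or> mono_on {p..q} (\<lambda>s. - X s)"
    using free pq by (intro X_monotone) (auto simp: brk_def)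
  have sin: "s1 < s" "s < s2" if "s \<in> {p<..<q}" for s using that pq by auto
  have dh: "(h has_real_derivative e * X' s) (at s)" if "s \<in> {p<..<q}" for s
    unfolding h_def using deriv_X[OF sin[OF that]] by (auto intro!: derivative_eq_intros)
  have cX': "continuous_on {p<..<q} X'" by (rule continuous_on_subset[OF cont_X']) (use pq in auto)
  have Wp: "4 * pi\<^sup>2 * ((1 - s\<^sup>2)\<^sup>2 * Rq s) > 0" if "s \<in> {p<..<q}" for s
    using Rq_pos[OF sin[OF that]] s_sq_less[of s] sin[OF that] by auto
  have e2: "(e * x)\<^sup>2 = x\<^sup>2" for x using e by auto
  have f_mono: "mono_on {p..q} f \<or> mono_on {p..q} (\<lambda>s. - f s)"
  proof (rule deriv_nonzero_monotone)
    show "continuous_on {p..q} f" unfolding f_def by (intro continuous_intros ch) auto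
    show "continuous_on {p<..<q} (\<lambda>s. \<kappa> * (\<xi> * (e * X' s) - 1/2))" by (intro continuous_intros cX')
    fix s assume s: "s \<in> {p<..<q}"
    show "(f has_real_derivative \<kappa> * (\<xi> * (e * X' s) - 1/2)) (at s)"
      unfolding f_def by (auto intro!: derivative_eq_intros dh[OF s])
    show "\<kappa> * (\<xi> * (e * X' s) - 1/2) \<noteq> 0"
    proof
      assume "\<kappa> * (\<xi> * (e * X' s) - 1/2) = 0"
      then have "\<xi> * (e * X' s) = 1/2" using \<kappa>_pos by simp
      then have "\<xi>\<^sup>2 * (X' s)\<^sup>2 = 1/4" by (metis e2 power_mult_distrib power_one_over power2_eq_square mult_2 numeral_Bit0 one_power2 power_divide mult.right_neutral mult_numeral_1)
      then have "\<xi>\<^sup>2 * (b - t * s)\<^sup>2 = pi\<^sup>2 * ((1 - s\<^sup>2)\<^sup>2 * Rq s)"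
        unfolding X'_sq[OF sin[OF s], symmetric] mult.assoc[symmetric] by simp
      then show False using free s by (auto simp: brk_def poly_P1)
    qed
  qed
  have g_mono: "mono_on {p..q} g \<or> mono_on {p..q} (\<lambda>s. - g s)"
  proof (rule deriv_nonzero_monotone)
    show "continuous_on {p..q} g" unfolding g_def by (intro continuous_intros ch) auto
    show "continuous_on {p<..<q} (\<lambda>s. \<kappa> * (- \<xi> / 2 - e * X' s))" by (intro continuous_intros cX')
    fix s assume s: "s \<in> {p<..<q}"
    show "(g has_real_derivative \<kappa> * (- \<xi> / 2 - e * X' s)) (at s)"
      unfolding g_def by (auto intro!: derivative_eq_intros dh[OF s])
    show "\<kappa> * (- \<xi> / 2 - e * X' s) \<noteq> 0"
    proof
      assume "\<kappa> * (- \<xi> / 2 - e * X' s) = 0"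
      then have "e * X' s = - \<xi> / 2" using \<kappa>_pos by simp
      then have "(X' s)\<^sup>2 = \<xi>\<^sup>2 / 4" using e2[of "X' s"] by (simp add: power_divide)
      then have "(b - t * s)\<^sup>2 = \<xi>\<^sup>2 * pi\<^sup>2 * ((1 - s\<^sup>2)\<^sup>2 * Rq s)"
        unfolding X'_sq[OF sin[OF s], symmetric] by simp
      then show False using free s by (auto simp: brk_def poly_P2)
    qed
  qed
  define B where "B = \<kappa> * (1 + \<bar>\<xi>\<bar>) * (\<bar>X q - X p\<bar> + (q - p) / 2)"
  have "finite ((\<lambda>s. (\<lfloor>f s\<rfloor>, \<lfloor>g s\<rfloor>)) ` {p<..<q}) \<and> real (card ((\<lambda>s. (\<lfloor>f s\<rfloor>, \<lfloor>g s\<rfloor>)) ` {p<..<q})) \<le> B + 3"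
  proof (rule card_cells_monotone)
    show "mono_on {p<..<q} f \<or> mono_on {p<..<q} (\<lambda>s. - f s)"
      using f_mono by (auto simp: mono_on_def)
    show "mono_on {p<..<q} g \<or> mono_on {p<..<q} (\<lambda>s. - g s)"
      using g_mono by (auto simp: mono_on_def)
    show "B \<ge> 0" using \<kappa>_pos pq by (simp add: B_def)
    fix s s' assume s: "s \<in> {p<..<q}" "s' \<in> {p<..<q}"
    define dx where "dx = h s - h s'"
    define dy where "dy = (s' - s) / 2"
    have "\<bar>dx\<bar> = \<bar>X s - X s'\<bar>" using e by (auto simp: dx_def h_def abs_minus_commute)
    also have "\<dots> \<le> \<bar>X q - X p\<bar>" using s by (intro mono_on_abs_diff_le[OF X_mono]) auto
    finally have dx: "\<bar>dx\<bar> \<le> \<bar>X q - X p\<bar>" .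
    have "\<bar>s' - s\<bar> \<le> q - p" using s by auto
    then have dy: "\<bar>dy\<bar> \<le> (q - p) / 2" by (simp add: dy_def)
    have "f s - f s' = \<kappa> * (\<xi> * dx + dy)" "g s - g s' = \<kappa> * (\<xi> * dy - dx)"
      by (simp_all add: f_def g_def dx_def dy_def algebra_simps add_divide_distrib diff_divide_distrib)
    then have "\<bar>f s - f s'\<bar> + \<bar>g s - g s'\<bar> = \<kappa> * (\<bar>\<xi> * dx + dy\<bar> + \<bar>\<xi> * dy - dx\<bar>)"
    proof -
      assume e: "f s - f s' = \<kappa> * (\<xi> * dx + dy)" "g s - g s' = \<kappa> * (\<xi> * dy - dx)"
      have "\<bar>\<kappa> * z\<bar> = \<kappa> * \<bar>z\<bar>" for z using \<kappa>_pos by (simp add: abs_mult)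
      then show ?thesis unfolding e by (simp only: distrib_left[symmetric])
    qed
    also have "\<dots> \<le> \<kappa> * ((\<bar>\<xi>\<bar> * \<bar>dx\<bar> + \<bar>dy\<bar>) + (\<bar>\<xi>\<bar> * \<bar>dy\<bar> + \<bar>dx\<bar>))"
      using \<kappa>_pos by (intro mult_left_mono add_mono) (auto simp: abs_mult[symmetric])
    also have "\<dots> = \<kappa> * (1 + \<bar>\<xi>\<bar>) * (\<bar>dx\<bar> + \<bar>dy\<bar>)" by (simp add: algebra_simps)
    also have "\<dots> \<le> B" unfolding B_def using \<kappa>_pos dx dy by (intro mult_left_mono add_mono) auto
    finally show "\<bar>f s - f s'\<bar> + \<bar>g s - g s'\<bar> \<le> B" .
  qed
  moreover have "(cell \<circ> \<gamma> e) ` {p<..<q} = (\<lambda>s. (\<lfloor>f s\<rfloor>, \<lfloor>g s\<rfloor>)) ` {p<..<q}"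
    using cellfg by (intro image_cong) auto
  ultimately show ?thesis by (simp only: B_def)
qed

lemma cells_monotone_arc:
  assumes pq: "s1 \<le> p" "p < q" "q \<le> s2" and m: "b / t \<notin> {p<..<q}" and e: "e \<in> {1, -1}"
  shows "finite ((cell \<circ> \<gamma> e) ` {p<..<q})
    \<and> real (card ((cell \<circ> \<gamma> e) ` {p<..<q})) \<le> \<kappa> * (1 + \<bar>\<xi>\<bar>) * (\<bar>X q - X p\<bar> + (q - p) / 2) + 64"
proof -
  let ?g = "cell \<circ> \<gamma> e" and ?k = "\<kappa> * (1 + \<bar>\<xi>\<bar>)"
  \<comment> \<open>Each of n pieces costs 3 and each of the n - 1 breakpoints at most one further
    cell, together 4n - 1. At most 15 breakpoints make this 63.\<close>
  define P where "P a d n \<longleftrightarrow> finite (?g ` {a<..<d}) \<and>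
      real (card (?g ` {a<..<d})) \<le> ?k * (\<bar>X d - X a\<bar> + (d - a) / 2) + (4 * real n - 1)" for a d and n :: nat
  have Xm: "mono_on {p..q} X \<or> mono_on {p..q} (\<lambda>s. - X s)" by (rule X_monotone[OF pq(1,3) m])
  have "P p q (card (brk \<inter> {p<..<q}) + 1)"
  proof (rule breakpoint_induct[where lo=p and hi=q])
    show "finite brk" by (rule brk_finite)
    show "P a d 1" if "p \<le> a" "a < d" "d \<le> q" "brk \<inter> {a<..<d} = {}" for a d
      using cells_base[of a d e] that pq e by (simp add: P_def)
    show "P a d (m + n)" if le: "p \<le> a" "a < z" "z < d" "d \<le> q" and PP: "P a z m" "P z d n" for a z d and m n :: nat
    proof -
      have "{a<..<d} = {a<..<z} \<union> {z} \<union> {z<..<d}" using le by auto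
      then have im: "?g ` {a<..<d} = ?g ` {a<..<z} \<union> {?g z} \<union> ?g ` {z<..<d}" by (simp only: image_Un image_insert image_empty)
      have "card (?g ` {a<..<d}) \<le> card (?g ` {a<..<z}) + card {?g z} + card (?g ` {z<..<d})"
        unfolding im by (meson add_mono card_Un_le order_refl order_trans)
      then have "real (card (?g ` {a<..<d})) \<le> real (card (?g ` {a<..<z})) + 1 + real (card (?g ` {z<..<d}))" by simp
      also have "\<dots> \<le> (?k * (\<bar>X z - X a\<bar> + (z - a) / 2) + (4 * real m - 1)) + 1 + (?k * (\<bar>X d - X z\<bar> + (d - z) / 2) + (4 * real n - 1))"
        using PP unfolding P_def by linarith
      also have "\<dots> = ?k * ((\<bar>X z - X a\<bar> + \<bar>X d - X z\<bar>) + (d - a) / 2) + (4 * real (m + n) - 1)"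
        by (simp add: algebra_simps add_divide_distrib diff_divide_distrib)
      also have "\<bar>X z - X a\<bar> + \<bar>X d - X z\<bar> = \<bar>X d - X a\<bar>"
        using mono_on_abs_diff_add[OF Xm, of a z d] le by simp
      finally show ?thesis using PP im by (simp add: P_def)
    qed
  qed (use pq in auto)
  moreover have "card (brk \<inter> {p<..<q}) \<le> 15" using brk_finite by (meson Int_lower1 card_mono order_trans)
  ultimately show ?thesis by (auto simp: P_def)
qed

lemma s2_minus_s1: "(s2 - s1) / 2 = vv" by (simp add: s1_def s2_def)

text \<open>The total variation of \<open>X\<close> over an arc is at most 1/2. If \<open>X\<close>
  is monotone, this is its range. If it turns at \<open>z = b / t\<close>, then
  \<open>t - b * s = t * (1 - z * s)\<close> keeps the sign of \<open>t\<close>, so \<open>X\<close>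
  stays on one side of 1/4 and each of the two monotone pieces varies by at most 1/4.\<close>

lemma cells_arc:
  assumes e: "e \<in> {1, -1}"
  shows "finite ((cell \<circ> \<gamma> e) ` {s1..s2})
    \<and> real (card ((cell \<circ> \<gamma> e) ` {s1..s2})) \<le> \<kappa> * (1 + \<bar>\<xi>\<bar>) * (1/2 + vv) + 140"
proof (cases "b / t \<in> {s1<..<s2}")
  case False
  let ?g = "cell \<circ> \<gamma> e"
  have "{s1..s2} = {s1<..<s2} \<union> {s1} \<union> {s2}" using s12 by auto
  then have im: "?g ` {s1..s2} = ?g ` {s1<..<s2} \<union> {?g s1} \<union> {?g s2}" by (simp only: image_Un image_insert image_empty)
  have m: "finite (?g ` {s1<..<s2}) \<and> real (card (?g ` {s1<..<s2})) \<le> \<kappa> * (1 + \<bar>\<xi>\<bar>) * (\<bar>X s2 - X s1\<bar> + (s2 - s1) / 2) + 64"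
    by (rule cells_monotone_arc) (use s12 False e in auto)
  have "card (?g ` {s1..s2}) \<le> card (?g ` {s1<..<s2}) + card {?g s1} + card {?g s2}"
    unfolding im by (meson add_mono card_Un_le order_refl order_trans)
  moreover have "\<kappa> * (1 + \<bar>\<xi>\<bar>) * (\<bar>X s2 - X s1\<bar> + (s2 - s1) / 2) \<le> \<kappa> * (1 + \<bar>\<xi>\<bar>) * (1/2 + vv)"
  proof -
    have "\<bar>X s2 - X s1\<bar> \<le> 1/2" using X_bounds[of s1] X_bounds[of s2] s12 by linarith
    then show ?thesis unfolding s2_minus_s1 using \<kappa>_pos by (intro mult_left_mono add_mono) auto
  qed
  ultimately show ?thesis using m im by auto
next
  case True
  let ?g = "cell \<circ> \<gamma> e"
  define z where "z = b / t"
  have z: "s1 < z" "z < s2" using True by (auto simp: z_def)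
  have z1: "\<bar>z\<bar> < 1" using z s12 by auto
  have bz: "b = t * z" using t_nz by (simp add: z_def)
  have "{s1..s2} = {s1<..<z} \<union> {z<..<s2} \<union> {s1} \<union> {z} \<union> {s2}" using z by auto
  then have im: "?g ` {s1..s2} = ?g ` {s1<..<z} \<union> ?g ` {z<..<s2} \<union> {?g s1} \<union> {?g z} \<union> {?g s2}"
    by (simp only: image_Un image_insert image_empty)
  have m1: "finite (?g ` {s1<..<z}) \<and> real (card (?g ` {s1<..<z})) \<le> \<kappa> * (1 + \<bar>\<xi>\<bar>) * (\<bar>X z - X s1\<bar> + (z - s1) / 2) + 64"
    by (rule cells_monotone_arc) (use z e in \<open>auto simp: z_def\<close>)
  have m2: "finite (?g ` {z<..<s2}) \<and> real (card (?g ` {z<..<s2})) \<le> \<kappa> * (1 + \<bar>\<xi>\<bar>) * (\<bar>X s2 - X z\<bar> + (s2 - z) / 2) + 64"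
    by (rule cells_monotone_arc) (use z e in \<open>auto simp: z_def\<close>)
  have gs: "G s * t \<ge> 0" if "s1 \<le> s" "s \<le> s2" for s
  proof -
    have "\<bar>z * s\<bar> \<le> 1" using z1 that s12 by (auto simp: abs_mult intro!: mult_le_one)
    then have "0 \<le> t\<^sup>2 * (1 - z * s)" by (intro mult_nonneg_nonneg) auto
    also have "t\<^sup>2 * (1 - z * s) = (t - b * s) * t" by (simp add: bz power2_eq_square algebra_simps)
    finally show ?thesis using c_pos s_sq_less[OF that] by (simp add: G_def)
  qed
  have quarter: "\<bar>X s - X s'\<bar> \<le> 1/4" if s: "s1 \<le> s" "s \<le> s2" "s1 \<le> s'" "s' \<le> s2" for s s'
  proof (cases "t > 0")
    case True
    have "0 \<le> X s \<and> X s \<le> 1/4" if "s1 \<le> s" "s \<le> s2" for s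
    proof -
      have "0 \<le> G s" using gs[OF that] True by (simp add: zero_le_mult_iff)
      then have "arccos (G s) \<le> arccos 0" using G_bounds[OF that] by (intro arccos_le_arccos) auto
      then show ?thesis using X_bounds[OF that] by (simp add: X_def field_simps)
    qed
    from this[of s] this[of s'] s show ?thesis by linarith
  next
    case False
    then have tn: "t < 0" using t_nz by simp
    have "1/4 \<le> X s \<and> X s \<le> 1/2" if "s1 \<le> s" "s \<le> s2" for s
    proof -
      have "G s \<le> 0" using gs[OF that] tn by (simp add: zero_le_mult_iff)
      then have "arccos 0 \<le> arccos (G s)" using G_bounds[OF that] by (intro arccos_le_arccos) auto
      then show ?thesis using X_bounds[OF that] by (simp add: X_def field_simps)
    qed
    from this[of s] this[of s'] s show ?thesis by linarith
  qed
  have "card (?g ` {s1..s2}) \<le> card (?g ` {s1<..<z}) + card (?g ` {z<..<s2}) + card {?g s1} + card {?g z} + card {?g s2}"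
    unfolding im by (meson add_mono card_Un_le order_refl order_trans)
  then have "real (card (?g ` {s1..s2})) \<le> real (card (?g ` {s1<..<z})) + real (card (?g ` {z<..<s2})) + 3" by simp
  moreover have "\<kappa> * (1 + \<bar>\<xi>\<bar>) * (\<bar>X z - X s1\<bar> + (z - s1) / 2) + \<kappa> * (1 + \<bar>\<xi>\<bar>) * (\<bar>X s2 - X z\<bar> + (s2 - z) / 2) \<le> \<kappa> * (1 + \<bar>\<xi>\<bar>) * (1/2 + vv)"
  proof -
    have "\<bar>X z - X s1\<bar> \<le> 1/4" "\<bar>X s2 - X z\<bar> \<le> 1/4" using quarter[of z s1] quarter[of s2 z] z by linarith+
    then have "(\<bar>X z - X s1\<bar> + (z - s1) / 2) + (\<bar>X s2 - X z\<bar> + (s2 - z) / 2) \<le> 1/2 + vv"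
      using s2_minus_s1 by (simp add: field_simps)
    then show ?thesis unfolding distrib_left[symmetric] using \<kappa>_pos by (intro mult_left_mono) auto
  qed
  ultimately show ?thesis using m1 m2 im by auto
qed

text \<open>Within the square, a tile that is not hit lies entirely in the open cap or entirely in
  its complement.\<close>

definition hit :: "int \<times> int \<Rightarrow> bool" where
  "hit n \<longleftrightarrow> (\<exists>w\<in>I2. cell w = n \<and> F w > t) \<and> (\<exists>w\<in>I2. cell w = n \<and> F w \<le> t)"

end

lemma convex_I2: "convex I2"
proof -
  have eq: "I2 = {v. 0 \<le> axis 1 1 \<bullet> v} \<inter> {v. axis 1 1 \<bullet> v < 1} \<inter> {v. 0 < axis 2 1 \<bullet> v} \<inter> {v. axis 2 1 \<bullet> v < 1}"
    by (auto simp: I2_def inner_axis')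
  show ?thesis
    unfolding eq by (intro convex_Int convex_halfspace_lt convex_halfspace_ge convex_halfspace_gt)
qed

context grid
begin

lemma convex_cell: "convex {w. cell w = n}"
proof -
  have gu: "gu = (\<lambda>w. vector [\<kappa>*\<xi>, \<kappa>] \<bullet> w)" and gv: "gv = (\<lambda>w. vector [-\<kappa>, \<kappa>*\<xi>] \<bullet> w)"
    by (auto simp: gu_def gv_def inner_vec_def sum_2 algebra_simps)
  have "{w. cell w = n} = {w. of_int (fst n) \<le> gu w} \<inter> {w. gu w < of_int (fst n) + 1} \<inter> {w. of_int (snd n) \<le> gv w} \<inter> {w. gv w < of_int (snd n) + 1}"
    by (auto simp: cell_def floor_eq_iff prod_eq_iff)
  moreover have "convex {w. a \<le> gu w}" "convex {w. gu w < a}" "convex {w. a \<le> gv w}" "convex {w. gv w < a}" for a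
    unfolding gu gv by (rule convex_halfspace_ge convex_halfspace_lt)+
  ultimately show ?thesis by (simp only: convex_Int)
qed

end

context gridcap
begin

lemma hit_curve:
  assumes "hit n"
  shows "\<exists>w\<in>I2. cell w = n \<and> F w = t"
proof -
  obtain w1 w2 where w: "w1 \<in> I2" "cell w1 = n" "F w1 > t" "w2 \<in> I2" "cell w2 = n" "F w2 \<le> t"
    using assms by (auto simp: hit_def)
  let ?S = "I2 \<inter> {w. cell w = n}"
  have "connected ?S" by (intro convex_connected convex_Int convex_I2 convex_cell)
  then have "connected (F ` ?S)"
    by (intro connected_continuous_image continuous_on_subset[OF continuous_capF]) auto
  then have "t \<in> F ` ?S"
    by (rule connectedD_interval[of _ "F w2" "F w1"]) (use w in auto)
  then show ?thesis by auto
qed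

text \<open>Together the two arcs vary by at most 1 in \<open>x\<close> and by \<open>2 * vv\<close>
  in \<open>y\<close>, whence the factor \<open>1 + 2 * vv\<close>, which is at most 3.\<close>

lemma card_hit:
  "finite {n. hit n} \<and> real (card {n. hit n}) \<le> \<kappa> * (1 + \<bar>\<xi>\<bar>) * (1 + 2 * vv) + 280"
proof -
  let ?A = "(cell \<circ> \<gamma> 1) ` {s1..s2}" and ?B = "(cell \<circ> \<gamma> (-1)) ` {s1..s2}"
  have sub: "{n. hit n} \<subseteq> ?A \<union> ?B"
  proof
    fix n assume "n \<in> {n. hit n}"
    then obtain w where w: "w \<in> I2" "cell w = n" "F w = t" using hit_curve[of n] by auto
    then obtain e s where "e \<in> {1,-1::real}" "s1 \<le> s" "s \<le> s2" "w = \<gamma> e s" using level_set_param by blast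
    then show "n \<in> ?A \<union> ?B" using w(2) by auto
  qed
  have f: "finite (?A \<union> ?B)" using cells_arc[of 1] cells_arc[of "-1"] by auto
  have "card {n. hit n} \<le> card ?A + card ?B"
    using card_mono[OF f sub] card_Un_le[of ?A ?B] by linarith
  then have "real (card {n. hit n}) \<le> real (card ?A) + real (card ?B)" by linarith
  also have "\<dots> \<le> (\<kappa> * (1 + \<bar>\<xi>\<bar>) * (1/2 + vv) + 140) + (\<kappa> * (1 + \<bar>\<xi>\<bar>) * (1/2 + vv) + 140)"
    using cells_arc[of 1] cells_arc[of "-1"] by (intro add_mono) auto
  also have "\<dots> = \<kappa> * (1 + \<bar>\<xi>\<bar>) * (1 + 2 * vv) + 280" by (simp add: algebra_simps)
  finally show ?thesis using finite_subset[OF sub f] by simp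
qed

end

section \<open>Area of the cap inside the tiles met by its boundary\<close>

lemma pi_ge_3: "pi \<ge> 3"
  using sin_x_le_x[of "pi/6"] by (simp add: sin_30)

lemma emeasure_vec2_sections':
  fixes A :: "(real^2) set"
  assumes [measurable]: "A \<in> sets borel"
  shows "emeasure lborel A = (\<integral>\<^sup>+x. emeasure lborel {y. pt x y \<in> A} \<partial>lborel)"
proof -
  let ?B = "{p::real\<times>real. pt (fst p) (snd p) \<in> A}"
  have B[measurable]: "?B \<in> sets (borel \<Otimes>\<^sub>M borel)"
    unfolding borel_prod using measurable_sets[OF measurable_pt assms] by (simp add: vimage_def)
  have "emeasure lborel A = emeasure (lborel :: (real\<times>real) measure) ?B"
    by (subst lborel_vec2, subst emeasure_distr) (auto simp: vimage_def)
  also have "\<dots> = emeasure (lborel \<Otimes>\<^sub>M lborel) ?B"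
    by (simp add: lborel_prod)
  also have "\<dots> = (\<integral>\<^sup>+x. emeasure lborel (Pair x -` ?B) \<partial>lborel)"
    by (rule lborel.emeasure_pair_measure_alt) simp
  finally show ?thesis by (simp add: vimage_def)
qed

text \<open>The chord bounds a triangle with base 1 and height \<open>\<bar>\<Delta>\<bar>\<close>;
  lowering it by \<open>d\<close> costs at most \<open>d\<close>. The integer heights form a null
  set and are left out because the points found here must avoid tile sides.\<close>

lemma measure_below_chord:
  fixes j q \<Delta> d :: real
  assumes d: "d \<ge> 0"
  defines "A \<equiv> {v::real^2. j < v$1 \<and> v$1 < j + 1 \<and> min q (q + \<Delta>) < v$2 \<and> v$2 < q + (v$1 - j) * \<Delta> - d \<and> v$2 \<notin> \<int>}"
  shows "A \<in> lmeasurable" "measure lebesgue A \<ge> \<bar>\<Delta>\<bar> / 2 - d"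
proof -
  have coord [measurable]: "(\<lambda>v::real^2. v$i) \<in> borel_measurable borel" for i
    by (intro borel_measurable_continuous_onI continuous_intros)
  have Ints_cl: "closed (\<int> :: real set)" by (rule closed_Ints)
  then have [measurable]: "(\<int> :: real set) \<in> sets borel" by (rule borel_closed)
  have Ab [measurable]: "A \<in> sets borel" unfolding A_def by measurable
  define lo where "lo = min q (q + \<Delta>)"
  have bd: "bounded A"
  proof -
    have "norm v \<le> \<bar>j\<bar> + 1 + (\<bar>q\<bar> + \<bar>\<Delta>\<bar> + d)" if "v \<in> A" for v
    proof -
      have v: "j < v$1" "v$1 < j + 1" "lo < v$2" "v$2 < q + (v$1 - j) * \<Delta> - d" using that by (auto simp: A_def lo_def)
      have "\<bar>(v$1 - j) * \<Delta>\<bar> \<le> 1 * \<bar>\<Delta>\<bar>" unfolding abs_mult using v by (intro mult_right_mono) auto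
      then have "\<bar>v$2\<bar> \<le> \<bar>q\<bar> + \<bar>\<Delta>\<bar> + d" using v(3,4) d by (auto simp: lo_def)
      moreover have "\<bar>v$1\<bar> \<le> \<bar>j\<bar> + 1" using v by auto
      moreover have "norm v \<le> \<bar>v$1\<bar> + \<bar>v$2\<bar>" using norm_le_l1_cart[of v] by (simp add: sum_2)
      ultimately show ?thesis by linarith
    qed
    then show ?thesis by (auto simp: bounded_iff)
  qed
  have Al: "A \<in> sets lebesgue" using Ab by simp
  show lm: "A \<in> lmeasurable" using bd Al by (rule bounded_set_imp_lmeasurable)
  define g where "g x = q - lo + (x - j) * \<Delta>" for x
  have g0: "g x \<ge> 0" if "x \<in> {j..j+1}" for x
  proof -
    have u: "0 \<le> x - j" "x - j \<le> 1" using that by auto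
    show ?thesis
    proof (cases "\<Delta> \<ge> 0")
      case True
      then show ?thesis using u by (simp add: g_def lo_def min_def)
    next
      case False
      then have "lo = q + \<Delta>" by (simp add: lo_def)
      moreover have "1 * \<Delta> \<le> (x - j) * \<Delta>" using u False by (intro mult_right_mono_neg) auto
      ultimately show ?thesis by (simp add: g_def)
    qed
  qed
  have sl: "emeasure lborel {y. pt x y \<in> A} = ennreal (g x - d) * indicator {j<..<j+1} x" for x
  proof (cases "j < x \<and> x < j + 1")
    case True
    have "emeasure lborel {y. pt x y \<in> A} = emeasure lborel {lo<..<lo + (g x - d)}"
    proof (rule emeasure_eq_AE)
      have "countable (\<int> :: real set)" by (rule countable_int)
      then have "AE y in lborel. y \<notin> (\<int> :: real set)"
        by (intro AE_not_in null_setsI) (auto simp: emeasure_lborel_countable)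
      then show "AE y in lborel. y \<in> {y. pt x y \<in> A} \<longleftrightarrow> y \<in> {lo<..<lo + (g x - d)}"
      proof eventually_elim
        case (elim y)
        then show ?case using True by (auto simp: A_def g_def lo_def)
      qed
      show "{y. pt x y \<in> A} \<in> sets lborel"
      proof -
        have "(\<lambda>y. pt x y) \<in> borel_measurable borel" by measurable
        from measurable_sets[OF this Ab] show ?thesis by (simp add: vimage_def)
      qed
    qed simp
    also have "\<dots> = ennreal (g x - d)"
      by (cases "g x - d \<ge> 0") (auto simp: ennreal_neg)
    finally show ?thesis using True by simp
  next
    case False
    then have "{y. pt x y \<in> A} = {}" by (auto simp: A_def)
    then show ?thesis using False by (simp only: emeasure_empty) auto
  qed
  have "ennreal (\<bar>\<Delta>\<bar> / 2) = (\<integral>\<^sup>+x. ennreal (g x) * indicator {j..j+1} x \<partial>lborel)"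
  proof -
    define G where "G x = (q - lo) * x + \<Delta> * (x - j)\<^sup>2 / 2" for x
    have "(\<integral>\<^sup>+x. ennreal (g x) * indicator {j..j+1} x \<partial>lborel) = ennreal (G (j+1) - G j)"
    proof (rule nn_integral_FTC_Icc)
      show "g \<in> borel_measurable borel" unfolding g_def by measurable
      show "DERIV G x :> g x" for x unfolding G_def g_def
        by (auto intro!: derivative_eq_intros simp: field_simps)
      show "g x \<ge> 0" if "x \<in> {j..j+1}" for x using g0 that by simp
    qed simp
    also have "G (j+1) - G j = \<bar>\<Delta>\<bar> / 2" by (auto simp: G_def lo_def min_def algebra_simps)
    finally show ?thesis by simp
  qed
  also have "\<dots> \<le> (\<integral>\<^sup>+x. ennreal (g x - d) * indicator {j<..<j+1} x + ennreal d * indicator {j..j+1} x \<partial>lborel)"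
  proof (rule nn_integral_mono_AE)
    have "AE x in lborel. x \<noteq> j" "AE x in lborel. x \<noteq> j + 1" by (simp_all add: AE_lborel_singleton)
    then show "AE x in lborel. ennreal (g x) * indicator {j..j+1} x \<le> ennreal (g x - d) * indicator {j<..<j+1} x + ennreal d * indicator {j..j+1} x"
    proof eventually_elim
      case (elim x)
      have "ennreal (g x) \<le> ennreal (g x - d) + ennreal d"
      proof (cases "g x - d \<ge> 0")
        case True
        then show ?thesis using d by (simp add: ennreal_plus[symmetric] del: ennreal_plus)
      next
        case False
        then have "ennreal (g x) \<le> ennreal d" by (intro ennreal_leI) simp
        then show ?thesis by (simp add: add_increasing)
      qed
      then show ?case using elim by (auto simp: indicator_def)
    qed
  qed
  also have "\<dots> = emeasure lborel A + ennreal d"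
    unfolding emeasure_vec2_sections'[OF Ab] sl
    by (subst nn_integral_add) (auto simp: g_def nn_integral_cmult)
  finally have "ennreal (\<bar>\<Delta>\<bar> / 2) \<le> emeasure lborel A + ennreal d" .
  moreover have "emeasure lborel A = ennreal (measure lebesgue A)"
  proof -
    have "emeasure lebesgue A = ennreal (measure lebesgue A)"
      using lm by (intro emeasure_eq_measure2) auto
    then show ?thesis using Ab by simp
  qed
  ultimately have "ennreal (\<bar>\<Delta>\<bar> / 2) \<le> ennreal (measure lebesgue A + d)" using d by (simp add: ennreal_plus)
  then show "measure lebesgue A \<ge> \<bar>\<Delta>\<bar> / 2 - d" using d by (subst (asm) ennreal_le_iff) auto
qed

text \<open>Clamping to the closed unit square gives a tile that crosses an edge a share of the cap outside the
  square as well, which makes the edge tiles comparable to the inner ones.\<close>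

definition cl :: "real^2 \<Rightarrow> real^2" where
  "cl w = pt (max 0 (min 1 (w$1))) (max 0 (min 1 (w$2)))"

lemma floor_minus_cong:
  fixes x y :: real
  assumes "\<lfloor>x\<rfloor> = \<lfloor>y\<rfloor>" "x \<notin> \<int>" "y \<notin> \<int>"
  shows "\<lfloor>-x\<rfloor> = \<lfloor>-y\<rfloor>"
proof -
  have "\<lceil>x\<rceil> = \<lfloor>x\<rfloor> + 1" "\<lceil>y\<rceil> = \<lfloor>y\<rfloor> + 1" using assms(2,3) by (metis Ints_of_int ceiling_altdef)+
  then show ?thesis using assms(1) by (simp add: floor_minus)
qed

text \<open>The coefficients \<open>a1\<close>, \<open>a2\<close> are \<open>\<kappa>\<close> and \<open>\<kappa> * \<xi>\<close> up to order and sign. With \<open>\<bar>a1\<bar> \<le> a2\<close> the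
  functional \<open>pf\<close> is monotone along the middle part \<open>\<bar>s - t * b\<bar> \<le> 17/32\<close> of both arcs, so that every row
  of tiles is crossed once; between two consecutive rows the curve cuts off a triangle, and the triangles add
  up to half the variation of \<open>qf\<close>.\<close>

locale saving = gridcap +
  fixes a1 a2 :: real
  assumes a12: "\<bar>a1\<bar> \<le> a2" and N0: "a1\<^sup>2 + a2\<^sup>2 = \<kappa>\<^sup>2 * (1 + \<xi>\<^sup>2)" and a2_ge: "a2 \<ge> 100000"
    and vv_ge: "vv \<ge> 4/5"
    and cell_det: "\<And>w w'. \<lbrakk>\<lfloor>a1 * w$1 + a2 * w$2\<rfloor> = \<lfloor>a1 * w'$1 + a2 * w'$2\<rfloor>; \<lfloor>a2 * w$1 - a1 * w$2\<rfloor> = \<lfloor>a2 * w'$1 - a1 * w'$2\<rfloor>;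
        a1 * w$1 + a2 * w$2 \<notin> \<int>; a1 * w'$1 + a2 * w'$2 \<notin> \<int>; a2 * w$1 - a1 * w$2 \<notin> \<int>; a2 * w'$1 - a1 * w'$2 \<notin> \<int>\<rbrakk>
        \<Longrightarrow> cell w = cell w'"
begin

section \<open>The middle part of the boundary curve\<close>

definition N :: real where "N = a1\<^sup>2 + a2\<^sup>2"

lemma N_bounds: "a2\<^sup>2 \<le> N" "N \<le> 2 * a2\<^sup>2" "N > 0"
proof -
  have "a1\<^sup>2 \<le> a2\<^sup>2" using a12 by (simp add: abs_le_square_iff[symmetric])
  moreover have "a2\<^sup>2 > 0" using a2_ge by simp
  ultimately show "a2\<^sup>2 \<le> N" "N \<le> 2 * a2\<^sup>2" "N > 0" by (auto simp: N_def add_nonneg_pos)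
qed

definition pf :: "real^2 \<Rightarrow> real" where "pf w = - (a1 * w$1 + a2 * w$2)"
definition qf :: "real^2 \<Rightarrow> real" where "qf w = a2 * w$1 - a1 * w$2"

lemma cell_eqI:
  assumes e: "e \<in> {1, -1::real}" and "\<lfloor>pf w\<rfloor> = \<lfloor>pf w'\<rfloor>" "\<lfloor>e * qf w\<rfloor> = \<lfloor>e * qf w'\<rfloor>"
    "pf w \<notin> \<int>" "pf w' \<notin> \<int>" "e * qf w \<notin> \<int>" "e * qf w' \<notin> \<int>"
  shows "cell w = cell w'"
proof (rule cell_det)
  have p: "a1 * w$1 + a2 * w$2 = - pf w" "a1 * w'$1 + a2 * w'$2 = - pf w'" by (auto simp: pf_def)
  have q: "a2 * w$1 - a1 * w$2 = qf w" "a2 * w'$1 - a1 * w'$2 = qf w'" by (auto simp: qf_def)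
  have ni: "qf w \<notin> \<int>" "qf w' \<notin> \<int>" using assms(6,7) e by auto
  show "\<lfloor>a1 * w$1 + a2 * w$2\<rfloor> = \<lfloor>a1 * w'$1 + a2 * w'$2\<rfloor>" unfolding p using assms by (intro floor_minus_cong) auto
  show "\<lfloor>a2 * w$1 - a1 * w$2\<rfloor> = \<lfloor>a2 * w'$1 - a1 * w'$2\<rfloor>" unfolding q
    using assms(3) e ni floor_minus_cong[of "- qf w" "- qf w'"] by auto
  show "a1 * w$1 + a2 * w$2 \<notin> \<int>" "a1 * w'$1 + a2 * w'$2 \<notin> \<int>" unfolding p using assms by auto
  show "a2 * w$1 - a1 * w$2 \<notin> \<int>" "a2 * w'$1 - a1 * w'$2 \<notin> \<int>" unfolding q by (rule ni)+
qed

definition lo :: real where "lo = t * b - 17/32"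
definition hi :: real where "hi = t * b + 17/32"

lemma mid_sub: "s1 < lo" "hi < s2" "lo < hi"
  using vv_ge by (auto simp: lo_def hi_def s1_def s2_def)

text \<open>With \<open>u = b^2 + t^2\<close>, the mean inequality gives
  \<open>\<bar>t * b\<bar> \<le> u / 2\<close>, and hence \<open>vv^2 = 1 - u + (t * b)^2\<close> is
  at most \<open>(1 - u / 2)^2\<close>. So \<open>vv \<ge> 4/5\<close> forces
  \<open>u \<le> 2/5\<close>.\<close>

lemma bt_sum: "b\<^sup>2 + t\<^sup>2 \<le> 2/5" "\<bar>t * b\<bar> \<le> 1/5"
proof -
  define u where "u = b\<^sup>2 + t\<^sup>2"
  have v64: "16/25 \<le> vv\<^sup>2" using power_mono[OF vv_ge, of 2] by (simp add: power2_eq_square)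
  have "0 \<le> (\<bar>b\<bar> - \<bar>t\<bar>)\<^sup>2" by simp
  also have "(\<bar>b\<bar> - \<bar>t\<bar>)\<^sup>2 = u - 2 * \<bar>t * b\<bar>" by (simp add: u_def power2_diff abs_mult)
  finally have tb: "\<bar>t * b\<bar> \<le> u / 2" by simp
  have "(t*b)\<^sup>2 \<le> (u/2)\<^sup>2" using power_mono[OF tb, of 2] by simp
  moreover have "vv\<^sup>2 = 1 - u + (t*b)\<^sup>2" unfolding vv_sq u_def by (simp add: power2_eq_square algebra_simps)
  ultimately have "(4/5)\<^sup>2 \<le> (1 - u/2)\<^sup>2" using v64 by (simp add: power2_eq_square algebra_simps)
  moreover have "0 \<le> 1 - u/2" using b2 t2 by (simp add: u_def)
  ultimately have "4/5 \<le> 1 - u/2" by (meson power2_le_imp_le)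
  then show "b\<^sup>2 + t\<^sup>2 \<le> 2/5" "\<bar>t * b\<bar> \<le> 1/5" using tb by (auto simp: u_def)
qed

context
  fixes s assumes s: "lo \<le> s" "s \<le> hi"
begin

lemma mid_range: "s1 < s" "s < s2" using mid_sub s by auto

lemma mid_s: "s\<^sup>2 \<le> 535/1000" "Rq s \<ge> 357/1000" "Rq s \<le> 1" "sqrt (Rq s) \<ge> 59/100" "sqrt (Rq s) \<le> 1"
proof -
  have d: "\<bar>s - t*b\<bar> \<le> 17/32" using s unfolding lo_def hi_def by linarith
  then have "\<bar>s\<bar> \<le> 73125/100000" using bt_sum(2) by linarith
  from power_mono[OF this, of 2] show "s\<^sup>2 \<le> 535/1000" by (simp add: power2_eq_square)
  have dd: "(s - t*b)\<^sup>2 \<le> (17/32)\<^sup>2" using power_mono[OF d, of 2] by simp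
  moreover have "16/25 \<le> vv\<^sup>2" using power_mono[OF vv_ge, of 2] by (simp add: power2_eq_square)
  ultimately show R: "Rq s \<ge> 357/1000" unfolding Rq_def by (simp add: power2_eq_square)
  have "(1 - t\<^sup>2) * (1 - b\<^sup>2) \<le> 1 * 1" using b2 t2 by (intro mult_mono) auto
  then show R1: "Rq s \<le> 1" unfolding Rq_def vv_sq using zero_le_power2[of "s - t*b"] by linarith
  show "sqrt (Rq s) \<ge> 59/100" by (rule real_le_rsqrt) (use R in \<open>simp add: power2_eq_square\<close>)
  show "sqrt (Rq s) \<le> 1" using R1 by simp
qed

text \<open>With \<open>d = s - t * b\<close> the numerator of \<open>X'\<close> is
  \<open>b * (1 - t^2) - t * d\<close>, and Lagrange's identity bounds its square by a product of
  two sums of squares.\<close>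

lemma num_bound: "(b - t * s)\<^sup>2 \<le> 52/100"
proof -
  define d where "d = s - t*b"
  have d: "\<bar>d\<bar> \<le> 17/32" using s unfolding lo_def hi_def d_def by linarith
  have n: "b - t * s = b * (1 - t\<^sup>2) - t * d" by (simp add: d_def power2_eq_square algebra_simps)
  have "(b * p - t * d)\<^sup>2 + (b * d + t * p)\<^sup>2 = (b\<^sup>2 + t\<^sup>2) * (p\<^sup>2 + d\<^sup>2)" for p
    by (simp add: power2_eq_square algebra_simps)
  then have "(b - t * s)\<^sup>2 + (b * d + t * (1 - t\<^sup>2))\<^sup>2 = (b\<^sup>2 + t\<^sup>2) * ((1 - t\<^sup>2)\<^sup>2 + d\<^sup>2)"
    unfolding n .
  then have "(b - t * s)\<^sup>2 \<le> (b\<^sup>2 + t\<^sup>2) * ((1 - t\<^sup>2)\<^sup>2 + d\<^sup>2)"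
    using zero_le_power2[of "b * d + t * (1 - t\<^sup>2)"] by linarith
  also have "\<dots> \<le> (2/5) * (1 + (17/32)\<^sup>2)"
  proof (rule mult_mono)
    have "(1 - t\<^sup>2)\<^sup>2 \<le> 1" using t2 by (intro power_le_one) auto
    then show "(1 - t\<^sup>2)\<^sup>2 + d\<^sup>2 \<le> 1 + (17/32)\<^sup>2" using power_mono[OF d, of 2] by simp
  qed (use bt_sum in auto)
  also have "\<dots> \<le> 52/100" by (simp add: power2_eq_square)
  finally show ?thesis .
qed

text \<open>What matters is that 9/20 is below 1/2, the rate at which \<open>y\<close> changes with
  \<open>s\<close>. With \<open>\<bar>a1\<bar> \<le> a2\<close> this makes \<open>pf\<close>
  strictly monotone along the curve.\<close>

lemma X'_bound: "\<bar>X' s\<bar> \<le> 9/20"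
proof -
  have a: "1 - s\<^sup>2 \<ge> 465/1000" using mid_s(1) by simp
  from power_mono[OF this, of 2] have "(1 - s\<^sup>2)\<^sup>2 \<ge> 216/1000" by (simp add: power2_eq_square)
  then have W: "(1 - s\<^sup>2)\<^sup>2 * Rq s \<ge> (216/1000) * (357/1000)" using mid_s(2) by (intro mult_mono) auto
  have "pi\<^sup>2 \<ge> 3\<^sup>2" by (rule power_mono[OF pi_ge_3]) simp
  then have "4 * pi\<^sup>2 \<ge> 36" by simp
  then have "4 * pi\<^sup>2 * ((1 - s\<^sup>2)\<^sup>2 * Rq s) \<ge> 36 * ((216/1000) * (357/1000))"
    by (rule mult_mono[OF _ W]) auto
  then have "(X' s)\<^sup>2 * (36 * ((216/1000) * (357/1000))) \<le> (b - t * s)\<^sup>2"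
    unfolding X'_sq[OF mid_range, symmetric] by (intro mult_left_mono) auto
  then have "(X' s)\<^sup>2 * (36 * ((216/1000) * (357/1000))) \<le> 52/100" using num_bound by linarith
  then have "(X' s)\<^sup>2 \<le> (9/20)\<^sup>2" by (simp add: power2_eq_square)
  then show ?thesis by (simp add: abs_le_square_iff[symmetric] abs_le_iff power2_le_iff_abs_le)
qed

text \<open>The sine of \<open>2 * pi * X s\<close> is at least \<open>sqrt (Rq s)\<close>, so
  \<open>X s\<close> keeps away from 0 and 1/2, where the two arcs meet. This separates the arcs and
  leaves room to step into the cap.\<close>

lemma X_thick: "7/100 \<le> X s" "X s \<le> 43/100"
proof -
  have m: "s1 \<le> s" "s \<le> s2" using mid_range by auto
  have "c\<^sup>2 \<le> 1" using cb zero_le_power2[of b] by linarith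
  then have c1: "c\<^sup>2 * (1 - s\<^sup>2) \<le> 1 * 1" using s_sq_less[OF m] by (intro mult_mono) auto
  have cp: "c\<^sup>2 * (1 - s\<^sup>2) > 0" using c_pos s_sq_less[OF m] by simp
  have "Rq s \<le> Rq s / (c\<^sup>2 * (1 - s\<^sup>2))" using c1 cp mid_s(2) by (simp add: le_divide_eq mult_left_le)
  then have "Rq s \<le> 1 - (G s)\<^sup>2" using G_sq[OF m] by simp
  also have "\<dots> = (sin (2 * pi * X s))\<^sup>2" unfolding sin_squared_eq cos_X[OF m] ..
  finally have "sqrt (Rq s) \<le> \<bar>sin (2 * pi * X s)\<bar>" by (metis real_sqrt_abs real_sqrt_le_mono)
  also have "\<dots> = sin (2 * pi * X s)" using X_bounds[OF m] by (intro abs_of_nonneg sin_ge_zero) auto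
  finally have sn: "59/100 \<le> sin (2 * pi * X s)" using mid_s(4) by simp
  have "59/100 \<le> 2 * pi * X s" using sn sin_x_le_x[of "2 * pi * X s"] X_bounds[OF m] by simp
  also have "\<dots> \<le> 2 * 4 * X s" using pi_less_4 X_bounds[OF m] by (intro mult_right_mono mult_left_mono) auto
  finally show "7/100 \<le> X s" by simp
  have "sin (pi - 2 * pi * X s) = sin (2 * pi * X s)" by simp
  moreover have "sin (pi - 2 * pi * X s) \<le> pi - 2 * pi * X s" using X_bounds[OF m] by (intro sin_x_le_x) simp
  ultimately have "59/100 \<le> pi * (1 - 2 * X s)" using sn by (simp add: algebra_simps)
  also have "\<dots> \<le> 4 * (1 - 2 * X s)" using pi_less_4 X_bounds[OF m] by (intro mult_right_mono) auto
  finally show "X s \<le> 43/100" by simp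
qed

text \<open>A bound on the second derivative of \<open>X\<close> makes the chord over one row
  accurate to second order. With at most \<open>2 * a2\<close> rows, each of parameter length
  O(1/a2), the accumulated loss stays bounded.\<close>

lemma X'_lipschitz_deriv: "\<exists>D. (X' has_real_derivative D) (at s) \<and> \<bar>D\<bar> \<le> 24"
proof -
  define r where "r = sqrt (Rq s)"
  define g where "g = (1 - s\<^sup>2) * r"
  define g' where "g' = - 2 * s * r + (1 - s\<^sup>2) * (- (s - t*b) / r)"
  have rp: "59/100 \<le> r" "r \<le> 1" using mid_s by (auto simp: r_def)
  have a: "465/1000 \<le> 1 - s\<^sup>2" "1 - s\<^sup>2 \<le> 1" using mid_s(1) by auto
  have g14: "1/4 \<le> g"
  proof -
    have "(465/1000) * (59/100) \<le> g" unfolding g_def using a rp by (intro mult_mono) auto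
    then show ?thesis by simp
  qed
  have dR: "(Rq has_real_derivative (- 2 * (s - t*b))) (at s)"
    unfolding Rq_def by (auto intro!: derivative_eq_intros)
  have Rp: "Rq s > 0" using mid_s(2) by simp
  have dr: "((\<lambda>s. sqrt (Rq s)) has_real_derivative (- (s - t*b) / r)) (at s)"
  proof -
    have "inverse (sqrt (Rq s)) / 2 * (- 2 * (s - t*b)) = - (s - t*b) / r"
      using rp by (simp add: r_def[symmetric] field_simps)
    from DERIV_cong[OF DERIV_chain2[OF DERIV_real_sqrt[OF Rp] dR] this] show ?thesis .
  qed
  have dg: "((\<lambda>s. (1 - s\<^sup>2) * sqrt (Rq s)) has_real_derivative g') (at s)"
  proof -
    have d1: "((\<lambda>s. 1 - s\<^sup>2) has_real_derivative (- 2 * s)) (at s)"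
      by (auto intro!: derivative_eq_intros)
    from DERIV_mult[OF d1 dr] show ?thesis by (simp add: g'_def r_def mult.commute)
  qed
  have dgp: "((\<lambda>s. 2 * pi * ((1 - s\<^sup>2) * sqrt (Rq s))) has_real_derivative 2 * pi * g') (at s)"
    by (rule DERIV_cmult[OF dg])
  have dn: "((\<lambda>s. b - t * s) has_real_derivative (- t)) (at s)"
    by (auto intro!: derivative_eq_intros)
  have nz: "2 * pi * ((1 - s\<^sup>2) * sqrt (Rq s)) \<noteq> 0" using g14 by (auto simp: g_def r_def)
  define D where "D = ((- t) * (2 * pi * g) - (b - t * s) * (2 * pi * g')) / ((2 * pi * g) * (2 * pi * g))"
  have "(X' has_real_derivative D) (at s)"
  proof -
    have eq: "X' = (\<lambda>s. (b - t * s) / (2 * pi * ((1 - s\<^sup>2) * sqrt (Rq s))))" by (auto simp: X'_def)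
    show ?thesis using DERIV_divide[OF dn dgp nz] unfolding eq D_def g_def r_def .
  qed
  moreover have "\<bar>D\<bar> \<le> 24"
  proof -
    have "\<bar>s\<bar> \<le> 1" using mid_s(1) by (simp add: abs_square_le_1[symmetric])
    have "\<bar>s - t*b\<bar> \<le> 59/100" using s unfolding lo_def hi_def by linarith
    then have k: "\<bar>(s - t*b) / r\<bar> \<le> 1" using rp by (simp add: abs_divide divide_le_eq_1)
    have "\<bar>g'\<bar> \<le> \<bar>2 * s * r\<bar> + \<bar>(1 - s\<^sup>2) * ((s - t*b) / r)\<bar>"     proof -
      have "g' = - (2 * s * r) - (1 - s\<^sup>2) * ((s - t*b) / r)" using rp by (simp add: g'_def field_simps)
      then show ?thesis by linarith
    qed
    also have "\<bar>2 * s * r\<bar> \<le> 2 * 1 * 1" unfolding abs_mult using \<open>\<bar>s\<bar> \<le> 1\<close> rp by (intro mult_mono) auto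
    also have "\<bar>(1 - s\<^sup>2) * ((s - t*b) / r)\<bar> \<le> 1 * 1" unfolding abs_mult using a k by (intro mult_mono) auto
    finally have g3: "\<bar>g'\<bar> \<le> 3" by simp
    have nb: "\<bar>b - t * s\<bar> \<le> 1" using num_bound by (simp add: abs_square_le_1[symmetric])
    have g1: "g \<le> 1 * 1" unfolding g_def using a rp by (intro mult_mono) auto
    have "D = ((- t) * g - (b - t * s) * g') / (2 * pi * g\<^sup>2)"
      using g14 by (simp add: D_def power2_eq_square field_simps)
    moreover have "\<bar>(- t) * g - (b - t * s) * g'\<bar> \<le> 1 * 1 + 1 * 3"
    proof -
      have "\<bar>(- t) * g - (b - t * s) * g'\<bar> \<le> \<bar>t\<bar> * \<bar>g\<bar> + \<bar>b - t * s\<bar> * \<bar>g'\<bar>"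
        unfolding abs_mult[symmetric] by linarith
      also have "\<dots> \<le> 1 * 1 + 1 * 3" using t_lt g1 g14 g3 nb by (intro add_mono mult_mono) auto
      finally show ?thesis .
    qed
    moreover have "2 * 3 * (1/4)\<^sup>2 \<le> 2 * pi * g\<^sup>2"
      using pi_ge_3 g14 by (intro mult_mono power_mono) auto
    ultimately show ?thesis
    proof -
      assume "D = ((- t) * g - (b - t * s) * g') / (2 * pi * g\<^sup>2)"
        and n4: "\<bar>(- t) * g - (b - t * s) * g'\<bar> \<le> 1 * 1 + 1 * 3" and d: "2 * 3 * (1/4)\<^sup>2 \<le> 2 * pi * g\<^sup>2"
      then have "\<bar>D\<bar> = \<bar>(- t) * g - (b - t * s) * g'\<bar> / (2 * pi * g\<^sup>2)" using pi_gt_zero by (simp add: abs_divide abs_mult)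
      also have "\<dots> \<le> 4 / (2 * 3 * (1/4)\<^sup>2)" using n4 d by (intro frac_le) auto
      finally show ?thesis by (simp add: power2_eq_square)
    qed
  qed
  ultimately show ?thesis by blast
qed

end

lemma X_diff_le: assumes "lo \<le> a" "a \<le> d" "d \<le> hi" shows "\<bar>X d - X a\<bar> \<le> 9/20 * (d - a)"
proof (cases "a = d")
  case False
  then have lt: "a < d" using assms by simp
  have "\<exists>z. z > a \<and> z < d \<and> X d - X a = (d - a) * X' z"
    by (rule MVT2[OF lt]) (use assms in \<open>auto intro!: deriv_X mid_range\<close>)
  then obtain z where z: "a < z" "z < d" "X d - X a = (d - a) * X' z" by blast
  have "\<bar>X d - X a\<bar> = (d - a) * \<bar>X' z\<bar>" using z(3) lt by (simp add: abs_mult)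
  also have "\<dots> \<le> (d - a) * (9/20)" using X'_bound[of z] z assms lt by (intro mult_left_mono) auto
  finally show ?thesis by simp
qed simp

lemma X'_diff_le: assumes "lo \<le> a" "a \<le> d" "d \<le> hi" shows "\<bar>X' d - X' a\<bar> \<le> 24 * (d - a)"
proof (cases "a = d")
  case False
  then have lt: "a < d" using assms by simp
  obtain D where D: "\<And>s. lo \<le> s \<Longrightarrow> s \<le> hi \<Longrightarrow> (X' has_real_derivative D s) (at s) \<and> \<bar>D s\<bar> \<le> 24"
    using X'_lipschitz_deriv by metis
  have "\<exists>z. z > a \<and> z < d \<and> X' d - X' a = (d - a) * D z"
    by (rule MVT2[OF lt]) (use assms D in auto)
  then obtain z where z: "a < z" "z < d" "X' d - X' a = (d - a) * D z" by blast
  have "\<bar>X' d - X' a\<bar> = (d - a) * \<bar>D z\<bar>" using z(3) lt by (simp add: abs_mult)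
  also have "\<dots> \<le> (d - a) * 24" using D[of z] z assms lt by (intro mult_left_mono) auto
  finally show ?thesis by simp
qed simp

text \<open>The mean value theorem on both sides of \<open>s\<close> expresses the distance from the
  chord through a difference of two slopes, which the Lipschitz bound for \<open>X'\<close>
  controls.\<close>

lemma X_above_chord:
  assumes "lo \<le> a" "a < s" "s < d" "d \<le> hi"
  shows "X s \<ge> X a + (s - a) / (d - a) * (X d - X a) - 24 * (d - a)\<^sup>2"
proof -
  have "\<exists>z. z > a \<and> z < s \<and> X s - X a = (s - a) * X' z"
    by (rule MVT2) (use assms in \<open>auto intro!: deriv_X mid_range\<close>)
  then obtain u where u: "a < u" "u < s" "X s - X a = (s - a) * X' u" by blast
  have "\<exists>z. z > s \<and> z < d \<and> X d - X s = (d - s) * X' z"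
    by (rule MVT2) (use assms in \<open>auto intro!: deriv_X mid_range\<close>)
  then obtain v where v: "s < v" "v < d" "X d - X s = (d - s) * X' v" by blast
  have "(d - a) * (X s - X a) - (s - a) * (X d - X a) = (d - s) * (X s - X a) - (s - a) * (X d - X s)"
    by (simp add: algebra_simps)
  also have "\<dots> = (d - s) * (s - a) * (X' u - X' v)" unfolding u(3) v(3) by (simp add: algebra_simps)
  also have "\<dots> \<ge> (d - s) * (s - a) * (- (24 * (d - a)))"
  proof (rule mult_left_mono)
    have "\<bar>X' v - X' u\<bar> \<le> 24 * (v - u)" by (rule X'_diff_le) (use u v assms in auto)
    also have "\<dots> \<le> 24 * (d - a)" using u v by simp
    finally show "- (24 * (d - a)) \<le> X' u - X' v" by linarith
  qed (use assms in auto)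
  finally have 1: "(d - a) * (X s - X a) - (s - a) * (X d - X a) \<ge> - (24 * ((d - s) * (s - a) * (d - a)))" by (simp add: algebra_simps)
  have "(d - s) * (s - a) * (d - a) \<le> (d - a) * (d - a) * (d - a)"
    using assms by (intro mult_mono) auto
  with 1 have "(d - a) * (X s - X a) - (s - a) * (X d - X a) \<ge> - (24 * ((d - a) * (d - a) * (d - a)))" by linarith
  moreover define L where "L = (s - a) / (d - a) * (X d - X a)"
  moreover have "(d - a) * L = (s - a) * (X d - X a)" using assms by (simp add: L_def)
  ultimately have "(d - a) * (X s - X a - L + 24 * (d - a)\<^sup>2) \<ge> 0"
    by (simp add: algebra_simps power2_eq_square)
  then show ?thesis using assms unfolding L_def[symmetric] by (simp add: zero_le_mult_iff)
qed

section \<open>Rows of tiles crossed by the arcs\<close>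

definition Ps :: "real \<Rightarrow> real \<Rightarrow> real" where "Ps e s = a2 * s / 2 - e * a1 * X s"
definition Qs :: "real \<Rightarrow> real \<Rightarrow> real" where "Qs e s = a2 * X s + e * a1 * s / 2"

lemma a2_pos: "a2 > 0" using a2_ge by simp

text \<open>The rate of change of \<open>Ps\<close> is \<open>a2 / 2\<close> up to
  \<open>\<bar>a1\<bar> * \<bar>X'\<bar>\<close>, which is at most \<open>9/20 * a2\<close>. So a
  row of height 1 takes a parameter length of at most \<open>20 / a2\<close>.\<close>

lemma Ps_diff:
  assumes e: "e \<in> {1, -1}" and ad: "lo \<le> a" "a \<le> d" "d \<le> hi"
  shows "a2 / 20 * (d - a) \<le> Ps e d - Ps e a" "Ps e d - Ps e a \<le> a2 * (d - a)"
proof -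
  have "\<bar>e * a1 * (X d - X a)\<bar> = \<bar>a1\<bar> * \<bar>X d - X a\<bar>" using e by (auto simp: abs_mult)
  also have "\<dots> \<le> a2 * (9/20 * (d - a))" using X_diff_le[OF ad] a12 a2_pos by (intro mult_mono) auto
  also have "\<dots> = 9/20 * (a2 * (d - a))" by simp
  finally have k: "\<bar>e * a1 * (X d - X a)\<bar> \<le> 9/20 * (a2 * (d - a))" .
  have "Ps e d - Ps e a = a2 * (d - a) / 2 - e * a1 * (X d - X a)" by (simp add: Ps_def algebra_simps diff_divide_distrib)
  moreover have "a2 * (d - a) \<ge> 0" using a2_pos ad by simp
  ultimately show "a2 / 20 * (d - a) \<le> Ps e d - Ps e a" "Ps e d - Ps e a \<le> a2 * (d - a)" using k by linarith+
qed

lemma Qs_diff: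
  assumes e: "e \<in> {1, -1}" and ad: "lo \<le> a" "a \<le> d" "d \<le> hi"
  shows "\<bar>Qs e d - Qs e a\<bar> \<le> a2 * (d - a)"
proof -
  have "\<bar>a2 * (X d - X a)\<bar> = a2 * \<bar>X d - X a\<bar>" using a2_pos by (simp add: abs_mult)
  also have "\<dots> \<le> a2 * (9/20 * (d - a))" using X_diff_le[OF ad] a2_pos by (intro mult_left_mono) auto
  also have "\<dots> = 9/20 * (a2 * (d - a))" by simp
  finally have 1: "\<bar>a2 * (X d - X a)\<bar> \<le> 9/20 * (a2 * (d - a))" .
  have "\<bar>e * a1 * (d - a) / 2\<bar> = \<bar>a1\<bar> * (d - a) / 2" using e ad by (auto simp: abs_mult)
  also have "\<dots> \<le> a2 * (d - a) / 2" using a12 ad by (intro divide_right_mono mult_right_mono) auto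
  finally have 2: "\<bar>e * a1 * (d - a) / 2\<bar> \<le> a2 * (d - a) / 2" .
  have "Qs e d - Qs e a = a2 * (X d - X a) + e * a1 * (d - a) / 2" by (simp add: Qs_def algebra_simps diff_divide_distrib)
  moreover have "a2 * (d - a) \<ge> 0" using a2_pos ad by simp
  ultimately show ?thesis using 1 2 by linarith
qed

lemma cont_PQ: "lo \<le> a \<Longrightarrow> d \<le> hi \<Longrightarrow> continuous_on {a..d} (Ps e)" "lo \<le> a \<Longrightarrow> d \<le> hi \<Longrightarrow> continuous_on {a..d} (Qs e)"
proof -
  assume "lo \<le> a" "d \<le> hi"
  then have c: "continuous_on {a..d} X" using mid_sub by (intro cont_X_sub) auto
  show "continuous_on {a..d} (Ps e)" unfolding Ps_def by (intro continuous_intros c) auto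
  show "continuous_on {a..d} (Qs e)" unfolding Qs_def by (intro continuous_intros c) auto
qed

definition pcon :: "int \<Rightarrow> real" where "pcon k = a1 * (x0 - of_int k) + a2 / 2"
definition qcon :: "real \<Rightarrow> int \<Rightarrow> real" where "qcon e k = e * (a2 * (x0 - of_int k) - a1 / 2)"

lemma pf_\<gamma>: "\<lfloor>x0 + e * X s\<rfloor> = k \<Longrightarrow> pf (\<gamma> e s) = Ps e s - pcon k"
  by (simp add: pf_def \<gamma>_def Ps_def pcon_def frac_def algebra_simps diff_divide_distrib)

lemma qf_\<gamma>: "e \<in> {1, -1} \<Longrightarrow> \<lfloor>x0 + e * X s\<rfloor> = k \<Longrightarrow> e * qf (\<gamma> e s) = Qs e s + qcon e k"
  by (auto simp: qf_def \<gamma>_def Qs_def qcon_def frac_def algebra_simps diff_divide_distrib)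

text \<open>The point \<open>w\<close> is attached to the curve at parameter \<open>s\<close>: it has the same value of \<open>pf\<close> and lies not
  far inside the cap. Uniqueness of \<open>s\<close> makes the areas found over different arcs disjoint.\<close>

definition att :: "real \<Rightarrow> real \<Rightarrow> real^2 \<Rightarrow> bool" where
  "att e s w \<longleftrightarrow> pf w = pf (\<gamma> e s) \<and> 0 < e * qf (\<gamma> e s) - e * qf w \<and> e * qf (\<gamma> e s) - e * qf w \<le> 20"

text \<open>Equal \<open>pf\<close> values make the displacement a multiple of
  \<open>(a2, - a1)\<close>. It has length O(1/a2), and since \<open>\<bar>a1\<bar> \<le> a2\<close>
  it is at least as wide as it is high, which is what lets it point into the cap.\<close>

lemma att_displacement:
  assumes e: "e \<in> {1, -1}" and w: "att e s w"
  defines "D \<equiv> e * qf (\<gamma> e s) - e * qf w"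
  shows "\<gamma> e s$1 - w$1 = a2 * e * D / N" "\<gamma> e s$2 - w$2 = - (a1 * e * D / N)"
    "\<bar>\<gamma> e s$1 - w$1\<bar> \<le> 20 / a2" "\<bar>\<gamma> e s$2 - w$2\<bar> \<le> 20 / a2" "0 < D" "a2 * D / N \<le> 20 / a2" "\<bar>a1\<bar> * D / N \<le> a2 * D / N"
proof -
  define dx where "dx = \<gamma> e s$1 - w$1"
  define dy where "dy = \<gamma> e s$2 - w$2"
  have D: "0 < D" "D \<le> 20" using w by (auto simp: att_def D_def)
  have p: "a1 * dx + a2 * dy = 0" using w by (auto simp: att_def pf_def dx_def dy_def algebra_simps)
  have "e * (a2 * dx - a1 * dy) = D" by (simp add: D_def qf_def dx_def dy_def algebra_simps)
  then have q: "a2 * dx - a1 * dy = e * D" using e by auto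
  have "N * dx = a2 * (a2 * dx - a1 * dy) + a1 * (a1 * dx + a2 * dy)" by (simp add: N_def power2_eq_square algebra_simps)
  then have x: "dx = a2 * e * D / N" using N_bounds(3) unfolding p q by (simp add: field_simps)
  have "N * dy = a2 * (a1 * dx + a2 * dy) - a1 * (a2 * dx - a1 * dy)" by (simp add: N_def power2_eq_square algebra_simps)
  then have y: "dy = - (a1 * e * D / N)" using N_bounds(3) unfolding p q by (simp add: field_simps)
  have "a2 * D / N \<le> a2 * 20 / a2\<^sup>2" using D a2_pos N_bounds by (intro frac_le mult_left_mono) auto
  then show aD: "a2 * D / N \<le> 20 / a2" using a2_pos by (simp add: power2_eq_square)
  show aD1: "\<bar>a1\<bar> * D / N \<le> a2 * D / N" using D a12 N_bounds by (intro divide_right_mono mult_right_mono) auto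
  have "\<bar>dx\<bar> = a2 * D / N" "\<bar>dy\<bar> = \<bar>a1\<bar> * D / N" unfolding x y using e D a2_pos N_bounds by (auto simp: abs_mult)
  then show "\<bar>\<gamma> e s$1 - w$1\<bar> \<le> 20 / a2" "\<bar>\<gamma> e s$2 - w$2\<bar> \<le> 20 / a2" using aD aD1 by (auto simp: dx_def dy_def)
  show "\<gamma> e s$1 - w$1 = a2 * e * D / N" "\<gamma> e s$2 - w$2 = - (a1 * e * D / N)" "0 < D" using x y D by (auto simp: dx_def dy_def)
qed

lemma small: "20 / a2 \<le> 1/5000" using a2_ge by (simp add: divide_le_eq)

text \<open>Both curve points are close to \<open>w\<close>, so the two parameters and the two
  values of \<open>X\<close> nearly agree. On different arcs \<open>2 * X s\<close> would then be
  nearly an integer, which \<open>X_thick\<close> excludes; on the same arc \<open>pf\<close> is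
  strictly monotone.\<close>

lemma att_unique:
  assumes e: "e \<in> {1, -1}" "e' \<in> {1, -1}" and s: "lo \<le> s" "s \<le> hi" "lo \<le> s'" "s' \<le> hi"
    and w: "att e s w" "att e' s' w"
  shows "e = e' \<and> s = s'"
proof -
  define n where "n = \<lfloor>x0 + e * X s\<rfloor>"
  define n' where "n' = \<lfloor>x0 + e' * X s'\<rfloor>"
  have g: "\<gamma> e s$1 = x0 + e * X s - n" "\<gamma> e s$2 = (1 - s) / 2" "\<gamma> e' s'$1 = x0 + e' * X s' - n'" "\<gamma> e' s'$2 = (1 - s') / 2"
    by (auto simp: \<gamma>_def frac_def n_def n'_def)
  note d = att_displacement(3,4)[OF e(1) w(1)] att_displacement(3,4)[OF e(2) w(2)]
  have "\<bar>(1 - s) / 2 - (1 - s') / 2\<bar> \<le> 2/5000" using d small unfolding g by linarith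
  moreover have "(1 - s) / 2 - (1 - s') / 2 = (s' - s) / 2" by (simp add: field_simps)
  ultimately have ss: "\<bar>s - s'\<bar> \<le> 4/5000" by (simp add: abs_minus_commute)
  have "\<bar>X s - X s'\<bar> \<le> 9/20 * \<bar>s - s'\<bar>"
    using X_diff_le[of s s'] X_diff_le[of s' s] s by (cases "s \<le> s'") (auto simp: abs_minus_commute)
  also have "\<dots> \<le> 9/20 * (4/5000)" using ss by (intro mult_left_mono) auto
  finally have XX: "\<bar>X s - X s'\<bar> \<le> 2/5000" by simp
  have xx: "\<bar>(x0 + e * X s - n) - (x0 + e' * X s' - n')\<bar> \<le> 2/5000" using d small unfolding g by linarith
  have thick: "7/100 \<le> X s" "X s \<le> 43/100" using X_thick s by auto
  have ee: "e = e'"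
  proof (rule ccontr)
    assume "e \<noteq> e'"
    then have "e' = - e" using e by auto
    then have "\<bar>e * (X s + X s') - real_of_int (n - n')\<bar> \<le> 2/5000" using xx by (simp add: algebra_simps)
    moreover define M where "M = real_of_int (n - n')"
    ultimately have M: "\<bar>e * (X s + X s') - M\<bar> \<le> 2/5000" by simp
    have "\<bar>2 * X s - e * M\<bar> \<le> 4/5000"
    proof (cases "e = 1")
      case True
      then have "\<bar>X s + X s' - M\<bar> \<le> 2/5000" using M by simp
      then have "\<bar>2 * X s - M\<bar> \<le> 4/5000" using XX by linarith
      then show ?thesis using True by simp
    next
      case False
      then have e1: "e = -1" using e by simp
      then have "\<bar>- X s - X s' - M\<bar> \<le> 2/5000" using M by simp
      then have "\<bar>2 * X s + M\<bar> \<le> 4/5000" using XX by linarith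
      then show ?thesis using e1 by simp
    qed
    then have "\<bar>2 * X s - e * real_of_int (n - n')\<bar> \<le> 4/5000" by (simp only: M_def)
    moreover obtain m :: int where "e * real_of_int (n - n') = real_of_int m"
    proof (cases "e = 1")
      case True
      then show ?thesis using that[of "n - n'"] by simp
    next
      case False
      then show ?thesis using that[of "n' - n"] e by simp
    qed
    ultimately have m: "\<bar>2 * X s - real_of_int m\<bar> \<le> 4/5000" by simp
    then have "real_of_int m > 0" "real_of_int m < 1" using thick by linarith+
    then show False by simp
  qed
  have "\<bar>real_of_int (n - n')\<bar> < 1"
  proof -
    define Z where "Z = (x0 + e * X s - n) - (x0 + e' * X s' - n')"
    have "real_of_int (n - n') = e * (X s - X s') - Z" by (simp add: Z_def ee algebra_simps)
    moreover have "\<bar>e * (X s - X s')\<bar> \<le> 2/5000" using XX e by (auto simp: abs_mult)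
    ultimately show ?thesis using xx unfolding Z_def[symmetric] by linarith
  qed
  then have nn: "n = n'" by linarith
  have "Ps e s - pcon n = Ps e s' - pcon n"
    using w pf_\<gamma>[of e s n] pf_\<gamma>[of e s' n] ee nn by (simp add: att_def n_def n'_def)
  then have P: "Ps e s = Ps e s'" by simp
  have "s = s'"
  proof (rule ccontr)
    assume "s \<noteq> s'"
    then consider "s < s'" | "s' < s" by linarith
    then show False
    proof cases
      case 1
      then have "a2 / 20 * (s' - s) > 0" using a2_pos by simp
      then show False using Ps_diff(1)[OF e(1), of s s'] P s 1 by simp
    next
      case 2
      then have "a2 / 20 * (s - s') > 0" using a2_pos by simp
      then show False using Ps_diff(1)[OF e(1), of s' s] P s 2 by simp
    qed
  qed
  then show ?thesis using ee by simp
qed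

lemma cos_shift: "e \<in> {1, -1} \<Longrightarrow> cos (2 * pi * (e * z - real_of_int k)) = cos (2 * pi * z)"
proof -
  assume e: "e \<in> {1, -1}"
  have "cos (2 * pi * (e * z - real_of_int k)) = cos (2 * pi * (e * z))"
    using cos_int_2pin[of k] sin_int_2pin[of k] by (simp add: right_diff_distrib cos_diff mult_ac)
  also have "\<dots> = cos (2 * pi * z)" using e by auto
  finally show ?thesis .
qed

text \<open>The cap at this height is the set of offsets of size less than \<open>X s\<close> from
  the centre. Stepping inward by \<open>r < 2 * X s\<close> does not leave it, and 14/100 is twice
  the lower bound for \<open>X s\<close>.\<close>

lemma F_inside:
  assumes e: "e \<in> {1, -1}" and s: "lo \<le> s" "s \<le> hi" and r: "0 < r" "r < 14/100"
  shows "F (pt (x0 + e * X s - of_int k - e * r) ((1 - s) / 2)) > t"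
proof -
  have m: "s1 \<le> s" "s \<le> s2" using s mid_sub by auto
  have ss: "s\<^sup>2 < 1" by (rule s_sq_less[OF m])
  have X: "7/100 \<le> X s" "X s \<le> 43/100" using X_thick[OF s] by auto
  have "cos (2 * pi * (x0 + e * X s - of_int k - e * r - x0)) = cos (2 * pi * (e * (X s - r) - of_int k))"
    by (simp add: algebra_simps)
  also have "\<dots> = cos (2 * pi * (X s - r))" by (rule cos_shift[OF e])
  also have "\<dots> = cos \<bar>2 * pi * (X s - r)\<bar>" by simp
  also have "\<dots> > cos (2 * pi * X s)"
  proof (rule cos_monotone_0_pi)
    have "\<bar>X s - r\<bar> < X s" using X r by auto
    then show "\<bar>2 * pi * (X s - r)\<bar> < 2 * pi * X s" by (simp add: abs_mult)
    have "2 * pi * X s \<le> 2 * pi * (1/2)" using X by (intro mult_left_mono) auto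
    then show "2 * pi * X s \<le> pi" by simp
  qed simp
  finally have "cos (2 * pi * (x0 + e * X s - of_int k - e * r - x0)) > G s" using cos_X[OF m] by simp
  then have "0 < c * sqrt (1 - s\<^sup>2) * (cos (2 * pi * (x0 + e * X s - of_int k - e * r - x0)) - G s)"
    using c_pos ss by (intro mult_pos_pos) auto
  then show ?thesis unfolding F_pt[OF ss, symmetric] by simp
qed

lemma F_\<gamma>:
  assumes e: "e \<in> {1, -1}" and m: "s1 \<le> s" "s \<le> s2"
  shows "F (\<gamma> e s) = t"
proof -
  have "cos (2 * pi * (frac (x0 + e * X s) - x0)) = cos (2 * pi * (e * X s - real_of_int \<lfloor>x0 + e * X s\<rfloor>))"
    by (simp add: frac_def algebra_simps)
  also have "\<dots> = G s" unfolding cos_shift[OF e] by (rule cos_X[OF m])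
  finally show ?thesis using F_pt[OF s_sq_less[OF m], of "frac (x0 + e * X s)"] by (simp add: \<gamma>_def)
qed

lemma \<gamma>_in_I2: "s1 \<le> s \<Longrightarrow> s \<le> s2 \<Longrightarrow> \<gamma> e s \<in> I2"
  using s12 by (simp add: \<gamma>_def I2_def frac_ge_0 frac_lt_1)

lemma eventually_floor_eq:
  fixes f :: "'a \<Rightarrow> real"
  assumes "(f \<longlongrightarrow> l) Fl" "l \<notin> \<int>"
  shows "eventually (\<lambda>x. \<lfloor>f x\<rfloor> = \<lfloor>l\<rfloor>) Fl"
proof -
  have "of_int \<lfloor>l\<rfloor> < l" using assms(2) by (metis Ints_of_int of_int_floor_le order_le_less)
  moreover have "l < of_int \<lfloor>l\<rfloor> + 1" by linarith
  ultimately have "eventually (\<lambda>x. of_int \<lfloor>l\<rfloor> < f x) Fl" "eventually (\<lambda>x. f x < of_int \<lfloor>l\<rfloor> + 1) Fl"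
    using order_tendstoD[OF assms(1)] by auto
  then show ?thesis by eventually_elim (simp add: floor_eq_iff)
qed

text \<open>The curve point itself has \<open>F = t\<close>; a small horizontal step inward gives
  \<open>F > t\<close>. Away from integers for \<open>pf\<close>, \<open>qf\<close> and the seam, a
  small step changes neither the cell nor membership in the square.\<close>

lemma curve_cell_hit:
  assumes e: "e \<in> {1, -1}" and s: "lo \<le> s" "s \<le> hi" and ni: "x0 + e * X s \<notin> \<int>"
    "pf (\<gamma> e s) \<notin> \<int>" "e * qf (\<gamma> e s) \<notin> \<int>"
  shows "hit (cell (\<gamma> e s))"
proof -
  have m: "s1 \<le> s" "s \<le> s2" using s mid_sub by auto
  define k where "k = \<lfloor>x0 + e * X s\<rfloor>"
  define w where "w r = pt (x0 + e * X s - of_int k - e * r) ((1 - s) / 2)" for r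
  have w0: "w 0 = \<gamma> e s" by (simp add: w_def \<gamma>_def frac_def k_def)
  have wt: "((\<lambda>r. w r$1) \<longlongrightarrow> w 0$1) (at_right 0)" unfolding w_def vector_2
    by (auto intro!: tendsto_eq_intros)
  have wt2: "((\<lambda>r. w r$2) \<longlongrightarrow> w 0$2) (at_right 0)" unfolding w_def vector_2 by (rule tendsto_const)
  have p: "((\<lambda>r. pf (w r)) \<longlongrightarrow> pf (w 0)) (at_right 0)" unfolding pf_def by (intro tendsto_intros wt wt2)
  have q: "((\<lambda>r. e * qf (w r)) \<longlongrightarrow> e * qf (w 0)) (at_right 0)" unfolding qf_def by (intro tendsto_intros wt wt2)
  have pI: "eventually (\<lambda>r. pf (w r) \<notin> \<int>) (at_right 0)" "eventually (\<lambda>r. e * qf (w r) \<notin> \<int>) (at_right 0)"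
  proof -
    have o: "open (- (\<int> :: real set))" by (simp add: closed_Ints open_Compl)
    show "eventually (\<lambda>r. pf (w r) \<notin> \<int>) (at_right 0)"
      using topological_tendstoD[OF p o] ni(2) by (simp add: w0)
    show "eventually (\<lambda>r. e * qf (w r) \<notin> \<int>) (at_right 0)"
      using topological_tendstoD[OF q o] ni(3) by (simp add: w0)
  qed
  have fr: "0 < w 0$1" "w 0$1 < 1" unfolding w0 \<gamma>_def vector_2 using ni(1) frac_lt_1 by auto
  have "eventually (\<lambda>r. w r$1 > 0) (at_right 0)" "eventually (\<lambda>r. w r$1 < 1) (at_right 0)"
    using order_tendstoD[OF wt] fr by auto
  moreover have "eventually (\<lambda>r::real. 0 < r) (at_right 0)" by (simp add: eventually_at_right_less)
  moreover have "eventually (\<lambda>r::real. r < 14/100) (at_right 0)" by (rule eventually_at_right_real[THEN eventually_mono, of 0 "14/100"]) auto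
  moreover have "eventually (\<lambda>r. \<lfloor>pf (w r)\<rfloor> = \<lfloor>pf (w 0)\<rfloor>) (at_right 0)" using ni(2) by (intro eventually_floor_eq[OF p]) (simp add: w0)
  moreover have "eventually (\<lambda>r. \<lfloor>e * qf (w r)\<rfloor> = \<lfloor>e * qf (w 0)\<rfloor>) (at_right 0)" using ni(3) by (intro eventually_floor_eq[OF q]) (simp add: w0)
  ultimately have "eventually (\<lambda>r. w r \<in> I2 \<and> F (w r) > t \<and> cell (w r) = cell (\<gamma> e s)) (at_right 0)"
    using pI
  proof eventually_elim
    case (elim r)
    have "w r \<in> I2" using elim s12 m by (simp add: I2_def w_def)
    moreover have "F (w r) > t" unfolding w_def by (rule F_inside[OF e s]) (use elim in auto)
    moreover have "cell (w r) = cell (\<gamma> e s)" using elim ni by (intro cell_eqI[OF e]) (auto simp: w0)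
    ultimately show ?case by simp
  qed
  then obtain r where "w r \<in> I2 \<and> F (w r) > t \<and> cell (w r) = cell (\<gamma> e s)"
    using eventually_happens'[OF trivial_limit_at_right_real] by blast
  moreover have "\<gamma> e s \<in> I2" "F (\<gamma> e s) \<le> t" using \<gamma>_in_I2[OF m] F_\<gamma>[OF e m] by auto
  ultimately show ?thesis by (auto simp: hit_def)
qed

text \<open>Two curve points are compared with \<open>w\<close>: one with the same
  \<open>pf\<close>, from which \<open>w\<close> is an inward displacement, and one with the same
  \<open>qf\<close>, which shares its cell. Together they put \<open>w\<close> in a hit tile and,
  after clamping, in the cap.\<close>

lemma row_point:
  assumes e: "e \<in> {1, -1}" and ad: "lo \<le> a" "d \<le> hi"
    and k: "\<And>s. a < s \<Longrightarrow> s < d \<Longrightarrow> \<lfloor>x0 + e * X s\<rfloor> = k \<and> x0 + e * X s \<notin> \<int>"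
    and \<sigma>: "a + 40 / a2 < \<sigma>1" "\<sigma>1 < \<sigma>2" "\<sigma>2 < d - 40 / a2"
    and P: "Ps e \<sigma>1 - pcon k = of_int j" "Ps e \<sigma>2 - pcon k = of_int j + 1"
  defines "q1 \<equiv> Qs e \<sigma>1 + qcon e k" and "\<Delta> \<equiv> Qs e \<sigma>2 - Qs e \<sigma>1"
  assumes w: "of_int j < pf w" "pf w < of_int j + 1" "min q1 (q1 + \<Delta>) < e * qf w"
    "e * qf w < q1 + (pf w - of_int j) * \<Delta> - 192000 / a2" "e * qf w \<notin> \<int>"
  shows "hit (cell w) \<and> F (cl w) > t \<and> (\<exists>s. a < s \<and> s < d \<and> att e s w)"
proof -
  have p40: "40 / a2 > 0" using a2_pos by simp
  have in_ad: "a < s \<and> s < d" if "\<sigma>1 \<le> s" "s \<le> \<sigma>2" for s using that \<sigma> p40 by linarith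
  have in_mid: "lo \<le> s \<and> s \<le> hi" if "\<sigma>1 \<le> s" "s \<le> \<sigma>2" for s using in_ad[OF that] ad by linarith
  have cP: "continuous_on {u..v} (\<lambda>s. Ps e s - pcon k)" if "\<sigma>1 \<le> u" "v \<le> \<sigma>2" for u v
    using that in_mid[of \<sigma>1] in_mid[of \<sigma>2] \<sigma> by (intro continuous_intros cont_PQ) auto
  have cQ: "continuous_on {u..v} (\<lambda>s. Qs e s + qcon e k)" if "\<sigma>1 \<le> u" "v \<le> \<sigma>2" for u v
    using that in_mid[of \<sigma>1] in_mid[of \<sigma>2] \<sigma> by (intro continuous_intros cont_PQ) auto
  have "\<exists>s\<ge>\<sigma>1. s \<le> \<sigma>2 \<and> Ps e s - pcon k = pf w"
    by (rule IVT') (use P w \<sigma> cP in auto)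
  then obtain s where s: "\<sigma>1 \<le> s" "s \<le> \<sigma>2" "Ps e s - pcon k = pf w" by blast
  have s': "\<sigma>1 < s" "s < \<sigma>2" using s P w by (auto simp: less_le)
  have pfg: "pf (\<gamma> e s) = pf w" using pf_\<gamma>[of e s k] k in_ad[OF s(1,2)] s(3) by simp
  have qfg: "e * qf (\<gamma> e u) = Qs e u + qcon e k" if "\<sigma>1 \<le> u" "u \<le> \<sigma>2" for u
    using qf_\<gamma>[OF e, of u k] k in_ad[OF that] by simp
  define len where "len = \<sigma>2 - \<sigma>1"
  have len: "0 < len" "len \<le> 20 / a2"
  proof -
    show "0 < len" using \<sigma> by (simp add: len_def)
    have "a2 / 20 * len \<le> 1" using Ps_diff(1)[OF e, of \<sigma>1 \<sigma>2] P in_mid[of \<sigma>1] in_mid[of \<sigma>2] \<sigma> by (simp add: len_def)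
    then show "len \<le> 20 / a2" using a2_pos by (simp add: field_simps)
  qed
  have osc: "\<bar>Qs e u - Qs e v\<bar> \<le> 20" if "\<sigma>1 \<le> u" "u \<le> \<sigma>2" "\<sigma>1 \<le> v" "v \<le> \<sigma>2" for u v
  proof -
    have "\<bar>Qs e u - Qs e v\<bar> \<le> a2 * \<bar>u - v\<bar>"
    proof (cases "u \<le> v")
      case True
      then show ?thesis using Qs_diff[OF e, of u v] in_mid[of u] in_mid[of v] that by (simp add: abs_minus_commute)
    next
      case False
      then show ?thesis using Qs_diff[OF e, of v u] in_mid[of u] in_mid[of v] that by (simp add: abs_minus_commute)
    qed
    also have "\<dots> \<le> a2 * (20 / a2)" using a2_pos that len by (intro mult_left_mono) (auto simp: len_def)
    finally show ?thesis using a2_pos by simp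
  qed
  \<comment> \<open>The deviation \<open>D\<close> of \<open>X\<close> from its chord enters
    \<open>pf\<close> and \<open>qf\<close>; the two effects combine to
    \<open>D * N * len / 2\<close>. With \<open>D \<ge> - 24 * len^2\<close>,
    \<open>N \<le> 2 * a2^2\<close> and \<open>len \<le> 20 / a2\<close> the loss is at most 12 * 2
    * 20^3 / a2 = 192000 / a2.\<close>
  have chord: "q1 + (pf w - of_int j) * \<Delta> - 192000 / a2 \<le> Qs e s + qcon e k"
  proof -
    define \<theta> where "\<theta> = (s - \<sigma>1) / len"
    define DX where "DX = X \<sigma>2 - X \<sigma>1"
    define D where "D = X s - X \<sigma>1 - \<theta> * DX"
    have D: "D \<ge> - (24 * len\<^sup>2)"
      using X_above_chord[of \<sigma>1 s \<sigma>2] s' in_mid[of \<sigma>1] in_mid[of \<sigma>2] \<sigma> by (simp add: D_def \<theta>_def DX_def len_def)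
    have ls: "s - \<sigma>1 = \<theta> * len" using len by (simp add: \<theta>_def)
    have Xs: "X s - X \<sigma>1 = \<theta> * DX + D" by (simp add: D_def)
    have one: "a2 * len / 2 - e * a1 * DX = 1"
      using P by (simp add: Ps_def len_def DX_def algebra_simps diff_divide_distrib)
    have Dl: "\<Delta> = a2 * DX + e * a1 * len / 2"
      by (simp add: \<Delta>_def Qs_def len_def DX_def algebra_simps diff_divide_distrib)
    have "pf w - of_int j = Ps e s - Ps e \<sigma>1" using P(1) s(3) by linarith
    also have "\<dots> = a2 * (s - \<sigma>1) / 2 - e * a1 * (X s - X \<sigma>1)"
      by (simp add: Ps_def algebra_simps diff_divide_distrib)
    also have "\<dots> = \<theta> * (a2 * len / 2 - e * a1 * DX) - e * a1 * D"
      unfolding ls Xs by (simp add: algebra_simps)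
    finally have pj: "pf w - of_int j = \<theta> - e * a1 * D" unfolding one by simp
    have "Qs e s + qcon e k - q1 = a2 * (X s - X \<sigma>1) + e * a1 * (s - \<sigma>1) / 2"
      by (simp add: q1_def Qs_def algebra_simps diff_divide_distrib)
    also have "\<dots> = \<theta> * \<Delta> + a2 * D" unfolding ls Xs Dl by (simp add: algebra_simps)
    finally have "Qs e s + qcon e k - q1 - (pf w - of_int j) * \<Delta> = D * (a2 + e * a1 * \<Delta>)"
      unfolding pj by (simp add: algebra_simps)
    also have "a2 + e * a1 * \<Delta> = a2 * (a2 * len / 2 - e * a1 * DX) + e * a1 * (a2 * DX + e * a1 * len / 2)"
      unfolding one Dl by simp
    also have "\<dots> = N * len / 2" using e by (auto simp: N_def power2_eq_square algebra_simps add_divide_distrib)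
    also have "D * (N * len / 2) \<ge> - (24 * len\<^sup>2) * (N * len / 2)"
      using D len N_bounds by (intro mult_right_mono) auto
    finally have 1: "Qs e s + qcon e k - q1 - (pf w - of_int j) * \<Delta> \<ge> - (24 * len\<^sup>2) * (N * len / 2)" .
    have "(24 * len\<^sup>2) * (N * len / 2) = 12 * (N * len ^ 3)" by (simp add: power2_eq_square power3_eq_cube)
    also have "\<dots> \<le> 12 * ((2 * a2\<^sup>2) * (20 / a2) ^ 3)"
      using N_bounds len by (intro mult_left_mono mult_mono power_mono) auto
    also have "\<dots> = 192000 / a2" using a2_pos by (simp add: power2_eq_square power3_eq_cube)
    finally show ?thesis using 1 by linarith
  qed
  define V where "V = e * qf w"
  have V1: "V < Qs e s + qcon e k" using chord w(4) by (simp add: V_def)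
  have q2: "q1 + \<Delta> = Qs e \<sigma>2 + qcon e k" by (simp add: q1_def \<Delta>_def)
  have att: "att e s w"
  proof -
    have "e * qf (\<gamma> e s) - V \<le> 20"
    proof -
      have "q1 < V \<or> Qs e \<sigma>2 + qcon e k < V" using w(3) unfolding V_def[symmetric] q2 by auto
      then show ?thesis
        using osc[OF s(1,2), of \<sigma>1] osc[OF s(1,2), of \<sigma>2] \<sigma>(2) unfolding qfg[OF s(1,2)] q1_def by linarith
    qed
    then show ?thesis using V1 pfg qfg[OF s(1,2)] by (simp add: att_def V_def)
  qed
  \<comment> \<open>The curve also takes the value \<open>V\<close> of \<open>e * qf\<close> between
    the two row boundaries, on whichever side of \<open>s\<close> the chord falls below
    \<open>V\<close>.\<close>
  have "\<exists>u. \<sigma>1 < u \<and> u < \<sigma>2 \<and> Qs e u + qcon e k = V"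
  proof (cases "q1 < V")
    case True
    have "\<exists>u\<ge>\<sigma>1. u \<le> s \<and> Qs e u + qcon e k = V"
      by (rule IVT') (use V1 True s cQ[of \<sigma>1 s] in \<open>auto simp: q1_def\<close>)
    then obtain u where u: "\<sigma>1 \<le> u" "u \<le> s" "Qs e u + qcon e k = V" by blast
    moreover have "u \<noteq> \<sigma>1" using u True by (auto simp: q1_def)
    ultimately show ?thesis using s' by (intro exI[of _ u]) auto
  next
    case False
    then have "Qs e \<sigma>2 + qcon e k < V" using w(3) unfolding V_def[symmetric] q2 by auto
    then have "\<exists>u\<ge>s. u \<le> \<sigma>2 \<and> Qs e u + qcon e k = V"
      by (intro IVT2') (use V1 s cQ[of s \<sigma>2] in auto)
    then obtain u where u: "s \<le> u" "u \<le> \<sigma>2" "Qs e u + qcon e k = V" by blast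
    moreover have "u \<noteq> \<sigma>2" using u \<open>Qs e \<sigma>2 + qcon e k < V\<close> by auto
    ultimately show ?thesis using s' by (intro exI[of _ u]) auto
  qed
  then obtain u where u: "\<sigma>1 < u" "u < \<sigma>2" "Qs e u + qcon e k = V" by blast
  have um: "lo \<le> u" "u \<le> hi" using in_mid[of u] u by auto
  have pu: "pf (\<gamma> e u) = Ps e u - pcon k" using pf_\<gamma>[of e u k] k in_ad[of u] u by simp
  have "a2 / 20 * (u - \<sigma>1) > 0" "a2 / 20 * (\<sigma>2 - u) > 0" using a2_pos u by auto
  then have pub: "of_int j < pf (\<gamma> e u)" "pf (\<gamma> e u) < of_int j + 1"
    using Ps_diff(1)[OF e, of \<sigma>1 u] Ps_diff(1)[OF e, of u \<sigma>2] P u in_mid[of \<sigma>1] in_mid[of \<sigma>2] um unfolding pu by auto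
  have nonint: "x \<notin> \<int>" if "of_int j < x" "x < of_int j + 1" for x :: real
  proof
    assume "x \<in> \<int>"
    then obtain m :: int where "x = of_int m" by (auto elim: Ints_cases)
    then have "real_of_int j < real_of_int m" "real_of_int m < real_of_int (j + 1)" using that by simp_all
    then have "j < m" "m < j + 1" by (simp_all only: of_int_less_iff)
    then show False by simp
  qed
  have flj: "\<lfloor>x\<rfloor> = j" if "of_int j < x" "x < of_int j + 1" for x :: real using that by linarith
  have qu: "e * qf (\<gamma> e u) = e * qf w" using qfg[of u] u by (simp add: V_def)
  have "cell w = cell (\<gamma> e u)"
    by (rule cell_eqI[OF e]) (use qu w(5) nonint[OF pub] nonint[OF w(1,2)] flj[OF pub] flj[OF w(1,2)] in auto)
  moreover have "hit (cell (\<gamma> e u))"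
    by (rule curve_cell_hit[OF e um]) (use k in_ad[of u] u nonint[OF pub] qu w(5) in auto)
  ultimately have hit: "hit (cell w)" by simp
  \<comment> \<open>\<open>sw\<close> is the curve parameter at the height of \<open>w\<close>.
    Comparing at equal height turns membership in the cap into a question about horizontal
    offsets.\<close>
  define sw where "sw = 1 - 2 * w$2"
  define D where "D = e * qf (\<gamma> e s) - e * qf w"
  note dd = att_displacement[OF e att, folded D_def]
  have \<gamma>s: "\<gamma> e s$1 = x0 + e * X s - of_int k" "\<gamma> e s$2 = (1 - s) / 2"
    using k in_ad[OF s(1,2)] by (auto simp: \<gamma>_def frac_def)
  have "\<bar>(sw - s) / 2\<bar> = \<bar>\<gamma> e s$2 - w$2\<bar>" unfolding \<gamma>s sw_def by (simp add: field_simps)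
  moreover have "\<bar>\<gamma> e s$2 - w$2\<bar> = \<bar>a1\<bar> * D / N" unfolding dd(2) using e dd(5) N_bounds by (auto simp: abs_mult)
  ultimately have sws: "\<bar>sw - s\<bar> = 2 * (\<bar>a1\<bar> * D / N)" by simp
  then have sw40: "\<bar>sw - s\<bar> \<le> 40 / a2" using dd(6,7) by simp
  then have swad: "a < sw" "sw < d" using \<sigma> s by linarith+
  have swm: "lo \<le> sw" "sw \<le> hi" using swad ad by auto
  have ksw: "\<lfloor>x0 + e * X sw\<rfloor> = k" "x0 + e * X sw \<notin> \<int>" using k[OF swad] by auto
  define xt where "xt = x0 + e * X sw - of_int k"
  have xt: "0 < xt" "xt < 1"
  proof -
    have "xt = frac (x0 + e * X sw)" by (simp add: xt_def frac_def ksw)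
    then show "0 < xt" "xt < 1" using ksw(2) frac_lt_1 by auto
  qed
  have "\<bar>X sw - X s\<bar> \<le> 9/20 * \<bar>sw - s\<bar>"
    using X_diff_le[of sw s] X_diff_le[of s sw] swm in_mid[OF s(1,2)] by (cases "sw \<le> s") (auto simp: abs_minus_commute)
  then have Xd: "\<bar>X sw - X s\<bar> \<le> 9/10 * (a2 * D / N)"
  proof -
    have "A \<le> 9/10 * z" if "A \<le> 9/20 * B" "B = 2 * y" "y \<le> z" for A B y z :: real using that by simp
    then show "\<bar>X sw - X s\<bar> \<le> 9/20 * \<bar>sw - s\<bar> \<Longrightarrow> ?thesis" using sws dd(7) by blast
  qed
  define r where "r = e * (xt - w$1)"
  have "r = e * (e * (X sw - X s)) + e * (\<gamma> e s$1 - w$1)" unfolding \<gamma>s r_def xt_def by (simp add: algebra_simps)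
  also have "\<dots> = (X sw - X s) + a2 * D / N" unfolding dd(1) using e by auto
  finally have r_eq: "r = (X sw - X s) + a2 * D / N" .
  have aDp: "a2 * D / N > 0" using a2_pos dd(5) N_bounds by simp
  have "0 < x + z \<and> x + z < 14/100" if "\<bar>x\<bar> \<le> 9/10 * z" "0 < z" "z \<le> y" "y \<le> 1/5000" for x y z :: real
    using that by (auto simp: abs_le_iff)
  from this[OF Xd aDp dd(6) small] have r: "0 < r" "r < 14/100" unfolding r_eq by blast+
  \<comment> \<open>Since \<open>xt\<close> lies in (0, 1), clamping moves the abscissa of
    \<open>w\<close> towards \<open>xt\<close> but never onto or past it, so the inward offset stays
    positive and does not grow.\<close>
  define x' where "x' = max 0 (min 1 (w$1))"
  define r' where "r' = e * (xt - x')"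
  have r': "0 < r'" "r' \<le> r" using e xt r by (auto simp: r'_def r_def x'_def)
  have w2: "w$2 = (1 - sw) / 2" by (simp add: sw_def)
  have "0 < w$2" "w$2 < 1" using swm mid_sub s12 unfolding w2 by auto
  then have "cl w = pt x' ((1 - sw) / 2)" by (simp add: cl_def x'_def w2[symmetric])
  also have "x' = x0 + e * X sw - of_int k - e * r'" using e by (auto simp: r'_def xt_def)
  finally have "F (cl w) > t" using F_inside[OF e swm, of r' k] r' r by simp
  then show ?thesis using hit att in_ad[OF s(1,2)] by blast
qed

text \<open>The map is a similarity with factor \<open>sqrt N\<close>, up to reflection, so areas
  are divided by \<open>N\<close> when pulled back.\<close>

lemma linear_preimage_measure:
  assumes e: "e \<in> {1, -1}" and A: "A \<in> lmeasurable"
  shows "{w. pt (pf w) (e * qf w) \<in> A} \<in> lmeasurable" "measure lebesgue {w. pt (pf w) (e * qf w) \<in> A} = measure lebesgue A / N"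
proof -
  define f :: "real^2 \<Rightarrow> real^2" where "f v = pt ((- a1 * v$1 + e * a2 * v$2) / N) ((- a2 * v$1 - e * a1 * v$2) / N)" for v
  have lin: "linear f"
    by (rule linearI) (auto simp: f_def vec_eq_iff forall_2 algebra_simps add_divide_distrib diff_divide_distrib)
  have ee: "e * e = 1" using e by auto
  have Nn: "N \<noteq> 0" "N = a1 * a1 + a2 * a2" using N_bounds by (auto simp: N_def power2_eq_square)
  have NK: "(a1 * a1 + a2 * a2) * x / N = x" for x
    unfolding Nn(2)[symmetric] using Nn(1) by simp
  have inv1: "pt (pf (f v)) (e * qf (f v)) = v" for v
  proof (rule vec2_eqI)
    have "pf (f v) = (a1 * a1 + a2 * a2) * v$1 / N"
      using Nn(1) by (simp add: pf_def f_def field_simps)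
    then show "pt (pf (f v)) (e * qf (f v)) $ 1 = v $ 1" unfolding NK by simp
    have "e * qf (f v) = (e * e) * ((a1 * a1 + a2 * a2) * v$2 / N)"
      using Nn(1) by (simp add: qf_def f_def field_simps)
    then show "pt (pf (f v)) (e * qf (f v)) $ 2 = v $ 2" unfolding NK ee by simp
  qed
  have inv2: "f (pt (pf w) (e * qf w)) = w" for w
  proof (rule vec2_eqI)
    have "f (pt (pf w) (e * qf w)) $ 1 = (a1 * a1 * w$1 + a1 * a2 * w$2 + (e * e) * (a2 * a2 * w$1 - a1 * a2 * w$2)) / N"
      by (simp add: f_def pf_def qf_def algebra_simps)
    also have "\<dots> = (a1 * a1 + a2 * a2) * w$1 / N" unfolding ee by (simp add: algebra_simps)
    finally show "f (pt (pf w) (e * qf w)) $ 1 = w $ 1" unfolding NK .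
    have "f (pt (pf w) (e * qf w)) $ 2 = (a1 * a2 * w$1 + a2 * a2 * w$2 - (e * e) * (a1 * a2 * w$1 - a1 * a1 * w$2)) / N"
      by (simp add: f_def pf_def qf_def algebra_simps)
    also have "\<dots> = (a1 * a1 + a2 * a2) * w$2 / N" unfolding ee by (simp add: algebra_simps)
    finally show "f (pt (pf w) (e * qf w)) $ 2 = w $ 2" unfolding NK .
  qed
  have im: "{w. pt (pf w) (e * qf w) \<in> A} = f ` A"
  proof
    show "{w. pt (pf w) (e * qf w) \<in> A} \<subseteq> f ` A" using inv2 by (metis (mono_tags) image_eqI mem_Collect_eq subsetI)
    show "f ` A \<subseteq> {w. pt (pf w) (e * qf w) \<in> A}"
      by (rule image_subsetI) (simp only: mem_Collect_eq inv1)
  qed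
  have "det (matrix f) = (- a1 / N) * (- e * a1 / N) - (e * a2 / N) * (- a2 / N)"
    by (simp add: det_2 matrix_def f_def axis_def)
  also have "\<dots> = e * (a1 * a1 + a2 * a2) / (N * N)" using Nn(1) by (simp add: divide_simps) (simp add: algebra_simps)
  also have "\<dots> = e / N" unfolding Nn(2)[symmetric] using Nn(1) by simp
  finally have d: "\<bar>det (matrix f)\<bar> = 1 / N" using e N_bounds(3) by auto
  show "{w. pt (pf w) (e * qf w) \<in> A} \<in> lmeasurable" unfolding im by (rule measurable_linear_image[OF lin A])
  show "measure lebesgue {w. pt (pf w) (e * qf w) \<in> A} = measure lebesgue A / N"
    unfolding im measure_linear_image[OF lin A] d by simp
qed

section \<open>Adding up the triangles cut off along both arcs\<close>

definition Ygood :: "real \<Rightarrow> real \<Rightarrow> real \<Rightarrow> real \<Rightarrow> (real^2) set \<Rightarrow> bool" where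
  "Ygood e a d C Y \<longleftrightarrow> Y \<in> lmeasurable \<and>
     (\<forall>w\<in>Y. hit (cell w) \<and> F (cl w) > t \<and> (\<exists>s. a < s \<and> s < d \<and> att e s w)) \<and>
     measure lebesgue Y \<ge> (\<bar>Qs e d - Qs e a\<bar> / 2 - C) / N"

lemma abs_telescope_le: "i \<le> j \<Longrightarrow> \<bar>f j - f i\<bar> \<le> (\<Sum>m\<in>{i..<j}. \<bar>f (m + 1) - f m\<bar>)" for f :: "int \<Rightarrow> real"
proof (induction rule: int_ge_induct)
  case (step j)
  have "{i..<j + 1} = insert j {i..<j}" using step.hyps by auto
  then have "(\<Sum>m\<in>{i..<j + 1}. \<bar>f (m + 1) - f m\<bar>) = \<bar>f (j + 1) - f j\<bar> + (\<Sum>m\<in>{i..<j}. \<bar>f (m + 1) - f m\<bar>)" by simp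
  then show ?case using step.IH by linarith
qed simp

lemma savings_base:
  assumes e: "e \<in> {1, -1}" and ad: "lo \<le> a" "a < d" "d \<le> hi" and free: "brk \<inter> {a<..<d} = {}"
  shows "\<exists>Y. Ygood e a d 1000000 Y"
proof (cases "d - a \<le> 200 / a2")
  \<comment> \<open>On so short a piece \<open>Qs\<close> varies by at most 200, far below the
    allowance, and the empty set serves.\<close>
  case True
  have "\<bar>Qs e d - Qs e a\<bar> \<le> a2 * (d - a)" by (rule Qs_diff[OF e]) (use ad in auto)
  also have "\<dots> \<le> a2 * (200 / a2)" using True a2_pos by (intro mult_left_mono) auto
  finally have "\<bar>Qs e d - Qs e a\<bar> \<le> 200" using a2_pos by simp
  then have "(\<bar>Qs e d - Qs e a\<bar> / 2 - 1000000) / N \<le> 0" using N_bounds(3) by (simp add: divide_le_0_iff)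
  then show ?thesis by (intro exI[of _ "{}"]) (auto simp: Ygood_def)
next
  case False
  have p40: "40 / a2 > 0" using a2_pos by simp
  have sr: "s1 < s" "s < s2" if "s \<in> {a<..<d}" for s using that ad mid_sub by auto
  have ni: "x0 + e * X s \<notin> \<int>" if "s \<in> {a<..<d}" for s
    using integer_offset_brk[OF sr[OF that] e] free that by (auto simp: brk_def)
  have "continuous_on {a..d} X" using ad mid_sub by (intro cont_X_sub) auto
  then have "continuous_on {a<..<d} (\<lambda>s. x0 + e * X s)" by (intro continuous_intros) (auto intro: continuous_on_subset)
  then obtain k where k: "\<And>s. s \<in> {a<..<d} \<Longrightarrow> \<lfloor>x0 + e * X s\<rfloor> = k"
    using integer_free_floor_const[of a d "\<lambda>s. x0 + e * X s"] ni by blast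
  \<comment> \<open>Passing from \<open>s\<close> to the parameter at the height of an attached
    point shifts it by at most \<open>40 / a2\<close>. Trimming by \<open>41 / a2\<close> keeps both
    parameters inside the piece.\<close>
  define a' where "a' = a + 41 / a2"
  define d' where "d' = d - 41 / a2"
  have f41: "40 / a2 < 41 / a2" using a2_pos by (simp add: divide_strict_right_mono)
  have ad': "a + 40/a2 < a'" "d' < d - 40/a2" "d' - a' > 118 / a2"
  proof -
    show "a + 40/a2 < a'" "d' < d - 40/a2" using f41 by (auto simp: a'_def d'_def)
    have "200 / a2 = 118 / a2 + 41 / a2 + 41 / a2" by (simp add: add_divide_distrib[symmetric])
    then show "d' - a' > 118 / a2" using False unfolding a'_def d'_def by linarith
  qed
  have a'd': "a' < d'" "lo \<le> a'" "d' \<le> hi" using ad' ad p40 a2_pos divide_pos_pos[of 118 a2] by linarith+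
  define \<pi>s where "\<pi>s s = Ps e s - pcon k" for s
  define j0 where "j0 = \<lceil>\<pi>s a'\<rceil>"
  define j1 where "j1 = \<lfloor>\<pi>s d'\<rfloor>"
  have Pd: "a2 / 20 * (d' - a') \<le> \<pi>s d' - \<pi>s a'" "\<pi>s d' - \<pi>s a' \<le> a2 * (d' - a')"
    using Ps_diff[OF e, of a' d'] a'd' by (auto simp: \<pi>s_def)
  have "a2 / 20 * (118 / a2) \<le> a2 / 20 * (d' - a')" using ad'(3) a2_pos by (intro mult_left_mono) auto
  then have "\<pi>s d' - \<pi>s a' \<ge> 5" using Pd(1) a2_pos by simp
  then have j01: "j0 \<le> j1" unfolding j0_def j1_def by linarith
  have jb: "\<pi>s a' \<le> of_int j0" "of_int j0 < \<pi>s a' + 1" "of_int j1 \<le> \<pi>s d'" "\<pi>s d' < of_int j1 + 1"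
    unfolding j0_def j1_def by linarith+
  have cP: "continuous_on {a'..d'} \<pi>s" unfolding \<pi>s_def using a'd' by (intro continuous_intros cont_PQ) auto
  have "\<exists>s. a' \<le> s \<and> s \<le> d' \<and> \<pi>s s = of_int j" if "j \<in> {j0..j1}" for j
  proof -
    have "real_of_int j0 \<le> real_of_int j" "real_of_int j \<le> real_of_int j1" using that by auto
    then have "\<pi>s a' \<le> of_int j" "of_int j \<le> \<pi>s d'" using jb by linarith+
    then show ?thesis using IVT'[of \<pi>s a' "of_int j" d'] cP a'd' by auto
  qed
  then obtain \<sigma> where \<sigma>: "\<And>j. j \<in> {j0..j1} \<Longrightarrow> a' \<le> \<sigma> j \<and> \<sigma> j \<le> d' \<and> \<pi>s (\<sigma> j) = of_int j" by metis
  have \<sigma>mid: "lo \<le> \<sigma> j" "\<sigma> j \<le> hi" if "j \<in> {j0..j1}" for j using \<sigma>[OF that] a'd' by linarith+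
  have mono: "\<sigma> j < \<sigma> (j + 1)" if "j \<in> {j0..<j1}" for j
  proof (rule ccontr)
    assume "\<not> \<sigma> j < \<sigma> (j + 1)"
    then have "\<sigma> (j + 1) \<le> \<sigma> j" by simp
    moreover have jj: "j \<in> {j0..j1}" "j + 1 \<in> {j0..j1}" using that by auto
    ultimately have "0 \<le> a2 / 20 * (\<sigma> j - \<sigma> (j + 1))" "a2 / 20 * (\<sigma> j - \<sigma> (j + 1)) \<le> Ps e (\<sigma> j) - Ps e (\<sigma> (j + 1))"
      using Ps_diff(1)[OF e, of "\<sigma> (j+1)" "\<sigma> j"] \<sigma>mid[OF jj(1)] \<sigma>mid[OF jj(2)] a2_pos by auto
    then show False using \<sigma>[OF jj(1)] \<sigma>[OF jj(2)] by (simp add: \<pi>s_def)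
  qed
  define E where "E = 192000 / a2"
  have E0: "E \<ge> 0" using a2_pos by (simp add: E_def)
  define q where "q j = Qs e (\<sigma> j) + qcon e k" for j
  define A where "A j = {v::real^2. of_int j < v$1 \<and> v$1 < of_int j + 1 \<and> min (q j) (q j + (q (j+1) - q j)) < v$2
      \<and> v$2 < q j + (v$1 - of_int j) * (q (j+1) - q j) - E \<and> v$2 \<notin> \<int>}" for j
  define Yj where "Yj j = {w. pt (pf w) (e * qf w) \<in> A j}" for j
  have Al: "A j \<in> lmeasurable" "measure lebesgue (A j) \<ge> \<bar>q (j+1) - q j\<bar> / 2 - E" for j
    unfolding A_def by (rule measure_below_chord[OF E0])+
  have Yl: "Yj j \<in> lmeasurable" "measure lebesgue (Yj j) = measure lebesgue (A j) / N" for j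
    unfolding Yj_def by (rule linear_preimage_measure[OF e Al(1)])+
  define Y where "Y = (\<Union>j\<in>{j0..<j1}. Yj j)"
  have disj: "pairwise (\<lambda>i j. disjnt (Yj i) (Yj j)) {j0..<j1}"
  proof (rule pairwiseI)
    fix i j :: int assume ij: "i \<noteq> j"
    have "False" if "w \<in> Yj i" "w \<in> Yj j" for w
    proof -
      have "of_int i < pf w" "pf w < of_int i + 1" "of_int j < pf w" "pf w < of_int j + 1"
        using that by (auto simp: Yj_def A_def)
      then have "\<lfloor>pf w\<rfloor> = i" "\<lfloor>pf w\<rfloor> = j" by linarith+
      then show False using ij by simp
    qed
    then show "disjnt (Yj i) (Yj j)" by (auto simp: disjnt_iff)
  qed
  have mY: "measure lebesgue Y = (\<Sum>j\<in>{j0..<j1}. measure lebesgue (Yj j))"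
    unfolding Y_def by (rule measure_UNION'[OF _ _ disj]) (use Yl in auto)
  have Ylm: "Y \<in> lmeasurable" unfolding Y_def using Yl by (intro fmeasurable.finite_UN) auto
  \<comment> \<open>A loss of \<open>192000 / a2\<close> in each of at most \<open>2 * a2\<close>
    rows adds up to the constant 384000. The incomplete rows and trimmed ends add another bounded
    amount.\<close>
  have n_le: "real (card {j0..<j1}) \<le> 2 * a2"
  proof -
    have "lo + 17/16 = hi" by (simp add: lo_def hi_def)
    then have "d' - a' \<le> 17/16" using a'd' by linarith
    then have "a2 * (d' - a') \<le> a2 * 2" using a2_pos by (intro mult_left_mono) auto
    then have "of_int j1 - of_int j0 \<le> a2 * 2" using jb Pd(2) by linarith
    then show ?thesis using j01 by simp
  qed
  have sumE: "(\<Sum>j\<in>{j0..<j1}. E) \<le> 384000"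
  proof -
    have "(\<Sum>j\<in>{j0..<j1}. E) = real (card {j0..<j1}) * E" by simp
    also have "\<dots> \<le> (2 * a2) * E" using n_le E0 by (rule mult_right_mono)
    also have "\<dots> = 384000" using a2_pos by (simp add: E_def)
    finally show ?thesis .
  qed
  have "\<bar>q j1 - q j0\<bar> / 2 - 384000 \<le> (\<Sum>j\<in>{j0..<j1}. \<bar>q (j+1) - q j\<bar> / 2 - E)"
    using abs_telescope_le[OF j01, of q] sumE by (simp add: sum_subtractf sum_divide_distrib[symmetric] del: sum_constant)
  also have "\<dots> \<le> (\<Sum>j\<in>{j0..<j1}. measure lebesgue (A j))" by (intro sum_mono Al)
  also have "\<dots> = N * measure lebesgue Y" unfolding mY Yl(2) using N_bounds(3) by (simp add: sum_divide_distrib[symmetric])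
  finally have mq: "\<bar>q j1 - q j0\<bar> / 2 - 384000 \<le> N * measure lebesgue Y" .
  have j0j1: "j0 \<in> {j0..j1}" "j1 \<in> {j0..j1}" using j01 by auto
  have near: "\<bar>Qs e u - Qs e v\<bar> \<le> 200" if "lo \<le> u" "u \<le> v" "v \<le> hi" "v - u \<le> 200 / a2" for u v
  proof -
    have "\<bar>Qs e v - Qs e u\<bar> \<le> a2 * (v - u)" by (rule Qs_diff[OF e]) (use that in auto)
    also have "\<dots> \<le> a2 * (200 / a2)" using that a2_pos by (intro mult_left_mono) auto
    finally show ?thesis using a2_pos by (simp add: abs_minus_commute)
  qed
  have step: "v - u \<le> 20 / a2" if "lo \<le> u" "u \<le> v" "v \<le> hi" "\<pi>s v - \<pi>s u \<le> 1" for u v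
  proof -
    have "a2 / 20 * (v - u) \<le> 1" using Ps_diff(1)[OF e, of u v] that by (simp add: \<pi>s_def)
    then show ?thesis using a2_pos by (simp add: field_simps)
  qed
  have s61: "20 / a2 + 41 / a2 \<le> 200 / a2" using a2_pos by (simp add: add_divide_distrib[symmetric] divide_right_mono)
  have "\<sigma> j0 - a' \<le> 20 / a2" by (rule step) (use \<sigma>[OF j0j1(1)] a'd' \<sigma>mid[OF j0j1(1)] jb in auto)
  then have n0: "\<bar>Qs e a - Qs e (\<sigma> j0)\<bar> \<le> 200"
    using s61 \<sigma>[OF j0j1(1)] \<sigma>mid[OF j0j1(1)] ad ad' p40 by (intro near) (auto simp: a'_def)
  have "d' - \<sigma> j1 \<le> 20 / a2" by (rule step) (use \<sigma>[OF j0j1(2)] a'd' \<sigma>mid[OF j0j1(2)] jb in auto)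
  then have n1: "\<bar>Qs e (\<sigma> j1) - Qs e d\<bar> \<le> 200"
    using s61 \<sigma>[OF j0j1(2)] \<sigma>mid[OF j0j1(2)] ad ad' p40 by (intro near) (auto simp: d'_def)
  have "q j1 - q j0 = Qs e (\<sigma> j1) - Qs e (\<sigma> j0)" by (simp add: q_def)
  moreover have "\<bar>y - x\<bar> / 2 - 1000000 \<le> m"
    if "p = v - u" "\<bar>p\<bar> / 2 - 384000 \<le> m" "\<bar>x - u\<bar> \<le> 200" "\<bar>v - y\<bar> \<le> 200" for x y u v p m :: real
  proof -
    have "\<bar>y - x\<bar> \<le> \<bar>p\<bar> + 400" using that(1,3,4) by linarith
    moreover have "A / 2 - 1000000 \<le> m" if "A \<le> B + 400" "B / 2 - 384000 \<le> m" for A B :: real using that by simp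
    ultimately show ?thesis using that(2) by blast
  qed
  ultimately have "\<bar>Qs e d - Qs e a\<bar> / 2 - 1000000 \<le> N * measure lebesgue Y" using mq n0 n1 by blast
  then have m: "(\<bar>Qs e d - Qs e a\<bar> / 2 - 1000000) / N \<le> measure lebesgue Y" using N_bounds(3) by (simp add: field_simps)
  have "hit (cell w) \<and> F (cl w) > t \<and> (\<exists>s. a < s \<and> s < d \<and> att e s w)" if wY: "w \<in> Y" for w
  proof -
    obtain j where j: "j \<in> {j0..<j1}" "w \<in> Yj j" using wY unfolding Y_def by blast
    have jj: "j \<in> {j0..j1}" "j + 1 \<in> {j0..j1}" using j by auto
    have qq: "q (j+1) - q j = Qs e (\<sigma> (j+1)) - Qs e (\<sigma> j)" by (simp add: q_def)
    have wj: "of_int j < pf w" "pf w < of_int j + 1" "min (q j) (q j + (q (j+1) - q j)) < e * qf w"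
      "e * qf w < q j + (pf w - of_int j) * (q (j+1) - q j) - E" "e * qf w \<notin> \<int>"
      using j(2) by (auto simp: Yj_def A_def)
    show ?thesis
    proof (rule row_point[OF e ad(1,3), where k=k and ?\<sigma>1.0="\<sigma> j" and ?\<sigma>2.0="\<sigma> (j+1)" and j=j])
      show "\<lfloor>x0 + e * X s\<rfloor> = k \<and> x0 + e * X s \<notin> \<int>" if "a < s" "s < d" for s using k ni that by auto
      show "a + 40 / a2 < \<sigma> j" "\<sigma> (j + 1) < d - 40 / a2" using \<sigma>[OF jj(1)] \<sigma>[OF jj(2)] ad' by linarith+
      show "\<sigma> j < \<sigma> (j + 1)" by (rule mono[OF j(1)])
      show "Ps e (\<sigma> j) - pcon k = of_int j" "Ps e (\<sigma> (j + 1)) - pcon k = of_int j + 1"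
        using \<sigma>[OF jj(1)] \<sigma>[OF jj(2)] by (auto simp: \<pi>s_def)
    qed (use wj in \<open>simp_all add: q_def E_def\<close>)
  qed
  with m Ylm show ?thesis by (intro exI[of _ Y]) (auto simp: Ygood_def)
qed

lemma savings_arc:
  assumes e: "e \<in> {1, -1}"
  shows "\<exists>Y. Ygood e lo hi 16000000 Y"
proof -
  define P where "P a d n \<longleftrightarrow> (\<exists>Y. Ygood e a d (1000000 * real n) Y)" for a d and n :: nat
  have "P lo hi (card (brk \<inter> {lo<..<hi}) + 1)"
  proof (rule breakpoint_induct[where lo=lo and hi=hi])
    show "finite brk" by (rule brk_finite)
    show "P a d 1" if "lo \<le> a" "a < d" "d \<le> hi" "brk \<inter> {a<..<d} = {}" for a d
      using savings_base[OF e that] by (simp add: P_def)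
    show "P a d (m + n)" if le: "lo \<le> a" "a < z" "z < d" "d \<le> hi" and PP: "P a z m" "P z d n" for a z d and m n :: nat
    proof -
      obtain Y1 Y2 where Y: "Ygood e a z (1000000 * real m) Y1" "Ygood e z d (1000000 * real n) Y2"
        using PP by (auto simp: P_def)
      have "Y1 \<inter> Y2 = {}"
      proof (rule ccontr)
        assume "Y1 \<inter> Y2 \<noteq> {}"
        then obtain w where "w \<in> Y1" "w \<in> Y2" by auto
        then obtain s s' where s: "a < s" "s < z" "att e s w" "z < s'" "s' < d" "att e s' w"
          using Y unfolding Ygood_def by meson
        then have "s = s'" using att_unique[OF e e, of s s' w] le by auto
        then show False using s by simp
      qed
      then have "measure lebesgue (Y1 \<union> Y2) = measure lebesgue Y1 + measure lebesgue Y2"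
        using Y by (intro measure_Un_AE) (auto simp: Ygood_def)
      moreover have "(\<bar>Qs e d - Qs e a\<bar> / 2 - 1000000 * real (m + n)) / N
        \<le> (\<bar>Qs e z - Qs e a\<bar> / 2 - 1000000 * real m) / N + (\<bar>Qs e d - Qs e z\<bar> / 2 - 1000000 * real n) / N"
        unfolding add_divide_distrib[symmetric] using N_bounds(3) by (intro divide_right_mono) auto
      moreover have "hit (cell w) \<and> F (cl w) > t \<and> (\<exists>s. a < s \<and> s < d \<and> att e s w)" if "w \<in> Y1 \<union> Y2" for w
      proof -
        have "hit (cell w) \<and> F (cl w) > t \<and> (\<exists>s. a < s \<and> s < z \<and> att e s w \<or> z < s \<and> s < d \<and> att e s w)"
          using that Y unfolding Ygood_def by blast
        then show ?thesis using le by (meson less_trans)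
      qed
      moreover have "Y1 \<union> Y2 \<in> lmeasurable" using Y by (auto simp: Ygood_def)
      ultimately have "Ygood e a d (1000000 * real (m + n)) (Y1 \<union> Y2)"
        using Y unfolding Ygood_def by simp
      then show ?thesis by (auto simp: P_def)
    qed
  qed (use mid_sub in auto)
  then obtain Y where Y: "Ygood e lo hi (1000000 * real (card (brk \<inter> {lo<..<hi}) + 1)) Y" by (auto simp: P_def)
  have "card (brk \<inter> {lo<..<hi}) \<le> 15" using brk_finite by (meson Int_lower1 card_mono order_trans)
  then have "1000000 * real (card (brk \<inter> {lo<..<hi}) + 1) \<le> 16000000" by simp
  then have "(\<bar>Qs e hi - Qs e lo\<bar> / 2 - 16000000) / N \<le> (\<bar>Qs e hi - Qs e lo\<bar> / 2 - 1000000 * real (card (brk \<inter> {lo<..<hi}) + 1)) / N"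
    using N_bounds(3) by (intro divide_right_mono) auto
  with Y show ?thesis unfolding Ygood_def by (intro exI[of _ Y]) auto
qed

text \<open>On the two arcs the contribution of \<open>X\<close> to \<open>Qs\<close> is the same
  and that of \<open>s\<close> has opposite signs. So the two variations add up to at least
  \<open>\<bar>a1\<bar> * (hi - lo)\<close>, whatever \<open>X\<close> does. Half of
  \<open>hi - lo = 17/16\<close> is the required 17/32.\<close>

lemma savings:
  "\<exists>Y\<in>lmeasurable. (\<forall>w\<in>Y. hit (cell w) \<and> F (cl w) > t) \<and>
     measure lebesgue Y \<ge> (\<bar>a1\<bar> * (17/32) - 32000000) / (\<kappa>\<^sup>2 * (1 + \<xi>\<^sup>2))"
proof -
  obtain Y1 Y2 where Y: "Ygood 1 lo hi 16000000 Y1" "Ygood (-1) lo hi 16000000 Y2"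
    using savings_arc[of 1] savings_arc[of "-1"] by auto
  have "Y1 \<inter> Y2 = {}"
  proof (rule ccontr)
    assume "Y1 \<inter> Y2 \<noteq> {}"
    then obtain w where "w \<in> Y1" "w \<in> Y2" by auto
    then obtain s s' where "lo < s" "s < hi" "att 1 s w" "lo < s'" "s' < hi" "att (-1) s' w"
      using Y unfolding Ygood_def by meson
    then show False using att_unique[of 1 "-1" s s' w] by auto
  qed
  then have "measure lebesgue (Y1 \<union> Y2) = measure lebesgue Y1 + measure lebesgue Y2"
    using Y by (intro measure_Un_AE) (auto simp: Ygood_def)
  moreover have "(\<bar>a1\<bar> * (17/32) - 32000000) / N \<le> (\<bar>Qs 1 hi - Qs 1 lo\<bar> / 2 - 16000000) / N + (\<bar>Qs (-1) hi - Qs (-1) lo\<bar> / 2 - 16000000) / N"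
    unfolding add_divide_distrib[symmetric]
  proof (rule divide_right_mono)
    have "(Qs 1 hi - Qs 1 lo) - (Qs (-1) hi - Qs (-1) lo) = a1 * (17/16)"
      by (simp add: Qs_def lo_def hi_def field_simps)
    then have "\<bar>a1\<bar> * (17/16) \<le> \<bar>Qs 1 hi - Qs 1 lo\<bar> + \<bar>Qs (-1) hi - Qs (-1) lo\<bar>"
      by (simp add: abs_if split: if_splits)
    moreover have "x * (17/32) - 32000000 \<le> A / 2 - 16000000 + (B / 2 - 16000000)" if "x * (17/16) \<le> A + B" for x A B :: real
      using that by simp
    ultimately show "\<bar>a1\<bar> * (17/32) - 32000000 \<le> \<bar>Qs 1 hi - Qs 1 lo\<bar> / 2 - 16000000 + (\<bar>Qs (-1) hi - Qs (-1) lo\<bar> / 2 - 16000000)"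
      by blast
  qed (use N_bounds(3) in simp)
  ultimately show ?thesis
    using Y unfolding Ygood_def N_def N0 by (intro bexI[of _ "Y1 \<union> Y2"]) auto
qed

end

section \<open>Tiles, extra points and missing points\<close>

lemma card_separated_le:
  fixes A \<mu> len :: real and S :: "int set"
  assumes \<mu>: "\<mu> > 0" and S: "\<And>i. i \<in> S \<Longrightarrow> A \<le> of_int i \<and> of_int i \<le> A + len"
    and sep: "\<And>i j. i \<in> S \<Longrightarrow> j \<in> S \<Longrightarrow> i \<noteq> j \<Longrightarrow> \<mu> * \<bar>of_int i - of_int j\<bar> \<ge> 1" and l: "len \<ge> 0"
  shows "finite S \<and> real (card S) \<le> \<mu> * len + 1"
proof -
  define f where "f i = \<lfloor>\<mu> * (of_int i - A)\<rfloor>" for i :: int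
  have inj: "inj_on f S"
  proof (rule inj_onI, rule ccontr)
    fix i j assume ij: "i \<in> S" "j \<in> S" "f i = f j" "i \<noteq> j"
    have "\<bar>\<mu> * (of_int i - A) - \<mu> * (of_int j - A)\<bar> < 1"
      using ij(3) unfolding f_def by linarith
    moreover have "\<bar>\<mu> * (of_int i - A) - \<mu> * (of_int j - A)\<bar> = \<mu> * \<bar>of_int i - of_int j\<bar>"
      using \<mu> by (simp add: abs_mult right_diff_distrib[symmetric])
    ultimately show False using sep[OF ij(1,2,4)] by simp
  qed
  have sub: "f ` S \<subseteq> {0..\<lfloor>\<mu> * len\<rfloor>}"
  proof
    fix x assume "x \<in> f ` S"
    then obtain i where i: "i \<in> S" "x = f i" by auto
    have "0 \<le> \<mu> * (of_int i - A)" "\<mu> * (of_int i - A) \<le> \<mu> * len"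
      using S[OF i(1)] \<mu> by (auto intro!: mult_left_mono)
    then show "x \<in> {0..\<lfloor>\<mu> * len\<rfloor>}" unfolding i f_def by (auto intro: floor_mono)
  qed
  have fin: "finite S" using finite_subset[OF sub] finite_imageD[OF _ inj] by auto
  have "card S = card (f ` S)" using card_image[OF inj] by simp
  also have "\<dots> \<le> card {0..\<lfloor>\<mu> * len\<rfloor>}" by (rule card_mono[OF _ sub]) simp
  finally have "card S \<le> nat (\<lfloor>\<mu> * len\<rfloor> + 1)" by simp
  moreover have "0 \<le> \<lfloor>\<mu> * len\<rfloor>" using \<mu> l by simp
  ultimately have "int (card S) \<le> \<lfloor>\<mu> * len\<rfloor> + 1" by linarith
  then have "real_of_int (int (card S)) \<le> \<mu> * len + 1" by linarith
  then show ?thesis using fin by simp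
qed

lemma constant_sign_on_interval:
  fixes \<psi> :: "real \<Rightarrow> real"
  assumes c: "continuous_on {\<alpha><..<\<beta>} \<psi>" and n: "\<And>y. \<alpha> < y \<Longrightarrow> y < \<beta> \<Longrightarrow> \<psi> y \<noteq> t"
  shows "(\<forall>y\<in>{\<alpha><..<\<beta>}. \<psi> y > t) \<or> (\<forall>y\<in>{\<alpha><..<\<beta>}. \<psi> y < t)"
proof (rule ccontr)
  assume "\<not> ?thesis"
  then obtain u v where uv: "u \<in> {\<alpha><..<\<beta>}" "v \<in> {\<alpha><..<\<beta>}" "\<psi> u \<le> t" "t \<le> \<psi> v" by (auto simp: not_less)
  have conn: "connected (\<psi> ` {\<alpha><..<\<beta>})" by (rule connected_continuous_image[OF c]) simp
  have "t \<in> \<psi> ` {\<alpha><..<\<beta>}"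
    by (rule connectedD_interval[OF conn imageI[OF uv(1)] imageI[OF uv(2)] uv(3,4)])
  then obtain y where "\<alpha> < y" "y < \<beta>" "\<psi> y = t" by auto
  then show False using n by blast
qed

lemma interior_I2: "interior I2 = {v. 0 < v$1 \<and> v$1 < 1 \<and> 0 < v$2 \<and> v$2 < 1}"
  and closure_I2: "closure I2 = {v. 0 \<le> v$1 \<and> v$1 \<le> 1 \<and> 0 \<le> v$2 \<and> v$2 \<le> 1}"
proof -
  let ?b = "box (pt 0 0) (pt 1 1)" and ?c = "cbox (pt 0 0) (pt 1 1)"
  have b: "?b = {v. 0 < v$1 \<and> v$1 < 1 \<and> 0 < v$2 \<and> v$2 < 1}"
    by (auto simp: mem_box_cart forall_2)
  have c: "?c = {v. 0 \<le> v$1 \<and> v$1 \<le> 1 \<and> 0 \<le> v$2 \<and> v$2 \<le> 1}"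
    by (auto simp: mem_box_cart forall_2)
  have bI: "?b \<subseteq> I2" unfolding b I2_def by auto
  have Ic: "I2 \<subseteq> ?c" unfolding c I2_def by auto
  have "pt (1/2) (1/2) \<in> ?b" unfolding b by simp
  then have ne: "?b \<noteq> {}" by blast
  have "interior I2 = ?b"
  proof
    show "interior I2 \<subseteq> ?b" using interior_mono[OF Ic] by (simp only: interior_cbox)
    show "?b \<subseteq> interior I2" by (rule interior_maximal[OF bI open_box])
  qed
  then show "interior I2 = {v. 0 < v$1 \<and> v$1 < 1 \<and> 0 < v$2 \<and> v$2 < 1}" by (simp only: b)
  have "closure I2 = ?c"
  proof
    show "closure I2 \<subseteq> ?c" by (rule closure_minimal[OF Ic closed_cbox])
    show "?c \<subseteq> closure I2" using closure_mono[OF bI] by (simp only: closure_box[OF ne])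
  qed
  then show "closure I2 = {v. 0 \<le> v$1 \<and> v$1 \<le> 1 \<and> 0 \<le> v$2 \<and> v$2 \<le> 1}"
    by (simp only: c)
qed

lemma closure_I2_interior: "closure (interior I2) = closure I2"
proof -
  have "pt (1/2) (1/2) \<in> interior I2" unfolding interior_I2 by simp
  then have "interior I2 \<noteq> {}" by blast
  then show ?thesis using convex_closure_interior[OF convex_I2] by simp
qed

lemma I2_lmeasurable: "I2 \<in> lmeasurable"
proof (rule bounded_set_imp_lmeasurable)
  have "I2 \<subseteq> cbox (pt 0 0) (pt 1 1)" by (auto simp: I2_def mem_box_cart forall_2)
  then show "bounded I2" using bounded_cbox bounded_subset by blast
qed (use I2_measurable in auto)

lemma measure_I2: "measure lebesgue I2 = 1"
  using emeasure_I2 by (simp add: measure_def)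

section \<open>Measure, diameter and position of the tiles\<close>

context grid
begin

definition Dn :: real where "Dn = \<kappa> * (1 + \<xi>\<^sup>2)"
definition area :: real where "area = 1 / (\<kappa>\<^sup>2 * (1 + \<xi>\<^sup>2))"
definition pos :: "real \<Rightarrow> real \<Rightarrow> real^2" where "pos u v = pt ((\<xi> * u - v) / Dn) ((u + \<xi> * v) / Dn)"
abbreviation T :: "int \<times> int \<Rightarrow> (real^2) set" where "T n \<equiv> {w. cell w = n}"
definition Tint :: "int \<times> int \<Rightarrow> (real^2) set" where
  "Tint n = {w. of_int (fst n) < gu w \<and> gu w < of_int (fst n) + 1 \<and> of_int (snd n) < gv w \<and> gv w < of_int (snd n) + 1}"

lemma one_xi: "1 + \<xi>\<^sup>2 > 0" by (simp add: add_pos_nonneg)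
lemma Dn_pos: "Dn > 0" using \<kappa>_pos one_xi by (simp add: Dn_def)
lemma area_pos: "area > 0" using \<kappa>_pos one_xi by (simp add: area_def)

lemma gu_pos [simp]: "gu (pos u v) = u" and gv_pos [simp]: "gv (pos u v) = v"
proof -
  have "gu (pos u v) = \<kappa> * ((\<xi> * (\<xi> * u - v) + (u + \<xi> * v)) / Dn)" by (simp add: gu_def pos_def add_divide_distrib)
  also have "\<xi> * (\<xi> * u - v) + (u + \<xi> * v) = (1 + \<xi>\<^sup>2) * u" by (simp add: power2_eq_square algebra_simps)
  finally show "gu (pos u v) = u" using \<kappa>_pos one_xi by (simp add: Dn_def)
  have "gv (pos u v) = \<kappa> * ((\<xi> * (u + \<xi> * v) - (\<xi> * u - v)) / Dn)" by (simp add: gv_def pos_def diff_divide_distrib)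
  also have "\<xi> * (u + \<xi> * v) - (\<xi> * u - v) = (1 + \<xi>\<^sup>2) * v" by (simp add: power2_eq_square algebra_simps)
  finally show "gv (pos u v) = v" using \<kappa>_pos one_xi by (simp add: Dn_def)
qed

lemma coord1: "w$1 = (\<xi> * gu w - gv w) / Dn" and coord2: "w$2 = (gu w + \<xi> * gv w) / Dn"
proof -
  have "\<xi> * gu w - gv w = Dn * w$1" "gu w + \<xi> * gv w = Dn * w$2"
    by (simp_all add: gu_def gv_def Dn_def power2_eq_square algebra_simps)
  then show "w$1 = (\<xi> * gu w - gv w) / Dn" "w$2 = (gu w + \<xi> * gv w) / Dn" using Dn_pos by simp_all
qed

lemma pos_gu_gv: "pos (gu w) (gv w) = w"
  by (intro vec2_eqI) (simp_all add: pos_def coord1[of w, symmetric] coord2[of w, symmetric])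

lemma cont_gu: "continuous_on S gu" and cont_gv: "continuous_on S gv"
  unfolding gu_def gv_def by (intro continuous_intros)+

lemma gu_measurable [measurable]: "gu \<in> borel_measurable borel" and gv_measurable [measurable]: "gv \<in> borel_measurable borel"
  by (auto intro!: borel_measurable_continuous_onI cont_gu cont_gv)

lemma T_borel [measurable]: "T n \<in> sets borel"
proof -
  have "T n = {w. \<lfloor>gu w\<rfloor> = fst n \<and> \<lfloor>gv w\<rfloor> = snd n}" by (auto simp: cell_def prod_eq_iff)
  then show ?thesis by simp
qed

lemma Tint_open: "open (Tint n)"
  unfolding Tint_def by (intro open_Collect_conj open_Collect_less continuous_intros cont_gu cont_gv)

lemma Tint_sub: "Tint n \<subseteq> T n"
  by (auto simp: Tint_def cell_def floor_eq_iff prod_eq_iff)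

lemma T_bounds: "cell w = n \<Longrightarrow> of_int (fst n) \<le> gu w \<and> gu w < of_int (fst n) + 1 \<and> of_int (snd n) \<le> gv w \<and> gv w < of_int (snd n) + 1"
  by (auto simp: cell_def floor_eq_iff prod_eq_iff)

lemma linear_box_measure:
  assumes "box (pt i j) (pt (i+1) (j+1)) \<subseteq> A" "A \<subseteq> cbox (pt i j) (pt (i+1) (j+1))" "A \<in> sets borel"
  shows "(\<lambda>v. pos (v$1) (v$2)) ` A \<in> lmeasurable" "measure lebesgue ((\<lambda>v. pos (v$1) (v$2)) ` A) = area"
proof -
  let ?b = "box (pt i j) (pt (i+1) (j+1))" and ?c = "cbox (pt i j) (pt (i+1) (j+1))"
  let ?f = "\<lambda>v::real^2. pos (v$1) (v$2)"
  have lin: "linear ?f"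
    by (rule linearI) (auto simp: pos_def vec_eq_iff forall_2 algebra_simps add_divide_distrib diff_divide_distrib)
  have Al: "A \<in> lmeasurable"
    using bounded_subset[OF bounded_cbox assms(2)] assms(3) by (intro bounded_set_imp_lmeasurable) auto
  have pr: "(\<Prod>k\<in>Basis. (pt (i+1) (j+1) - pt i j) \<bullet> k) = 1"
    by (simp add: Basis_vec2 axis_neq2 inner_axis)
  have "pt i j \<bullet> k \<le> pt (i+1) (j+1) \<bullet> k" if "k \<in> Basis" for k
    using that by (auto simp: Basis_vec2 inner_axis)
  then have "measure lebesgue ?b = 1" "measure lebesgue ?c = 1"
    using pr by (simp_all add: measure_lborel_box_eq measure_lborel_cbox_eq)
  moreover have "measure lebesgue ?b \<le> measure lebesgue A"
    by (rule measure_mono_fmeasurable[OF assms(1) _ Al]) simp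
  moreover have "measure lebesgue A \<le> measure lebesgue ?c"
    by (rule measure_mono_fmeasurable[OF assms(2) fmeasurableD[OF Al]]) simp
  ultimately have m: "measure lebesgue A = 1" by simp
  have "det (matrix ?f) = (\<xi> / Dn) * (\<xi> / Dn) - (- 1 / Dn) * (1 / Dn)"
    by (simp add: det_2 matrix_def pos_def axis_def)
  also have "\<dots> = (1 + \<xi>\<^sup>2) / Dn\<^sup>2" by (simp add: power2_eq_square add_divide_distrib)
  also have "\<dots> = area" using one_xi \<kappa>_pos by (simp add: Dn_def area_def power2_eq_square)
  finally have d: "\<bar>det (matrix ?f)\<bar> = area" using area_pos by simp
  show "?f ` A \<in> lmeasurable" by (rule measurable_linear_image[OF lin Al])
  show "measure lebesgue (?f ` A) = area" unfolding measure_linear_image[OF lin Al] d m by simp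
qed

lemma vec_preimage: "{w. P (gu w) (gv w)} = (\<lambda>v::real^2. pos (v$1) (v$2)) ` {v::real^2. P (v$1) (v$2)}"
proof
  show "{w. P (gu w) (gv w)} \<subseteq> (\<lambda>v::real^2. pos (v$1) (v$2)) ` {v::real^2. P (v$1) (v$2)}"
  proof
    fix w assume "w \<in> {w. P (gu w) (gv w)}"
    then show "w \<in> (\<lambda>v::real^2. pos (v$1) (v$2)) ` {v::real^2. P (v$1) (v$2)}"
      using pos_gu_gv[of w] by (intro image_eqI[of _ _ "pt (gu w) (gv w)"]) auto
  qed
qed auto

lemma coord_measurable [measurable]: "(\<lambda>v::real^2. v$i) \<in> borel_measurable borel"
  by (intro borel_measurable_continuous_onI continuous_intros)

lemma T_measure: "T n \<in> lmeasurable" "measure lebesgue (T n) = area"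
proof -
  let ?A = "{v::real^2. of_int (fst n) \<le> v$1 \<and> v$1 < of_int (fst n) + 1 \<and> of_int (snd n) \<le> v$2 \<and> v$2 < of_int (snd n) + 1}"
  have "T n = {w. of_int (fst n) \<le> gu w \<and> gu w < of_int (fst n) + 1 \<and> of_int (snd n) \<le> gv w \<and> gv w < of_int (snd n) + 1}"
    by (auto simp: cell_def floor_eq_iff prod_eq_iff)
  then have eq: "T n = (\<lambda>v. pos (v$1) (v$2)) ` ?A"
    using vec_preimage[of "\<lambda>u v. of_int (fst n) \<le> u \<and> u < of_int (fst n) + 1 \<and> of_int (snd n) \<le> v \<and> v < of_int (snd n) + 1"] by (simp only:)
  have s: "box (pt (of_int (fst n)) (of_int (snd n))) (pt (of_int (fst n)+1) (of_int (snd n)+1)) \<subseteq> ?A"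
    "?A \<subseteq> cbox (pt (of_int (fst n)) (of_int (snd n))) (pt (of_int (fst n)+1) (of_int (snd n)+1))" "?A \<in> sets borel"
    by (auto simp: mem_box_cart forall_2)
  show "T n \<in> lmeasurable" "measure lebesgue (T n) = area" unfolding eq using linear_box_measure[OF s] by auto
qed

lemma Tint_measure: "Tint n \<in> lmeasurable" "measure lebesgue (Tint n) = area"
proof -
  let ?A = "{v::real^2. of_int (fst n) < v$1 \<and> v$1 < of_int (fst n) + 1 \<and> of_int (snd n) < v$2 \<and> v$2 < of_int (snd n) + 1}"
  have eq: "Tint n = (\<lambda>v. pos (v$1) (v$2)) ` ?A"
    using vec_preimage[of "\<lambda>u v. of_int (fst n) < u \<and> u < of_int (fst n) + 1 \<and> of_int (snd n) < v \<and> v < of_int (snd n) + 1"] by (simp only: Tint_def)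
  have s: "box (pt (of_int (fst n)) (of_int (snd n))) (pt (of_int (fst n)+1) (of_int (snd n)+1)) \<subseteq> ?A"
    "?A \<subseteq> cbox (pt (of_int (fst n)) (of_int (snd n))) (pt (of_int (fst n)+1) (of_int (snd n)+1))" "?A \<in> sets borel"
    by (auto simp: mem_box_cart forall_2)
  show "Tint n \<in> lmeasurable" "measure lebesgue (Tint n) = area" unfolding eq using linear_box_measure[OF s] by auto
qed

lemma Tint_convex: "convex (Tint n)"
proof -
  have gu: "gu = (\<lambda>w. vector [\<kappa>*\<xi>, \<kappa>] \<bullet> w)" and gv: "gv = (\<lambda>w. vector [-\<kappa>, \<kappa>*\<xi>] \<bullet> w)"
    by (auto simp: gu_def gv_def inner_vec_def sum_2 algebra_simps)
  have eq: "Tint n = {w. of_int (fst n) < gu w} \<inter> {w. gu w < of_int (fst n) + 1} \<inter> {w. of_int (snd n) < gv w} \<inter> {w. gv w < of_int (snd n) + 1}"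
    by (auto simp: Tint_def)
  have "convex {w. a < gu w}" "convex {w. gu w < a}" "convex {w. a < gv w}" "convex {w. gv w < a}" for a
    unfolding gu gv by (rule convex_halfspace_gt convex_halfspace_lt)+
  then show ?thesis unfolding eq by (simp only: convex_Int)
qed

lemma Tint_ne: "Tint n \<noteq> {}"
proof -
  have "pos (of_int (fst n) + 1/2) (of_int (snd n) + 1/2) \<in> Tint n" by (simp add: Tint_def)
  then show ?thesis by blast
qed

lemma gu_diff: "\<bar>gu w - gu w'\<bar> \<le> \<kappa> * (1 + \<bar>\<xi>\<bar>) * d" and gv_diff: "\<bar>gv w - gv w'\<bar> \<le> \<kappa> * (1 + \<bar>\<xi>\<bar>) * d"
  if d: "\<bar>w$1 - w'$1\<bar> \<le> d" "\<bar>w$2 - w'$2\<bar> \<le> d"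
proof -
  have aux: "\<bar>\<kappa> * (\<xi> * x + y)\<bar> \<le> \<kappa> * (1 + \<bar>\<xi>\<bar>) * d" if "\<bar>x\<bar> \<le> d" "\<bar>y\<bar> \<le> d" for x y
  proof -
    have "\<bar>\<kappa> * (\<xi> * x + y)\<bar> = \<kappa> * \<bar>\<xi> * x + y\<bar>" using \<kappa>_pos by (simp add: abs_mult)
    also have "\<dots> \<le> \<kappa> * (\<bar>\<xi>\<bar> * \<bar>x\<bar> + \<bar>y\<bar>)" using \<kappa>_pos by (intro mult_left_mono) (auto simp: abs_mult[symmetric])
    also have "\<dots> \<le> \<kappa> * (\<bar>\<xi>\<bar> * d + d)" using that \<kappa>_pos by (intro mult_left_mono add_mono) auto
    finally show ?thesis by (simp add: algebra_simps)
  qed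
  have 1: "gu w - gu w' = \<kappa> * (\<xi> * (w$1 - w'$1) + (w$2 - w'$2))" by (simp add: gu_def algebra_simps)
  have 2: "gv w - gv w' = \<kappa> * (\<xi> * (w$2 - w'$2) + - (w$1 - w'$1))" by (simp add: gv_def algebra_simps)
  show "\<bar>gu w - gu w'\<bar> \<le> \<kappa> * (1 + \<bar>\<xi>\<bar>) * d" unfolding 1 using d by (intro aux) auto
  show "\<bar>gv w - gv w'\<bar> \<le> \<kappa> * (1 + \<bar>\<xi>\<bar>) * d" unfolding 2 by (rule aux) (use d in \<open>simp_all add: abs_minus_commute\<close>)
qed

lemma T_diam:
  assumes "cell w = cell w'"
  shows "\<bar>w$1 - w'$1\<bar> \<le> 2 / \<kappa>" "\<bar>w$2 - w'$2\<bar> \<le> 2 / \<kappa>"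
proof -
  have u: "\<bar>gu w - gu w'\<bar> \<le> 1" "\<bar>gv w - gv w'\<bar> \<le> 1"
    using T_bounds[OF assms] T_bounds[of w' "cell w'"] by (auto simp: abs_le_iff)
  have "\<bar>\<xi>\<bar> \<le> 1 + \<xi>\<^sup>2"
  proof -
    have "0 \<le> (\<bar>\<xi>\<bar> - 1)\<^sup>2" by simp
    then have "2 * \<bar>\<xi>\<bar> \<le> 1 + \<xi>\<^sup>2" by (simp add: power2_diff)
    then show ?thesis by linarith
  qed
  then have k: "(\<bar>\<xi>\<bar> + 1) / Dn \<le> 2 / \<kappa>"
  proof -
    have "x + 1 \<le> 2 * (1 + y)" if "x \<le> 1 + y" "0 \<le> y" for x y :: real
      using add_right_mono[OF that(1), of 1] that(2) by (simp add: distrib_left)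
    then have "\<bar>\<xi>\<bar> + 1 \<le> 2 * (1 + \<xi>\<^sup>2)" using \<open>\<bar>\<xi>\<bar> \<le> 1 + \<xi>\<^sup>2\<close> zero_le_power2[of \<xi>] by blast
    then have "(\<bar>\<xi>\<bar> + 1) / Dn \<le> 2 * (1 + \<xi>\<^sup>2) / Dn" using Dn_pos by (intro divide_right_mono) auto
    also have "\<dots> = 2 / \<kappa>" unfolding Dn_def using one_xi \<kappa>_pos by (simp add: divide_eq_eq eq_divide_eq del: distrib_left_numeral)
    finally show ?thesis .
  qed
  have aux: "\<bar>(\<xi> * x + y) / Dn\<bar> \<le> 2 / \<kappa>" if "\<bar>x\<bar> \<le> 1" "\<bar>y\<bar> \<le> 1" for x y
  proof -
    have "\<bar>\<xi> * x + y\<bar> \<le> \<bar>\<xi>\<bar> * \<bar>x\<bar> + \<bar>y\<bar>" by (simp add: abs_mult[symmetric])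
    also have "\<dots> \<le> \<bar>\<xi>\<bar> * 1 + 1" using that by (intro add_mono mult_left_mono) auto
    finally have "\<bar>(\<xi> * x + y) / Dn\<bar> \<le> (\<bar>\<xi>\<bar> + 1) / Dn" using Dn_pos by (simp add: abs_divide divide_right_mono)
    then show ?thesis using k by simp
  qed
  have 1: "w$1 - w'$1 = (\<xi> * (gu w - gu w') + - (gv w - gv w')) / Dn"
    unfolding coord1[of w] coord1[of w'] by (simp add: algebra_simps diff_divide_distrib add_divide_distrib)
  have 2: "w$2 - w'$2 = (\<xi> * (gv w - gv w') + (gu w - gu w')) / Dn"
    unfolding coord2[of w] coord2[of w'] by (simp add: algebra_simps diff_divide_distrib add_divide_distrib)
  show "\<bar>w$1 - w'$1\<bar> \<le> 2 / \<kappa>" unfolding 1 using u by (intro aux) (simp_all add: abs_minus_commute)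
  show "\<bar>w$2 - w'$2\<bar> \<le> 2 / \<kappa>" unfolding 2 using u by (intro aux)
qed

lemma cells_near:
  fixes p :: "real^2"
  assumes d: "d \<ge> 0"
  shows "finite {n. \<exists>w. cell w = n \<and> \<bar>w$1 - p$1\<bar> \<le> d \<and> \<bar>w$2 - p$2\<bar> \<le> d}"
    "real (card {n. \<exists>w. cell w = n \<and> \<bar>w$1 - p$1\<bar> \<le> d \<and> \<bar>w$2 - p$2\<bar> \<le> d}) \<le> (2 * (\<kappa> * (1 + \<bar>\<xi>\<bar>) * d) + 3)\<^sup>2"
proof -
  let ?S = "{n. \<exists>w. cell w = n \<and> \<bar>w$1 - p$1\<bar> \<le> d \<and> \<bar>w$2 - p$2\<bar> \<le> d}"
  define r where "r = \<kappa> * (1 + \<bar>\<xi>\<bar>) * d"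
  have r0: "r \<ge> 0" using \<kappa>_pos d by (simp add: r_def)
  define I where "I x = {\<lfloor>x - r\<rfloor>..\<lfloor>x + r\<rfloor>}" for x
  have sub: "?S \<subseteq> I (gu p) \<times> I (gv p)"
  proof
    fix n assume "n \<in> ?S"
    then obtain w where w: "cell w = n" "\<bar>w$1 - p$1\<bar> \<le> d" "\<bar>w$2 - p$2\<bar> \<le> d" by auto
    have "\<bar>gu w - gu p\<bar> \<le> r" "\<bar>gv w - gv p\<bar> \<le> r" unfolding r_def using gu_diff[OF w(2,3)] gv_diff[OF w(2,3)] by auto
    then have "gu p - r \<le> gu w" "gu w \<le> gu p + r" "gv p - r \<le> gv w" "gv w \<le> gv p + r" by linarith+
    then show "n \<in> I (gu p) \<times> I (gv p)" unfolding w(1)[symmetric] by (auto simp: cell_def I_def intro: floor_mono)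
  qed
  have cI: "real (card (I x)) \<le> 2 * r + 3" for x
  proof -
    have "\<lfloor>x - r\<rfloor> \<le> \<lfloor>x + r\<rfloor>" using r0 by (intro floor_mono) simp
    then have "real (card (I x)) = of_int (\<lfloor>x + r\<rfloor> - \<lfloor>x - r\<rfloor> + 1)" by (simp add: I_def)
    also have "\<dots> \<le> 2 * r + 3" by linarith
    finally show ?thesis .
  qed
  have fin: "finite (I (gu p) \<times> I (gv p))" by (simp add: I_def)
  show "finite ?S" by (rule finite_subset[OF sub fin])
  have "real (card ?S) \<le> real (card (I (gu p) \<times> I (gv p)))" using card_mono[OF fin sub] by simp
  also have "\<dots> = real (card (I (gu p))) * real (card (I (gv p)))" by (simp add: card_cartesian_product)
  also have "\<dots> \<le> (2 * r + 3) * (2 * r + 3)" using cI r0 by (intro mult_mono) auto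
  finally show "real (card ?S) \<le> (2 * (\<kappa> * (1 + \<bar>\<xi>\<bar>) * d) + 3)\<^sup>2" by (simp add: r_def power2_eq_square)
qed

definition Act :: "(int \<times> int) set" where "Act = {n. T n \<inter> I2 \<noteq> {}}"

lemma finite_Act: "finite Act"
proof (rule finite_subset)
  show "Act \<subseteq> {n. \<exists>w. cell w = n \<and> \<bar>w$1 - pt (1/2) (1/2)$1\<bar> \<le> 1/2 \<and> \<bar>w$2 - pt (1/2) (1/2)$2\<bar> \<le> 1/2}"
  proof
    fix n assume "n \<in> Act"
    then obtain w where "cell w = n" "w \<in> I2" by (auto simp: Act_def)
    then show "n \<in> {n. \<exists>w. cell w = n \<and> \<bar>w$1 - pt (1/2) (1/2)$1\<bar> \<le> 1/2 \<and> \<bar>w$2 - pt (1/2) (1/2)$2\<bar> \<le> 1/2}"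
    proof -
      have "0 \<le> w$1" "w$1 \<le> 1" "0 \<le> w$2" "w$2 \<le> 1" using \<open>w \<in> I2\<close> by (auto simp: I2_def)
      then have "\<bar>w$1 - 1/2\<bar> \<le> 1/2" "\<bar>w$2 - 1/2\<bar> \<le> 1/2" by linarith+
      with \<open>cell w = n\<close> show ?thesis by (intro CollectI exI[of _ w]) (simp only: vector_2 simp_thms)
    qed
  qed
qed (rule cells_near, simp)

lemma measure_cells_sum:
  assumes S: "S \<in> lmeasurable" and A: "finite A" "\<And>w. w \<in> S \<Longrightarrow> cell w \<in> A"
  shows "(\<Sum>n\<in>A. measure lebesgue (T n \<inter> S)) = measure lebesgue S"
proof -
  have "(\<Union>n\<in>A. T n \<inter> S) = S" using A by auto
  moreover have "measure lebesgue (\<Union>n\<in>A. T n \<inter> S) = (\<Sum>n\<in>A. measure lebesgue (T n \<inter> S))"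
    by (rule measure_UNION'[OF A(1)]) (use S T_measure in \<open>auto intro!: fmeasurable.Int simp: pairwise_def disjnt_iff\<close>)
  ultimately show ?thesis by simp
qed

definition AdI :: "(int \<times> int) set" where "AdI = {n. interior (T n) \<inter> frontier I2 \<noteq> {}}"

lemma AdI_inner:
  assumes "n \<in> AdI"
  shows "interior (T n) \<inter> interior I2 \<noteq> {}"
proof -
  obtain f where f: "f \<in> interior (T n)" "f \<in> frontier I2" using assms by (auto simp: AdI_def)
  have "f \<in> closure (interior I2)" using f(2) by (simp add: frontier_def closure_I2_interior)
  then show ?thesis using f(1) open_Int_closure_eq_empty[of "interior (T n)" "interior I2"] by auto
qed

lemma AdI_sub_Act: "AdI \<subseteq> Act"
  using AdI_inner interior_subset unfolding Act_def by blast

text \<open>The open tile is connected, so if it avoids the frontier of the square it lies on one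
  side of it.\<close>

lemma not_Ad_cases:
  assumes "n \<notin> AdI"
  shows "Tint n \<subseteq> interior I2 \<or> Tint n \<inter> closure I2 = {}"
proof -
  have ns: "Tint n \<subseteq> interior (T n)" by (rule interior_maximal[OF Tint_sub Tint_open])
  then have nf: "Tint n \<inter> frontier I2 = {}" using assms by (auto simp: AdI_def)
  have "connected (Tint n)" by (rule convex_connected[OF Tint_convex])
  then have "Tint n \<inter> I2 = {} \<or> Tint n - I2 = {}"
    using connected_Int_frontier[of "Tint n" I2] nf by blast
  then show ?thesis
  proof
    assume "Tint n \<inter> I2 = {}"
    then show ?thesis using nf by (auto simp: frontier_def dest: subsetD[OF interior_subset])
  next
    assume "Tint n - I2 = {}"
    then show ?thesis using nf closure_subset[of I2] by (auto simp: frontier_def)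
  qed
qed

text \<open>Only the open tile is required to lie inside. The half-open tile may touch an edge from
  within, and a point chosen on that edge need not belong to \<open>I2\<close>.\<close>

definition Inn :: "(int \<times> int) set" where "Inn = {n. Tint n \<subseteq> interior I2}"

lemma Inn_sub_Act: "Inn \<subseteq> Act"
  unfolding Inn_def Act_def using Tint_ne Tint_sub interior_subset by blast

lemma T_diff_Tint_null: "measure lebesgue (T n - Tint n) = 0"
  using measurable_measure_Diff[OF T_measure(1) Tint_measure(1)[THEN fmeasurableD] Tint_sub, of n] T_measure(2) Tint_measure(2) by simp

lemma measure_T_Int_Inn:
  assumes "n \<in> Inn" "S \<in> sets lebesgue"
  shows "measure lebesgue (T n \<inter> I2 \<inter> S) = measure lebesgue (T n \<inter> S)"
proof -
  have l: "T n \<inter> S \<in> lmeasurable" "T n \<inter> I2 \<inter> S \<in> lmeasurable"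
    using T_measure(1)[of n] I2_lmeasurable assms(2) by (auto intro!: fmeasurable_Int_fmeasurable)
  have "T n \<inter> S \<subseteq> (T n \<inter> I2 \<inter> S) \<union> (T n - Tint n)"
    using assms(1) interior_subset by (auto simp: Inn_def)
  then have "measure lebesgue (T n \<inter> S) \<le> measure lebesgue ((T n \<inter> I2 \<inter> S) \<union> (T n - Tint n))"
    using l T_measure(1)[of n] Tint_measure(1)[of n] by (intro measure_mono_fmeasurable) (auto intro!: fmeasurable.Un fmeasurable.Diff)
  also have "\<dots> \<le> measure lebesgue (T n \<inter> I2 \<inter> S) + measure lebesgue (T n - Tint n)"
    using l T_measure(1)[of n] Tint_measure(1)[of n] by (intro measure_Un_le) auto
  finally have "measure lebesgue (T n \<inter> S) \<le> measure lebesgue (T n \<inter> I2 \<inter> S)" by (simp add: T_diff_Tint_null)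
  moreover have "measure lebesgue (T n \<inter> I2 \<inter> S) \<le> measure lebesgue (T n \<inter> S)"
    using l by (intro measure_mono_fmeasurable) auto
  ultimately show ?thesis by simp
qed

lemma measure_T_I2_Out:
  assumes "Tint n \<inter> closure I2 = {}" "S \<subseteq> I2" "S \<in> sets lebesgue"
  shows "measure lebesgue (T n \<inter> S) = 0"
proof -
  have "T n \<inter> S \<subseteq> T n - Tint n" using assms(1,2) closure_subset[of I2] by auto
  then have "measure lebesgue (T n \<inter> S) \<le> measure lebesgue (T n - Tint n)"
    using T_measure(1)[of n] Tint_measure(1)[of n] assms by (intro measure_mono_fmeasurable) (auto intro!: fmeasurable.Diff)
  then show ?thesis using T_diff_Tint_null[of n] measure_nonneg[of lebesgue "T n \<inter> S"] by linarith
qed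

text \<open>A tile contains its lower sides and not its upper ones. Increasing a grid coordinate
  slightly therefore always leads inward, decreasing it only when the point is not on that lower
  side.\<close>

lemma interior_direction:
  fixes z :: "real^2" and \<delta>1 \<delta>2 :: real
  assumes d1: "\<delta>1 > 0 \<or> (\<delta>1 < 0 \<and> gu z \<notin> \<int>)" and d2: "\<delta>2 > 0 \<or> (\<delta>2 < 0 \<and> gv z \<notin> \<int>)"
  shows "eventually (\<lambda>r. pos (gu z + r * \<delta>1) (gv z + r * \<delta>2) \<in> Tint (cell z)) (at_right 0)"
proof -
  have aux: "eventually (\<lambda>r. of_int \<lfloor>x\<rfloor> < x + r * \<delta> \<and> x + r * \<delta> < of_int \<lfloor>x\<rfloor> + 1) (at_right (0::real))"
    if d: "\<delta> > 0 \<or> (\<delta> < 0 \<and> x \<notin> \<int>)" for x \<delta> :: real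
  proof -
    have t: "((\<lambda>r. x + r * \<delta>) \<longlongrightarrow> x) (at_right 0)" by (auto intro!: tendsto_eq_intros)
    have up: "eventually (\<lambda>r. x + r * \<delta> < of_int \<lfloor>x\<rfloor> + 1) (at_right 0)"
      by (rule order_tendstoD(2)[OF t]) linarith
    have lw: "eventually (\<lambda>r. of_int \<lfloor>x\<rfloor> < x + r * \<delta>) (at_right 0)"
    proof (cases "\<delta> > 0")
      case True
      have "eventually (\<lambda>r::real. 0 < r) (at_right 0)" by (simp add: eventually_at_right_less)
      then show ?thesis
      proof eventually_elim
        case (elim r)
        then have "r * \<delta> > 0" using True by simp
        then show ?case by linarith
      qed
    next
      case False
      then have "x \<notin> \<int>" using d by auto
      then have "of_int \<lfloor>x\<rfloor> < x" by (metis Ints_of_int of_int_floor_le order_le_less)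
      then show ?thesis by (rule order_tendstoD(1)[OF t])
    qed
    from up lw show ?thesis by eventually_elim auto
  qed
  from aux[OF d1] aux[OF d2] show ?thesis
    by eventually_elim (simp add: Tint_def cell_def)
qed

lemma Tint_closure: "T n \<subseteq> closure (Tint n)"
proof
  fix z assume "z \<in> T n"
  then have n: "n = cell z" by simp
  have ev: "eventually (\<lambda>r. pos (gu z + r * 1) (gv z + r * 1) \<in> Tint n) (at_right 0)"
    unfolding n by (rule interior_direction) auto
  have "((\<lambda>r. pos (gu z + r * 1) (gv z + r * 1)) \<longlongrightarrow> pos (gu z + 0 * 1) (gv z + 0 * 1)) (at_right 0)"
    unfolding pos_def
  proof (rule vec_tendstoI)
    fix i :: 2
    show "((\<lambda>r. pt ((\<xi> * (gu z + r * 1) - (gv z + r * 1)) / Dn) ((gu z + r * 1 + \<xi> * (gv z + r * 1)) / Dn) $ i) \<longlongrightarrow>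
       pt ((\<xi> * (gu z + 0 * 1) - (gv z + 0 * 1)) / Dn) ((gu z + 0 * 1 + \<xi> * (gv z + 0 * 1)) / Dn) $ i) (at_right 0)"
    proof -
      have "((\<lambda>r. (\<xi> * (gu z + r * 1) - (gv z + r * 1)) / Dn) \<longlongrightarrow> (\<xi> * (gu z + 0 * 1) - (gv z + 0 * 1)) / Dn) (at_right 0)"
        "((\<lambda>r. (gu z + r * 1 + \<xi> * (gv z + r * 1)) / Dn) \<longlongrightarrow> (gu z + 0 * 1 + \<xi> * (gv z + 0 * 1)) / Dn) (at_right 0)"
        using Dn_pos by (intro tendsto_intros; simp)+
      then show ?thesis using exhaust_2[of i] by (elim disjE) (simp_all only: vector_2)
    qed
  qed
  then have "((\<lambda>r. pos (gu z + r * 1) (gv z + r * 1)) \<longlongrightarrow> z) (at_right 0)" by (simp add: pos_gu_gv)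
  then show "z \<in> closure (Tint n)"
    by (rule Lim_in_closed_set[OF closed_closure, rotated -1]) (use ev closure_subset in \<open>auto elim!: eventually_mono\<close>)
qed

lemma pos_shift:
  "pos (gu z + r * \<delta>1) (gv z + r * \<delta>2) $ 1 = z$1 + r * (\<xi> * \<delta>1 - \<delta>2) / Dn"
  "pos (gu z + r * \<delta>1) (gv z + r * \<delta>2) $ 2 = z$2 + r * (\<delta>1 + \<xi> * \<delta>2) / Dn"
  unfolding coord1[of z] coord2[of z] pos_def
  by (simp_all add: add_divide_distrib[symmetric] diff_divide_distrib[symmetric]) (simp_all add: algebra_simps)

section \<open>Chosen points on tile sides that touch an edge of the square\<close>

definition adm :: "real \<Rightarrow> real \<Rightarrow> bool" where "adm x \<delta> \<longleftrightarrow> \<delta> > 0 \<or> (\<delta> < 0 \<and> x \<notin> \<int>)"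

lemma interior_direction_near:
  assumes "adm (gu z) \<delta>1" "adm (gv z) \<delta>2" "e > 0"
  shows "\<exists>r. 0 < r \<and> r < e \<and> pos (gu z + r * \<delta>1) (gv z + r * \<delta>2) \<in> Tint (cell z)"
proof -
  have "eventually (\<lambda>r. pos (gu z + r * \<delta>1) (gv z + r * \<delta>2) \<in> Tint (cell z)) (at_right 0)"
    using assms by (intro interior_direction) (auto simp: adm_def)
  moreover have "eventually (\<lambda>r. r \<in> {0<..<e}) (at_right (0::real))" using assms(3) by (rule eventually_at_right_real)
  ultimately have "eventually (\<lambda>r. 0 < r \<and> r < e \<and> pos (gu z + r * \<delta>1) (gv z + r * \<delta>2) \<in> Tint (cell z)) (at_right 0)"
    by eventually_elim auto
  then show ?thesis using eventually_happens'[OF trivial_limit_at_right_real] by blast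
qed

lemma small_bound: "\<exists>e>0. \<forall>r. 0 < r \<longrightarrow> r < e \<longrightarrow> \<bar>r * x\<bar> < d" if "d > 0" for x d :: real
proof (intro exI[of _ "d / (1 + \<bar>x\<bar>)"] conjI allI impI)
  show "0 < d / (1 + \<bar>x\<bar>)" using that by (simp add: add_pos_nonneg)
  fix r assume r: "0 < r" "r < d / (1 + \<bar>x\<bar>)"
  have p: "1 + \<bar>x\<bar> > 0" by simp
  have "\<bar>r * x\<bar> = r * \<bar>x\<bar>" using r by (simp add: abs_mult)
  also have "\<dots> < r * (1 + \<bar>x\<bar>)" using r by simp
  also have "\<dots> < d" using r(2) p by (simp add: pos_less_divide_eq)
  finally show "\<bar>r * x\<bar> < d" .
qed

text \<open>The number \<open>\<xi> * \<delta>1 - \<delta>2\<close> is the change of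
  \<open>x\<close> up to a positive factor. If every inward direction decreases \<open>x\<close>,
  the point is on the rightmost part of its tile: a side for \<open>\<xi> = 0\<close>, otherwise a
  single corner. That corner belongs to the half-open tile only for negative
  \<open>\<xi>\<close>.\<close>

lemma left_contact:
  assumes "\<And>\<delta>1 \<delta>2. adm (gu z) \<delta>1 \<Longrightarrow> adm (gv z) \<delta>2 \<Longrightarrow> \<xi> * \<delta>1 - \<delta>2 < 0"
  shows "\<xi> \<le> 0 \<and> gv z \<in> \<int> \<and> (gu z \<in> \<int> \<or> \<xi> = 0)"
proof -
  have x0: "\<xi> \<le> 0" using assms[of 1 "\<xi>/2"] by (cases "\<xi> > 0") (auto simp: adm_def)
  have p: "1 + \<bar>\<xi>\<bar> > 0" by simp
  have "gv z \<in> \<int>"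
  proof (rule ccontr)
    assume "gv z \<notin> \<int>"
    then have "\<xi> * (1 / (1 + \<bar>\<xi>\<bar>)) - (-1) < 0" using p by (intro assms) (auto simp: adm_def)
    then have "(\<xi> + (1 + \<bar>\<xi>\<bar>)) / (1 + \<bar>\<xi>\<bar>) < 0" using p by (simp add: add_divide_distrib)
    then show False using p by (simp add: divide_less_0_iff)
  qed
  moreover have "gu z \<in> \<int> \<or> \<xi> = 0"
    using assms[of "-1" "-\<xi>/2"] x0 by (cases "\<xi> = 0") (auto simp: adm_def)
  ultimately show ?thesis using x0 by simp
qed

lemma bottom_contact:
  assumes "\<And>\<delta>1 \<delta>2. adm (gu z) \<delta>1 \<Longrightarrow> adm (gv z) \<delta>2 \<Longrightarrow> \<delta>1 + \<xi> * \<delta>2 > 0"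
  shows "\<xi> \<ge> 0 \<and> gu z \<in> \<int> \<and> (gv z \<in> \<int> \<or> \<xi> = 0)"
proof -
  have x0: "\<xi> \<ge> 0" using assms[of "-\<xi>/2" 1] by (cases "\<xi> < 0") (auto simp: adm_def)
  have p: "1 + \<bar>\<xi>\<bar> > 0" by simp
  have "gu z \<in> \<int>"
  proof (rule ccontr)
    assume "gu z \<notin> \<int>"
    then have "(-1) + \<xi> * (1 / (1 + \<bar>\<xi>\<bar>)) > 0" using p by (intro assms) (auto simp: adm_def)
    then have "(\<xi> - (1 + \<bar>\<xi>\<bar>)) / (1 + \<bar>\<xi>\<bar>) > 0" using p by (simp add: diff_divide_distrib)
    then show False using p by (simp add: zero_less_divide_iff)
  qed
  moreover have "gv z \<in> \<int> \<or> \<xi> = 0"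
    using assms[of "\<xi>/2" "-1"] x0 by (cases "\<xi> = 0") (auto simp: adm_def)
  ultimately show ?thesis using x0 by simp
qed

text \<open>Of its four edges the square contains only the left one, so an outer tile can contribute
  a point only by touching that edge from the left.\<close>

lemma extra_point:
  assumes out: "Tint (cell z) \<inter> closure I2 = {}" and z: "z \<in> I2"
  shows "z$1 = 0 \<and> \<xi> \<le> 0 \<and> gv z \<in> \<int> \<and> (gu z \<in> \<int> \<or> \<xi> = 0)"
proof -
  have "z \<in> closure (Tint (cell z))" using Tint_closure by blast
  then have "z \<notin> interior I2"
    using open_Int_closure_eq_empty[of "interior I2" "Tint (cell z)"] out interior_subset[of I2] closure_subset[of I2] by blast
  then have "\<not> (0 < z$1 \<and> z$1 < 1 \<and> 0 < z$2 \<and> z$2 < 1)" unfolding interior_I2 by simp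
  then have z1: "z$1 = 0" "0 < z$2" "z$2 < 1" using z by (auto simp: I2_def)
  have "\<xi> * \<delta>1 - \<delta>2 < 0" if a: "adm (gu z) \<delta>1" "adm (gv z) \<delta>2" for \<delta>1 \<delta>2
  proof (rule ccontr)
    assume n: "\<not> \<xi> * \<delta>1 - \<delta>2 < 0"
    define A where "A = (\<xi> * \<delta>1 - \<delta>2) / Dn"
    define B where "B = (\<delta>1 + \<xi> * \<delta>2) / Dn"
    have A0: "A \<ge> 0" using n Dn_pos by (simp add: A_def)
    obtain e1 where e1: "e1 > 0" "\<And>r. 0 < r \<Longrightarrow> r < e1 \<Longrightarrow> \<bar>r * A\<bar> < 1" using small_bound[of 1 A] by auto
    obtain e2 where e2: "e2 > 0" "\<And>r. 0 < r \<Longrightarrow> r < e2 \<Longrightarrow> \<bar>r * B\<bar> < min (z$2) (1 - z$2)" using small_bound[of "min (z$2) (1 - z$2)" B] z1 by auto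
    obtain r where r: "0 < r" "r < min e1 e2" "pos (gu z + r * \<delta>1) (gv z + r * \<delta>2) \<in> Tint (cell z)"
      using interior_direction_near[OF a, of "min e1 e2"] e1 e2 by auto
    have "pos (gu z + r * \<delta>1) (gv z + r * \<delta>2) \<in> closure I2"
    proof -
      have "\<bar>r * A\<bar> < 1" "\<bar>r * B\<bar> < min (z$2) (1 - z$2)" "r * A \<ge> 0" using e1(2)[of r] e2(2)[of r] r A0 by auto
      then have "r * A < 1" "0 \<le> r * A" "r * B < 1 - z$2" "- (r * B) < z$2" by linarith+
      then show ?thesis unfolding closure_I2 using z1 pos_shift[of z r \<delta>1 \<delta>2] by (simp add: A_def B_def)
    qed
    then show False using out r(3) by blast
  qed
  from left_contact[OF this] z1 show ?thesis by simp
qed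

text \<open>An inner tile loses its point only on an edge that does not belong to \<open>I2\<close>.
  Right and bottom are possible and need opposite signs of \<open>\<xi>\<close>, or
  \<open>\<xi> = 0\<close>.\<close>

lemma missing_point:
  assumes inn: "Tint (cell z) \<subseteq> interior I2" and z: "z \<notin> I2"
  shows "(z$1 = 1 \<and> 0 < z$2 \<and> z$2 < 1 \<and> \<xi> \<le> 0 \<and> gv z \<in> \<int> \<and> (gu z \<in> \<int> \<or> \<xi> = 0))
    \<or> (z$2 = 0 \<and> 0 \<le> z$1 \<and> z$1 \<le> 1 \<and> \<xi> \<ge> 0 \<and> gu z \<in> \<int> \<and> (gv z \<in> \<int> \<or> \<xi> = 0))"
proof -
  have "z \<in> closure (Tint (cell z))" using Tint_closure by blast
  then have "z \<in> closure I2" using closure_mono[OF inn] closure_I2_interior by blast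
  then have zc: "0 \<le> z$1" "z$1 \<le> 1" "0 \<le> z$2" "z$2 \<le> 1" by (auto simp: closure_I2)
  have dir: "\<exists>r>0. 0 < z$1 + r * (\<xi> * \<delta>1 - \<delta>2) / Dn \<and> z$1 + r * (\<xi> * \<delta>1 - \<delta>2) / Dn < 1 \<and> 0 < z$2 + r * (\<delta>1 + \<xi> * \<delta>2) / Dn \<and> z$2 + r * (\<delta>1 + \<xi> * \<delta>2) / Dn < 1"
    if a: "adm (gu z) \<delta>1" "adm (gv z) \<delta>2" for \<delta>1 \<delta>2
  proof -
    obtain r where r: "0 < r" "pos (gu z + r * \<delta>1) (gv z + r * \<delta>2) \<in> Tint (cell z)"
      using interior_direction_near[OF a, of 1] by auto
    then have "pos (gu z + r * \<delta>1) (gv z + r * \<delta>2) \<in> interior I2" using inn by blast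
    then show ?thesis using r(1) unfolding interior_I2 mem_Collect_eq pos_shift by blast
  qed
  have sgn: "0 < r * x / Dn \<longleftrightarrow> 0 < x" "r * x / Dn < 0 \<longleftrightarrow> x < 0" if "r > 0" for r x
    using that Dn_pos by (auto simp: zero_less_divide_iff divide_less_0_iff zero_less_mult_iff mult_less_0_iff)
  \<comment> \<open>At the top edge a step of 1 in \<open>gu\<close> and a small one in
    \<open>gv\<close> is always admissible and increases \<open>y\<close>, so the tile would leave
    the square.\<close>
  have z2: "z$2 \<noteq> 1"
  proof
    assume "z$2 = 1"
    have "1 + \<bar>\<xi>\<bar> > 0" by simp
    then obtain r where "r > 0" "1 + r * (1 + \<xi> * (1 / (1 + \<bar>\<xi>\<bar>))) / Dn < 1"
      using dir[of 1 "1 / (1 + \<bar>\<xi>\<bar>)"] \<open>z$2 = 1\<close> by (auto simp: adm_def)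
    then have "1 + \<xi> * (1 / (1 + \<bar>\<xi>\<bar>)) < 0" using sgn(2)[of r "1 + \<xi> * (1 / (1 + \<bar>\<xi>\<bar>))"] by simp
    then have "((1 + \<bar>\<xi>\<bar>) + \<xi>) / (1 + \<bar>\<xi>\<bar>) < 0" using \<open>1 + \<bar>\<xi>\<bar> > 0\<close> by (simp add: add_divide_distrib)
    then show False using \<open>1 + \<bar>\<xi>\<bar> > 0\<close> by (simp add: divide_less_0_iff)
  qed
  show ?thesis
  proof (cases "z$2 = 0")
    case True
    have "\<delta>1 + \<xi> * \<delta>2 > 0" if a: "adm (gu z) \<delta>1" "adm (gv z) \<delta>2" for \<delta>1 \<delta>2
      using dir[OF a] sgn(1) True by auto
    from bottom_contact[OF this] show ?thesis using True zc by simp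
  next
    case False
    then have z1: "z$1 = 1" using z zc z2 by (auto simp: I2_def)
    have "\<xi> * \<delta>1 - \<delta>2 < 0" if a: "adm (gu z) \<delta>1" "adm (gv z) \<delta>2" for \<delta>1 \<delta>2
      using dir[OF a] sgn(2) z1 by auto
    from left_contact[OF this] show ?thesis using False z1 zc z2 by simp
  qed
qed

text \<open>The index pairs of the tiles with a point gained or lost at one edge lie on a line of slope \<open>\<xi>\<close>
  (\<open>-\<xi>\<close> after swapping the coordinates, for the bottom edge), so they are at least \<open>1 / \<mu>\<close> apart.\<close>

definition \<mu> :: real where "\<mu> = (if \<xi> = 0 then 1 else min 1 \<bar>\<xi>\<bar>)"

lemma \<mu>_bounds: "0 < \<mu>" "\<mu> \<le> 1" by (auto simp: \<mu>_def)

lemma count_line: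
  fixes S :: "(int \<times> int) set" and e C A len :: real
  assumes e: "\<bar>e\<bar> = \<bar>\<xi>\<bar>" and line: "\<And>n. n \<in> S \<Longrightarrow> of_int (snd n) = e * of_int (fst n) + C"
    and rng: "\<And>n. n \<in> S \<Longrightarrow> A \<le> of_int (fst n) \<and> of_int (fst n) \<le> A + len" and l: "len \<ge> 0"
  shows "finite S \<and> real (card S) \<le> \<mu> * len + 1"
proof -
  have inj: "inj_on fst S"
  proof (rule inj_onI)
    fix m n assume mn: "m \<in> S" "n \<in> S" "fst m = fst n"
    then have "real_of_int (snd m) = real_of_int (snd n)" using line[of m] line[of n] by simp
    then show "m = n" using mn by (simp add: prod_eq_iff)
  qed
  have "finite (fst ` S) \<and> real (card (fst ` S)) \<le> \<mu> * len + 1"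
  proof (rule card_separated_le[OF \<mu>_bounds(1) _ _ l])
    show "A \<le> of_int i \<and> of_int i \<le> A + len" if "i \<in> fst ` S" for i using that rng by auto
    fix i j assume "i \<in> fst ` S" "j \<in> fst ` S" and ij: "i \<noteq> j"
    then obtain m n where mn: "m \<in> S" "n \<in> S" "i = fst m" "j = fst n" by auto
    have a1: "\<bar>real_of_int i - real_of_int j\<bar> \<ge> 1" using ij by linarith
    show "\<mu> * \<bar>real_of_int i - real_of_int j\<bar> \<ge> 1"
    proof (cases "\<xi> = 0 \<or> \<bar>\<xi>\<bar> \<ge> 1")
      case True
      then have "\<mu> = 1" by (auto simp: \<mu>_def)
      then show ?thesis using a1 by simp
    next
      case False
      then have m: "\<mu> = \<bar>e\<bar>" "e \<noteq> 0" using e by (auto simp: \<mu>_def)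
      have eq: "e * (real_of_int i - real_of_int j) = real_of_int (snd m - snd n)"
        using line[OF mn(1)] line[OF mn(2)] mn by (simp add: right_diff_distrib)
      then have "real_of_int (snd m - snd n) \<noteq> 0" using m ij by (metis eq_iff_diff_eq_0 mult_eq_0_iff of_int_eq_iff)
      then have "snd m - snd n \<noteq> 0" by simp
      then have "1 \<le> \<bar>real_of_int (snd m - snd n)\<bar>" by linarith
      also have "\<dots> = \<mu> * \<bar>real_of_int i - real_of_int j\<bar>" unfolding eq[symmetric] m(1) abs_mult ..
      finally show ?thesis .
    qed
  qed
  then show ?thesis using card_image[OF inj] finite_imageD[OF _ inj] by auto
qed

lemma integer_floor: "x \<in> \<int> \<Longrightarrow> of_int \<lfloor>x\<rfloor> = (x::real)" by (auto elim: Ints_cases)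

definition Eset :: "((int \<times> int) \<Rightarrow> real^2) \<Rightarrow> (int \<times> int) set" where
  "Eset z = {n. Tint n \<inter> closure I2 = {} \<and> z n \<in> I2}"
definition Mset :: "((int \<times> int) \<Rightarrow> real^2) \<Rightarrow> (int \<times> int) set" where
  "Mset z = {n. n \<in> Inn \<and> z n \<notin> I2}"
definition Mright :: "((int \<times> int) \<Rightarrow> real^2) \<Rightarrow> (int \<times> int) set" where
  "Mright z = {n \<in> Mset z. z n$2 \<noteq> 0}"
definition Mbot :: "((int \<times> int) \<Rightarrow> real^2) \<Rightarrow> (int \<times> int) set" where
  "Mbot z = {n \<in> Mset z. z n$2 = 0}"

context
  fixes z :: "(int \<times> int) \<Rightarrow> real^2"
  assumes zc: "\<And>n. cell (z n) = n"
begin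

lemma Eset_props:
  assumes "n \<in> Eset z"
  shows "z n$1 = 0" "0 < z n$2" "z n$2 < 1" "\<xi> \<le> 0" "of_int (snd n) = \<xi> * of_int (fst n) + 0" "fst n = \<lfloor>\<kappa> * z n$2\<rfloor>"
proof -
  have e: "z n$1 = 0 \<and> \<xi> \<le> 0 \<and> gv (z n) \<in> \<int> \<and> (gu (z n) \<in> \<int> \<or> \<xi> = 0)" "z n \<in> I2"
    using assms extra_point[of "z n"] zc by (auto simp: Eset_def)
  then show "z n$1 = 0" "0 < z n$2" "z n$2 < 1" "\<xi> \<le> 0" by (auto simp: I2_def)
  have gu: "gu (z n) = \<kappa> * z n$2" and gv: "gv (z n) = \<xi> * gu (z n)" using e by (auto simp: gu_def gv_def)
  have fl: "fst n = \<lfloor>gu (z n)\<rfloor>" "snd n = \<lfloor>gv (z n)\<rfloor>" using zc[of n] by (auto simp: cell_def prod_eq_iff)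
  show "fst n = \<lfloor>\<kappa> * z n$2\<rfloor>" unfolding fl gu ..
  show "of_int (snd n) = \<xi> * of_int (fst n) + 0" using e fl gv integer_floor by auto
qed

lemma Mright_props:
  assumes "n \<in> Mright z"
  shows "z n$1 = 1" "0 < z n$2" "z n$2 < 1" "\<xi> \<le> 0" "of_int (snd n) = \<xi> * of_int (fst n) + (- Dn)" "fst n = \<lfloor>\<kappa> * (\<xi> + z n$2)\<rfloor>"
proof -
  have e: "z n$1 = 1 \<and> 0 < z n$2 \<and> z n$2 < 1 \<and> \<xi> \<le> 0 \<and> gv (z n) \<in> \<int> \<and> (gu (z n) \<in> \<int> \<or> \<xi> = 0)"
    using assms missing_point[of "z n"] zc by (auto simp: Mright_def Mset_def Inn_def)
  then show "z n$1 = 1" "0 < z n$2" "z n$2 < 1" "\<xi> \<le> 0" by auto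
  have gu: "gu (z n) = \<kappa> * (\<xi> + z n$2)" and gv: "gv (z n) = \<xi> * gu (z n) - Dn" using e by (auto simp: gu_def gv_def Dn_def power2_eq_square algebra_simps)
  have fl: "fst n = \<lfloor>gu (z n)\<rfloor>" "snd n = \<lfloor>gv (z n)\<rfloor>" using zc[of n] by (auto simp: cell_def prod_eq_iff)
  show "fst n = \<lfloor>\<kappa> * (\<xi> + z n$2)\<rfloor>" unfolding fl gu ..
  show "of_int (snd n) = \<xi> * of_int (fst n) + (- Dn)" using e fl gv integer_floor by auto
qed

lemma Mbot_props:
  assumes "n \<in> Mbot z"
  shows "0 \<le> z n$1" "z n$1 \<le> 1" "\<xi> \<ge> 0" "of_int (fst n) = - \<xi> * of_int (snd n) + 0" "snd n = \<lfloor>- \<kappa> * z n$1\<rfloor>"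
proof -
  have e: "z n$2 = 0 \<and> 0 \<le> z n$1 \<and> z n$1 \<le> 1 \<and> \<xi> \<ge> 0 \<and> gu (z n) \<in> \<int> \<and> (gv (z n) \<in> \<int> \<or> \<xi> = 0)"
    using assms missing_point[of "z n"] zc by (auto simp: Mbot_def Mset_def Inn_def)
  then show "0 \<le> z n$1" "z n$1 \<le> 1" "\<xi> \<ge> 0" by auto
  have gv: "gv (z n) = - \<kappa> * z n$1" and gu: "gu (z n) = - \<xi> * gv (z n)" using e by (auto simp: gu_def gv_def)
  have fl: "fst n = \<lfloor>gu (z n)\<rfloor>" "snd n = \<lfloor>gv (z n)\<rfloor>" using zc[of n] by (auto simp: cell_def prod_eq_iff)
  show "snd n = \<lfloor>- \<kappa> * z n$1\<rfloor>" unfolding fl gv ..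
  show "of_int (fst n) = - \<xi> * of_int (snd n) + 0" using e fl gu integer_floor by auto
qed

lemma count_E:
  assumes "\<alpha> \<le> \<beta>" "S \<subseteq> Eset z" "\<And>n. n \<in> S \<Longrightarrow> \<alpha> \<le> z n$2 \<and> z n$2 \<le> \<beta>"
  shows "finite S \<and> real (card S) \<le> \<mu> * \<kappa> * (\<beta> - \<alpha>) + 2"
proof -
  have "finite S \<and> real (card S) \<le> \<mu> * (\<kappa> * (\<beta> - \<alpha>) + 1) + 1"
  proof (rule count_line[of \<xi> _ 0 "\<kappa> * \<alpha> - 1"])
    fix n assume n: "n \<in> S"
    show "of_int (snd n) = \<xi> * of_int (fst n) + 0" using Eset_props assms n by blast
    have "\<kappa> * \<alpha> \<le> \<kappa> * z n$2" "\<kappa> * z n$2 \<le> \<kappa> * \<beta>" using assms(3)[OF n] \<kappa>_pos by auto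
    moreover have "\<kappa> * \<alpha> - 1 + (\<kappa> * (\<beta> - \<alpha>) + 1) = \<kappa> * \<beta>" by (simp add: algebra_simps)
    moreover have "fst n = \<lfloor>\<kappa> * z n$2\<rfloor>" using Eset_props assms n by blast
    ultimately show "\<kappa> * \<alpha> - 1 \<le> of_int (fst n) \<and> of_int (fst n) \<le> \<kappa> * \<alpha> - 1 + (\<kappa> * (\<beta> - \<alpha>) + 1)" by linarith
  qed (use assms \<kappa>_pos in auto)
  moreover have "\<mu> * (\<kappa> * (\<beta> - \<alpha>) + 1) + 1 \<le> \<mu> * \<kappa> * (\<beta> - \<alpha>) + 2" using \<mu>_bounds by (simp add: algebra_simps)
  ultimately show ?thesis by linarith
qed

lemma count_Mright:
  assumes "\<alpha> \<le> \<beta>" "S \<subseteq> Mright z" "\<And>n. n \<in> S \<Longrightarrow> \<alpha> \<le> z n$2 \<and> z n$2 \<le> \<beta>"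
  shows "finite S \<and> real (card S) \<le> \<mu> * \<kappa> * (\<beta> - \<alpha>) + 2"
proof -
  have "finite S \<and> real (card S) \<le> \<mu> * (\<kappa> * (\<beta> - \<alpha>) + 1) + 1"
  proof (rule count_line[of \<xi> _ "- Dn" "\<kappa> * (\<xi> + \<alpha>) - 1"])
    fix n assume n: "n \<in> S"
    show "of_int (snd n) = \<xi> * of_int (fst n) + (- Dn)" using Mright_props assms n by blast
    have "\<kappa> * (\<xi> + \<alpha>) \<le> \<kappa> * (\<xi> + z n$2)" "\<kappa> * (\<xi> + z n$2) \<le> \<kappa> * (\<xi> + \<beta>)" using assms(3)[OF n] \<kappa>_pos by auto
    moreover have "\<kappa> * (\<xi> + \<alpha>) - 1 + (\<kappa> * (\<beta> - \<alpha>) + 1) = \<kappa> * (\<xi> + \<beta>)" by (simp add: algebra_simps)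
    moreover have "fst n = \<lfloor>\<kappa> * (\<xi> + z n$2)\<rfloor>" using Mright_props assms n by blast
    ultimately show "\<kappa> * (\<xi> + \<alpha>) - 1 \<le> of_int (fst n) \<and> of_int (fst n) \<le> \<kappa> * (\<xi> + \<alpha>) - 1 + (\<kappa> * (\<beta> - \<alpha>) + 1)" by linarith
  qed (use assms \<kappa>_pos in auto)
  moreover have "\<mu> * (\<kappa> * (\<beta> - \<alpha>) + 1) + 1 \<le> \<mu> * \<kappa> * (\<beta> - \<alpha>) + 2" using \<mu>_bounds by (simp add: algebra_simps)
  ultimately show ?thesis by linarith
qed

lemma count_Mbot: "finite (Mbot z) \<and> real (card (Mbot z)) \<le> \<mu> * \<kappa> + 2"
proof -
  have "finite (prod.swap ` Mbot z) \<and> real (card (prod.swap ` Mbot z)) \<le> \<mu> * (\<kappa> + 1) + 1"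
  proof (rule count_line[of "- \<xi>" _ 0 "- \<kappa> - 1"])
    fix m assume "m \<in> prod.swap ` Mbot z"
    then obtain n where n: "n \<in> Mbot z" "m = prod.swap n" by auto
    note pr = Mbot_props[OF n(1)]
    show "of_int (snd m) = - \<xi> * of_int (fst m) + 0" using pr(4) n(2) by simp
    have "- \<kappa> * 1 \<le> - \<kappa> * z n$1" "- \<kappa> * z n$1 \<le> 0" using pr(1,2) \<kappa>_pos by auto
    then show "- \<kappa> - 1 \<le> of_int (fst m) \<and> of_int (fst m) \<le> - \<kappa> - 1 + (\<kappa> + 1)" using pr(5) n(2) by simp linarith
  qed (use \<kappa>_pos in auto)
  moreover have "card (prod.swap ` Mbot z) = card (Mbot z)" by (rule card_image) (auto simp: inj_on_def)
  moreover have "finite (prod.swap ` Mbot z) \<longleftrightarrow> finite (Mbot z)" by (rule finite_image_iff) (auto simp: inj_on_def)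
  moreover have "\<mu> * (\<kappa> + 1) + 1 \<le> \<mu> * \<kappa> + 2" using \<mu>_bounds by (simp add: algebra_simps)
  ultimately show ?thesis by linarith
qed

end

end

section \<open>Weighted count of the lost and gained points\<close>

context gridcap
begin

lemma F_seam: "F (pt 0 y) = F (pt 1 y)"
proof -
  have "cos (2 * pi * (1 - x0)) = cos (2 * pi * (0 - x0))"
    using cos_periodic[of "2 * pi * (0 - x0)"] by (simp add: algebra_simps)
  then show ?thesis by (simp add: capF_def)
qed

definition Zy :: "real set" where "Zy = {y. 0 < y \<and> y < 1 \<and> F (pt 0 y) = t}"

lemma Zy_finite: "finite Zy" "card Zy \<le> 2"
proof -
  have sub: "Zy \<subseteq> (\<lambda>s. (1 - s) / 2) ` {s. poly P3 s = 0}"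
  proof
    fix y assume y: "y \<in> Zy"
    define s where "s = 1 - 2 * y"
    have yy: "y = (1 - s) / 2" by (simp add: s_def)
    have ss: "s\<^sup>2 < 1" using y by (subst abs_square_less_1) (auto simp: Zy_def s_def abs_less_iff)
    have "c * sqrt (1 - s\<^sup>2) * (cos (2 * pi * (0 - x0)) - G s) = 0"
      using y F_pt[OF ss, of 0] by (simp add: Zy_def yy[symmetric])
    then have "G s = cos (2 * pi * x0)" using c_pos ss by simp
    then have "t - b * s = c * sqrt (1 - s\<^sup>2) * cos (2 * pi * x0)"
      using c_pos ss by (simp add: G_def divide_eq_eq)
    then have "(t - b * s)\<^sup>2 = (c * cos (2 * pi * x0))\<^sup>2 * (1 - s\<^sup>2)"
      using ss by (simp add: power_mult_distrib)
    then have "poly P3 s = 0" by (simp add: poly_P3)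
    then show "y \<in> (\<lambda>s. (1 - s) / 2) ` {s. poly P3 s = 0}" using yy by blast
  qed
  have f: "finite {s. poly P3 s = 0}" using nonzero_polys poly_roots_finite by blast
  show "finite Zy" using finite_subset[OF sub] f by blast
  have d3: "degree P3 \<le> 2"
    unfolding P3_def
    by (intro degree_diff_le order_trans[OF degree_smult_le] order_trans[OF degree_power_le]) (auto simp: degree_pCons_eq_if)
  have "card Zy \<le> card ((\<lambda>s. (1 - s) / 2) ` {s. poly P3 s = 0})" by (rule card_mono[OF finite_imageI[OF f] sub])
  also have "\<dots> \<le> card {s. poly P3 s = 0}" by (rule card_image_le[OF f])
  also have "\<dots> \<le> 2" using card_poly_roots_bound[OF nonzero_polys(3)] d3 by linarith
  finally show "card Zy \<le> 2" .
qed

definition \<sigma> :: real where "\<sigma> = (1 - t) / 2"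

lemma \<sigma>_bounds: "0 < \<sigma>" "\<sigma> < 1" "\<sigma> \<le> (1 + \<bar>t\<bar>) / 2" "1 - \<sigma> \<le> (1 + \<bar>t\<bar>) / 2"
  using t_lt by (simp_all add: \<sigma>_def field_simps abs_less_iff)

text \<open>A gained point in the cap raises the surplus by \<open>1 - \<sigma>\<close>; a lost
  point of a tile outside the cap raises it by \<open>\<sigma>\<close> because the total shrinks.
  Both weights are at most \<open>(1 + \<bar>t\<bar>) / 2\<close>. The left and right edges are the
  same meridian, and the two effects need opposite signs of \<open>F - t\<close> there, so each part
  of the edge is charged once. The bottom edge matters only for \<open>\<xi> \<ge> 0\<close>, hence
  the factor 2 at \<open>\<xi> = 0\<close>.\<close>

lemma EM_bound:
  assumes zc: "\<And>n. cell (z n) = n"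
  shows "\<sigma> * real (card {n \<in> Mset z. \<forall>w\<in>T n \<inter> I2. F w \<le> t}) + (1 - \<sigma>) * real (card {n \<in> Eset z. F (z n) > t})
    \<le> (1 + \<bar>t\<bar>) / 2 * \<mu> * \<kappa> * (if \<xi> = 0 then 2 else 1) + 20"
proof -
  let ?w = "(1 + \<bar>t\<bar>) / 2"
  have w1: "0 \<le> ?w" "?w \<le> 1" using t_lt by auto
  define Eo where "Eo \<alpha> \<beta> = {n \<in> Eset z. F (z n) > t \<and> \<alpha> < z n$2 \<and> z n$2 < \<beta>}" for \<alpha> \<beta>
  define Mo where "Mo \<alpha> \<beta> = {n \<in> Mright z. (\<forall>w\<in>T n \<inter> I2. F w \<le> t) \<and> \<alpha> < z n$2 \<and> z n$2 < \<beta>}" for \<alpha> \<beta>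
  have finE: "finite (Eo \<alpha> \<beta>)" and cE: "\<alpha> \<le> \<beta> \<Longrightarrow> real (card (Eo \<alpha> \<beta>)) \<le> \<mu> * \<kappa> * (\<beta> - \<alpha>) + 2" for \<alpha> \<beta>
  proof -
    show "finite (Eo \<alpha> \<beta>)"
      by (rule count_E[OF zc zero_le_one, THEN conjunct1]) (auto simp: Eo_def dest: Eset_props(2,3)[OF zc])
    show "real (card (Eo \<alpha> \<beta>)) \<le> \<mu> * \<kappa> * (\<beta> - \<alpha>) + 2" if "\<alpha> \<le> \<beta>"
      by (rule count_E[OF zc that, THEN conjunct2]) (auto simp: Eo_def)
  qed
  have finM: "finite (Mo \<alpha> \<beta>)" and cM: "\<alpha> \<le> \<beta> \<Longrightarrow> real (card (Mo \<alpha> \<beta>)) \<le> \<mu> * \<kappa> * (\<beta> - \<alpha>) + 2" for \<alpha> \<beta>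
  proof -
    show "finite (Mo \<alpha> \<beta>)"
      by (rule count_Mright[OF zc zero_le_one, THEN conjunct1]) (auto simp: Mo_def dest: Mright_props(2,3)[OF zc])
    show "real (card (Mo \<alpha> \<beta>)) \<le> \<mu> * \<kappa> * (\<beta> - \<alpha>) + 2" if "\<alpha> \<le> \<beta>"
      by (rule count_Mright[OF zc that, THEN conjunct2]) (auto simp: Mo_def)
  qed
  define \<Phi> where "\<Phi> \<alpha> \<beta> = \<sigma> * real (card (Mo \<alpha> \<beta>)) + (1 - \<sigma>) * real (card (Eo \<alpha> \<beta>))" for \<alpha> \<beta>
  \<comment> \<open>A piece costs at most 2, and so does a breakpoint since the weights add up to 1;
    \<open>6 * n - 4\<close> covers this. At most two zeros give three pieces, hence 14.\<close>
  define P where "P \<alpha> \<beta> n \<longleftrightarrow> \<Phi> \<alpha> \<beta> \<le> ?w * (\<mu> * \<kappa> * (\<beta> - \<alpha>)) + (6 * real n - 4)" for \<alpha> \<beta> and n :: nat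
  have "P 0 1 (card (Zy \<inter> {0<..<1}) + 1)"
  proof (rule breakpoint_induct[where lo=0 and hi=1])
    show "finite Zy" by (rule Zy_finite)
    show "P \<alpha> \<beta> 1" if le: "0 \<le> \<alpha>" "\<alpha> < \<beta>" "\<beta> \<le> 1" and free: "Zy \<inter> {\<alpha><..<\<beta>} = {}" for \<alpha> \<beta>
    proof -
      define \<psi> where "\<psi> y = F (pt 0 y)" for y
      have cont: "continuous_on {\<alpha><..<\<beta>} \<psi>" unfolding \<psi>_def capF_def vector_2 by (intro continuous_intros)
      have nz: "\<psi> y \<noteq> t" if "\<alpha> < y" "y < \<beta>" for y
      proof
        assume "\<psi> y = t"
        then have "y \<in> Zy" using le that by (simp add: Zy_def \<psi>_def)
        then show False using that free by auto
      qed
      have "(\<forall>y\<in>{\<alpha><..<\<beta>}. \<psi> y > t) \<or> (\<forall>y\<in>{\<alpha><..<\<beta>}. \<psi> y < t)"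
        by (rule constant_sign_on_interval[OF cont nz])
      then have "Mo \<alpha> \<beta> = {} \<or> Eo \<alpha> \<beta> = {}"
      proof
        assume pos: "\<forall>y\<in>{\<alpha><..<\<beta>}. \<psi> y > t"
        have "False" if n: "n \<in> Mo \<alpha> \<beta>" for n
        proof -
          have mr: "n \<in> Mright z" "\<forall>w\<in>T n \<inter> I2. F w \<le> t" "\<alpha> < z n$2" "z n$2 < \<beta>" using n by (auto simp: Mo_def)
          have "Tint n \<subseteq> interior I2" using mr(1) by (auto simp: Mright_def Mset_def Inn_def)
          then have le: "F w \<le> t" if "w \<in> Tint n" for w using mr(2) that Tint_sub interior_subset by blast
          have "z n \<in> closure (Tint n)" using Tint_closure[of n] zc[of n] by blast
          then have "F (z n) \<le> t"
            using continuous_le_on_closure[OF continuous_on_subset[OF continuous_capF subset_UNIV], where S = "Tint n" and x = "z n" and a = t] le by blast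
          moreover have "z n = pt 1 (z n$2)" using Mright_props[OF zc mr(1)] by (intro vec2_eqI) auto
          ultimately have "\<psi> (z n$2) \<le> t" unfolding \<psi>_def F_seam by metis
          then show False using pos mr(3,4) by force
        qed
        then show ?thesis by blast
      next
        assume neg: "\<forall>y\<in>{\<alpha><..<\<beta>}. \<psi> y < t"
        have "False" if n: "n \<in> Eo \<alpha> \<beta>" for n
        proof -
          have mr: "n \<in> Eset z" "F (z n) > t" "\<alpha> < z n$2" "z n$2 < \<beta>" using n by (auto simp: Eo_def)
          have "z n = pt 0 (z n$2)" using Eset_props[OF zc mr(1)] by (intro vec2_eqI) auto
          then have "\<psi> (z n$2) > t" unfolding \<psi>_def using mr(2) by metis
          then show False using neg mr(3,4) by force
        qed
        then show ?thesis by blast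
      qed
      moreover have "x * real m \<le> ?w * (\<mu> * \<kappa> * (\<beta> - \<alpha>)) + 2" if "0 \<le> x" "x \<le> ?w" "real m \<le> \<mu> * \<kappa> * (\<beta> - \<alpha>) + 2" for x and m :: nat
      proof -
        have "x * real m \<le> ?w * (\<mu> * \<kappa> * (\<beta> - \<alpha>) + 2)" using that w1 by (intro mult_mono) auto
        also have "\<dots> = ?w * (\<mu> * \<kappa> * (\<beta> - \<alpha>)) + ?w * 2" by (rule distrib_left)
        also have "\<dots> \<le> ?w * (\<mu> * \<kappa> * (\<beta> - \<alpha>)) + 2" using w1 by simp
        finally show ?thesis .
      qed
      ultimately show ?thesis unfolding P_def \<Phi>_def using cE[of \<alpha> \<beta>] cM[of \<alpha> \<beta>] le \<sigma>_bounds by auto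
    qed
    show "P \<alpha> \<beta> (m + n)" if le: "0 \<le> \<alpha>" "\<alpha> < y" "y < \<beta>" "\<beta> \<le> 1" and PP: "P \<alpha> y m" "P y \<beta> n" for \<alpha> y \<beta> and m n :: nat
    proof -
      define Ey where "Ey = {n \<in> Eset z. F (z n) > t \<and> z n$2 = y}"
      define My where "My = {n \<in> Mright z. (\<forall>w\<in>T n \<inter> I2. F w \<le> t) \<and> z n$2 = y}"
      have c2: "real (card Ey) \<le> 2" "real (card My) \<le> 2"
        using count_E[OF zc, of y y Ey] count_Mright[OF zc, of y y My] by (auto simp: Ey_def My_def)
      have eqs: "Eo \<alpha> \<beta> = (Eo \<alpha> y \<union> Eo y \<beta>) \<union> Ey" "Mo \<alpha> \<beta> = (Mo \<alpha> y \<union> Mo y \<beta>) \<union> My"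
        using le by (auto simp: Eo_def Mo_def Ey_def My_def)
      have c3: "card (A \<union> B \<union> C) \<le> card A + card B + card C" for A B C :: "(int \<times> int) set"
        by (rule order_trans[OF card_Un_le add_right_mono[OF card_Un_le]])
      have "card (Eo \<alpha> \<beta>) \<le> card (Eo \<alpha> y) + card (Eo y \<beta>) + card Ey" "card (Mo \<alpha> \<beta>) \<le> card (Mo \<alpha> y) + card (Mo y \<beta>) + card My"
        unfolding eqs by (rule c3)+
      then have "real (card (Eo \<alpha> \<beta>)) \<le> real (card (Eo \<alpha> y)) + real (card (Eo y \<beta>)) + 2" "real (card (Mo \<alpha> \<beta>)) \<le> real (card (Mo \<alpha> y)) + real (card (Mo y \<beta>)) + 2"
        using c2 by linarith+
      then have "\<Phi> \<alpha> \<beta> \<le> \<sigma> * (real (card (Mo \<alpha> y)) + real (card (Mo y \<beta>)) + 2) + (1 - \<sigma>) * (real (card (Eo \<alpha> y)) + real (card (Eo y \<beta>)) + 2)"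
        unfolding \<Phi>_def using \<sigma>_bounds by (intro add_mono mult_left_mono) auto
      also have "\<dots> = \<Phi> \<alpha> y + \<Phi> y \<beta> + 2" by (simp add: \<Phi>_def algebra_simps)
      also have "\<dots> \<le> ?w * (\<mu> * \<kappa> * (y - \<alpha>)) + (6 * real m - 4) + (?w * (\<mu> * \<kappa> * (\<beta> - y)) + (6 * real n - 4)) + 2"
        using PP unfolding P_def by linarith
      also have "?w * (\<mu> * \<kappa> * (y - \<alpha>)) + (6 * real m - 4) + (?w * (\<mu> * \<kappa> * (\<beta> - y)) + (6 * real n - 4)) + 2
        = ?w * (\<mu> * \<kappa> * (\<beta> - \<alpha>)) + (6 * real (m + n) - 6)" by (simp add: algebra_simps)
      finally show ?thesis unfolding P_def by linarith
    qed
  qed auto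
  moreover have "card (Zy \<inter> {0<..<1}) \<le> 2" using Zy_finite by (meson Int_lower1 card_mono order_trans)
  ultimately have \<Phi>01: "\<Phi> 0 1 \<le> ?w * (\<mu> * \<kappa>) + 14" unfolding P_def by auto
  have E_eq: "{n \<in> Eset z. F (z n) > t} = Eo 0 1" using Eset_props[OF zc] by (auto simp: Eo_def)
  have M_sub: "{n \<in> Mset z. \<forall>w\<in>T n \<inter> I2. F w \<le> t} \<subseteq> Mo 0 1 \<union> Mbot z"
    using Mright_props[OF zc] by (auto simp: Mo_def Mbot_def Mright_def)
  have finMb: "finite (Mbot z)" and cMb: "real (card (Mbot z)) \<le> \<mu> * \<kappa> + 2" using count_Mbot[OF zc] by auto
  have "card {n \<in> Mset z. \<forall>w\<in>T n \<inter> I2. F w \<le> t} \<le> card (Mo 0 1) + card (Mbot z)"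
    using card_mono[OF finite_UnI[OF finM[of 0 1] finMb] M_sub] card_Un_le[of "Mo 0 1" "Mbot z"] by linarith
  then have "real (card {n \<in> Mset z. \<forall>w\<in>T n \<inter> I2. F w \<le> t}) \<le> real (card (Mo 0 1)) + real (card (Mbot z))" by linarith
  then have "\<sigma> * real (card {n \<in> Mset z. \<forall>w\<in>T n \<inter> I2. F w \<le> t}) \<le> \<sigma> * (real (card (Mo 0 1)) + real (card (Mbot z)))"
    using \<sigma>_bounds by (intro mult_left_mono) auto
  then have main: "\<sigma> * real (card {n \<in> Mset z. \<forall>w\<in>T n \<inter> I2. F w \<le> t}) + (1 - \<sigma>) * real (card {n \<in> Eset z. F (z n) > t})
     \<le> \<Phi> 0 1 + \<sigma> * real (card (Mbot z))"
    unfolding E_eq \<Phi>_def by (simp add: algebra_simps)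
  have bot: "\<sigma> * real (card (Mbot z)) \<le> ?w * (\<mu> * \<kappa>) + 2"
  proof -
    have "\<sigma> * real (card (Mbot z)) \<le> ?w * (\<mu> * \<kappa> + 2)" using cMb \<sigma>_bounds w1 by (intro mult_mono) auto
    also have "\<dots> = ?w * (\<mu> * \<kappa>) + ?w * 2" by (rule distrib_left)
    finally show ?thesis using w1 by linarith
  qed
  show ?thesis
  proof (cases "\<xi> = 0")
    case True
    then have "?w * \<mu> * \<kappa> * (if \<xi> = 0 then 2 else 1) = ?w * (\<mu> * \<kappa>) + ?w * (\<mu> * \<kappa>)" by (simp only: if_True) simp
    then show ?thesis using main bot \<Phi>01 by linarith
  next
    case False
    have K0: "0 \<le> ?w * (\<mu> * \<kappa>)" using w1 \<mu>_bounds \<kappa>_pos by simp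
    have "\<Phi> 0 1 + \<sigma> * real (card (Mbot z)) \<le> ?w * (\<mu> * \<kappa>) + 20"
    proof (cases "\<xi> > 0")
      case True
      then have "Eo 0 1 = {}" "Mo 0 1 = {}" using Eset_props(4)[OF zc] Mright_props(4)[OF zc] by (force simp: Eo_def Mo_def)+
      then show ?thesis using bot by (simp add: \<Phi>_def)
    next
      case f: False
      then have "Mbot z = {}" using Mbot_props(3)[OF zc] False by force
      then show ?thesis using \<Phi>01 by simp
    qed
    then show ?thesis using main False by (simp add: mult.assoc)
  qed
qed

end

section \<open>The added points\<close>

lemma cl_I2: "w \<in> I2 \<Longrightarrow> cl w = w"
  by (intro vec2_eqI) (auto simp: cl_def I2_def)

lemma continuous_cl: "continuous_on UNIV cl"
proof -
  have eq: "cl = (\<lambda>w. \<chi> i. max 0 (min 1 (w$i)))" by (auto simp: fun_eq_iff cl_def vec_eq_iff forall_2)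
  show ?thesis unfolding eq by (intro continuous_on_vec_lambda continuous_on_max continuous_on_min continuous_intros)
qed

definition on_edge :: "real^2 \<Rightarrow> bool" where
  "on_edge p \<longleftrightarrow> 0 \<le> p$1 \<and> p$1 \<le> 1 \<and> 0 \<le> p$2 \<and> p$2 \<le> 1 \<and> (p$1 \<in> {0,1} \<or> p$2 \<in> {0,1})"

lemma on_edge_cl: "w \<notin> I2 \<Longrightarrow> on_edge (cl w)"
  by (auto simp: on_edge_def cl_def I2_def min_def max_def)

lemma rho_simps:
  "0 \<le> s \<Longrightarrow> s \<le> 1 \<Longrightarrow> rho s = pt s 0"
  "1 \<le> s \<Longrightarrow> s \<le> 2 \<Longrightarrow> rho s = pt 1 (s - 1)"
  "2 \<le> s \<Longrightarrow> s \<le> 3 \<Longrightarrow> rho s = pt (3 - s) 1"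
  "3 \<le> s \<Longrightarrow> s \<le> 4 \<Longrightarrow> rho s = pt 0 (4 - s)"
  by (auto simp: rho_def hat_def min_def max_def)

lemma on_edge_rho: "0 \<le> s \<Longrightarrow> s \<le> 4 \<Longrightarrow> on_edge (rho s)"
  using rho_simps[of s] by (cases "s \<le> 1"; cases "s \<le> 2"; cases "s \<le> 3") (auto simp: on_edge_def)

lemma cl_on_edge: "on_edge p \<Longrightarrow> cl p = p"
  by (intro vec2_eqI) (auto simp: cl_def on_edge_def)

lemma cl_lipschitz: "\<bar>cl v $ 1 - cl w $ 1\<bar> \<le> \<bar>v$1 - w$1\<bar>" "\<bar>cl v $ 2 - cl w $ 2\<bar> \<le> \<bar>v$2 - w$2\<bar>"
  by (auto simp: cl_def min_def max_def)

context grid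
begin

definition wt :: "int \<times> int \<Rightarrow> real" where "wt n = measure lebesgue (T n \<inter> I2) / area"

lemma wt_bounds: "0 \<le> wt n" "wt n \<le> 1"
proof -
  have "measure lebesgue (T n \<inter> I2) \<le> measure lebesgue (T n)"
    using T_measure(1)[of n] I2_lmeasurable by (intro measure_mono_fmeasurable) auto
  then show "wt n \<le> 1" using T_measure(2)[of n] area_pos by (simp add: wt_def)
  show "0 \<le> wt n" using area_pos by (simp add: wt_def)
qed

text \<open>Tile and square are convex with a common interior point, and shrinking the edge point
  towards it stays in both interiors.\<close>

lemma edge_closure:
  assumes n: "n \<in> AdI" and p: "cell p = n" "on_edge p"
  shows "p \<in> closure (T n \<inter> interior I2)"
proof -
  obtain g where g: "g \<in> interior (T n)" "g \<in> interior I2" using AdI_inner[OF n] by auto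
  have pI: "p \<in> closure I2" using p(2) by (simp add: on_edge_def closure_I2)
  have pT: "p \<in> closure (T n)" by (rule subsetD[OF closure_subset]) (simp add: p(1))
  show ?thesis unfolding closure_approachable
  proof (intro allI impI)
    fix e :: real assume e: "e > 0"
    define r where "r = min 1 (e / (2 * (1 + dist g p)))"
    have dp: "1 + dist g p > 0" by (simp add: add_pos_nonneg)
    have r: "0 < r" "r \<le> 1" using e dp by (auto simp: r_def)
    have "p - r *\<^sub>R (p - g) \<in> interior (T n)"
      by (rule mem_interior_closure_convex_shrink[OF convex_cell g(1) pT r])
    moreover have "p - r *\<^sub>R (p - g) \<in> interior I2"
      by (rule mem_interior_closure_convex_shrink[OF convex_I2 g(2) pI r])
    moreover have "dist (p - r *\<^sub>R (p - g)) p < e"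
    proof -
      have "dist (p - r *\<^sub>R (p - g)) p = r * dist g p" using r(1) by (simp add: dist_norm norm_minus_commute)
      also have "\<dots> \<le> e / (2 * (1 + dist g p)) * (1 + dist g p)" using r dp e by (intro mult_mono) (auto simp: r_def)
      also have "\<dots> = e / 2" using dp by (simp add: divide_simps)
      finally show ?thesis using e by simp
    qed
    ultimately show "\<exists>y\<in>T n \<inter> interior I2. dist y p < e" using interior_subset by blast
  qed
qed

end

section \<open>Shares of the cap in edge tiles, and the exceptional ones\<close>

context gridcap
begin

definition R :: "(real^2) set" where "R = {w \<in> I2. F w > t}"
definition Rhat :: "(real^2) set" where "Rhat = {w. F (cl w) > t}"
definition wR :: "int \<times> int \<Rightarrow> real" where "wR n = measure lebesgue (T n \<inter> R) / area"
definition what :: "int \<times> int \<Rightarrow> real" where "what n = measure lebesgue (T n \<inter> Rhat) / area"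

lemma R_sub: "R \<subseteq> I2" by (auto simp: R_def)

lemma Rhat_I2: "Rhat \<inter> I2 = R" by (auto simp: Rhat_def R_def cl_I2)

lemma R_lmeasurable: "R \<in> lmeasurable"
proof (rule bounded_set_imp_lmeasurable)
  have "I2 \<subseteq> cbox (pt 0 0) (pt 1 1)" by (auto simp: I2_def mem_box_cart forall_2)
  then show "bounded R" using bounded_cbox bounded_subset R_sub by blast
  have "{w \<in> I2. F w > t} \<in> sets borel" by measurable
  then show "R \<in> sets lebesgue" by (simp add: R_def)
qed

lemma measure_R: "measure lebesgue R = \<sigma>"
proof -
  have b: "R \<in> sets lborel" unfolding R_def by measurable
  have "emeasure lborel R = ennreal ((1 - t) / 2)"
    unfolding R_def by (rule emeasure_capF_gt[OF c_pos cb x0]) (use t_lt in auto)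
  then show ?thesis using b t_lt by (simp add: measure_def \<sigma>_def)
qed

lemma Rhat_borel: "Rhat \<in> sets borel"
proof -
  have "continuous_on UNIV (F \<circ> cl)"
    by (intro continuous_on_compose continuous_cl continuous_on_subset[OF continuous_capF subset_UNIV])
  then have "open {w. t < (F \<circ> cl) w}" by (intro open_Collect_less) auto
  then show ?thesis by (simp add: Rhat_def)
qed

lemma T_R_lmeasurable: "T n \<inter> R \<in> lmeasurable" "T n \<inter> Rhat \<in> lmeasurable" "T n \<inter> I2 \<in> lmeasurable"
  using T_measure(1)[of n] R_lmeasurable I2_lmeasurable Rhat_borel
  by (auto intro!: fmeasurable_Int_fmeasurable)

lemma wR_bounds: "0 \<le> wR n" "wR n \<le> wt n"
proof -
  have "T n \<inter> R \<subseteq> T n \<inter> I2" using R_sub by blast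
  from measure_mono_fmeasurable[OF this _ T_R_lmeasurable(3)] show "wR n \<le> wt n"
    using area_pos T_R_lmeasurable(1)[of n] by (simp add: wR_def wt_def divide_right_mono)
qed (use area_pos in \<open>simp add: wR_def\<close>)

lemma what_bounds: "0 \<le> what n" "what n \<le> 1" "what n \<le> wR n + (1 - wt n)"
proof -
  show "0 \<le> what n" using area_pos by (simp add: what_def)
  have "measure lebesgue (T n \<inter> Rhat) \<le> area"
    using measure_mono_fmeasurable[OF _ _ T_measure(1)[of n], of "T n \<inter> Rhat"] T_R_lmeasurable(2)[of n] T_measure(2)[of n] by auto
  then show "what n \<le> 1" using area_pos by (simp add: what_def)
  have D: "measure lebesgue (T n - T n \<inter> I2) = area - measure lebesgue (T n \<inter> I2)"
    using measurable_measure_Diff[OF T_measure(1)[of n], of "T n \<inter> I2"] T_R_lmeasurable(3)[of n] T_measure(2)[of n] by auto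
  have "measure lebesgue (T n \<inter> Rhat) \<le> measure lebesgue ((T n \<inter> R) \<union> (T n - T n \<inter> I2))"
    using T_R_lmeasurable[of n] T_measure(1)[of n] Rhat_I2 by (intro measure_mono_fmeasurable) (auto intro!: fmeasurable.Un fmeasurable.Diff)
  also have "\<dots> \<le> measure lebesgue (T n \<inter> R) + measure lebesgue (T n - T n \<inter> I2)"
    using T_R_lmeasurable[of n] T_measure(1)[of n] by (intro measure_Un_le) auto
  finally have "measure lebesgue (T n \<inter> Rhat) \<le> measure lebesgue (T n \<inter> R) + (area - measure lebesgue (T n \<inter> I2))" unfolding D .
  then have "what n \<le> (measure lebesgue (T n \<inter> R) + (area - measure lebesgue (T n \<inter> I2))) / area"
    unfolding what_def using area_pos by (intro divide_right_mono) auto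
  then show "what n \<le> wR n + (1 - wt n)" using area_pos by (simp add: wR_def wt_def add_divide_distrib diff_divide_distrib)
qed

definition Exc :: "(real^2) set" where
  "Exc = {pt 0 0, pt 0 1, pt 1 0, pt 1 1} \<union> pt 0 ` Zy \<union> pt 1 ` Zy"

lemma Exc_finite: "finite Exc" and card_Exc: "card Exc \<le> 8"
proof -
  show "finite Exc" using Zy_finite(1) by (simp add: Exc_def)
  have "card {pt 0 0, pt 0 1, pt 1 0, pt 1 1} \<le> 4" by (intro card_insert_le_m1) auto
  moreover have "card (pt 0 ` Zy) \<le> 2" "card (pt 1 ` Zy) \<le> 2"
    using card_image_le[OF Zy_finite(1)] Zy_finite(2) order_trans by blast+
  moreover have "card Exc \<le> card {pt 0 0, pt 0 1, pt 1 0, pt 1 1} + card (pt 0 ` Zy) + card (pt 1 ` Zy)"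
    unfolding Exc_def by (rule order_trans[OF card_Un_le add_right_mono[OF card_Un_le]])
  ultimately show "card Exc \<le> 8" by linarith
qed

lemma F_bottom: "F (pt x 0) = b" and F_top: "F (pt x 1) = - b"
  by (simp_all add: capF_def)

text \<open>The bottom and top edges are mapped to the poles, so \<open>F\<close> is constant on
  each of them. The sign of \<open>F - t\<close> can change between nearby edge points only at a
  corner or at a zero on a vertical edge.\<close>

lemma sign_change_near_exception:
  assumes p: "on_edge p" "F p < t" and q: "on_edge q" "F q > t"
    and d: "\<bar>p$1 - q$1\<bar> \<le> d" "\<bar>p$2 - q$2\<bar> \<le> d" "d < 1"
  shows "\<exists>e\<in>Exc. \<bar>p$1 - e$1\<bar> \<le> d \<and> \<bar>p$2 - e$2\<bar> \<le> d"
proof -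
  have d0: "d \<ge> 0" using d by linarith
  have corner: ?thesis if "x \<in> {0,1}" "y \<in> {0,1}" "\<bar>p$1 - x\<bar> \<le> d" "\<bar>p$2 - y\<bar> \<le> d" for x y
    using that by (intro bexI[of _ "pt x y"]) (auto simp: Exc_def)
  consider "p$1 \<in> {0,1}" "q$1 \<in> {0,1}" | "p$1 \<in> {0,1}" "q$2 \<in> {0,1}" | "p$2 \<in> {0,1}" "q$1 \<in> {0,1}" | "p$2 \<in> {0,1}" "q$2 \<in> {0,1}"
    using p(1) q(1) unfolding on_edge_def by blast
  then show ?thesis
  proof cases
    case 1
    then have eq: "q$1 = p$1" using d by auto
    define x where "x = p$1"
    have x: "x \<in> {0,1}" using 1 by (simp add: x_def)
    have pe: "p = pt x (p$2)" and qe: "q = pt x (q$2)" by (auto intro!: vec2_eqI simp: x_def eq)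
    define \<psi> where "\<psi> y = F (pt x y)" for y
    have cont: "continuous_on A \<psi>" for A unfolding \<psi>_def capF_def vector_2 by (intro continuous_intros)
    have s: "\<psi> (p$2) < t" "\<psi> (q$2) > t" using p(2) q(2) pe qe unfolding \<psi>_def by metis+
    obtain y where y: "\<psi> y = t" "min (p$2) (q$2) \<le> y" "y \<le> max (p$2) (q$2)"
    proof (cases "p$2 \<le> q$2")
      case True
      then show ?thesis using IVT'[of \<psi> "p$2" t "q$2", OF _ _ _ cont] s by (auto intro: that)
    next
      case False
      then show ?thesis using IVT2'[of \<psi> "p$2" t "q$2", OF _ _ _ cont] s by (auto intro: that)
    qed
    have "y \<noteq> p$2" "y \<noteq> q$2" using s y(1) by auto
    moreover have "0 \<le> p$2" "p$2 \<le> 1" "0 \<le> q$2" "q$2 \<le> 1" using p(1) q(1) by (auto simp: on_edge_def)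
    ultimately have "0 < y" "y < 1" "\<bar>p$2 - y\<bar> \<le> d" using y(2,3) d(2) by linarith+
    moreover have "F (pt 0 y) = t" using y(1) x F_seam[of y] by (auto simp: \<psi>_def)
    ultimately have "pt x y \<in> Exc" "\<bar>p$2 - y\<bar> \<le> d" using x by (auto simp: Exc_def Zy_def)
    then show ?thesis using d0 by (intro bexI[of _ "pt x y"]) (auto simp: x_def)
  next
    case 2
    then show ?thesis using d d0 by (intro corner[of "p$1" "q$2"]) auto
  next
    case 3
    then show ?thesis using d d0 by (intro corner[of "q$1" "p$2"]) auto
  next
    case 4
    then have eq: "q$2 = p$2" using d by auto
    have "F p = F (pt (p$1) (p$2))" "F q = F (pt (q$1) (p$2))" using pt_eta[of p] pt_eta[of q] eq by simp_all
    then have "F p = F q" using 4 F_bottom F_top by auto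
    then show ?thesis using p q by simp
  qed
qed

definition ExT :: "(int \<times> int) set" where
  "ExT = (\<Union>e\<in>Exc. {n. \<exists>w. cell w = n \<and> \<bar>w$1 - e$1\<bar> \<le> 2 / \<kappa> \<and> \<bar>w$2 - e$2\<bar> \<le> 2 / \<kappa>})"

text \<open>There are at most eight exceptional points, and around each the cells within the
  diameter bound \<open>2 / \<kappa>\<close> are counted. The result does not depend on
  \<open>\<kappa>\<close>.\<close>

definition CE :: real where "CE = 8 * (4 * (1 + \<bar>\<xi>\<bar>) + 3)\<^sup>2"

lemma ExT_finite: "finite ExT" and card_ExT: "real (card ExT) \<le> CE"
proof -
  have k: "2 / \<kappa> \<ge> 0" using \<kappa>_pos by simp
  show "finite ExT" unfolding ExT_def using Exc_finite cells_near(1)[OF k] by blast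
  let ?X = "\<lambda>e::real^2. {n. \<exists>w. cell w = n \<and> \<bar>w$1 - e$1\<bar> \<le> 2 / \<kappa> \<and> \<bar>w$2 - e$2\<bar> \<le> 2 / \<kappa>}"
  have one: "real (card (?X e)) \<le> (4 * (1 + \<bar>\<xi>\<bar>) + 3)\<^sup>2" for e
  proof -
    have "2 * (\<kappa> * (1 + \<bar>\<xi>\<bar>) * (2 / \<kappa>)) + 3 = 4 * (1 + \<bar>\<xi>\<bar>) + 3" using \<kappa>_pos by simp
    then show ?thesis using cells_near(2)[OF k, of e] by simp
  qed
  have "real (card ExT) \<le> real (\<Sum>e\<in>Exc. card (?X e))" unfolding ExT_def using card_UN_le[OF Exc_finite, of ?X] by (simp only: of_nat_le_iff)
  also have "\<dots> \<le> (\<Sum>e\<in>Exc. (4 * (1 + \<bar>\<xi>\<bar>) + 3)\<^sup>2)" unfolding of_nat_sum by (intro sum_mono one)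
  also have "\<dots> \<le> CE" unfolding CE_def using card_Exc by (simp add: mult_right_mono)
  finally show "real (card ExT) \<le> CE" .
qed

lemma edge_sign:
  assumes n: "n \<in> AdI" and p: "cell p = n" "on_edge p"
  shows "F p > t \<Longrightarrow> \<exists>w\<in>I2. cell w = n \<and> F w > t"
    and "F p < t \<Longrightarrow> \<exists>w\<in>I2. cell w = n \<and> F w \<le> t"
proof -
  have cl: "p \<in> closure (T n \<inter> interior I2)" by (rule edge_closure[OF n p])
  have cF: "continuous_on S F" for S by (rule continuous_on_subset[OF continuous_capF subset_UNIV])
  show "\<exists>w\<in>I2. cell w = n \<and> F w > t" if "F p > t"
  proof (rule ccontr)
    assume "\<not> ?thesis"
    then have "\<And>w. w \<in> T n \<inter> interior I2 \<Longrightarrow> F w \<le> t" using interior_subset by (fastforce simp: not_less)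
    then have "F p \<le> t" by (rule continuous_le_on_closure[OF cF cl])
    then show False using that by simp
  qed
  show "\<exists>w\<in>I2. cell w = n \<and> F w \<le> t" if "F p < t"
  proof (rule ccontr)
    assume "\<not> ?thesis"
    then have "\<And>w. w \<in> T n \<inter> interior I2 \<Longrightarrow> F w \<ge> t" using interior_subset by (fastforce simp: not_le)
    then have "F p \<ge> t" by (rule continuous_ge_on_closure[OF cF cl])
    then show False using that by simp
  qed
qed

text \<open>If the tile had a part outside the square with \<open>F > t\<close> after clamping, it
  would yield an edge point of opposite sign within one tile diameter, and the tile would be
  exceptional.\<close>

lemma what_eq_wR:
  assumes p: "cell p = n" "on_edge p" "F p < t" and n: "n \<notin> ExT" and k: "\<kappa> > 2"
  shows "what n = wR n"
proof -
  have "T n \<inter> Rhat = T n \<inter> R"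
  proof (intro equalityI subsetI)
    fix w assume w: "w \<in> T n \<inter> Rhat"
    show "w \<in> T n \<inter> R"
    proof (rule ccontr)
      assume "w \<notin> T n \<inter> R"
      then have wI: "w \<notin> I2" using w Rhat_I2 by blast
      have "cell p = cell w" using w p(1) by simp
      note dd = T_diam[OF this]
      have "\<bar>p$1 - cl w$1\<bar> \<le> 2 / \<kappa>" "\<bar>p$2 - cl w$2\<bar> \<le> 2 / \<kappa>"
        using cl_lipschitz[of p w] dd unfolding cl_on_edge[OF p(2)] by linarith+
      moreover have "F (cl w) > t" using w by (simp add: Rhat_def)
      moreover have "2 / \<kappa> < 1" using k by simp
      ultimately obtain e where "e \<in> Exc" "\<bar>p$1 - e$1\<bar> \<le> 2 / \<kappa> \<and> \<bar>p$2 - e$2\<bar> \<le> 2 / \<kappa>"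
        using sign_change_near_exception[OF p(2,3) on_edge_cl[OF wI]] by blast
      then show False using n p(1) unfolding ExT_def by blast
    qed
  qed (use Rhat_I2 in auto)
  then show ?thesis by (simp add: what_def wR_def)
qed

end

text \<open>What the count needs from a run: \<open>nn\<close> lists the edge tiles along the
  boundary, \<open>tt\<close> their parameters, and \<open>C k\<close> the indices at which edge
  \<open>k\<close> receives a point. Of the selection rule only \<open>C_card\<close> is kept: on
  consecutive tiles of one edge the number of added points agrees with the weight up to 1.\<close>

locale modrun = grid \<xi> \<kappa> for \<xi> \<kappa> +
  fixes z :: "int \<times> int \<Rightarrow> real^2" and \<zeta> :: "nat \<Rightarrow> real^2" and L :: nat and tt :: "nat \<Rightarrow> real"
    and nn :: "nat \<Rightarrow> int \<times> int" and C :: "nat \<Rightarrow> nat set" and P :: "(real^2) set"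
  assumes zc: "\<And>n. cell (z n) = n"
    and nn_inj: "inj_on nn {..<L}" and nn_range: "nn ` {..<L} = AdI"
    and tt_mono: "\<And>i j. i < j \<Longrightarrow> j < L \<Longrightarrow> tt i < tt j"
    and tt_range: "\<And>j. j < L \<Longrightarrow> 0 \<le> tt j \<and> tt j \<le> 4"
    and tt_cell: "\<And>j. j < L \<Longrightarrow> cell (rho (tt j)) = nn j"
    and C_sub: "\<And>k. k \<in> {1..4} \<Longrightarrow> C k \<subseteq> {j. j < L \<and> real k - 1 \<le> tt j \<and> tt j < real k}"
    and \<zeta>_in: "\<And>k j. k \<in> {1..4} \<Longrightarrow> j \<in> C k \<Longrightarrow> cell (\<zeta> j) = nn j \<and> \<zeta> j \<in> I2"
    and C_card: "\<And>k i j. k \<in> {1..4} \<Longrightarrow> i \<le> j \<Longrightarrow> j < L \<Longrightarrow> real k - 1 \<le> tt i \<Longrightarrow> tt j < real k \<Longrightarrow>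
        \<bar>real (card (C k \<inter> {i..j})) - (\<Sum>l=i..j. wt (nn l))\<bar> \<le> 1"
    and P_eq: "P = {z n |n. n \<notin> AdI \<and> z n \<in> I2} \<union> \<zeta> ` (\<Union>k\<in>{1..4}. C k)"
    and \<kappa>_gt2: "\<kappa> > 2"
begin

definition J :: "real \<Rightarrow> real \<Rightarrow> nat set" where "J \<alpha> \<beta> = {j. j < L \<and> \<alpha> < tt j \<and> tt j < \<beta>}"
definition B :: "nat \<Rightarrow> nat set" where "B k = {j. j < L \<and> real k - 1 \<le> tt j \<and> tt j < real k}"

lemma J_finite: "finite (J \<alpha> \<beta>)" by (simp add: J_def)
lemma B_finite: "finite (B k)" by (simp add: B_def)

lemma order_interval_eq:
  assumes S: "S = {j. j < L \<and> V (tt j)}" and cvx: "\<And>u v w. V u \<Longrightarrow> V w \<Longrightarrow> u \<le> v \<Longrightarrow> v \<le> w \<Longrightarrow> V v" and ne: "S \<noteq> {}"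
  shows "S = {Min S..Max S}"
proof -
  have fin: "finite S" unfolding S by simp
  have mm: "Min S \<in> S" "Max S \<in> S" using fin ne by auto
  have mono: "tt i \<le> tt j" if "i \<le> j" "j < L" for i j using tt_mono[of i j] that by (cases "i = j") auto
  show ?thesis
  proof (intro equalityI subsetI)
    fix j assume "j \<in> {Min S..Max S}"
    then have j: "Min S \<le> j" "j \<le> Max S" by auto
    have inS: "i \<in> S \<longleftrightarrow> i < L \<and> V (tt i)" for i using S by blast
    have V: "V (tt (Min S))" "V (tt (Max S))" "Max S < L" using mm inS by blast+
    have "tt (Min S) \<le> tt j" "tt j \<le> tt (Max S)" using mono j V(3) by simp_all
    then have "V (tt j)" using cvx V by blast
    then show "j \<in> S" using inS j V(3) by simp
  qed (use fin in auto)
qed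

end

section \<open>Surplus of the added points along one edge\<close>

locale modcap = gridcap \<xi> \<kappa> c b x0 t + modrun \<xi> \<kappa> z \<zeta> L tt nn C P
  for \<xi> \<kappa> c b x0 t z \<zeta> L tt nn C P
begin

lemma nn_AdI: "j < L \<Longrightarrow> nn j \<in> AdI" using nn_range by auto

text \<open>The error contributed by the \<open>j\<close>-th edge tile beyond the share of that tile in \<open>main_count\<close>.
  Where \<open>F > t\<close> on the edge, the number of added points follows the accumulated weight; where \<open>F < t\<close>,
  no tile contributes unless it is near a corner or a zero of \<open>F - t\<close> on the edge.\<close>

definition gain :: "nat \<Rightarrow> nat \<Rightarrow> real" where
  "gain k j = (if j \<in> C k \<and> F (\<zeta> j) > t then 1 else 0) - wR (nn j) - (if hit (nn j) then 1 - what (nn j) else 0)"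

lemma gain_le_1: "gain k j \<le> 1"
  unfolding gain_def using wR_bounds(1)[of "nn j"] what_bounds(2)[of "nn j"] by auto

text \<open>The inequality \<open>what \<le> wR + (1 - wt)\<close> turns the credit of a hit tile
  into its full weight; an edge tile that is not hit lies in the cap, so \<open>wR = wt\<close>.
  Either way the gain is comparable with points minus weight.\<close>

lemma gain_positive_edge:
  assumes "j < L" "F (rho (tt j)) > t"
  shows "gain k j \<le> (if j \<in> C k then 1 else 0) - wt (nn j)"
proof -
  obtain w where w: "w \<in> I2" "cell w = nn j" "F w > t"
    using edge_sign(1)[OF nn_AdI tt_cell on_edge_rho assms(2)] assms(1) tt_range by blast
  show ?thesis
  proof (cases "hit (nn j)")
    case True
    then show ?thesis unfolding gain_def using what_bounds(3)[of "nn j"] by auto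
  next
    case False
    then have "T (nn j) \<inter> R = T (nn j) \<inter> I2" using w unfolding hit_def R_def by force
    then have "wR (nn j) = wt (nn j)" by (simp add: wR_def wt_def)
    then show ?thesis unfolding gain_def using False by auto
  qed
qed

text \<open>In a hit tile \<open>what = wR\<close> cancels the possible point; a tile that is not
  hit lies outside the cap and so does a point added in it.\<close>

lemma gain_negative_edge:
  assumes k: "k \<in> {1..4}" and j: "j < L" "F (rho (tt j)) < t" and x: "nn j \<notin> ExT"
  shows "gain k j \<le> 0"
proof -
  obtain w where w: "w \<in> I2" "cell w = nn j" "F w \<le> t"
    using edge_sign(2)[OF nn_AdI tt_cell on_edge_rho j(2)] j(1) tt_range by blast
  show ?thesis
  proof (cases "hit (nn j)")
    case True
    have "what (nn j) = wR (nn j)"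
      by (rule what_eq_wR[OF tt_cell on_edge_rho j(2) x \<kappa>_gt2]) (use j tt_range in auto)
    then show ?thesis unfolding gain_def using True by auto
  next
    case False
    then have "\<not> F (\<zeta> j) > t" if "j \<in> C k" using w \<zeta>_in[OF k that] unfolding hit_def by blast
    then show ?thesis unfolding gain_def using False wR_bounds(1)[of "nn j"] by auto
  qed
qed

lemma edge_zeros:
  assumes k: "k \<in> {1..4}"
  shows "finite {\<tau>. real k - 1 < \<tau> \<and> \<tau> < real k \<and> F (rho \<tau>) = t}" "card {\<tau>. real k - 1 < \<tau> \<and> \<tau> < real k \<and> F (rho \<tau>) = t} \<le> 2"
proof -
  let ?Z = "{\<tau>. real k - 1 < \<tau> \<and> \<tau> < real k \<and> F (rho \<tau>) = t}"
  have bt': "b \<noteq> t" "- b \<noteq> t" using bt by auto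
  obtain f :: "real \<Rightarrow> real" where f: "?Z \<subseteq> f ` Zy"
  proof -
    consider "k = 1" | "k = 2" | "k = 3" | "k = 4" using k by fastforce
    then show ?thesis
    proof cases
      case 1
      then have "?Z = {}" using bt' by (auto simp: rho_simps F_bottom)
      then show ?thesis using that by blast
    next
      case 2
      have "?Z \<subseteq> (\<lambda>y. y + 1) ` Zy"
      proof
        fix \<tau> assume "\<tau> \<in> ?Z"
        then have "\<tau> - 1 \<in> Zy" using 2 by (auto simp: rho_simps Zy_def F_seam)
        then show "\<tau> \<in> (\<lambda>y. y + 1) ` Zy" by (intro image_eqI[of _ _ "\<tau> - 1"]) auto
      qed
      then show ?thesis by (rule that)
    next
      case 3
      then have "?Z = {}" using bt' by (auto simp: rho_simps F_top)
      then show ?thesis using that by blast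
    next
      case 4
      have "?Z \<subseteq> (\<lambda>y. 4 - y) ` Zy"
      proof
        fix \<tau> assume "\<tau> \<in> ?Z"
        then have "4 - \<tau> \<in> Zy" using 4 by (auto simp: rho_simps Zy_def)
        then show "\<tau> \<in> (\<lambda>y. 4 - y) ` Zy" by (intro image_eqI[of _ _ "4 - \<tau>"]) auto
      qed
      then show ?thesis by (rule that)
    qed
  qed
  show "finite ?Z" by (rule finite_subset[OF f finite_imageI[OF Zy_finite(1)]])
  have "card ?Z \<le> card (f ` Zy)" by (rule card_mono[OF finite_imageI[OF Zy_finite(1)] f])
  also have "\<dots> \<le> 2" using card_image_le[OF Zy_finite(1)] Zy_finite(2) order_trans by blast
  finally show "card ?Z \<le> 2" .
qed

lemma CE_nonneg: "CE \<ge> 0" by (simp add: CE_def)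

lemma edge_gain_base:
  assumes k: "k \<in> {1..4}" and ab: "real k - 1 \<le> \<alpha>" "\<beta> \<le> real k"
    and s: "(\<forall>\<tau>\<in>{\<alpha><..<\<beta>}. F (rho \<tau>) > t) \<or> (\<forall>\<tau>\<in>{\<alpha><..<\<beta>}. F (rho \<tau>) < t)"
  shows "(\<Sum>j\<in>J \<alpha> \<beta>. gain k j) \<le> 1 + CE"
  using s
proof
  assume pos: "\<forall>\<tau>\<in>{\<alpha><..<\<beta>}. F (rho \<tau>) > t"
  show ?thesis
  proof (cases "J \<alpha> \<beta> = {}")
    case True
    then show ?thesis using CE_nonneg by simp
  next
    case False
    define lo hi where "lo = Min (J \<alpha> \<beta>)" and "hi = Max (J \<alpha> \<beta>)"
    have Jeq: "J \<alpha> \<beta> = {lo..hi}" unfolding lo_def hi_def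
      by (rule order_interval_eq[where V = "\<lambda>x. \<alpha> < x \<and> x < \<beta>"]) (use False in \<open>auto simp: J_def\<close>)
    have mm: "lo \<in> J \<alpha> \<beta>" "hi \<in> J \<alpha> \<beta>" unfolding lo_def hi_def using J_finite False by auto
    have lh: "lo \<le> hi" using mm(1) Jeq by auto
    have "(\<Sum>j\<in>J \<alpha> \<beta>. gain k j) \<le> (\<Sum>j\<in>J \<alpha> \<beta>. (if j \<in> C k then 1 else 0) - wt (nn j))"
      using pos by (intro sum_mono gain_positive_edge) (auto simp: J_def)
    also have "\<dots> = real (card (C k \<inter> {lo..hi})) - (\<Sum>j=lo..hi. wt (nn j))"
      unfolding Jeq sum_subtractf by (simp add: sum.If_cases Int_commute)
    also have "\<dots> \<le> 1" using C_card[OF k lh] mm ab by (auto simp: J_def abs_le_iff)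
    finally show ?thesis using CE_nonneg by simp
  qed
next
  assume neg: "\<forall>\<tau>\<in>{\<alpha><..<\<beta>}. F (rho \<tau>) < t"
  have "(\<Sum>j\<in>J \<alpha> \<beta>. gain k j) \<le> (\<Sum>j\<in>J \<alpha> \<beta>. if nn j \<in> ExT then 1 else 0)"
  proof (rule sum_mono)
    fix j assume j: "j \<in> J \<alpha> \<beta>"
    show "gain k j \<le> (if nn j \<in> ExT then 1 else 0)"
      using gain_le_1[of k j] gain_negative_edge[OF k, of j] j neg by (auto simp: J_def)
  qed
  also have "\<dots> = real (card {j \<in> J \<alpha> \<beta>. nn j \<in> ExT})" using J_finite by (simp add: sum.If_cases Int_def)
  also have "\<dots> \<le> real (card ExT)"
  proof -
    have "inj_on nn {j \<in> J \<alpha> \<beta>. nn j \<in> ExT}" by (rule inj_on_subset[OF nn_inj]) (auto simp: J_def)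
    then show ?thesis using card_inj_on_le[of nn "{j \<in> J \<alpha> \<beta>. nn j \<in> ExT}" ExT] ExT_finite by auto
  qed
  finally show ?thesis using card_ExT by linarith
qed

lemma single_gain: "(\<Sum>j\<in>{j. j < L \<and> tt j = \<tau>}. gain k j) \<le> 1"
proof -
  have "card {j. j < L \<and> tt j = \<tau>} \<le> 1"
    unfolding One_nat_def
    by (subst card_le_Suc0_iff_eq) (auto, metis less_irrefl linorder_neqE_nat tt_mono)
  moreover have "(\<Sum>j\<in>{j. j < L \<and> tt j = \<tau>}. gain k j) \<le> real (card {j. j < L \<and> tt j = \<tau>}) * 1"
    by (rule sum_bounded_above) (rule gain_le_1)
  ultimately show ?thesis by simp
qed

lemma edge_gain:
  assumes k: "k \<in> {1..4}"
  shows "(\<Sum>j\<in>B k. gain k j) \<le> 6 + 3 * CE"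
proof -
  define Z where "Z = {\<tau>. real k - 1 < \<tau> \<and> \<tau> < real k \<and> F (rho \<tau>) = t}"
  \<comment> \<open>A piece costs \<open>1 + CE\<close> and a breakpoint at most 1, so m pieces cost
    \<open>(2 + CE) * m - 1\<close>. Three pieces and the tile at the initial corner give
    \<open>6 + 3 * CE\<close>.\<close>
  define Q where "Q \<alpha> \<beta> m \<longleftrightarrow> (\<Sum>j\<in>J \<alpha> \<beta>. gain k j) \<le> (2 + CE) * real m - 1" for \<alpha> \<beta> and m :: nat
  have cont: "continuous_on A rho" for A
  proof -
    have eq: "rho = (\<lambda>s. \<chi> i. if i = 1 then hat s else hat (4 - s))" by (auto simp: fun_eq_iff rho_def vec_eq_iff forall_2)
    have h: "continuous_on A hat" "continuous_on A (\<lambda>s. hat (4 - s))" unfolding hat_def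
      by (intro continuous_on_max continuous_on_min continuous_intros)+
    show ?thesis unfolding eq
    proof (intro continuous_on_vec_lambda)
      show "continuous_on A (\<lambda>s. if i = 1 then hat s else hat (4 - s))" for i :: 2 using h by (cases "i = 1") auto
    qed
  qed
  have "Q (real k - 1) (real k) (card (Z \<inter> {real k - 1<..<real k}) + 1)"
  proof (rule breakpoint_induct[where lo = "real k - 1" and hi = "real k"])
    show "finite Z" unfolding Z_def by (rule edge_zeros[OF k])
    show "Q \<alpha> \<beta> 1" if ab: "real k - 1 \<le> \<alpha>" "\<alpha> < \<beta>" "\<beta> \<le> real k" and free: "Z \<inter> {\<alpha><..<\<beta>} = {}" for \<alpha> \<beta>
    proof -
      have nz: "(F \<circ> rho) \<tau> \<noteq> t" if "\<alpha> < \<tau>" "\<tau> < \<beta>" for \<tau>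
      proof
        assume "(F \<circ> rho) \<tau> = t"
        then have "\<tau> \<in> Z" using that ab by (simp add: Z_def)
        then show False using that free by auto
      qed
      have cF: "continuous_on {\<alpha><..<\<beta>} (F \<circ> rho)"
        by (rule continuous_on_compose[OF cont continuous_on_subset[OF continuous_capF subset_UNIV]])
      have "(\<Sum>j\<in>J \<alpha> \<beta>. gain k j) \<le> 1 + CE"
        using edge_gain_base[OF k ab(1,3)] constant_sign_on_interval[OF cF nz] by simp
      then show ?thesis by (simp add: Q_def)
    qed
    show "Q \<alpha> \<beta> (m + n)" if ab: "real k - 1 \<le> \<alpha>" "\<alpha> < \<tau>" "\<tau> < \<beta>" "\<beta> \<le> real k" and QQ: "Q \<alpha> \<tau> m" "Q \<tau> \<beta> n"
      for \<alpha> \<tau> \<beta> and m n :: nat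
    proof -
      let ?S = "{j. j < L \<and> tt j = \<tau>}"
      have eq: "J \<alpha> \<beta> = (J \<alpha> \<tau> \<union> J \<tau> \<beta>) \<union> ?S" using ab by (auto simp: J_def)
      have "(\<Sum>j\<in>J \<alpha> \<beta>. gain k j) = (\<Sum>j\<in>J \<alpha> \<tau> \<union> J \<tau> \<beta>. gain k j) + (\<Sum>j\<in>?S. gain k j)"
        unfolding eq by (rule sum.union_disjoint) (auto simp: J_def)
      also have "(\<Sum>j\<in>J \<alpha> \<tau> \<union> J \<tau> \<beta>. gain k j) = (\<Sum>j\<in>J \<alpha> \<tau>. gain k j) + (\<Sum>j\<in>J \<tau> \<beta>. gain k j)"
        by (rule sum.union_disjoint) (auto simp: J_def)
      finally have "(\<Sum>j\<in>J \<alpha> \<beta>. gain k j) \<le> ((2 + CE) * real m - 1) + ((2 + CE) * real n - 1) + 1"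
        using QQ single_gain[of k \<tau>] unfolding Q_def by linarith
      then show ?thesis by (simp add: Q_def algebra_simps)
    qed
  qed auto
  moreover have "card (Z \<inter> {real k - 1<..<real k}) + 1 \<le> 3"
    using edge_zeros[OF k] card_mono[of Z "Z \<inter> {real k - 1<..<real k}"] unfolding Z_def by auto
  then have "(2 + CE) * real (card (Z \<inter> {real k - 1<..<real k}) + 1) \<le> (2 + CE) * 3"
    using CE_nonneg by (intro mult_left_mono) auto
  then have "(2 + CE) * real (card (Z \<inter> {real k - 1<..<real k}) + 1) \<le> 6 + 3 * CE" by (simp add: algebra_simps)
  ultimately have main: "(\<Sum>j\<in>J (real k - 1) (real k). gain k j) \<le> 5 + 3 * CE" unfolding Q_def by linarith
  have "(\<Sum>j\<in>B k. gain k j) = (\<Sum>j\<in>J (real k - 1) (real k) \<union> {j. j < L \<and> tt j = real k - 1}. gain k j)"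
    by (rule sum.cong) (auto simp: B_def J_def)
  also have "\<dots> = (\<Sum>j\<in>J (real k - 1) (real k). gain k j) + (\<Sum>j\<in>{j. j < L \<and> tt j = real k - 1}. gain k j)"
    by (rule sum.union_disjoint) (auto simp: J_def)
  finally show ?thesis using main single_gain[of k "real k - 1"] by linarith
qed

end

section \<open>Counting the points of the modified set\<close>

context grid
begin

text \<open>For the convex set \<open>I2\<close> the closure has the same interior, so near a
  frontier point there are points outside the closure. If the frontier point were interior to the
  tile, some of them would lie in the open tile.\<close>

lemma Inn_not_Ad: "Inn \<inter> AdI = {}"
proof (rule ccontr)
  assume "Inn \<inter> AdI \<noteq> {}"
  then obtain n f where n: "n \<in> Inn" and f: "f \<in> interior (T n)" "f \<in> frontier I2" by (auto simp: AdI_def)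
  have "f \<notin> interior (closure I2)" using f(2) convex_interior_closure[OF convex_I2] by (simp add: frontier_def)
  then have "f \<in> closure (- closure I2)" by (simp add: interior_closure)
  then have "interior (T n) \<inter> - closure I2 \<noteq> {}"
    using f(1) open_Int_closure_eq_empty[of "interior (T n)" "- closure I2"] by auto
  then obtain g where g: "g \<in> interior (T n) \<inter> - closure I2" by blast
  have "g \<in> closure (Tint n)" using g interior_subset Tint_closure by blast
  moreover have "open (interior (T n) \<inter> - closure I2)" by (intro open_Int open_interior open_Compl closed_closure)
  ultimately have "interior (T n) \<inter> - closure I2 \<inter> Tint n \<noteq> {}"
    using g open_Int_closure_eq_empty by blast
  then show False using n interior_subset closure_subset unfolding Inn_def by blast
qed

lemma Out_not_Ad:
  assumes "Tint n \<inter> closure I2 = {}"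
  shows "n \<notin> AdI"
proof
  assume "n \<in> AdI"
  then obtain g where g: "g \<in> interior (T n) \<inter> interior I2" using AdI_inner by blast
  have "g \<in> closure (Tint n)" using g interior_subset Tint_closure by blast
  then have "interior (T n) \<inter> interior I2 \<inter> Tint n \<noteq> {}"
    using g open_Int_closure_eq_empty[of "interior (T n) \<inter> interior I2" "Tint n"] by blast
  then show False using assms interior_subset closure_subset by blast
qed

lemma Inn_not_Out: "n \<in> Inn \<Longrightarrow> Tint n \<inter> closure I2 \<noteq> {}"
  using Tint_ne[of n] interior_subset[of I2] closure_subset[of I2] unfolding Inn_def by blast

lemma finite_Inn: "finite Inn" and finite_AdI: "finite AdI"
  using finite_subset[OF Inn_sub_Act finite_Act] finite_subset[OF AdI_sub_Act finite_Act] by auto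

lemma measure_split:
  assumes S: "S \<in> lmeasurable" "S \<subseteq> I2"
  shows "measure lebesgue S = (\<Sum>n\<in>Inn. measure lebesgue (T n \<inter> S)) + (\<Sum>n\<in>AdI. measure lebesgue (T n \<inter> S))"
proof -
  have "measure lebesgue S = (\<Sum>n\<in>Act. measure lebesgue (T n \<inter> S))"
    by (rule measure_cells_sum[symmetric, OF S(1) finite_Act]) (use S(2) in \<open>auto simp: Act_def\<close>)
  also have "\<dots> = (\<Sum>n\<in>Inn \<union> AdI. measure lebesgue (T n \<inter> S))"
  proof (rule sum.mono_neutral_right[OF finite_Act])
    show "Inn \<union> AdI \<subseteq> Act" using Inn_sub_Act AdI_sub_Act by blast
    show "\<forall>n\<in>Act - (Inn \<union> AdI). measure lebesgue (T n \<inter> S) = 0"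
      using not_Ad_cases measure_T_I2_Out S unfolding Inn_def by blast
  qed
  also have "\<dots> = (\<Sum>n\<in>Inn. measure lebesgue (T n \<inter> S)) + (\<Sum>n\<in>AdI. measure lebesgue (T n \<inter> S))"
    by (rule sum.union_disjoint[OF finite_Inn finite_AdI Inn_not_Ad])
  finally show ?thesis .
qed

lemma wt_Inn: "n \<in> Inn \<Longrightarrow> wt n = 1"
  using measure_T_Int_Inn[of n UNIV] T_measure(2)[of n] area_pos by (simp add: wt_def)

end

section \<open>Size of the modified point set\<close>

context modrun
begin

lemma finite_Eset: "finite (Eset z)" and card_Eset: "real (card (Eset z)) \<le> \<mu> * \<kappa> + 2"
proof -
  have "finite (Eset z) \<and> real (card (Eset z)) \<le> \<mu> * \<kappa> * (1 - 0) + 2"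
    by (rule count_E[OF zc]) (auto dest: Eset_props(2,3)[OF zc])
  then show "finite (Eset z)" "real (card (Eset z)) \<le> \<mu> * \<kappa> + 2" by auto
qed

lemma finite_Mset: "finite (Mset z)" and card_Mset: "real (card (Mset z)) \<le> 2 * (\<mu> * \<kappa> + 2)"
proof -
  have r: "finite (Mright z) \<and> real (card (Mright z)) \<le> \<mu> * \<kappa> * (1 - 0) + 2"
    by (rule count_Mright[OF zc]) (auto dest: Mright_props(2,3)[OF zc])
  have b: "finite (Mbot z) \<and> real (card (Mbot z)) \<le> \<mu> * \<kappa> + 2" by (rule count_Mbot[OF zc])
  have eq: "Mset z = Mright z \<union> Mbot z" by (auto simp: Mright_def Mbot_def)
  show "finite (Mset z)" unfolding eq using r b by simp
  have "real (card (Mright z \<union> Mbot z)) \<le> real (card (Mright z)) + real (card (Mbot z))"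
    using card_Un_le[of "Mright z" "Mbot z"] by (simp only: of_nat_add[symmetric] of_nat_le_iff)
  then show "real (card (Mset z)) \<le> 2 * (\<mu> * \<kappa> + 2)" unfolding eq distrib_left using r b by simp
qed

lemma B_disjoint: "k \<noteq> l \<Longrightarrow> B k \<inter> B l = {}"
  unfolding B_def by (cases "k < l") auto

lemma C_sub_B: "k \<in> {1..4} \<Longrightarrow> C k \<subseteq> B k" using C_sub by (auto simp: B_def)

lemma C_finite: "k \<in> {1..4} \<Longrightarrow> finite (C k)" using C_sub_B B_finite finite_subset by blast

text \<open>Every point determines its cell and the three kinds of points use disjoint sets of
  cells, so nothing is counted twice.\<close>

lemma count_points:
  "finite P"
  "card {p\<in>P. V p} = card {n\<in>Inn. z n \<in> I2 \<and> V (z n)} + card {n\<in>Eset z. V (z n)} + (\<Sum>k\<in>{1..4}. card {j\<in>C k. V (\<zeta> j)})"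
proof -
  define X1 where "X1 V = {n\<in>Inn. z n \<in> I2 \<and> V (z n)}" for V
  define X2 where "X2 V = {n\<in>Eset z. V (z n)}" for V
  define X3 where "X3 V = (\<Union>k\<in>{1..4}. {j\<in>C k. V (\<zeta> j)})" for V
  have fin: "finite (X1 V)" "finite (X2 V)" "finite (X3 V)" for V
    unfolding X1_def X2_def X3_def using finite_Inn finite_Eset C_finite by auto
  have A0: "{n. n \<notin> AdI \<and> z n \<in> I2 \<and> V (z n)} = X1 V \<union> X2 V" for V
    using not_Ad_cases Inn_not_Ad Out_not_Ad unfolding X1_def X2_def Inn_def Eset_def by blast
  have eq: "{p\<in>P. V p} = z ` (X1 V \<union> X2 V) \<union> \<zeta> ` X3 V" for V
    unfolding A0[symmetric] P_eq X3_def by blast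
  have "P = {p\<in>P. True}" by simp
  then show "finite P" using eq[of "\<lambda>_. True"] fin[of "\<lambda>_. True"] by simp
  have zi: "inj z" using zc by (metis injI)
  have \<zeta>c: "cell (\<zeta> j) = nn j \<and> j < L" if "j \<in> X3 V" for j V using that \<zeta>_in C_sub unfolding X3_def by blast
  have \<zeta>i: "inj_on \<zeta> (X3 V)" for V
  proof (rule inj_onI)
    fix i j assume "i \<in> X3 V" "j \<in> X3 V" "\<zeta> i = \<zeta> j"
    then have "nn i = nn j" "i < L" "j < L" using \<zeta>c by metis+
    then show "i = j" using nn_inj by (auto simp: inj_on_def)
  qed
  have "z ` (X1 V \<union> X2 V) \<inter> \<zeta> ` X3 V = {}"
  proof (rule ccontr)
    assume "\<not> ?thesis"
    then obtain n j where n: "n \<in> X1 V \<union> X2 V" and j: "j \<in> X3 V" and e: "z n = \<zeta> j" by blast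
    then have "n = nn j" "j < L" using zc \<zeta>c by metis+
    then have "n \<in> AdI" using nn_range by blast
    then show False using n A0[of V] by blast
  qed
  then have "card {p\<in>P. V p} = card (z ` (X1 V \<union> X2 V)) + card (\<zeta> ` X3 V)"
    unfolding eq using fin[of V] by (intro card_Un_disjoint) auto
  also have "card (\<zeta> ` X3 V) = card (X3 V)" by (rule card_image[OF \<zeta>i])
  also have "card (z ` (X1 V \<union> X2 V)) = card (X1 V \<union> X2 V)" by (rule card_image) (rule inj_on_subset[OF zi subset_UNIV])
  also have "card (X1 V \<union> X2 V) = card (X1 V) + card (X2 V)"
    using fin[of V] Inn_not_Out by (intro card_Un_disjoint) (auto simp: X1_def X2_def Eset_def)
  also have "card (X3 V) = (\<Sum>k\<in>{1..4}. card {j\<in>C k. V (\<zeta> j)})"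
    unfolding X3_def
  proof (rule card_UN_disjoint)
    show "\<forall>i\<in>{1..4}. \<forall>j\<in>{1..4}. i \<noteq> j \<longrightarrow> {l \<in> C i. V (\<zeta> l)} \<inter> {l \<in> C j. V (\<zeta> l)} = {}"
      using B_disjoint C_sub_B by blast
  qed (use C_finite in auto)
  finally show "card {p\<in>P. V p} = card {n\<in>Inn. z n \<in> I2 \<and> V (z n)} + card {n\<in>Eset z. V (z n)} + (\<Sum>k\<in>{1..4}. card {j\<in>C k. V (\<zeta> j)})"
    unfolding X1_def X2_def .
qed

text \<open>The parameter 4 is allowed in the boundary list but belongs to no \<open>B k\<close>,
  whose intervals are open on the right. A tile listed there gets no point, which costs at most one
  unit.\<close>

definition D4 :: "nat set" where "D4 = {j. j < L \<and> tt j = 4}"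

lemma card_D4: "card D4 \<le> 1" "finite D4"
proof -
  show "card D4 \<le> 1" unfolding One_nat_def D4_def
    by (subst card_le_Suc0_iff_eq) (auto, metis less_irrefl linorder_neqE_nat tt_mono)
qed (simp add: D4_def)

lemma sum_edges:
  fixes f :: "nat \<Rightarrow> real"
  shows "(\<Sum>j<L. f j) = (\<Sum>k\<in>{1..4}. \<Sum>j\<in>B k. f j) + (\<Sum>j\<in>D4. f j)"
proof -
  have cov: "{..<L} = (\<Union>k\<in>{1..4}. B k) \<union> D4"
  proof (intro equalityI subsetI)
    fix j assume "j \<in> {..<L}"
    then have j: "j < L" "0 \<le> tt j" "tt j \<le> 4" using tt_range by auto
    show "j \<in> (\<Union>k\<in>{1..4}. B k) \<union> D4"
    proof (cases "tt j = 4")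
      case False
      define k where "k = Suc (nat \<lfloor>tt j\<rfloor>)"
      have "real k - 1 \<le> tt j" "tt j < real k" "k \<in> {1..4}" using j False unfolding k_def by (auto simp: floor_less_iff nat_less_iff Suc_le_eq) linarith+
      then show ?thesis using j unfolding B_def by blast
    qed (use j in \<open>simp add: D4_def\<close>)
  qed (auto simp: B_def D4_def)
  have dis: "(\<Union>k\<in>{1..4}. B k) \<inter> D4 = {}" by (auto simp: B_def D4_def)
  have "(\<Sum>j<L. f j) = sum f (\<Union>k\<in>{1..4}. B k) + sum f D4"
    unfolding cov by (rule sum.union_disjoint[OF _ _ dis]) (auto simp: B_finite card_D4)
  also have "sum f (\<Union>k\<in>{1..4}. B k) = (\<Sum>k\<in>{1..4}. \<Sum>j\<in>B k. f j)"
    by (rule sum.UNION_disjoint) (use B_disjoint B_finite in auto)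
  finally show ?thesis .
qed

lemma C_card_B:
  assumes k: "k \<in> {1..4}"
  shows "\<bar>real (card (C k)) - (\<Sum>j\<in>B k. wt (nn j))\<bar> \<le> 1"
proof (cases "B k = {}")
  case True
  then show ?thesis using C_sub_B[OF k] by simp
next
  case False
  have eq: "B k = {Min (B k)..Max (B k)}"
    by (rule order_interval_eq[where V = "\<lambda>x. real k - 1 \<le> x \<and> x < real k"]) (use False in \<open>auto simp: B_def\<close>)
  have mm: "Min (B k) \<in> B k" "Max (B k) \<in> B k" using B_finite False by auto
  have "Min (B k) \<le> Max (B k)" using mm(1) B_finite by auto
  then have "\<bar>real (card (C k \<inter> {Min (B k)..Max (B k)})) - (\<Sum>l=Min (B k)..Max (B k). wt (nn l))\<bar> \<le> 1"
    using mm by (intro C_card[OF k]) (auto simp: B_def)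
  then show ?thesis using C_sub_B[OF k] by (simp add: eq[symmetric] Int_absorb2)
qed

lemma sum_AdI: "(\<Sum>n\<in>AdI. f n) = (\<Sum>j<L. f (nn j))" for f :: "int \<times> int \<Rightarrow> real"
  unfolding nn_range[symmetric] by (simp add: sum.reindex[OF nn_inj])

lemma D4_wt: "0 \<le> (\<Sum>j\<in>D4. wt (nn j))" "(\<Sum>j\<in>D4. wt (nn j)) \<le> 1"
proof -
  show "0 \<le> (\<Sum>j\<in>D4. wt (nn j))" by (intro sum_nonneg wt_bounds)
  have "(\<Sum>j\<in>D4. wt (nn j)) \<le> real (card D4) * 1" by (rule sum_bounded_above) (rule wt_bounds)
  then show "(\<Sum>j\<in>D4. wt (nn j)) \<le> 1" using card_D4 by simp
qed

text \<open>Each edge errs by at most 1 in either direction, and the tile at parameter 4 can only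
  increase the total weight. This accounts for the asymmetry of the interval.\<close>

lemma added_points: "(\<Sum>k\<in>{1..4}. real (card (C k))) - (\<Sum>n\<in>AdI. wt n) \<in> {-5..4}"
proof -
  have "\<bar>(\<Sum>k\<in>{1..4}. real (card (C k))) - (\<Sum>k\<in>{1..4}. \<Sum>j\<in>B k. wt (nn j))\<bar> \<le> (\<Sum>k\<in>{1..4::nat}. 1)"
    unfolding sum_subtractf[symmetric] by (rule order_trans[OF sum_abs sum_mono[OF C_card_B]])
  then have "\<bar>(\<Sum>k\<in>{1..4}. real (card (C k))) - (\<Sum>k\<in>{1..4}. \<Sum>j\<in>B k. wt (nn j))\<bar> \<le> 4" by simp
  then show ?thesis unfolding sum_AdI sum_edges using D4_wt unfolding atLeastAtMost_iff abs_le_iff by linarith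
qed

lemma cells_total: "1 / area = real (card Inn) + (\<Sum>n\<in>AdI. wt n)"
proof -
  have "1 / area = measure lebesgue I2 / area" by (simp add: measure_I2)
  also have "\<dots> = (\<Sum>n\<in>Inn. wt n) + (\<Sum>n\<in>AdI. wt n)"
    unfolding measure_split[OF I2_lmeasurable subset_refl] by (simp add: add_divide_distrib sum_divide_distrib wt_def)
  also have "(\<Sum>n\<in>Inn. wt n) = real (card Inn)" by (simp add: wt_Inn)
  finally show ?thesis .
qed

lemma card_Inn_kept: "card {n\<in>Inn. z n \<in> I2} + card (Mset z) = card Inn"
proof -
  have "card Inn = card ({n\<in>Inn. z n \<in> I2} \<union> Mset z)" by (rule arg_cong[where f = card]) (auto simp: Mset_def)
  also have "\<dots> = card {n\<in>Inn. z n \<in> I2} + card (Mset z)"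
    by (rule card_Un_disjoint) (use finite_Inn finite_Mset in \<open>auto simp: Mset_def\<close>)
  finally show ?thesis by simp
qed

lemma card_P_eq: "real (card P) = 1 / area - real (card (Mset z)) + real (card (Eset z)) + ((\<Sum>k\<in>{1..4}. real (card (C k))) - (\<Sum>n\<in>AdI. wt n))"
proof -
  have "card P = card {n\<in>Inn. z n \<in> I2} + card (Eset z) + (\<Sum>k\<in>{1..4}. card (C k))"
    using count_points(2)[of "\<lambda>_. True"] by simp
  then have "real (card P) = real (card {n\<in>Inn. z n \<in> I2}) + real (card (Eset z)) + (\<Sum>k\<in>{1..4}. real (card (C k)))" by simp
  moreover have "real (card {n\<in>Inn. z n \<in> I2}) + real (card (Mset z)) = real (card Inn)" using card_Inn_kept by (simp only: of_nat_add[symmetric])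
  ultimately show ?thesis unfolding cells_total by linarith
qed

lemma card_P_bounds: "\<bar>real (card P) - 1 / area\<bar> \<le> 2 * \<mu> * \<kappa> + 9"
proof -
  have "0 \<le> \<mu> * \<kappa>" using \<mu>_bounds \<kappa>_pos by simp
  then show ?thesis unfolding card_P_eq abs_le_iff using added_points card_Eset card_Mset unfolding atLeastAtMost_iff by (simp add: algebra_simps)
qed

end

section \<open>Surplus in an open cap\<close>

context modcap
begin

lemma what_Inn: "n \<in> Inn \<Longrightarrow> what n = wR n"
proof -
  assume n: "n \<in> Inn"
  have "T n \<inter> I2 \<inter> Rhat = T n \<inter> R" using Rhat_I2 by blast
  then show ?thesis using measure_T_Int_Inn[OF n, of Rhat] Rhat_borel by (simp add: what_def wR_def)
qed

lemma R_total: "\<sigma> / area = (\<Sum>n\<in>Inn. what n) + (\<Sum>n\<in>AdI. wR n)"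
proof -
  have "\<sigma> / area = (\<Sum>n\<in>Inn. wR n) + (\<Sum>n\<in>AdI. wR n)"
    unfolding measure_R[symmetric] measure_split[OF R_lmeasurable R_sub] by (simp add: add_divide_distrib sum_divide_distrib wR_def)
  then show ?thesis by (simp add: what_Inn)
qed

text \<open>A lost point lowers the expected number by \<open>\<sigma>\<close>. If its tile lies in
  the cap, the count drops by 1 as well, so no charge remains; if the tile is hit, the term
  \<open>1 - what\<close> covers it. Only a tile outside the cap is charged.\<close>

lemma inner_gain:
  assumes n: "n \<in> Inn"
  shows "(if z n \<in> I2 \<and> F (z n) > t then 1 else 0) + \<sigma> * (if n \<in> Mset z then 1 else 0) - what n
    \<le> (if hit n then 1 - what n else 0) + \<sigma> * (if n \<in> Mset z \<and> (\<forall>w\<in>T n \<inter> I2. F w \<le> t) then 1 else 0)"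
proof -
  have M: "n \<in> Mset z \<longleftrightarrow> z n \<notin> I2" using n by (simp add: Mset_def)
  consider "hit n" | "\<not> hit n" "\<forall>w\<in>T n \<inter> I2. F w > t" | "\<not> hit n" "\<forall>w\<in>T n \<inter> I2. F w \<le> t"
    unfolding hit_def using not_less by blast
  then show ?thesis
  proof cases
    case 1
    then show ?thesis using M \<sigma>_bounds by auto
  next
    case 2
    then have "T n \<inter> R = T n \<inter> I2" by (auto simp: R_def)
    then have "what n = 1" using what_Inn[OF n] wt_Inn[OF n] by (simp add: wR_def wt_def)
    then show ?thesis using 2 M \<sigma>_bounds by auto
  next
    case 3
    then have nF: "\<not> (z n \<in> I2 \<and> F (z n) > t)" using zc[of n] by force
    then show ?thesis using 3 what_bounds(1)[of n] by (simp only: if_False) auto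
  qed
qed

lemma hit_finite: "finite {n. hit n}" using card_hit by simp

text \<open>The area shares and points are compared tile by tile: inner tiles by
  \<open>inner_gain\<close>, edge tiles by the edge gains. The constant 49 is 20 from the lost and
  gained points, 24 from four edges and 5 from the size of the set.\<close>

lemma main_count:
  "real (card {p\<in>P. F p > t}) - \<sigma> * real (card P)
     \<le> (\<Sum>n\<in>{n. hit n}. 1 - what n) + (1 + \<bar>t\<bar>) / 2 * \<mu> * \<kappa> * (if \<xi> = 0 then 2 else 1) + 49 + 12 * CE"
proof -
  let ?h = "\<lambda>n. if hit n then 1 - what n else 0"
  define MZ where "MZ = {n \<in> Mset z. \<forall>w\<in>T n \<inter> I2. F w \<le> t}"
  have MI: "Mset z \<subseteq> Inn" by (auto simp: Mset_def)
  have h0: "?h n \<ge> 0" for n using what_bounds(2)[of n] by simp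
  have s1: "(\<Sum>n\<in>Inn. (if z n \<in> I2 \<and> F (z n) > t then 1 else (0::real))) = real (card {n\<in>Inn. z n \<in> I2 \<and> F (z n) > t})"
    using finite_Inn by (simp add: sum.If_cases Int_def)
  have s2: "(\<Sum>n\<in>Inn. \<sigma> * (if n \<in> Mset z then 1 else 0)) = \<sigma> * real (card (Mset z))"
    unfolding sum_distrib_left[symmetric] using finite_Inn MI by (simp add: sum.If_cases Int_absorb1)
  have "Inn \<inter> {n. n \<in> Mset z \<and> (\<forall>w\<in>T n \<inter> I2. F w \<le> t)} = MZ" using MI by (auto simp: MZ_def)
  then have s3: "(\<Sum>n\<in>Inn. \<sigma> * (if n \<in> Mset z \<and> (\<forall>w\<in>T n \<inter> I2. F w \<le> t) then 1 else 0)) = \<sigma> * real (card MZ)"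
    unfolding sum_distrib_left[symmetric] using finite_Inn by (simp only: sum.If_cases) simp
  have "(\<Sum>n\<in>Inn. (if z n \<in> I2 \<and> F (z n) > t then 1 else 0) + \<sigma> * (if n \<in> Mset z then 1 else 0) - what n)
     \<le> (\<Sum>n\<in>Inn. ?h n + \<sigma> * (if n \<in> Mset z \<and> (\<forall>w\<in>T n \<inter> I2. F w \<le> t) then 1 else 0))"
    by (intro sum_mono inner_gain)
  then have inner: "real (card {n\<in>Inn. z n \<in> I2 \<and> F (z n) > t}) + \<sigma> * real (card (Mset z)) - (\<Sum>n\<in>Inn. what n)
     \<le> (\<Sum>n\<in>Inn. ?h n) + \<sigma> * real (card MZ)"
    unfolding sum.distrib sum_subtractf s1 s2 s3 .
  have e1: "(\<Sum>j\<in>B k. gain k j) = real (card {j\<in>C k. F (\<zeta> j) > t}) - (\<Sum>j\<in>B k. wR (nn j)) - (\<Sum>j\<in>B k. ?h (nn j))" if k: "k \<in> {1..4}" for k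
  proof -
    have "B k \<inter> {j. j \<in> C k \<and> F (\<zeta> j) > t} = {j\<in>C k. F (\<zeta> j) > t}" using C_sub_B[OF k] by auto
    then have "(\<Sum>j\<in>B k. (if j \<in> C k \<and> F (\<zeta> j) > t then 1 else (0::real))) = real (card {j\<in>C k. F (\<zeta> j) > t})"
      using B_finite by (simp only: sum.If_cases) simp
    then show ?thesis unfolding gain_def sum_subtractf by simp
  qed
  have "(\<Sum>k\<in>{1..4}. \<Sum>j\<in>B k. gain k j) \<le> (\<Sum>k\<in>{1..4::nat}. 6 + 3 * CE)" by (intro sum_mono edge_gain)
  then have "(\<Sum>k\<in>{1..4}. real (card {j\<in>C k. F (\<zeta> j) > t})) - (\<Sum>k\<in>{1..4}. \<Sum>j\<in>B k. wR (nn j)) - (\<Sum>k\<in>{1..4}. \<Sum>j\<in>B k. ?h (nn j)) \<le> 24 + 12 * CE"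
    by (simp add: e1 sum_subtractf)
  moreover have "(\<Sum>k\<in>{1..4}. \<Sum>j\<in>B k. wR (nn j)) \<le> (\<Sum>n\<in>AdI. wR n)"
    unfolding sum_AdI sum_edges using wR_bounds by (simp add: sum_nonneg)
  moreover have "(\<Sum>k\<in>{1..4}. \<Sum>j\<in>B k. ?h (nn j)) \<le> (\<Sum>n\<in>AdI. ?h n)"
    unfolding sum_AdI sum_edges using h0 by (simp add: sum_nonneg)
  ultimately have edges: "(\<Sum>k\<in>{1..4}. real (card {j\<in>C k. F (\<zeta> j) > t})) - (\<Sum>n\<in>AdI. wR n) \<le> (\<Sum>n\<in>AdI. ?h n) + 24 + 12 * CE"
    by linarith
  have hits: "(\<Sum>n\<in>Inn. ?h n) + (\<Sum>n\<in>AdI. ?h n) \<le> (\<Sum>n\<in>{n. hit n}. 1 - what n)"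
  proof -
    have "(\<Sum>n\<in>Inn. ?h n) + (\<Sum>n\<in>AdI. ?h n) = (\<Sum>n\<in>Inn \<union> AdI. ?h n)"
      by (rule sum.union_disjoint[symmetric, OF finite_Inn finite_AdI Inn_not_Ad])
    also have "\<dots> = (\<Sum>n\<in>(Inn \<union> AdI) \<inter> {n. hit n}. 1 - what n)"
      using finite_Inn finite_AdI by (simp add: sum.If_cases)
    also have "\<dots> \<le> (\<Sum>n\<in>{n. hit n}. 1 - what n)"
      by (rule sum_mono2[OF hit_finite]) (use what_bounds(2) in auto)
    finally show ?thesis .
  qed
  have E: "real (card {n\<in>Eset z. F (z n) > t}) \<le> real (card (Eset z))"
    using card_mono[OF finite_Eset, of "{n\<in>Eset z. F (z n) > t}"] by auto
  then have E': "\<sigma> * real (card {n\<in>Eset z. F (z n) > t}) \<le> \<sigma> * real (card (Eset z))" using \<sigma>_bounds by (intro mult_left_mono) auto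
  have added: "- 5 \<le> \<sigma> * ((\<Sum>k\<in>{1..4}. real (card (C k))) - (\<Sum>n\<in>AdI. wt n))"
  proof -
    have "- 5 \<le> \<sigma> * a" if "a \<ge> -5" for a
    proof -
      have "\<sigma> * (-5) \<le> \<sigma> * a" using that \<sigma>_bounds by (intro mult_left_mono) auto
      then show ?thesis using \<sigma>_bounds by linarith
    qed
    then show ?thesis using added_points by simp
  qed
  have cP: "\<sigma> * real (card P) = \<sigma> / area - \<sigma> * real (card (Mset z)) + \<sigma> * real (card (Eset z))
      + \<sigma> * ((\<Sum>k\<in>{1..4}. real (card (C k))) - (\<Sum>n\<in>AdI. wt n))"
    unfolding card_P_eq by (simp add: distrib_left right_diff_distrib)
  have "card {p\<in>P. F p > t} = card {n\<in>Inn. z n \<in> I2 \<and> F (z n) > t} + card {n\<in>Eset z. F (z n) > t} + (\<Sum>k\<in>{1..4}. card {j\<in>C k. F (\<zeta> j) > t})"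
    by (rule count_points(2))
  then have cF: "real (card {p\<in>P. F p > t}) = real (card {n\<in>Inn. z n \<in> I2 \<and> F (z n) > t}) + real (card {n\<in>Eset z. F (z n) > t}) + (\<Sum>k\<in>{1..4}. real (card {j\<in>C k. F (\<zeta> j) > t}))"
    by (simp only: of_nat_add of_nat_sum)
  have EM: "\<sigma> * real (card MZ) + (real (card {n \<in> Eset z. F (z n) > t}) - \<sigma> * real (card {n \<in> Eset z. F (z n) > t}))
    \<le> (1 + \<bar>t\<bar>) / 2 * \<mu> * \<kappa> * (if \<xi> = 0 then 2 else 1) + 20"
    using EM_bound[OF zc] by (simp only: MZ_def left_diff_distrib mult_1)
  have arith: "real (card {p\<in>P. F p > t}) - \<sigma> * real (card P) \<le> u"
    if "real (card {p\<in>P. F p > t}) = a1 + a2 + a3" "\<sigma> * real (card P) = s - m + e + d" "s = w + r" "a1 + m - w \<le> h1 + mz" "a3 - r \<le> h2 + 24 + q"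
      "h1 + h2 \<le> h" "e' \<le> e" "-5 \<le> d" "mz + (a2 - e') \<le> v + 20" "u = h + v + 49 + q" for a1 a2 a3 s m e d w r h1 mz h2 q h e' v u :: real
    using that by linarith
  show ?thesis by (rule arith[OF cF cP R_total inner edges hits E' added EM refl])
qed

end

section \<open>The numerical bound\<close>

text \<open>The claim is \<open>\<bar>t\<bar> \<le> 7 - 8 * v\<close>. This line meets the circle
  \<open>v^2 + t^2 = 1\<close> at \<open>(4/5, 3/5)\<close>, which is the origin of the threshold
  4/5.\<close>

lemma area_tradeoff_small:
  fixes v t :: real
  assumes "0 \<le> v" "v \<le> 4/5" "v\<^sup>2 \<le> 1 - t\<^sup>2"
  shows "1 + 2 * v + (1 + \<bar>t\<bar>) / 4 \<le> 3"
proof -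
  have "v - 4/5 \<le> 0" "65 * v - 60 \<le> 0" using assms by simp_all
  then have "(v - 4/5) * (65 * v - 60) \<ge> 0" by (rule mult_nonpos_nonpos)
  moreover have "(7 - 8 * v)\<^sup>2 - (1 - v\<^sup>2) = (v - 4/5) * (65 * v - 60)" by (simp add: power2_eq_square algebra_simps)
  ultimately have "t\<^sup>2 \<le> (7 - 8 * v)\<^sup>2" using assms(3) by linarith
  then have "\<bar>t\<bar>\<^sup>2 \<le> (7 - 8 * v)\<^sup>2" by simp
  moreover have "0 \<le> 7 - 8 * v" using assms by simp
  ultimately have "\<bar>t\<bar> \<le> 7 - 8 * v" by (rule power2_le_imp_le)
  then show ?thesis by (simp add: field_simps)
qed

text \<open>Near the circle \<open>t^2 \<le> 2 * (1 - v)\<close>, so \<open>4 * (1 - v)\<close>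
  covers \<open>2 * t^2\<close>. What is left of \<open>\<bar>t\<bar> / 2\<close> is at most 1/32,
  with equality at \<open>\<bar>t\<bar> = 1/8\<close>.\<close>

lemma area_tradeoff_large:
  fixes v t :: real
  assumes "0 \<le> v" "v \<le> 1" "v\<^sup>2 \<le> 1 - t\<^sup>2"
  shows "(1 + \<bar>t\<bar>) / 2 - 17/32 \<le> 4 * (1 - v)"
proof -
  have "0 \<le> (1 - v)\<^sup>2" by simp
  then have "t\<^sup>2 \<le> 2 * (1 - v)" using assms(3) by (simp add: power2_diff)
  moreover have "0 \<le> 2 * (\<bar>t\<bar> - 1/8)\<^sup>2" by simp
  then have "\<bar>t\<bar> / 2 \<le> 2 * t\<^sup>2 + 1/32" by (simp add: power2_diff power2_eq_square field_simps)
  ultimately have "\<bar>t\<bar> / 2 \<le> 4 * (1 - v) + 1/32" by (simp add: algebra_simps)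
  then show ?thesis by (simp add: field_simps)
qed

context modcap
begin

lemma vv_le: "vv\<^sup>2 \<le> 1 - t\<^sup>2" "0 \<le> vv" "vv \<le> 1"
proof -
  have "(1 - t\<^sup>2) * (1 - b\<^sup>2) \<le> (1 - t\<^sup>2) * 1" using t2 by (intro mult_left_mono) auto
  then show *: "vv\<^sup>2 \<le> 1 - t\<^sup>2" by (simp add: vv_sq)
  show "0 \<le> vv" using vv_pos by simp
  have "1 - t\<^sup>2 \<le> 1\<^sup>2" by simp
  with * have "vv\<^sup>2 \<le> 1\<^sup>2" by (rule order_trans)
  then show "vv \<le> 1" by (rule power2_le_imp_le) simp
qed

text \<open>In each of the three ranges of \<open>\<xi>\<close> the grid coordinates are permuted
  and negated so that the smaller coefficient becomes \<open>a1\<close>; its size is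
  \<open>\<mu> * \<kappa>\<close>. Floors of negated coordinates agree because integer values are
  excluded.\<close>

lemma hit_savings:
  assumes xi: "\<xi> \<noteq> 0" and big: "\<kappa> \<ge> 100000" and v: "vv \<ge> 4/5"
  shows "(\<Sum>n\<in>{n. hit n}. what n) \<ge> \<mu> * \<kappa> * (17/32) - 32000000"
proof -
  obtain Y where Y: "Y \<in> lmeasurable" "\<And>w. w \<in> Y \<Longrightarrow> hit (cell w) \<and> F (cl w) > t"
    and mY: "measure lebesgue Y \<ge> (\<mu> * \<kappa> * (17/32) - 32000000) * area"
  proof -
    have neg: "\<lfloor>x\<rfloor> = \<lfloor>y\<rfloor>" if "\<lfloor>- x\<rfloor> = \<lfloor>- y\<rfloor>" "- x \<notin> \<int>" "- y \<notin> \<int>" for x y :: real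
      using floor_minus_cong[OF that] by simp
    have sq: "\<bar>\<xi>\<bar> * \<bar>\<xi>\<bar> = \<xi>\<^sup>2" by (simp add: power2_eq_square)
    have "\<exists>a1 a2. saving \<xi> \<kappa> c b x0 t a1 a2 \<and> \<bar>a1\<bar> = \<mu> * \<kappa>"
    proof -
      consider "\<bar>\<xi>\<bar> \<le> 1" | "\<xi> > 1" | "\<xi> < -1" by linarith
      then show ?thesis
      proof cases
        case 1
        have "saving \<xi> \<kappa> c b x0 t (\<kappa> * \<xi>) \<kappa>"
        proof unfold_locales
          show "\<bar>\<kappa> * \<xi>\<bar> \<le> \<kappa>" using 1 \<kappa>_pos by (simp add: abs_mult)
          show "(\<kappa> * \<xi>)\<^sup>2 + \<kappa>\<^sup>2 = \<kappa>\<^sup>2 * (1 + \<xi>\<^sup>2)" by (simp add: power_mult_distrib algebra_simps)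
          fix w w' :: "real^2"
          have gu: "\<kappa> * \<xi> * v$1 + \<kappa> * v$2 = gu v" and gv: "\<kappa> * v$1 - \<kappa> * \<xi> * v$2 = - gv v" for v
            by (simp_all add: gu_def gv_def algebra_simps)
          assume "\<lfloor>\<kappa> * \<xi> * w$1 + \<kappa> * w$2\<rfloor> = \<lfloor>\<kappa> * \<xi> * w'$1 + \<kappa> * w'$2\<rfloor>"
            "\<lfloor>\<kappa> * w$1 - \<kappa> * \<xi> * w$2\<rfloor> = \<lfloor>\<kappa> * w'$1 - \<kappa> * \<xi> * w'$2\<rfloor>"
            "\<kappa> * w$1 - \<kappa> * \<xi> * w$2 \<notin> \<int>" "\<kappa> * w'$1 - \<kappa> * \<xi> * w'$2 \<notin> \<int>"
          then show "cell w = cell w'" unfolding gu gv cell_def by (auto dest: neg)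
        qed (use big v in auto)
        moreover have "\<bar>\<kappa> * \<xi>\<bar> = \<mu> * \<kappa>" using 1 xi \<kappa>_pos by (simp add: abs_mult \<mu>_def)
        ultimately show ?thesis by blast
      next
        case 2
        have "saving \<xi> \<kappa> c b x0 t (- \<kappa>) (\<kappa> * \<xi>)"
        proof unfold_locales
          show "\<bar>- \<kappa>\<bar> \<le> \<kappa> * \<xi>" using 2 \<kappa>_pos by simp
          have "\<kappa> * 1 \<le> \<kappa> * \<xi>" using 2 \<kappa>_pos by (intro mult_left_mono) auto
          then show "100000 \<le> \<kappa> * \<xi>" using big by linarith
          show "(- \<kappa>)\<^sup>2 + (\<kappa> * \<xi>)\<^sup>2 = \<kappa>\<^sup>2 * (1 + \<xi>\<^sup>2)" by (simp add: power_mult_distrib algebra_simps)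
          fix w w' :: "real^2"
          have gu: "- \<kappa> * v$1 + \<kappa> * \<xi> * v$2 = gv v" and gv: "\<kappa> * \<xi> * v$1 - - \<kappa> * v$2 = gu v" for v
            by (simp_all add: gu_def gv_def algebra_simps)
          assume "\<lfloor>- \<kappa> * w$1 + \<kappa> * \<xi> * w$2\<rfloor> = \<lfloor>- \<kappa> * w'$1 + \<kappa> * \<xi> * w'$2\<rfloor>"
            "\<lfloor>\<kappa> * \<xi> * w$1 - - \<kappa> * w$2\<rfloor> = \<lfloor>\<kappa> * \<xi> * w'$1 - - \<kappa> * w'$2\<rfloor>"
          then show "cell w = cell w'" unfolding gu gv cell_def by auto
        qed (use v in auto)
        moreover have "\<bar>- \<kappa>\<bar> = \<mu> * \<kappa>" using 2 \<kappa>_pos by (simp add: \<mu>_def)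
        ultimately show ?thesis by blast
      next
        case 3
        have "saving \<xi> \<kappa> c b x0 t \<kappa> (- \<kappa> * \<xi>)"
        proof unfold_locales
          have le: "\<kappa> * 1 \<le> \<kappa> * (- \<xi>)" using 3 \<kappa>_pos by (intro mult_left_mono) auto
          then show "\<bar>\<kappa>\<bar> \<le> - \<kappa> * \<xi>" using \<kappa>_pos by simp
          show "100000 \<le> - \<kappa> * \<xi>" using big le by linarith
          show "\<kappa>\<^sup>2 + (- \<kappa> * \<xi>)\<^sup>2 = \<kappa>\<^sup>2 * (1 + \<xi>\<^sup>2)" by (simp add: power_mult_distrib algebra_simps)
          fix w w' :: "real^2"
          have gu: "\<kappa> * v$1 + - \<kappa> * \<xi> * v$2 = - gv v" and gv: "- \<kappa> * \<xi> * v$1 - \<kappa> * v$2 = - gu v" for v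
            by (simp_all add: gu_def gv_def algebra_simps)
          assume "\<lfloor>\<kappa> * w$1 + - \<kappa> * \<xi> * w$2\<rfloor> = \<lfloor>\<kappa> * w'$1 + - \<kappa> * \<xi> * w'$2\<rfloor>"
            "\<lfloor>- \<kappa> * \<xi> * w$1 - \<kappa> * w$2\<rfloor> = \<lfloor>- \<kappa> * \<xi> * w'$1 - \<kappa> * w'$2\<rfloor>"
            "\<kappa> * w$1 + - \<kappa> * \<xi> * w$2 \<notin> \<int>" "\<kappa> * w'$1 + - \<kappa> * \<xi> * w'$2 \<notin> \<int>"
            "- \<kappa> * \<xi> * w$1 - \<kappa> * w$2 \<notin> \<int>" "- \<kappa> * \<xi> * w'$1 - \<kappa> * w'$2 \<notin> \<int>"
          then show "cell w = cell w'" unfolding gu gv cell_def by (auto dest: neg)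
        qed (use v in auto)
        moreover have "\<bar>\<kappa>\<bar> = \<mu> * \<kappa>" using 3 \<kappa>_pos by (simp add: \<mu>_def)
        ultimately show ?thesis by blast
      qed
    qed
    then obtain a1 a2 where s: "saving \<xi> \<kappa> c b x0 t a1 a2" and a1: "\<bar>a1\<bar> = \<mu> * \<kappa>" by blast
    from saving.savings[OF s] obtain Y where "Y \<in> lmeasurable" "\<forall>w\<in>Y. hit (cell w) \<and> F (cl w) > t"
      "measure lebesgue Y \<ge> (\<bar>a1\<bar> * (17/32) - 32000000) / (\<kappa>\<^sup>2 * (1 + \<xi>\<^sup>2))" by blast
    then show thesis by (intro that[of Y]) (auto simp: a1 area_def)
  qed
  have "measure lebesgue Y = (\<Sum>n\<in>{n. hit n}. measure lebesgue (T n \<inter> Y))"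
    by (rule measure_cells_sum[symmetric, OF Y(1) hit_finite]) (use Y(2) in blast)
  also have "\<dots> \<le> (\<Sum>n\<in>{n. hit n}. measure lebesgue (T n \<inter> Rhat))"
  proof (rule sum_mono)
    fix n
    show "measure lebesgue (T n \<inter> Y) \<le> measure lebesgue (T n \<inter> Rhat)"
      by (rule measure_mono_fmeasurable[OF _ _ T_R_lmeasurable(2)]) (use Y T_measure(1)[of n] in \<open>auto simp: Rhat_def\<close>)
  qed
  also have "\<dots> = (\<Sum>n\<in>{n. hit n}. what n) * area" using area_pos by (simp add: what_def sum_divide_distrib[symmetric])
  finally have "(\<mu> * \<kappa> * (17/32) - 32000000) * area \<le> (\<Sum>n\<in>{n. hit n}. what n) * area" using mY by linarith
  then show ?thesis using area_pos by (simp only: mult_le_cancel_right_pos)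
qed

text \<open>The square of \<open>1 + \<bar>\<xi>\<bar>\<close> is at most
  \<open>2 * (1 + \<xi>^2)\<close>, with equality for \<open>\<bar>\<xi>\<bar> = 1\<close>. The
  constant 18 is 2 times the square of the maximal \<open>1 + 2 * vv\<close>.\<close>

lemma sqrt_18_bound: "3 * (1 + \<bar>\<xi>\<bar>) \<le> sqrt 18 * sqrt (1 + \<xi>\<^sup>2)"
proof -
  have "0 \<le> 9 * (1 - \<bar>\<xi>\<bar>)\<^sup>2" by simp
  then have "(3 * (1 + \<bar>\<xi>\<bar>))\<^sup>2 \<le> 18 * (1 + \<xi>\<^sup>2)" by (simp add: power2_diff power2_sum power_mult_distrib)
  then have "3 * (1 + \<bar>\<xi>\<bar>) \<le> sqrt (18 * (1 + \<xi>\<^sup>2))" by (rule real_le_rsqrt)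
  then show ?thesis by (simp only: real_sqrt_mult)
qed

text \<open>The slack of the curve count against \<open>3 * (1 + \<bar>\<xi>\<bar>)\<close> is
  \<open>2 * (1 + \<bar>\<xi>\<bar>) * (1 - vv)\<close>, and
  \<open>2 * \<mu> \<le> 1 + \<bar>\<xi>\<bar>\<close> converts it into the scale of the lost and
  gained points. For large \<open>vv\<close> the area saving pays the rest.\<close>

lemma one_sided:
  assumes big: "\<kappa> \<ge> 100000"
  shows "real (card {p\<in>P. F p > t}) - \<sigma> * real (card P) \<le> sqrt 18 * (\<kappa> * sqrt (1 + \<xi>\<^sup>2)) + (40000000 + 12 * CE)"
proof -
  define S where "S = (\<Sum>n\<in>{n. hit n}. what n)"
  have S0: "S \<ge> 0" unfolding S_def by (intro sum_nonneg what_bounds)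
  have h: "(\<Sum>n\<in>{n. hit n}. 1 - what n) \<le> \<kappa> * (1 + \<bar>\<xi>\<bar>) * (1 + 2 * vv) + 280 - S"
    unfolding sum_subtractf S_def using card_hit by simp
  have m2: "2 * \<mu> \<le> 1 + \<bar>\<xi>\<bar>" if "\<xi> \<noteq> 0" using that by (auto simp: \<mu>_def)
  have t1: "0 \<le> \<bar>t\<bar>" "\<bar>t\<bar> \<le> 1" using t_lt by auto
  have "\<kappa> * (1 + \<bar>\<xi>\<bar>) * (1 + 2 * vv) - S + (1 + \<bar>t\<bar>) / 2 * \<mu> * \<kappa> * (if \<xi> = 0 then 2 else 1)
    \<le> sqrt 18 * (\<kappa> * sqrt (1 + \<xi>\<^sup>2)) + 32000000"
  proof (cases "\<xi> = 0")
    case True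
    then have mu: "\<mu> = 1" unfolding \<mu>_def by simp
    \<comment> \<open>On \<open>vv^2 + t^2 \<le> 1\<close> the sum
      \<open>2 * vv + \<bar>t\<bar>\<close> is at most \<open>sqrt 5 < 224/100\<close>, and 2 +
      224/100 is still below \<open>sqrt 18\<close>, so no area saving is needed here.\<close>
    have "0 \<le> (vv - 2 * \<bar>t\<bar>)\<^sup>2" by simp
    then have "(2 * vv + \<bar>t\<bar>)\<^sup>2 \<le> 5 * (vv\<^sup>2 + t\<^sup>2)" by (simp add: power2_diff power2_sum power_mult_distrib)
    also have "\<dots> \<le> (224/100)\<^sup>2" using vv_le(1) by (simp add: power2_eq_square)
    finally have a: "2 * vv + \<bar>t\<bar> \<le> 224/100" by (rule power2_le_imp_le) simp
    have "424/100 \<le> sqrt (18::real)" by (rule real_le_rsqrt) (simp add: power2_eq_square)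
    then have "1 + 2 * vv + (1 + \<bar>t\<bar>) \<le> sqrt 18" using a by linarith
    then have "\<kappa> * (1 + 2 * vv + (1 + \<bar>t\<bar>)) \<le> \<kappa> * sqrt 18" using \<kappa>_pos by (intro mult_left_mono) auto
    then show ?thesis using S0 True mu by (simp add: algebra_simps add_divide_distrib)
  next
    case False
    have s18: "\<kappa> * (3 * (1 + \<bar>\<xi>\<bar>)) \<le> sqrt 18 * (\<kappa> * sqrt (1 + \<xi>\<^sup>2))"
      using mult_left_mono[OF sqrt_18_bound, of \<kappa>] \<kappa>_pos by (simp add: mult.left_commute)
    have x1: "0 \<le> 1 + \<bar>\<xi>\<bar>" by simp
    have "(1 + \<bar>\<xi>\<bar>) * (1 + 2 * vv) + (1 + \<bar>t\<bar>) / 2 * \<mu> - S / \<kappa> \<le> 3 * (1 + \<bar>\<xi>\<bar>) + 32000000 / \<kappa>"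
    proof (cases "vv \<le> 4/5")
      case True
      have "(1 + \<bar>t\<bar>) / 2 * \<mu> = (1 + \<bar>t\<bar>) / 4 * (2 * \<mu>)" by simp
      also have "\<dots> \<le> (1 + \<bar>t\<bar>) / 4 * (1 + \<bar>\<xi>\<bar>)" using m2[OF False] t1 by (intro mult_left_mono) auto
      finally have "(1 + \<bar>\<xi>\<bar>) * (1 + 2 * vv) + (1 + \<bar>t\<bar>) / 2 * \<mu> \<le> (1 + \<bar>\<xi>\<bar>) * (1 + 2 * vv + (1 + \<bar>t\<bar>) / 4)"
        by (simp add: algebra_simps)
      also have "\<dots> \<le> (1 + \<bar>\<xi>\<bar>) * 3"
        by (rule mult_left_mono[OF area_tradeoff_small[OF vv_le(2) True vv_le(1)] x1])
      finally have "(1 + \<bar>\<xi>\<bar>) * (1 + 2 * vv) + (1 + \<bar>t\<bar>) / 2 * \<mu> \<le> 3 * (1 + \<bar>\<xi>\<bar>)" by simp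
      moreover have "0 \<le> S / \<kappa>" "0 \<le> 32000000 / \<kappa>" using S0 \<kappa>_pos by auto
      ultimately show ?thesis by linarith
    next
      case f: False
      have "\<mu> * \<kappa> * (17/32) - 32000000 \<le> S" unfolding S_def using hit_savings[OF False big] f by simp
      then have "(\<mu> * \<kappa> * (17/32) - 32000000) / \<kappa> \<le> S / \<kappa>" using \<kappa>_pos by (intro divide_right_mono) auto
      then have Sk: "\<mu> * (17/32) - 32000000 / \<kappa> \<le> S / \<kappa>" using \<kappa>_pos by (simp add: diff_divide_distrib)
      have "(1 + \<bar>t\<bar>) / 2 * \<mu> - \<mu> * (17/32) = \<mu> * ((1 + \<bar>t\<bar>) / 2 - 17/32)" by (simp add: algebra_simps)
      also have "\<dots> \<le> \<mu> * (4 * (1 - vv))"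
        using \<mu>_bounds area_tradeoff_large[OF vv_le(2,3,1)] by (intro mult_left_mono) auto
      also have "\<dots> = (2 * \<mu>) * (2 * (1 - vv))" by simp
      also have "\<dots> \<le> (1 + \<bar>\<xi>\<bar>) * (2 * (1 - vv))" using m2[OF False] vv_le by (intro mult_right_mono) auto
      finally have "(1 + \<bar>t\<bar>) / 2 * \<mu> - \<mu> * (17/32) \<le> (1 + \<bar>\<xi>\<bar>) * (2 * (1 - vv))" .
      moreover have "(1 + \<bar>\<xi>\<bar>) * (1 + 2 * vv) + (1 + \<bar>\<xi>\<bar>) * (2 * (1 - vv)) = 3 * (1 + \<bar>\<xi>\<bar>)" by (simp add: algebra_simps)
      ultimately show ?thesis using Sk by linarith
    qed
    then have "\<kappa> * ((1 + \<bar>\<xi>\<bar>) * (1 + 2 * vv) + (1 + \<bar>t\<bar>) / 2 * \<mu> - S / \<kappa>) \<le> \<kappa> * (3 * (1 + \<bar>\<xi>\<bar>) + 32000000 / \<kappa>)"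
      using \<kappa>_pos by (intro mult_left_mono) auto
    moreover have "\<kappa> * ((1 + \<bar>\<xi>\<bar>) * (1 + 2 * vv) + (1 + \<bar>t\<bar>) / 2 * \<mu> - S / \<kappa>) = \<kappa> * (1 + \<bar>\<xi>\<bar>) * (1 + 2 * vv) - S + (1 + \<bar>t\<bar>) / 2 * \<mu> * \<kappa> * (if \<xi> = 0 then 2 else 1)"
      using \<kappa>_pos False by (simp add: algebra_simps)
    moreover have "\<kappa> * (3 * (1 + \<bar>\<xi>\<bar>) + 32000000 / \<kappa>) = \<kappa> * (3 * (1 + \<bar>\<xi>\<bar>)) + 32000000" using \<kappa>_pos by (simp add: distrib_left)
    ultimately show ?thesis using s18 by linarith
  qed
  then show ?thesis using main_count h by linarith
qed

end

section \<open>Runs of the algorithm\<close>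

text \<open>Each tile adds weight at most 1, so the accumulated weight cannot jump over a threshold:
  when the next point is placed, the weight exceeds the number of points by at most 1. This
  invariant survives every step and the final stop.\<close>

lemma edge_run_extract:
  assumes run: "edge_run Q K tq k m prev A"
    and pr: "prev \<le> Max (edge_indices tq k)" "lo \<le> prev"
    and up: "\<And>s. lo \<le> s \<Longrightarrow> s < Max (edge_indices tq k) \<Longrightarrow> edge_weight Q K tq k s \<le> edge_weight Q K tq k (Suc s)
        \<and> edge_weight Q K tq k (Suc s) \<le> edge_weight Q K tq k s + 1"
    and inv: "real m \<le> edge_weight Q K tq k prev" "edge_weight Q K tq k prev \<le> real m + 1"
  shows "\<exists>C \<zeta>. C \<subseteq> {prev<..Max (edge_indices tq k)} \<and> A = \<zeta> ` C \<and> (\<forall>s\<in>C. \<zeta> s \<in> tile Q K (snd (tq ! s)) \<inter> I2) \<and>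
    (\<forall>s\<in>{prev..Max (edge_indices tq k)}. real m + real (card (C \<inter> {prev<..s})) \<le> edge_weight Q K tq k s \<and>
       edge_weight Q K tq k s \<le> real m + real (card (C \<inter> {prev<..s})) + 1)"
  using run pr inv
proof (induction rule: edge_run.induct)
  case (stop prev m)
  let ?W = "edge_weight Q K tq k" and ?M = "Max (edge_indices tq k)"
  have mono: "?W prev \<le> ?W s" if "prev \<le> s" "s \<le> ?M" for s
    using that
  proof (induction s rule: dec_induct)
    case (step s)
    then show ?case using up[of s] stop.prems by force
  qed simp
  have small: "?W s \<le> real m + 1" if s: "prev < s" "s \<le> ?M" for s
  proof (rule ccontr)
    assume "\<not> ?thesis"
    then have ex: "prev < s \<and> s \<le> ?M \<and> ?W s > real (Suc m)" using s by simp
    define s0 where "s0 = (LEAST s. prev < s \<and> s \<le> ?M \<and> ?W s > real (Suc m))"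
    have s0: "prev < s0 \<and> s0 \<le> ?M \<and> ?W s0 > real (Suc m)"
      unfolding s0_def by (rule LeastI[of "\<lambda>s. prev < s \<and> s \<le> ?M \<and> ?W s > real (Suc m)", OF ex])
    have "\<not> ?W s' > real (Suc m)" if "prev < s'" "s' < s0" for s'
      using not_less_Least[of s' "\<lambda>s. prev < s \<and> s \<le> ?M \<and> ?W s > real (Suc m)"] that s0 unfolding s0_def by auto
    then have "first_index Q K tq k prev (Suc m) s0" using s0 unfolding first_index_def by blast
    then show False using stop.hyps by blast
  qed
  show ?case
  proof (intro exI[of _ "{}"] exI[of _ undefined] conjI ballI)
    fix s assume s: "s \<in> {prev..?M}"
    then show "real m + real (card ({} \<inter> {prev<..s})) \<le> ?W s" using mono[of s] stop.prems by simp
    show "?W s \<le> real m + real (card ({} \<inter> {prev<..s})) + 1" using small[of s] stop.prems s by (cases "s = prev") auto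
  qed auto
next
  case (step prev m s \<zeta>0 A)
  let ?W = "edge_weight Q K tq k" and ?M = "Max (edge_indices tq k)"
  have f: "prev < s" "s \<le> ?M" "?W s > real (Suc m)" "\<And>s'. prev < s' \<Longrightarrow> s' < s \<Longrightarrow> ?W s' \<le> real (Suc m)"
    using step.hyps(1) unfolding first_index_def by (auto simp: not_less)
  have before: "?W s' \<le> real m + 1" if "prev \<le> s'" "s' < s" for s'
    using f(4)[of s'] that step.prems by (cases "s' = prev") auto
  have mono: "?W prev \<le> ?W s" if "prev \<le> s" "s \<le> ?M" for s
    using that
  proof (induction s rule: dec_induct)
    case (step s')
    then show ?case using up[of s'] \<open>lo \<le> prev\<close> by force
  qed simp
  obtain r where r: "s = Suc r" using f(1) by (cases s) auto
  have "?W s \<le> ?W r + 1" unfolding r by (rule conjunct2[OF up]) (use r f step.prems in auto)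
  then have Ws: "?W s \<le> real (Suc m) + 1" using before[of r] f r by auto
  obtain C \<zeta> where C: "C \<subseteq> {s<..?M}" "A = \<zeta> ` C" "\<forall>s\<in>C. \<zeta> s \<in> tile Q K (snd (tq ! s)) \<inter> I2"
    and W: "\<forall>s'\<in>{s..?M}. real (Suc m) + real (card (C \<inter> {s<..s'})) \<le> ?W s' \<and> ?W s' \<le> real (Suc m) + real (card (C \<inter> {s<..s'})) + 1"
    using step.IH f Ws step.prems by force
  have sC: "s \<notin> C" using C(1) by auto
  show ?case
  proof (intro exI[of _ "insert s C"] exI[of _ "\<zeta>(s := \<zeta>0)"] conjI ballI)
    show "insert s C \<subseteq> {prev<..?M}" using C(1) f by auto
    show "insert \<zeta>0 A = \<zeta>(s := \<zeta>0) ` insert s C" using C(2) sC by (auto simp: image_iff)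
    show "(\<zeta>(s := \<zeta>0)) s' \<in> tile Q K (snd (tq ! s')) \<inter> I2" if "s' \<in> insert s C" for s'
      using that C(3) step.hyps(2) by auto
    fix s' assume s': "s' \<in> {prev..?M}"
    have "real m + real (card (insert s C \<inter> {prev<..s'})) \<le> ?W s' \<and> ?W s' \<le> real m + real (card (insert s C \<inter> {prev<..s'})) + 1"
    proof (cases "s' < s")
      case True
      then have e: "insert s C \<inter> {prev<..s'} = {}" using C(1) by auto
      show ?thesis unfolding e using before[of s'] mono[of s'] True s' step.prems by auto
    next
      case False
      have e: "insert s C \<inter> {prev<..s'} = insert s (C \<inter> {s<..s'})" using C(1) f False by auto
      have "card (insert s C \<inter> {prev<..s'}) = Suc (card (C \<inter> {s<..s'}))" unfolding e by (rule card_insert_disjoint) auto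
      then show ?thesis using W[rule_format, of s'] False s' by auto
    qed
    then show "real m + real (card (insert s C \<inter> {prev<..s'})) \<le> ?W s'" "?W s' \<le> real m + real (card (insert s C \<inter> {prev<..s'})) + 1" by auto
  qed
qed

section \<open>Lattice tiles as grid cells\<close>

lemma frontier_I2: "frontier I2 = {p. on_edge p}"
  by (auto simp: frontier_def closure_I2 interior_I2 on_edge_def not_less)

lemma on_edge_rho_iff: "on_edge p \<longleftrightarrow> (\<exists>s\<in>{0..4}. rho s = p)"
proof
  assume p: "on_edge p"
  then consider "p$2 = 0" | "p$1 = 1" | "p$2 = 1" | "p$1 = 0" unfolding on_edge_def by auto
  then show "\<exists>s\<in>{0..4}. rho s = p"
  proof cases
    case 1
    then show ?thesis using p rho_simps(1)[of "p$1"] pt_eta[of p] by (intro bexI[of _ "p$1"]) (auto simp: on_edge_def)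
  next
    case 2
    then show ?thesis using p rho_simps(2)[of "1 + p$2"] pt_eta[of p] by (intro bexI[of _ "1 + p$2"]) (auto simp: on_edge_def)
  next
    case 3
    then show ?thesis using p rho_simps(3)[of "3 - p$1"] pt_eta[of p] by (intro bexI[of _ "3 - p$1"]) (auto simp: on_edge_def)
  next
    case 4
    then show ?thesis using p rho_simps(4)[of "4 - p$2"] pt_eta[of p] by (intro bexI[of _ "4 - p$2"]) (auto simp: on_edge_def)
  qed
qed (use on_edge_rho in auto)

locale square_lattice =
  fixes \<xi> \<eta> :: real and K :: nat
  assumes \<eta>_pos: "\<eta> > 0" and K_pos: "K \<ge> 1"
begin

sublocale grid \<xi> "real K * \<eta> / (1 + \<xi>\<^sup>2)"
  by unfold_locales (use \<eta>_pos K_pos in \<open>simp add: add_pos_nonneg\<close>)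

abbreviation Q :: "real^2^2" where "Q \<equiv> Qmat \<xi> \<eta>"

definition lat :: "int \<times> int \<Rightarrow> real^2" where "lat n = Q *v pt (of_int (fst n)) (of_int (snd n))"

lemma Q_mult: "Q *v u = pt ((\<xi> * u$1 - u$2) / \<eta>) ((u$1 + \<xi> * u$2) / \<eta>)"
  by (intro vec2_eqI) (simp_all add: Qmat_def matrix_vector_mult_def sum_2 add_divide_distrib diff_divide_distrib)

lemma lattice_eq: "lattice Q = range lat"
proof -
  have "{v::real^2. \<forall>i. v$i \<in> \<int>} = range (\<lambda>n. pt (of_int (fst n)) (of_int (snd n)))"
  proof (intro equalityI subsetI)
    fix v :: "real^2" assume "v \<in> {v. \<forall>i. v$i \<in> \<int>}"
    then have "v$1 \<in> \<int>" "v$2 \<in> \<int>" by auto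
    then obtain i j where "v$1 = of_int i" "v$2 = of_int j" by (elim Ints_cases) blast
    then have "v = pt (of_int (fst (i,j))) (of_int (snd (i,j)))" by (intro vec2_eqI) auto
    then show "v \<in> range (\<lambda>n. pt (of_int (fst n)) (of_int (snd n)))" by blast
  qed (auto simp: forall_2)
  then show ?thesis unfolding lattice_def lat_def[abs_def] by (simp add: image_image)
qed

lemma gu_tile: "gu ((1 / real K) *\<^sub>R (lat n + Q *v u)) = of_int (fst n) + u$1"
  and gv_tile: "gv ((1 / real K) *\<^sub>R (lat n + Q *v u)) = of_int (snd n) + u$2"
proof -
  have K0: "real K > 0" using K_pos by simp
  have o: "1 + \<xi>\<^sup>2 \<noteq> 0" using one_xi by simp
  define v where "v = pt (of_int (fst n) + u$1) (of_int (snd n) + u$2)"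
  have s: "lat n + Q *v u = Q *v v" unfolding lat_def v_def Q_mult by (intro vec2_eqI) (simp_all add: add_divide_distrib diff_divide_distrib algebra_simps)
  have "\<xi> * ((\<xi> * v$1 - v$2) / \<eta>) + (v$1 + \<xi> * v$2) / \<eta> = (1 + \<xi>\<^sup>2) * v$1 / \<eta>"
    "\<xi> * ((v$1 + \<xi> * v$2) / \<eta>) - (\<xi> * v$1 - v$2) / \<eta> = (1 + \<xi>\<^sup>2) * v$2 / \<eta>"
    by (simp_all add: add_divide_distrib[symmetric] diff_divide_distrib[symmetric] power2_eq_square algebra_simps)
  note eq = this
  have "gu ((1 / real K) *\<^sub>R (Q *v v)) = real K * \<eta> / (1 + \<xi>\<^sup>2) * ((\<xi> * ((\<xi> * v$1 - v$2) / \<eta>) + (v$1 + \<xi> * v$2) / \<eta>) / real K)"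
    unfolding gu_def Q_mult by (simp add: add_divide_distrib)
  also have "\<dots> = v$1" unfolding eq using K0 \<eta>_pos o by simp
  finally show "gu ((1 / real K) *\<^sub>R (lat n + Q *v u)) = of_int (fst n) + u$1" unfolding s by (simp add: v_def)
  have "gv ((1 / real K) *\<^sub>R (Q *v v)) = real K * \<eta> / (1 + \<xi>\<^sup>2) * ((\<xi> * ((v$1 + \<xi> * v$2) / \<eta>) - (\<xi> * v$1 - v$2) / \<eta>) / real K)"
    unfolding gv_def Q_mult by (simp add: diff_divide_distrib)
  also have "\<dots> = v$2" unfolding eq using K0 \<eta>_pos o by simp
  finally show "gv ((1 / real K) *\<^sub>R (lat n + Q *v u)) = of_int (snd n) + u$2" unfolding s by (simp add: v_def)
qed

lemma tile_lat: "tile Q K (lat n) = T n"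
proof (intro equalityI subsetI)
  fix w assume "w \<in> tile Q K (lat n)"
  then obtain u where u: "\<forall>i. 0 \<le> u$i \<and> u$i < 1" "w = (1 / real K) *\<^sub>R (lat n + Q *v u)"
    unfolding tile_def fund_domain_def by auto
  have "cell w = n" unfolding u(2) cell_def gu_tile gv_tile prod_eq_iff using u(1) by (simp add: floor_eq_iff forall_2)
  then show "w \<in> T n" by simp
next
  fix w assume "w \<in> T n"
  then have w: "cell w = n" by simp
  define u where "u = pt (gu w - of_int (fst n)) (gv w - of_int (snd n))"
  have u: "\<forall>i. 0 \<le> u$i \<and> u$i < 1" using T_bounds[OF w] by (auto simp: u_def forall_2)
  have "pos (gu ((1 / real K) *\<^sub>R (lat n + Q *v u))) (gv ((1 / real K) *\<^sub>R (lat n + Q *v u))) = pos (gu w) (gv w)"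
    unfolding gu_tile gv_tile by (simp add: u_def)
  then have "w = (1 / real K) *\<^sub>R (lat n + Q *v u)" by (simp only: pos_gu_gv)
  then show "w \<in> tile Q K (lat n)" unfolding tile_def fund_domain_def using u by blast
qed

lemma lat_inj: "inj lat"
proof (rule injI)
  fix m n assume "lat m = lat n"
  then have "T m = T n" using tile_lat by metis
  moreover obtain w where "w \<in> T m" using Tint_ne[of m] Tint_sub[of m] by blast
  ultimately show "m = n" by auto
qed

lemma Ad_eq: "Ad Q K = lat ` AdI"
proof -
  have *: "{p \<in> range lat. V p} = lat ` {n. V (lat n)}" for V by blast
  show ?thesis unfolding Ad_def lattice_eq AdI_def * tile_lat ..
qed

lemma weight_factor: "(real K)\<^sup>2 / \<bar>det Q\<bar> = 1 / area"
proof -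
  have "det Q = (1 + \<xi>\<^sup>2) / \<eta>\<^sup>2" by (simp add: det_2 Qmat_def power2_eq_square add_divide_distrib)
  then show ?thesis unfolding area_def using one_xi \<eta>_pos by (simp add: power_divide power_mult_distrib power2_eq_square)
qed

lemma edge_weight_eq:
  assumes "\<And>j. j < length tq \<Longrightarrow> snd (tq ! j) = lat (nn j)" "s < length tq"
  shows "edge_weight Q K tq k s = (\<Sum>j = Min (edge_indices tq k)..s. wt (nn j))"
  unfolding edge_weight_def weight_factor sum_distrib_left wt_def
  using assms tile_lat by (intro sum.cong) auto

text \<open>On initial segments the weight minus the number of points lies in [0, 1]; a block of
  consecutive tiles is a difference of two initial segments, hence an error of at most 1.\<close>

lemma edge_extract:
  assumes add: "edge_additions Q K tq k A"
    and snd_tq: "\<And>j. j < length tq \<Longrightarrow> snd (tq ! j) = lat (nn j)"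
    and mono: "\<And>i j. i < j \<Longrightarrow> j < length tq \<Longrightarrow> fst (tq ! i) < fst (tq ! j)"
  shows "\<exists>C \<zeta>. C \<subseteq> edge_indices tq k \<and> A = \<zeta> ` C \<and> (\<forall>j\<in>C. cell (\<zeta> j) = nn j \<and> \<zeta> j \<in> I2) \<and>
    (\<forall>i j. i \<le> j \<longrightarrow> j < length tq \<longrightarrow> real k - 1 \<le> fst (tq ! i) \<longrightarrow> fst (tq ! j) < real k \<longrightarrow>
      \<bar>real (card (C \<inter> {i..j})) - (\<Sum>l=i..j. wt (nn l))\<bar> \<le> 1)"
proof (cases "edge_indices tq k = {}")
  case True
  have "\<not> (i \<le> j \<and> j < length tq \<and> real k - 1 \<le> fst (tq ! i) \<and> fst (tq ! j) < real k)" for i j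
  proof
    assume a: "i \<le> j \<and> j < length tq \<and> real k - 1 \<le> fst (tq ! i) \<and> fst (tq ! j) < real k"
    then have "fst (tq ! i) \<le> fst (tq ! j)" using mono[of i j] by (cases "i = j") auto
    then have "j \<in> edge_indices tq k" using a by (simp add: edge_indices_def)
    then show False using True by simp
  qed
  moreover have "A = {}" using add True by (simp add: edge_additions_def)
  ultimately show ?thesis by (intro exI[of _ "{}"]) auto
next
  case False
  let ?E = "edge_indices tq k"
  let ?W = "edge_weight Q K tq k"
  define lo hi where "lo = Min ?E" and "hi = Max ?E"
  have fin: "finite ?E" by (simp add: edge_indices_def)
  have lh: "lo \<in> ?E" "hi \<in> ?E" unfolding lo_def hi_def using fin False by auto
  have lohi: "lo \<le> hi" unfolding lo_def using fin lh by auto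
  have hiL: "hi < length tq" using lh by (simp add: edge_indices_def)
  have W: "?W s = (\<Sum>j=lo..s. wt (nn j))" if "s \<le> hi" for s
    unfolding lo_def by (rule edge_weight_eq[OF snd_tq]) (use that hiL in auto)
  have Wlo: "?W lo = wt (nn lo)" using W[of lo] lohi by simp
  have run: "edge_run Q K tq k 0 lo A" using add False by (simp add: edge_additions_def lo_def)
  have ex: "\<exists>C \<zeta>. C \<subseteq> {lo<..Max ?E} \<and> A = \<zeta> ` C \<and> (\<forall>s\<in>C. \<zeta> s \<in> tile Q K (snd (tq ! s)) \<inter> I2) \<and>
    (\<forall>s\<in>{lo..Max ?E}. real 0 + real (card (C \<inter> {lo<..s})) \<le> ?W s \<and> ?W s \<le> real 0 + real (card (C \<inter> {lo<..s})) + 1)"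
  proof (rule edge_run_extract[OF run])
    show "lo \<le> Max ?E" using lohi hi_def by simp
    show "real 0 \<le> ?W lo" "?W lo \<le> real 0 + 1" using Wlo wt_bounds by auto
    fix s assume s: "lo \<le> s" "s < Max ?E"
    then have "?W (Suc s) = ?W s + wt (nn (Suc s))" using W[of s] W[of "Suc s"] by (simp add: hi_def)
    then show "?W s \<le> ?W (Suc s) \<and> ?W (Suc s) \<le> ?W s + 1" using wt_bounds[of "nn (Suc s)"] by simp
  qed simp
  then obtain C \<zeta> where C: "C \<subseteq> {lo<..hi}" "A = \<zeta> ` C" "\<forall>s\<in>C. \<zeta> s \<in> tile Q K (snd (tq ! s)) \<inter> I2"
    and CW: "\<And>s. lo \<le> s \<Longrightarrow> s \<le> hi \<Longrightarrow> real (card (C \<inter> {lo<..s})) \<le> ?W s \<and> ?W s \<le> real (card (C \<inter> {lo<..s})) + 1"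
    unfolding hi_def by auto
  have le_mono: "fst (tq ! i) \<le> fst (tq ! j)" if "i \<le> j" "j < length tq" for i j
    using mono[of i j] that by (cases "i = j") auto
  have CE: "C \<subseteq> ?E"
  proof
    fix j assume "j \<in> C"
    then have "lo \<le> j" "j \<le> hi" using C(1) by auto
    then have "fst (tq ! lo) \<le> fst (tq ! j)" "fst (tq ! j) \<le> fst (tq ! hi)" "j < length tq" using le_mono hiL by auto
    then show "j \<in> ?E" using lh by (simp add: edge_indices_def)
  qed
  show ?thesis
  proof (intro exI[of _ C] exI[of _ \<zeta>] conjI ballI allI impI)
    show "C \<subseteq> ?E" "A = \<zeta> ` C" by (fact CE C(2))+
    show "cell (\<zeta> j) = nn j" "\<zeta> j \<in> I2" if "j \<in> C" for j
    proof -
      have "j < length tq" using that CE by (auto simp: edge_indices_def)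
      then show "cell (\<zeta> j) = nn j" "\<zeta> j \<in> I2" using C(3) that snd_tq tile_lat[of "nn j"] by auto
    qed
    fix i j assume ij: "i \<le> j" "j < length tq" "real k - 1 \<le> fst (tq ! i)" "fst (tq ! j) < real k"
    have "fst (tq ! i) \<le> fst (tq ! j)" using le_mono ij by blast
    then have "i \<in> ?E" "j \<in> ?E" using ij by (auto simp: edge_indices_def)
    then have b: "lo \<le> i" "i \<le> hi" "lo \<le> j" "j \<le> hi" using fin by (auto simp: lo_def hi_def)
    show "\<bar>real (card (C \<inter> {i..j})) - (\<Sum>l=i..j. wt (nn l))\<bar> \<le> 1"
    proof (cases "i = lo")
      case True
      have "C \<inter> {i..j} = C \<inter> {lo<..j}" using C(1) True by auto
      then show ?thesis using CW[of j] W[of j] b True by (simp add: abs_le_iff)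
    next
      case False
      then obtain r where r: "i = Suc r" "lo \<le> r" using b by (cases i) auto
      have "C \<inter> {lo<..j} = (C \<inter> {lo<..r}) \<union> (C \<inter> {i..j})" using r ij b by auto
      then have "card (C \<inter> {lo<..j}) = card (C \<inter> {lo<..r}) + card (C \<inter> {i..j})"
        by (simp only:) (rule card_Un_disjoint, use r in auto)
      then have cc: "real (card (C \<inter> {lo<..j})) = real (card (C \<inter> {lo<..r})) + real (card (C \<inter> {i..j}))" by simp
      have "{lo..j} = {lo..r} \<union> {i..j}" using r ij b by auto
      then have "(\<Sum>l=lo..j. wt (nn l)) = (\<Sum>l=lo..r. wt (nn l)) + (\<Sum>l=i..j. wt (nn l))"
        by (simp only:) (rule sum.union_disjoint, use r in auto)
      then have ww: "?W j = ?W r + (\<Sum>l=i..j. wt (nn l))" using W[of j] W[of r] b r by simp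
      show ?thesis using CW[of j] CW[of r] b r cc ww unfolding abs_le_iff by auto
    qed
  qed
qed

lemma modified_run:
  assumes zc: "tile_choice Q K z0" and P: "modified_point_set Q K z0 P"
    and big: "real K * \<eta> / (1 + \<xi>\<^sup>2) > 2"
  shows "\<exists>z \<zeta> L tt nn C. modrun \<xi> (real K * \<eta> / (1 + \<xi>\<^sup>2)) z \<zeta> L tt nn C P"
proof -
  define z where "z n = z0 (lat n)" for n
  have z: "cell (z n) = n" for n
    using zc tile_lat[of n] unfolding tile_choice_def z_def lattice_eq by blast
  have zi: "inj z" using z by (metis injI)
  have ps: "point_set Q z0 = {z n |n. z n \<in> I2}" unfolding point_set_def lattice_eq z_def by blast
  have zAd: "z0 ` Ad Q K = z ` AdI" unfolding Ad_eq z_def by (simp add: image_image)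
  show ?thesis
  proof (cases "Ad Q K = {}")
    case True
    then have A: "AdI = {}" using Ad_eq by simp
    have "P = {z n |n. z n \<in> I2}" using P True ps by (simp add: modified_point_set_def)
    then have "modrun \<xi> (real K * \<eta> / (1 + \<xi>\<^sup>2)) z undefined 0 undefined undefined (\<lambda>_. {}) P"
      by unfold_locales (use z big A in auto)
    then show ?thesis by blast
  next
    case False
    then obtain tq0 A where bl: "boundary_list Q K tq0" and ed: "\<forall>k\<in>{1..4}. edge_additions Q K (Ad_list Q K tq0) k (A k)"
      and Pe: "P = (point_set Q z0 - z0 ` Ad Q K) \<union> (\<Union>k\<in>{1..4}. A k)"
      using P by (auto simp: modified_point_set_def)
    define tq where "tq = Ad_list Q K tq0"
    have tq_set: "set tq = {x \<in> set tq0. snd x \<in> Ad Q K}" by (auto simp: tq_def Ad_list_def)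
    have "sorted_wrt (\<lambda>x y. fst x < fst y) tq0" using bl by (simp add: boundary_list_def sorted_wrt_map)
    then have so: "sorted_wrt (\<lambda>x y. fst x < fst y) tq" unfolding tq_def Ad_list_def by (rule sorted_wrt_filter)
    have di: "distinct (map snd tq)" using bl unfolding boundary_list_def tq_def Ad_list_def by (simp add: distinct_map_filter)
    define nn where "nn j = inv lat (snd (tq ! j))" for j
    have snd_tq: "snd (tq ! j) = lat (nn j)" if "j < length tq" for j
    proof -
      have "snd (tq ! j) \<in> Ad Q K" using tq_set nth_mem[OF that] by blast
      then show ?thesis unfolding nn_def Ad_eq by (auto simp: f_inv_into_f)
    qed
    have mono: "fst (tq ! i) < fst (tq ! j)" if "i < j" "j < length tq" for i j
      by (rule sorted_wrt_nth_less[OF so that])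
    have pr: "fst (tq ! j) \<in> {0..4}" "cell (rho (fst (tq ! j))) = nn j" if "j < length tq" for j
    proof -
      have "tq ! j \<in> set tq0" using tq_set nth_mem[OF that] by blast
      then have "fst (tq ! j) \<in> {0..4} \<and> rho (fst (tq ! j)) \<in> tile Q K (snd (tq ! j))"
        using bl unfolding boundary_list_def by (cases "tq ! j") auto
      then show "fst (tq ! j) \<in> {0..4}" "cell (rho (fst (tq ! j))) = nn j" using snd_tq[OF that] tile_lat[of "nn j"] by auto
    qed
    have inj: "inj_on nn {..<length tq}"
    proof (rule inj_onI)
      fix i j assume ij: "i \<in> {..<length tq}" "j \<in> {..<length tq}" "nn i = nn j"
      then have "map snd tq ! i = map snd tq ! j" using snd_tq[of i] snd_tq[of j] by simp
      then show "i = j" using nth_eq_iff_index_eq[OF di] ij by simp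
    qed
    have range: "nn ` {..<length tq} = AdI"
    proof (intro equalityI subsetI)
      fix n assume "n \<in> nn ` {..<length tq}"
      then obtain j where j: "j < length tq" "n = nn j" by auto
      then have "lat n \<in> Ad Q K" using tq_set nth_mem[OF j(1)] snd_tq[OF j(1)] by auto
      then show "n \<in> AdI" unfolding Ad_eq using lat_inj by (auto simp: inj_image_mem_iff)
    next
      fix n assume n: "n \<in> AdI"
      then obtain p where p: "p \<in> T n" "p \<in> frontier I2" using interior_subset unfolding AdI_def by blast
      then obtain s where s: "s \<in> {0..4}" "rho s = p" by (auto simp: frontier_I2 on_edge_rho_iff)
      then have "rho s \<in> tile Q K (lat n)" using p tile_lat[of n] by simp
      then have "lat n \<in> snd ` set tq0" using bl s(1) unfolding boundary_list_def lattice_eq by blast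
      moreover have "lat n \<in> Ad Q K" using n Ad_eq by blast
      ultimately have "lat n \<in> snd ` set tq" unfolding tq_set by auto
      then obtain j where j: "j < length tq" "lat n = snd (tq ! j)" by (auto simp: in_set_conv_nth)
      then have "n = nn j" using snd_tq lat_inj by (auto simp: inj_eq)
      then show "n \<in> nn ` {..<length tq}" using j by auto
    qed
    have "\<forall>k\<in>{1..4}. \<exists>C \<zeta>. C \<subseteq> edge_indices tq k \<and> A k = \<zeta> ` C \<and> (\<forall>j\<in>C. cell (\<zeta> j) = nn j \<and> \<zeta> j \<in> I2) \<and>
      (\<forall>i j. i \<le> j \<longrightarrow> j < length tq \<longrightarrow> real k - 1 \<le> fst (tq ! i) \<longrightarrow> fst (tq ! j) < real k \<longrightarrow>
      \<bar>real (card (C \<inter> {i..j})) - (\<Sum>l=i..j. wt (nn l))\<bar> \<le> 1)"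
      using ed snd_tq mono unfolding tq_def[symmetric] by (intro ballI edge_extract) auto
    then obtain C \<zeta>f where C: "\<And>k. k \<in> {1..4} \<Longrightarrow> C k \<subseteq> edge_indices tq k \<and> A k = \<zeta>f k ` C k \<and> (\<forall>j\<in>C k. cell (\<zeta>f k j) = nn j \<and> \<zeta>f k j \<in> I2) \<and>
      (\<forall>i j. i \<le> j \<longrightarrow> j < length tq \<longrightarrow> real k - 1 \<le> fst (tq ! i) \<longrightarrow> fst (tq ! j) < real k \<longrightarrow>
      \<bar>real (card (C k \<inter> {i..j})) - (\<Sum>l=i..j. wt (nn l))\<bar> \<le> 1)"
      by metis
    \<comment> \<open>The four edges have their own choice functions. The index \<open>j\<close>
      determines its edge as the floor of its parameter plus 1, so they merge into one
      function.\<close>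
    define \<zeta> where "\<zeta> j = \<zeta>f (Suc (nat \<lfloor>fst (tq ! j)\<rfloor>)) j" for j
    have \<zeta>: "\<zeta> j = \<zeta>f k j" if "k \<in> {1..4}" "j \<in> C k" for k j
    proof -
      have "real k - 1 \<le> fst (tq ! j)" "fst (tq ! j) < real k" using C[OF that(1)] that(2) by (auto simp: edge_indices_def)
      then have "\<lfloor>fst (tq ! j)\<rfloor> = int k - 1" by (simp add: floor_eq_iff)
      moreover have "1 \<le> k" using that(1) by simp
      ultimately have "Suc (nat \<lfloor>fst (tq ! j)\<rfloor>) = k" by linarith
      then show ?thesis by (simp add: \<zeta>_def)
    qed
    have Aeq: "A k = \<zeta> ` C k" if "k \<in> {1..4}" for k
      using C[OF that] \<zeta>[OF that] by (metis (no_types, lifting) image_cong)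
    have P1: "point_set Q z0 - z0 ` Ad Q K = {z n |n. n \<notin> AdI \<and> z n \<in> I2}"
      unfolding ps zAd using zi by (auto simp: inj_eq)
    have P2: "(\<Union>k\<in>{1..4}. A k) = \<zeta> ` (\<Union>k\<in>{1..4}. C k)" using Aeq by auto
    have "modrun \<xi> (real K * \<eta> / (1 + \<xi>\<^sup>2)) z \<zeta> (length tq) (\<lambda>j. fst (tq ! j)) nn C P"
    proof unfold_locales
      show "P = {z n |n. n \<notin> AdI \<and> z n \<in> I2} \<union> \<zeta> ` (\<Union>k\<in>{1..4}. C k)" unfolding Pe P1 P2 ..
      show "C k \<subseteq> {j. j < length tq \<and> real k - 1 \<le> fst (tq ! j) \<and> fst (tq ! j) < real k}" if "k \<in> {1..4}" for k
        using C[OF that] unfolding edge_indices_def by blast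
      show "cell (\<zeta> j) = nn j \<and> \<zeta> j \<in> I2" if "k \<in> {1..4}" "j \<in> C k" for k j
        using C[OF that(1)] that(2) \<zeta>[OF that] by simp
      show "\<bar>real (card (C k \<inter> {i..j})) - (\<Sum>l=i..j. wt (nn l))\<bar> \<le> 1"
        if "k \<in> {1..4}" "i \<le> j" "j < length tq" "real k - 1 \<le> fst (tq ! i)" "fst (tq ! j) < real k" for k i j
        using C[OF that(1)] that(2-) by blast
    qed (use z inj range mono pr big in auto)
    then show ?thesis by blast
  qed
qed

end

section \<open>From generic open caps to the discrepancy\<close>

text \<open>Finitely many strict inequalities survive a small tilt of a polar axis. Tilting by the
  angle \<open>a\<close> towards any fixed meridian gives \<open>(sin a, b * cos a)\<close>.\<close>

lemma nonpolar_perturbation: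
  assumes c: "c \<ge> 0" "c\<^sup>2 + b\<^sup>2 = 1" and G: "finite G" "\<And>p. p \<in> G \<Longrightarrow> capF c b x0 p > t"
  shows "\<exists>c' b'. c' > 0 \<and> c'\<^sup>2 + b'\<^sup>2 = 1 \<and> (\<forall>p\<in>G. capF c' b' x0 p > t)"
proof (cases "c > 0")
  case True
  then show ?thesis using assms by blast
next
  case False
  then have c0: "c = 0" "b\<^sup>2 = 1" using c by auto
  have "eventually (\<lambda>a. \<forall>p\<in>G. capF (sin a) (b * cos a) x0 p > t) (at_right 0)"
  proof (rule eventually_ball_finite[OF G(1)], rule ballI)
    fix p assume "p \<in> G"
    then have "capF (sin 0) (b * cos 0) x0 p > t" using G(2) c0 by simp
    moreover have "((\<lambda>a. capF (sin a) (b * cos a) x0 p) \<longlongrightarrow> capF (sin 0) (b * cos 0) x0 p) (at_right 0)"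
      unfolding capF_def by (intro tendsto_intros)
    ultimately show "eventually (\<lambda>a. capF (sin a) (b * cos a) x0 p > t) (at_right 0)" by (rule order_tendstoD(1)[rotated])
  qed
  moreover have "eventually (\<lambda>a. a \<in> {0<..<pi}) (at_right (0::real))" by (rule eventually_at_right_real) simp
  ultimately have "eventually (\<lambda>a. (\<forall>p\<in>G. capF (sin a) (b * cos a) x0 p > t) \<and> a \<in> {0<..<pi}) (at_right 0)"
    by eventually_elim auto
  then obtain a where a: "\<forall>p\<in>G. capF (sin a) (b * cos a) x0 p > t" "0 < a" "a < pi"
    using eventually_happens'[OF trivial_limit_at_right_real] by fastforce
  have "(sin a)\<^sup>2 + (b * cos a)\<^sup>2 = 1" using c0 by (simp add: power_mult_distrib)
  moreover have "sin a > 0" using a by (simp add: sin_gt_zero)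
  ultimately show ?thesis using a(1) by blast
qed

lemma generic_level:
  assumes "finite G" "\<And>p. p \<in> G \<Longrightarrow> f p > t" "t < 1" "finite (S :: real set)"
  shows "\<exists>t'>t. t' < 1 \<and> t' \<notin> S \<and> (\<forall>p\<in>G. f p > t')"
proof -
  define m where "m = Min (insert 1 (f ` G))"
  have m: "t < m" "m \<le> 1" "\<And>p. p \<in> G \<Longrightarrow> m \<le> f p" using assms by (auto simp: m_def)
  have "infinite ({t<..<m} - S)" using m assms(4) by (intro Diff_infinite_finite) auto
  then have "{t<..<m} - S \<noteq> {}" using finite.emptyI by fastforce
  then obtain t' where "t' \<in> {t<..<m} - S" by blast
  then show ?thesis using m by (intro exI[of _ t']) force
qed

definition deviation :: "real \<Rightarrow> real \<Rightarrow> real" where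
  "deviation \<xi> \<kappa> = sqrt 18 * (\<kappa> * sqrt (1 + \<xi>\<^sup>2)) + (40000000 + 96 * (4 * (1 + \<bar>\<xi>\<bar>) + 3)\<^sup>2)"

context modrun
begin

lemma P_sub: "P \<subseteq> I2" using P_eq \<zeta>_in by auto

text \<open>Both perturbations keep all points of the cap, and raising the threshold only shrinks
  the area. An upper bound for the surplus of the generic cap therefore bounds that of the given
  one.\<close>

lemma open_cap_bound:
  assumes big: "\<kappa> \<ge> 100000" and w: "w \<in> sphere 0 1" and t: "-1 < t" "t < 1"
  shows "real (card {p\<in>P. w \<bullet> lambert p > t}) - (1 - t) / 2 * real (card P) \<le> deviation \<xi> \<kappa>"
proof -
  define G where "G = {p\<in>P. w \<bullet> lambert p > t}"
  have finG: "finite G" using count_points(1) by (simp add: G_def)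
  obtain c0 b0 x0 where p: "c0 \<ge> 0" "c0\<^sup>2 + b0\<^sup>2 = 1" "0 \<le> x0" "x0 < 1"
    and w_eq: "w = vector [c0 * cos (2*pi*x0), c0 * sin (2*pi*x0), b0]"
    using unit_vector_param[OF w] by blast
  have G0: "capF c0 b0 x0 q > t" if "q \<in> G" for q
    using that unfolding G_def w_eq inner_lambert by simp
  obtain c b where cb: "c > 0" "c\<^sup>2 + b\<^sup>2 = 1" "\<forall>q\<in>G. capF c b x0 q > t"
    using nonpolar_perturbation[OF p(1,2) finG G0] by blast
  obtain t' where t': "t' > t" "t' < 1" "t' \<notin> {0, b, - b}" "\<forall>q\<in>G. capF c b x0 q > t'"
    using generic_level[OF finG, of t "capF c b x0" "{0, b, - b}"] cb(3) t by auto
  interpret mc: modcap \<xi> \<kappa> c b x0 t' z \<zeta> L tt nn C P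
    by unfold_locales (use cb p t' t in \<open>auto simp: abs_less_iff abs_eq_iff\<close>)
  have sub: "G \<subseteq> {q\<in>P. capF c b x0 q > t'}" using t'(4) by (auto simp: G_def)
  have "real (card G) \<le> real (card {q\<in>P. capF c b x0 q > t'})"
    using card_mono[OF _ sub] count_points(1) by simp
  also have "\<dots> \<le> deviation \<xi> \<kappa> + (1 - t') / 2 * real (card P)"
    using mc.one_sided[OF big] by (simp add: deviation_def mc.CE_def mc.\<sigma>_def)
  also have "(1 - t') / 2 * real (card P) \<le> (1 - t) / 2 * real (card P)" using t' by (intro mult_right_mono) auto
  finally show ?thesis by (simp add: G_def)
qed

lemma deviation_nonneg: "deviation \<xi> \<kappa> \<ge> 0" using \<kappa>_pos by (simp add: deviation_def)

lemma inner_le_1: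
  assumes "w \<in> sphere 0 1" "p \<in> P"
  shows "\<bar>w \<bullet> lambert p\<bar> \<le> 1"
proof -
  have "norm (lambert p) = 1" "norm w = 1" using lambert_in_sphere[of p] P_sub assms by auto
  then show ?thesis using Cauchy_Schwarz_ineq2[of w "lambert p"] by simp
qed

text \<open>From above, the closed cap is contained in open caps with slightly lower thresholds.
  From below, its complement is the open cap with axis \<open>- w\<close> and threshold
  \<open>- t\<close>, whose surplus is the deficit of the closed cap.\<close>

lemma closed_cap_bound:
  assumes big: "\<kappa> \<ge> 100000" and w: "w \<in> sphere 0 1" and t: "-1 \<le> t" "t \<le> 1"
  shows "\<bar>real (card {p\<in>P. w \<bullet> lambert p \<ge> t}) - (1 - t) / 2 * real (card P)\<bar> \<le> deviation \<xi> \<kappa>"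
proof -
  let ?c = "real (card {p\<in>P. w \<bullet> lambert p \<ge> t})"
  have le_P: "?c \<le> real (card P)" using card_mono[OF count_points(1), of "{p\<in>P. w \<bullet> lambert p \<ge> t}"] by auto
  have upper: "?c - (1 - t) / 2 * real (card P) \<le> deviation \<xi> \<kappa>"
  proof (cases "t = -1")
    case True
    then show ?thesis using le_P deviation_nonneg by simp
  next
    case False
    show ?thesis
    proof (rule field_le_epsilon)
      fix e :: real assume e: "e > 0"
      define d where "d = min ((t + 1) / 2) (e / (1 + real (card P)))"
      have "d \<le> (t + 1) / 2" unfolding d_def by (rule min.cobounded1)
      moreover have "d > 0" using e False t by (auto simp: d_def add_pos_nonneg)
      ultimately have d: "d > 0" "-1 < t - d" "t - d < 1" using False t by (auto simp: field_simps)
      have "d * real (card P) \<le> e / (1 + real (card P)) * (1 + real (card P))"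
        using e by (intro mult_mono) (auto simp: d_def)
      then have dP: "d * real (card P) \<le> e" using e by (simp add: add_nonneg_eq_0_iff)
      have "card {p\<in>P. w \<bullet> lambert p \<ge> t} \<le> card {p\<in>P. w \<bullet> lambert p > t - d}"
        using count_points(1) d by (intro card_mono) auto
      then have "?c \<le> deviation \<xi> \<kappa> + (1 - (t - d)) / 2 * real (card P)"
        using open_cap_bound[OF big w d(2,3)] by simp
      also have "(1 - (t - d)) / 2 * real (card P) = (1 - t) / 2 * real (card P) + d * real (card P) / 2"
        by (simp add: field_simps)
      finally show "?c - (1 - t) / 2 * real (card P) \<le> deviation \<xi> \<kappa> + e" using dP e by linarith
    qed
  qed
  have lower: "(1 - t) / 2 * real (card P) - ?c \<le> deviation \<xi> \<kappa>"
  proof -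
    consider "t = 1" | "t = -1" | "-1 < t" "t < 1" using t by linarith
    then show ?thesis
    proof cases
      case 1
      then show ?thesis using deviation_nonneg by simp
    next
      case 2
      then have "{p\<in>P. w \<bullet> lambert p \<ge> t} = P" using inner_le_1[OF w] by (auto simp: abs_le_iff)
      then show ?thesis using 2 deviation_nonneg by simp
    next
      case 3
      have "- w \<in> sphere 0 1" using w by simp
      from open_cap_bound[OF big this, of "- t"] 3
      have o: "real (card {p\<in>P. w \<bullet> lambert p < t}) - (1 + t) / 2 * real (card P) \<le> deviation \<xi> \<kappa>" by simp
      have "P = {p\<in>P. w \<bullet> lambert p < t} \<union> {p\<in>P. w \<bullet> lambert p \<ge> t}" by auto
      then have "card P = card {p\<in>P. w \<bullet> lambert p < t} + card {p\<in>P. w \<bullet> lambert p \<ge> t}"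
        using card_Un_disjoint[of "{p\<in>P. w \<bullet> lambert p < t}" "{p\<in>P. w \<bullet> lambert p \<ge> t}"] count_points(1) by force
      then have "real (card P) = real (card {p\<in>P. w \<bullet> lambert p < t}) + ?c" by (simp only: of_nat_add[symmetric])
      moreover have "(1 - t) / 2 * real (card P) = real (card P) - (1 + t) / 2 * real (card P)" by (simp add: field_simps)
      ultimately show ?thesis using o by linarith
    qed
  qed
  show ?thesis using upper lower unfolding abs_le_iff by linarith
qed

end

section \<open>Passage to the discrepancy\<close>

lemma cap_discrepancy_le:
  assumes "\<And>w t. w \<in> sphere 0 1 \<Longrightarrow> -1 \<le> t \<Longrightarrow> t \<le> 1 \<Longrightarrow>
     \<bar>(1 / real (card P)) * (\<Sum>p\<in>P. indicator (cap w t) p) - (1 - t) / 2\<bar> \<le> B"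
  shows "cap_discrepancy P \<le> B"
  unfolding cap_discrepancy_def
proof (rule cSUP_least)
  show "sphere (0::real^3) 1 \<noteq> {}" by simp
  fix w :: "real^3" assume w: "w \<in> sphere 0 1"
  show "(SUP t\<in>{-1..1}. \<bar>(1 / real (card P)) * (\<Sum>p\<in>P. indicator (cap w t) p) - measure sphere_measure (cap w t)\<bar>) \<le> B"
  proof (rule cSUP_least)
    fix t :: real assume t: "t \<in> {-1..1}"
    then have m: "measure sphere_measure (cap w t) = (1 - t) / 2" by (intro measure_cap[OF w]) (auto simp: abs_le_iff)
    show "\<bar>(1 / real (card P)) * (\<Sum>p\<in>P. indicator (cap w t) p) - measure sphere_measure (cap w t)\<bar> \<le> B"
      unfolding m using assms[OF w] t by simp
  qed simp
qed

lemma cap_discrepancy_le_1: "cap_discrepancy P \<le> 1"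
proof (rule cap_discrepancy_le)
  fix w :: "real^3" and t :: real assume t: "-1 \<le> t" "t \<le> 1"
  have "(\<Sum>p\<in>P. indicator (cap w t) p) \<le> real (card P) * (1::real)"
    by (rule sum_bounded_above) (simp add: indicator_def)
  moreover have "0 \<le> (\<Sum>p\<in>P. indicator (cap w t) p :: real)" by (intro sum_nonneg) simp
  ultimately have "0 \<le> (1 / real (card P)) * (\<Sum>p\<in>P. indicator (cap w t) p)" "(1 / real (card P)) * (\<Sum>p\<in>P. indicator (cap w t) p) \<le> 1"
    by (auto simp: divide_le_eq)
  then show "\<bar>(1 / real (card P)) * (\<Sum>p\<in>P. indicator (cap w t) p) - (1 - t) / 2\<bar> \<le> 1" using t unfolding abs_le_iff by (simp add: field_simps)
qed

lemma (in modrun) discrepancy_le: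
  assumes big: "\<kappa> \<ge> 100000" and N: "card P \<ge> 1"
  shows "cap_discrepancy (lambert ` P) \<le> deviation \<xi> \<kappa> / real (card P)"
proof (rule cap_discrepancy_le)
  fix w :: "real^3" and t :: real assume w: "w \<in> sphere 0 1" and t: "-1 \<le> t" "t \<le> 1"
  have inj: "inj_on lambert P" by (rule inj_on_subset[OF lambert_inj P_sub])
  have c: "card (lambert ` P) = card P" by (rule card_image[OF inj])
  have "(\<Sum>p\<in>lambert ` P. indicator (cap w t) p) = (\<Sum>p\<in>P. if t \<le> w \<bullet> lambert p then 1 else (0::real))"
    unfolding sum.reindex[OF inj] by (rule sum.cong) (use P_sub lambert_in_sphere in \<open>auto simp: cap_def indicator_def\<close>)
  also have "\<dots> = real (card {p\<in>P. w \<bullet> lambert p \<ge> t})" using count_points(1) by (simp add: sum.If_cases Int_def)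
  finally have s: "(\<Sum>p\<in>lambert ` P. indicator (cap w t) p) = real (card {p\<in>P. w \<bullet> lambert p \<ge> t})" .
  have N0: "real (card P) > 0" using N by simp
  have "\<bar>(1 / real (card P)) * real (card {p\<in>P. w \<bullet> lambert p \<ge> t}) - (1 - t) / 2\<bar>
     = \<bar>real (card {p\<in>P. w \<bullet> lambert p \<ge> t}) - (1 - t) / 2 * real (card P)\<bar> / real (card P)"
  proof -
    have "(1 / real (card P)) * real (card {p\<in>P. w \<bullet> lambert p \<ge> t}) - (1 - t) / 2
      = (real (card {p\<in>P. w \<bullet> lambert p \<ge> t}) - (1 - t) / 2 * real (card P)) / real (card P)"
      using N0 by (simp add: diff_divide_distrib)
    then show ?thesis using N0 by (simp add: abs_divide)
  qed
  also have "\<dots> \<le> deviation \<xi> \<kappa> / real (card P)"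
    using closed_cap_bound[OF big w t] N0 by (intro divide_right_mono) auto
  finally show "\<bar>(1 / real (card (lambert ` P))) * (\<Sum>p\<in>lambert ` P. indicator (cap w t) p) - (1 - t) / 2\<bar> \<le> deviation \<xi> \<kappa> / real (card P)"
    unfolding c s .
qed

text \<open>The number of points \<open>n\<close> differs from \<open>h^2\<close> by O(h), so
  \<open>h\<close> and \<open>sqrt n\<close> differ by O(1). Replacing one by the other in the
  leading term therefore changes the quotient by O(1/n) only.\<close>

lemma (in modrun) discrepancy_asymptotic:
  assumes big: "\<kappa> \<ge> 100000" and N: "card P \<ge> 1"
  shows "cap_discrepancy (lambert ` P) \<le> sqrt (18 / real (card P)) + 2 * (40000015 + 96 * (4 * (1 + \<bar>\<xi>\<bar>) + 3)\<^sup>2) * area"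
proof -
  define h where "h = \<kappa> * sqrt (1 + \<xi>\<^sup>2)"
  define n where "n = real (card P)"
  define C1 where "C1 = 40000000 + 96 * (4 * (1 + \<bar>\<xi>\<bar>) + 3)\<^sup>2"
  have C1: "C1 \<ge> 0" by (simp add: C1_def)
  have h2: "1 / area = h\<^sup>2" using one_xi by (simp add: area_def h_def power_mult_distrib)
  have "\<kappa> * 1 \<le> \<kappa> * sqrt (1 + \<xi>\<^sup>2)" using \<kappa>_pos by (intro mult_left_mono) auto
  then have hk: "\<kappa> \<le> h" by (simp add: h_def)
  then have hbig: "h \<ge> 100000" using big by linarith
  have n0: "n > 0" using N by (simp add: n_def)
  have "\<mu> * \<kappa> \<le> 1 * h" using \<mu>_bounds hk \<kappa>_pos by (intro mult_mono) auto
  then have dev: "\<bar>n - h\<^sup>2\<bar> \<le> 3 * h"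
    using card_P_bounds hbig unfolding h2 n_def by simp
  \<comment> \<open>The deviation of at most \<open>3 * h\<close> costs 3 in the root, which times
    \<open>sqrt 18 \<le> 5\<close> is the 15 in the final constant.\<close>
  have sq: "h - 3 \<le> sqrt n"
  proof (rule real_le_rsqrt)
    have "(h - 3)\<^sup>2 = h\<^sup>2 - 6 * h + 9" by (simp add: power2_diff)
    then show "(h - 3)\<^sup>2 \<le> n" using dev hbig unfolding abs_le_iff by linarith
  qed
  have hh: "100000 * h \<le> h\<^sup>2" using mult_right_mono[OF hbig, of h] hbig by (simp add: power2_eq_square)
  have n_half: "h\<^sup>2 / 2 \<le> n" using dev hh hbig unfolding abs_le_iff by linarith
  have s18: "sqrt (18::real) \<le> 5" by (rule real_le_lsqrt) auto
  have "sqrt 18 * h \<le> sqrt 18 * sqrt n + sqrt 18 * 3"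
    using mult_left_mono[OF sq, of "sqrt 18"] by (simp add: algebra_simps)
  then have "sqrt 18 * h + C1 \<le> sqrt 18 * sqrt n + (15 + C1)" using s18 by linarith
  then have "(sqrt 18 * h + C1) / n \<le> (sqrt 18 * sqrt n + (15 + C1)) / n" using n0 by (intro divide_right_mono) auto
  also have "\<dots> = sqrt 18 * (sqrt n / n) + (15 + C1) / n" by (simp add: add_divide_distrib)
  also have "sqrt n / n = 1 / sqrt n" using n0 by (simp add: real_div_sqrt divide_simps)
  also have "sqrt 18 * (1 / sqrt n) = sqrt (18 / n)" by (simp add: real_sqrt_divide)
  also have "(15 + C1) / n \<le> (15 + C1) / (h\<^sup>2 / 2)"
    using n_half C1 hbig n0 by (intro divide_left_mono) auto
  also have "(15 + C1) / (h\<^sup>2 / 2) = 2 * (15 + C1) * area"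
  proof -
    have "area = 1 / (1 / area)" by simp
    then have "area = 1 / h\<^sup>2" unfolding h2 .
    then show ?thesis by simp
  qed
  finally have "deviation \<xi> \<kappa> / n \<le> sqrt (18 / n) + 2 * (15 + C1) * area"
    by (simp add: deviation_def h_def C1_def)
  then show ?thesis using discrepancy_le[OF big N] by (simp add: n_def C1_def)
qed

theorem mainTheorem4:
  fixes x y :: real
  assumes "y > 0"
  shows "\<exists>C::real. \<forall>K::nat. \<forall>z P.
           K \<ge> 1 \<longrightarrow> tile_choice (Qmat x y) K z \<longrightarrow>
           modified_point_set (Qmat x y) K z P \<longrightarrow> card P \<ge> 1 \<longrightarrow>
           cap_discrepancy (lambert ` P) \<le> sqrt (18 / real (card P)) + C / (real K)^2"
proof -
  define k where "k = 1 + x\<^sup>2"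
  have k: "k > 0" by (simp add: k_def add_pos_nonneg)
  \<comment> \<open>From \<open>K0\<close> on, \<open>\<kappa>\<close> is at least 100000. For the
    finitely many smaller \<open>K\<close> the trivial bound 1 on the discrepancy is absorbed by
    \<open>K0^2 / K^2\<close>.\<close>
  define K0 where "K0 = 100000 * k / y"
  define D where "D = 2 * (40000015 + 96 * (4 * (1 + \<bar>x\<bar>) + 3)\<^sup>2)"
  have pos: "K0 > 0" "D \<ge> 0" using k assms by (auto simp: K0_def D_def)
  show ?thesis
  proof (intro exI[of _ "K0\<^sup>2 + D * k / y\<^sup>2"] allI impI)
    fix K :: nat and z P
    assume K: "K \<ge> 1" and z: "tile_choice (Qmat x y) K z" and P: "modified_point_set (Qmat x y) K z P" and N: "card P \<ge> 1"
    have K0: "real K > 0" using K by simp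
    interpret square_lattice x y K by unfold_locales (use assms K in auto)
    have s0: "0 \<le> sqrt (18 / real (card P))" by simp
    show "cap_discrepancy (lambert ` P) \<le> sqrt (18 / real (card P)) + (K0\<^sup>2 + D * k / y\<^sup>2) / (real K)\<^sup>2"
    proof (cases "real K < K0")
      case True
      have "(real K)\<^sup>2 \<le> K0\<^sup>2" using True K0 by (intro power_mono) auto
      moreover have "0 \<le> D * k / y\<^sup>2" using pos k by simp
      ultimately have "(real K)\<^sup>2 \<le> K0\<^sup>2 + D * k / y\<^sup>2" by linarith
      then have "1 \<le> (K0\<^sup>2 + D * k / y\<^sup>2) / (real K)\<^sup>2" using K0 by (simp add: le_divide_eq)
      then show ?thesis using cap_discrepancy_le_1[of "lambert ` P"] s0 by linarith
    next
      case False
      then have "100000 * k \<le> real K * y" using assms by (simp add: K0_def divide_le_eq not_less)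
      then have big: "real K * y / (1 + x\<^sup>2) \<ge> 100000" using k by (simp add: k_def[symmetric] le_divide_eq)
      then have "real K * y / (1 + x\<^sup>2) > 2" by linarith
      from modified_run[OF z P this] obtain zz \<zeta> L tt nn C
        where m: "modrun x (real K * y / (1 + x\<^sup>2)) zz \<zeta> L tt nn C P" by blast
      have ar: "area = k / y\<^sup>2 / (real K)\<^sup>2"
        unfolding area_def unfolding k_def[symmetric] using k assms K0 by (simp add: power_divide power_mult_distrib power2_eq_square)
      have "cap_discrepancy (lambert ` P) \<le> sqrt (18 / real (card P)) + D * area"
        using modrun.discrepancy_asymptotic[OF m big N] by (simp add: D_def)
      also have "D * area \<le> (K0\<^sup>2 + D * k / y\<^sup>2) / (real K)\<^sup>2"
        unfolding ar by (simp add: add_divide_distrib)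
      finally show ?thesis by simp
    qed
  qed
qed

end
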